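(* Let $q>2$ be an integer. Let $(u,w)\in\mathcal{U}$ be the solution of $B((u,w),(y,z))=F(y)$ for all $(y,z)\in\mathcal{U}$, having the solution decomposition described in the context, and let $(u_h,w_h)\in\mathcal{U}_h$ be the solution of $B((u_h,w_h),(y,z))=F(y)$ for all $(y,z)\in\mathcal{U}_h$, with piecewise polynomials of degree $q$ on the weak S-type mesh with parameter $\sigma$ described in the context. If $u,w\in H^{q+1}(\Omega)$ and $\sigma\ge q+1$, then the supercloseness result $$|||(I_1u-u_h,\,I_2w-w_h)|||\lesssim(\tilde h+N^{-1}\max|\psi'|)^{q+1}$$ and the convergence result $$|||(u-u_h,\,w-w_h)|||\lesssim(\tilde h+N^{-1}\max|\psi'|)^{q}$$ hold.
   Context: Problem: $m\in\{1,2\}$, $\Omega=(0,2)$, $\varepsilon>0$ small; $u$ solves $\varepsilon^2u^{(4)}-bu''+cu+d\,u(\cdot-1)=f$ in $\Omega$, $u=\Phi$ on $(-1,0)$, $u(0)=u(2)=0$, $u^{(m)}(0)=u^{(m)}(2)=0$, where $b,c,d$ are smooth, $b\ge\beta^2>0$ ($\beta>0$), $c-\frac12\|d\|_{L^\infty(1,2)}-\frac{1}{2\beta^2}\|b'\|_{L^\infty}^2\ge\delta>0$, $\Phi(0)=\Phi^{(m)}(0)=0$. Put $w=\varepsilon u''$. Variational formulation: $\mathcal{U}=H_0^1(\Omega)\times H^1(\Omega)$ if $m=1$, $\mathcal{U}=H_0^1(\Omega)\times H_0^1(\Omega)$ if $m=2$. With $\langle\cdot,\cdot\rangle_D$ the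 $L^2(D)$ inner product ($D=\Omega$ if omitted; likewise for norms), $$B((u,w),(y,z))=-\varepsilon\langle w',y'\rangle+\langle bu',y'\rangle+\langle b'u',y\rangle+\langle cu,y\rangle+\langle d\,u(\cdot-1),y\rangle_{(1,2)}+\varepsilon\langle u',z'\rangle+\langle w,z\rangle,$$ $F(y)=\langle f,y\rangle-\langle d\,\Phi(\cdot-1),y\rangle_{(0,1)}$, and $|||(y,z)|||^2=\|z\|_{L^2}^2+\frac{\beta^2}{2}\|y'\|_{L^2}^2+\delta\|y\|_{L^2}^2$. Solution decomposition (standing assumption): $u=S+E_1+E_2+W_1\chi_{(0,1)}+W_2\chi_{(1,2)}$ and $w=\tilde S+\tilde E_1+\tilde E_2+\tilde W_1\chi_{(0,1)}+\tilde W_2\chi_{(1,2)}$, where for $0\le k\le q+1$: $\|S^{(k)}\|_{L^2(0,1)}+\|S^{(k)}\|_{L^2(1,2)}\lesssim1$; $|E_1^{(k)}(x)|\lesssim\varepsilon^{m-k}e^{-\beta x/\varepsilon}$, $|E_2^{(k)}(x)|\lesssim\varepsilon^{m-k}e^{-\beta(2-x)/\varepsilon}$; $|W_1^{(k)}(x)|\lesssim\varepsilon^{3-k}e^{-\beta(1-x)/\varepsilon}$ on $(0,1)$, $|W_2^{(k)}(x)|\lesssim\varepsilon^{3-k}e^{-\beta(x-1)/\varepsilon}$ on $(1,2)$; $|\tilde S^{(k)}(x)|\lesssim\varepsilon$ on $\Omega\setminus\{1\}$; $|\tilde E_1^{(k)}(x)|\lesssim\varepsilon^{m-1-k}e^{-\beta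 x/\varepsilon}$, $|\tilde E_2^{(k)}(x)|\lesssim\varepsilon^{m-1-k}e^{-\beta(2-x)/\varepsilon}$; $|\tilde W_1^{(k)}(x)|\lesssim\varepsilon^{2-k}e^{-\beta(1-x)/\varepsilon}$ on $(0,1)$, $|\tilde W_2^{(k)}(x)|\lesssim\varepsilon^{2-k}e^{-\beta(x-1)/\varepsilon}$ on $(1,2)$. Weak S-type mesh ($q>2$): $N\in\mathbb{N}$ divisible by 8, $\sigma>0$, $\lambda=\frac{\sigma}{\beta}\varepsilon\ln N$ and $\nu=\frac{\sigma}{\beta}\varepsilon^{1-\frac{5}{2(q+1)}}\ln N$, with $\varepsilon$ small enough that $\lambda\le\nu<\frac14$. The mesh-defining function $\phi:[0,\frac12]\to\mathbb{R}$ (which may depend on $N$) is continuous, piecewise continuously differentiable, monotonically increasing, $\phi(0)=0$, $\phi(\frac12)=\ln N$, $\max\phi'\lesssim N$. The nodes are $x_i=\frac{\sigma\varepsilon}{\beta}\phi(\frac{4i}{N})$ for $0\le i\le\frac N8$; equidistant from $x_{N/8}=\lambda$ to $x_{3N/8}=1-\nu$; $x_i=1-\frac{\sigma}{\beta}\varepsilon^{1-\frac{5}{2(q+1)}}\phi(2-\frac{4i}{N})$ for $\frac{3N}8\le i\le\frac N2$; and symmetric about $x=1$, i.e. $x_{N-i}=2-x_i$. The mesh characterising function is $\psi=e^{-\phi}$, $\max|\psi'|=\max_{t\in[0,1/2]}|\psi'(t)|$. $\tilde h$ denotes the maximum mesh width in the inner layer region $(1-\nu,1+\nu)$; the maximum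 mesh width $h$ in the boundary layer regions $(0,\lambda)\cup(2-\lambda,2)$ satisfies $h\lesssim\tilde h\lesssim\varepsilon^{1-\frac{5}{2(q+1)}}$. Discrete space: $\mathcal{U}_h=\{(y,z)\in\mathcal{U}: y|_T,z|_T\in\mathbb{P}_q(T)\text{ for each mesh cell }T=[x_{i-1},x_i]\}$, $\mathbb{P}_q$ the polynomials of degree at most $q$. Interpolation: for $j\in\{1,2\}$ and continuous $v$, $I_jv$ is the continuous piecewise polynomial of degree $\le q$ with, on each cell, $(I_jv-v)(x_{i-1})=(I_jv-v)(x_i)=0$ and $\int_{x_{i-1}}^{x_i}(I_jv-v)\xi\,dx=0$ for all polynomials $\xi$ of degree $\le q-2$. $A\lesssim B$ means $A\le CB$ with $C$ independent of $\varepsilon$ and $N$. *)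

theory Defs
  imports
    "HOL-Analysis.Analysis"
    "HOL-Computational_Algebra.Polynomial"
    "HOL-Probability.Essential_Supremum"
begin

section \<open>Function spaces on an open interval\<close>

definition square_integrable :: "real \<Rightarrow> real \<Rightarrow> (real \<Rightarrow> real) \<Rightarrow> bool" where
  "square_integrable a b v \<longleftrightarrow>
     set_borel_measurable lebesgue {a<..<b} v \<and>
     set_integrable lebesgue {a<..<b} (\<lambda>x. (v x)\<^sup>2)"

definition L2_inner :: "real \<Rightarrow> real \<Rightarrow> (real \<Rightarrow> real) \<Rightarrow> (real \<Rightarrow> real) \<Rightarrow> real" where
  "L2_inner a b v w = set_lebesgue_integral lebesgue {a<..<b} (\<lambda>x. v x * w x)"

definition L2_norm :: "real \<Rightarrow> real \<Rightarrow> (real \<Rightarrow> real) \<Rightarrow> real" where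
  "L2_norm a b v = sqrt (L2_inner a b v v)"

definition Linf_norm :: "real \<Rightarrow> real \<Rightarrow> (real \<Rightarrow> real) \<Rightarrow> real" where
  "Linf_norm a b v = real_of_ereal (esssup (lebesgue_on {a<..<b}) (\<lambda>x. ereal \<bar>v x\<bar>))"

text \<open>Test functions are taken from \<open>C\<^sup>1\<close> with compact support in \<open>(a,b)\<close>, as is usual for Sobolev
  spaces on an interval; smooth test functions yield the same weak derivatives.\<close>

definition test_function :: "real \<Rightarrow> real \<Rightarrow> (real \<Rightarrow> real) \<Rightarrow> bool" where
  "test_function a b \<theta> \<longleftrightarrow>
     \<theta> C1_differentiable_on UNIV \<and>
     (\<exists>A. compact A \<and> A \<subseteq> {a<..<b} \<and> (\<forall>x. x \<notin> A \<longrightarrow> \<theta> x = 0))"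

definition has_weak_deriv :: "real \<Rightarrow> real \<Rightarrow> (real \<Rightarrow> real) \<Rightarrow> (real \<Rightarrow> real) \<Rightarrow> bool" where
  "has_weak_deriv a b v g \<longleftrightarrow>
     square_integrable a b v \<and> square_integrable a b g \<and>
     (\<forall>\<theta>. test_function a b \<theta> \<longrightarrow> L2_inner a b v (deriv \<theta>) = - L2_inner a b g \<theta>)"

text \<open>The weak derivative is determined only up to a null set; all uses below are integrals.\<close>

definition wderiv :: "real \<Rightarrow> real \<Rightarrow> (real \<Rightarrow> real) \<Rightarrow> (real \<Rightarrow> real)" where
  "wderiv a b v = (SOME g. has_weak_deriv a b v g)"

definition sobolev :: "nat \<Rightarrow> real \<Rightarrow> real \<Rightarrow> (real \<Rightarrow> real) \<Rightarrow> bool" where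
  "sobolev k a b v \<longleftrightarrow>
     square_integrable a b v \<and>
     (\<exists>D. D 0 = v \<and> (\<forall>j<k. has_weak_deriv a b (D j) (D (Suc j))))"

text \<open>Elements of \<open>H\<^sup>1(a,b)\<close> are represented by their continuous representative on \<open>[a,b]\<close>, so that
  point values and boundary values make sense.\<close>

definition H1 :: "real \<Rightarrow> real \<Rightarrow> (real \<Rightarrow> real) set" where
  "H1 a b = {v. sobolev 1 a b v \<and> continuous_on {a..b} v}"

definition H1_0 :: "real \<Rightarrow> real \<Rightarrow> (real \<Rightarrow> real) set" where
  "H1_0 a b = {v \<in> H1 a b. v a = 0 \<and> v b = 0}"

text \<open>\<open>D k\<close> is the classical \<open>k\<close>-th derivative of \<open>D 0\<close> on \<open>A\<close> for \<open>k \<le> n\<close> (one-sided at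
  endpoints that belong to \<open>A\<close>).\<close>

definition derivs_upto :: "nat \<Rightarrow> real set \<Rightarrow> (nat \<Rightarrow> real \<Rightarrow> real) \<Rightarrow> bool" where
  "derivs_upto n A D \<longleftrightarrow>
     (\<forall>k<n. \<forall>x\<in>A. (D k has_real_derivative D (Suc k) x) (at x within A))"

definition smooth_on_closed :: "real \<Rightarrow> real \<Rightarrow> (real \<Rightarrow> real) \<Rightarrow> bool" where
  "smooth_on_closed a b v \<longleftrightarrow> (\<exists>D. D 0 = v \<and> (\<forall>n. derivs_upto n {a..b} D))"


section \<open>The continuous problem on (0,2)\<close>

definition admissible_data ::
  "nat \<Rightarrow> real \<Rightarrow> real \<Rightarrow> (real \<Rightarrow> real) \<Rightarrow> (real \<Rightarrow> real) \<Rightarrow> (real \<Rightarrow> real) \<Rightarrow>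
   (real \<Rightarrow> real) \<Rightarrow> (real \<Rightarrow> real) \<Rightarrow> bool" where
  "admissible_data m \<beta> \<delta> b c d f \<Phi> \<longleftrightarrow>
     m \<in> {1, 2} \<and> \<beta> > 0 \<and> \<delta> > 0 \<and>
     smooth_on_closed 0 2 b \<and> smooth_on_closed 0 2 c \<and> smooth_on_closed 0 2 d \<and>
     square_integrable 0 2 f \<and>
     (\<forall>x\<in>{0<..<2}. b x \<ge> \<beta>\<^sup>2) \<and>
     (\<forall>x\<in>{0<..<2}. c x - Linf_norm 1 2 d / 2 - (Linf_norm 0 2 (deriv b))\<^sup>2 / (2 * \<beta>\<^sup>2) \<ge> \<delta>) \<and>
     (\<exists>D. D 0 = \<Phi> \<and> derivs_upto m {-1..0} D \<and> \<Phi> 0 = 0 \<and> D m 0 = 0)"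

definition space_U :: "nat \<Rightarrow> ((real \<Rightarrow> real) \<times> (real \<Rightarrow> real)) set" where
  "space_U m = H1_0 0 2 \<times> (if m = 1 then H1 0 2 else H1_0 0 2)"

definition form_B ::
  "real \<Rightarrow> (real \<Rightarrow> real) \<Rightarrow> (real \<Rightarrow> real) \<Rightarrow> (real \<Rightarrow> real) \<Rightarrow>
   (real \<Rightarrow> real) \<times> (real \<Rightarrow> real) \<Rightarrow> (real \<Rightarrow> real) \<times> (real \<Rightarrow> real) \<Rightarrow> real" where
  "form_B \<epsilon> b c d = (\<lambda>(u, w) (y, z).
     - \<epsilon> * L2_inner 0 2 (wderiv 0 2 w) (wderiv 0 2 y)
     + L2_inner 0 2 (\<lambda>x. b x * wderiv 0 2 u x) (wderiv 0 2 y)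
     + L2_inner 0 2 (\<lambda>x. deriv b x * wderiv 0 2 u x) y
     + L2_inner 0 2 (\<lambda>x. c x * u x) y
     + L2_inner 1 2 (\<lambda>x. d x * u (x - 1)) y
     + \<epsilon> * L2_inner 0 2 (wderiv 0 2 u) (wderiv 0 2 z)
     + L2_inner 0 2 w z)"

definition form_F ::
  "(real \<Rightarrow> real) \<Rightarrow> (real \<Rightarrow> real) \<Rightarrow> (real \<Rightarrow> real) \<Rightarrow> (real \<Rightarrow> real) \<Rightarrow> real" where
  "form_F d f \<Phi> y = L2_inner 0 2 f y - L2_inner 0 1 (\<lambda>x. d x * \<Phi> (x - 1)) y"

definition solves_in ::
  "((real \<Rightarrow> real) \<times> (real \<Rightarrow> real)) set \<Rightarrow> real \<Rightarrow> (real \<Rightarrow> real) \<Rightarrow> (real \<Rightarrow> real) \<Rightarrow>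
   (real \<Rightarrow> real) \<Rightarrow> (real \<Rightarrow> real) \<Rightarrow> (real \<Rightarrow> real) \<Rightarrow> (real \<Rightarrow> real) \<Rightarrow> (real \<Rightarrow> real) \<Rightarrow> bool" where
  "solves_in V \<epsilon> b c d f \<Phi> u w \<longleftrightarrow>
     (u, w) \<in> V \<and> (\<forall>(y, z)\<in>V. form_B \<epsilon> b c d (u, w) (y, z) = form_F d f \<Phi> y)"

definition triple_norm :: "real \<Rightarrow> real \<Rightarrow> (real \<Rightarrow> real) \<times> (real \<Rightarrow> real) \<Rightarrow> real" where
  "triple_norm \<beta> \<delta> = (\<lambda>(y, z).
     sqrt ((L2_norm 0 2 z)\<^sup>2 + \<beta>\<^sup>2 / 2 * (L2_norm 0 2 (wderiv 0 2 y))\<^sup>2 + \<delta> * (L2_norm 0 2 y)\<^sup>2))"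

text \<open>\<open>K\<close> is the constant hidden in all the bounds. Each component is given by the sequence of its
  derivatives: \<open>S\<close> has weak derivatives on \<open>(0,1)\<close> and on \<open>(1,2)\<close> separately, the other components
  have classical ones.\<close>

definition solution_decomposition ::
  "nat \<Rightarrow> nat \<Rightarrow> real \<Rightarrow> real \<Rightarrow> real \<Rightarrow> (real \<Rightarrow> real) \<Rightarrow> (real \<Rightarrow> real) \<Rightarrow> bool" where
  "solution_decomposition m q \<beta> K \<epsilon> u w \<longleftrightarrow>
   (\<exists>S E1 E2 W1 W2 tS tE1 tE2 tW1 tW2 :: nat \<Rightarrow> real \<Rightarrow> real.
     (\<forall>x\<in>{0<..<2}. u x = S 0 x + E1 0 x + E2 0 x
        + W1 0 x * indicator {0<..<1} x + W2 0 x * indicator {1<..<2} x) \<and>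
     (\<forall>x\<in>{0<..<2}. w x = tS 0 x + tE1 0 x + tE2 0 x
        + tW1 0 x * indicator {0<..<1} x + tW2 0 x * indicator {1<..<2} x) \<and>
     (\<forall>k\<le>q. has_weak_deriv 0 1 (S k) (S (Suc k)) \<and> has_weak_deriv 1 2 (S k) (S (Suc k))) \<and>
     derivs_upto (q + 1) {0<..<2} E1 \<and> derivs_upto (q + 1) {0<..<2} E2 \<and>
     derivs_upto (q + 1) {0<..<1} W1 \<and> derivs_upto (q + 1) {1<..<2} W2 \<and>
     derivs_upto (q + 1) ({0<..<2} - {1}) tS \<and>
     derivs_upto (q + 1) {0<..<2} tE1 \<and> derivs_upto (q + 1) {0<..<2} tE2 \<and>
     derivs_upto (q + 1) {0<..<1} tW1 \<and> derivs_upto (q + 1) {1<..<2} tW2 \<and>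
     (\<forall>k\<le>q + 1.
        L2_norm 0 1 (S k) + L2_norm 1 2 (S k) \<le> K \<and>
        (\<forall>x\<in>{0<..<2}.
           \<bar>E1 k x\<bar> \<le> K * \<epsilon> powi (int m - int k) * exp (- \<beta> * x / \<epsilon>) \<and>
           \<bar>E2 k x\<bar> \<le> K * \<epsilon> powi (int m - int k) * exp (- \<beta> * (2 - x) / \<epsilon>) \<and>
           \<bar>tE1 k x\<bar> \<le> K * \<epsilon> powi (int m - 1 - int k) * exp (- \<beta> * x / \<epsilon>) \<and>
           \<bar>tE2 k x\<bar> \<le> K * \<epsilon> powi (int m - 1 - int k) * exp (- \<beta> * (2 - x) / \<epsilon>)) \<and>
        (\<forall>x\<in>{0<..<2} - {1}. \<bar>tS k x\<bar> \<le> K * \<epsilon>) \<and>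
        (\<forall>x\<in>{0<..<1}.
           \<bar>W1 k x\<bar> \<le> K * \<epsilon> powi (3 - int k) * exp (- \<beta> * (1 - x) / \<epsilon>) \<and>
           \<bar>tW1 k x\<bar> \<le> K * \<epsilon> powi (2 - int k) * exp (- \<beta> * (1 - x) / \<epsilon>)) \<and>
        (\<forall>x\<in>{1<..<2}.
           \<bar>W2 k x\<bar> \<le> K * \<epsilon> powi (3 - int k) * exp (- \<beta> * (x - 1) / \<epsilon>) \<and>
           \<bar>tW2 k x\<bar> \<le> K * \<epsilon> powi (2 - int k) * exp (- \<beta> * (x - 1) / \<epsilon>))))"


section \<open>The weak S-type mesh\<close>

definition inner_scale :: "nat \<Rightarrow> real \<Rightarrow> real" where
  "inner_scale q \<epsilon> = \<epsilon> powr (1 - 5 / (2 * (real q + 1)))"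

definition mesh_lambda :: "real \<Rightarrow> real \<Rightarrow> real \<Rightarrow> nat \<Rightarrow> real" where
  "mesh_lambda \<sigma> \<beta> \<epsilon> N = \<sigma> / \<beta> * \<epsilon> * ln (real N)"

definition mesh_nu :: "nat \<Rightarrow> real \<Rightarrow> real \<Rightarrow> real \<Rightarrow> nat \<Rightarrow> real" where
  "mesh_nu q \<sigma> \<beta> \<epsilon> N = \<sigma> / \<beta> * inner_scale q \<epsilon> * ln (real N)"

text \<open>The derivative of \<open>\<phi>\<close> may be undefined at finitely many points; suprema of \<open>\<bar>\<phi>'\<bar>\<close> and \<open>\<bar>\<psi>'\<bar>\<close> are
  taken over the remaining ones. Bounding \<open>\<phi>'\<close> pointwise avoids the junk value of \<open>Sup\<close> on unbounded
  sets.\<close>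

definition mesh_defining :: "real \<Rightarrow> nat \<Rightarrow> (real \<Rightarrow> real) \<Rightarrow> bool" where
  "mesh_defining K N \<phi> \<longleftrightarrow>
     \<phi> piecewise_C1_differentiable_on {0..1/2} \<and> mono_on {0..1/2} \<phi> \<and>
     \<phi> 0 = 0 \<and> \<phi> (1/2) = ln (real N) \<and>
     (\<forall>t\<in>{0<..<1/2}. \<phi> differentiable (at t) \<longrightarrow> deriv \<phi> t \<le> K * real N)"

definition mesh_characterising :: "(real \<Rightarrow> real) \<Rightarrow> real \<Rightarrow> real" where
  "mesh_characterising \<phi> t = exp (- \<phi> t)"

definition max_abs_deriv :: "(real \<Rightarrow> real) \<Rightarrow> real" where
  "max_abs_deriv \<psi> = (SUP t\<in>{t \<in> {0<..<1/2}. \<psi> differentiable (at t)}. \<bar>deriv \<psi> t\<bar>)"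

definition left_node ::
  "nat \<Rightarrow> real \<Rightarrow> real \<Rightarrow> real \<Rightarrow> nat \<Rightarrow> (real \<Rightarrow> real) \<Rightarrow> nat \<Rightarrow> real" where
  "left_node q \<sigma> \<beta> \<epsilon> N \<phi> i =
     (if i \<le> N div 8 then \<sigma> * \<epsilon> / \<beta> * \<phi> (4 * real i / real N)
      else if i \<le> 3 * N div 8 then
        mesh_lambda \<sigma> \<beta> \<epsilon> N
        + (1 - mesh_nu q \<sigma> \<beta> \<epsilon> N - mesh_lambda \<sigma> \<beta> \<epsilon> N) * (real i - real N / 8) / (real N / 4)
      else 1 - \<sigma> / \<beta> * inner_scale q \<epsilon> * \<phi> (2 - 4 * real i / real N))"

definition node ::
  "nat \<Rightarrow> real \<Rightarrow> real \<Rightarrow> real \<Rightarrow> nat \<Rightarrow> (real \<Rightarrow> real) \<Rightarrow> nat \<Rightarrow> real" where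
  "node q \<sigma> \<beta> \<epsilon> N \<phi> i =
     (if i \<le> N div 2 then left_node q \<sigma> \<beta> \<epsilon> N \<phi> i else 2 - left_node q \<sigma> \<beta> \<epsilon> N \<phi> (N - i))"

definition mesh_width :: "(nat \<Rightarrow> real) \<Rightarrow> nat set \<Rightarrow> real" where
  "mesh_width x I = Max ((\<lambda>i. x i - x (i - 1)) ` I)"

definition h_inner :: "(nat \<Rightarrow> real) \<Rightarrow> nat \<Rightarrow> real" where
  "h_inner x N = mesh_width x {3 * N div 8 + 1..5 * N div 8}"

definition h_boundary :: "(nat \<Rightarrow> real) \<Rightarrow> nat \<Rightarrow> real" where
  "h_boundary x N = mesh_width x ({1..N div 8} \<union> {7 * N div 8 + 1..N})"

definition admissible_mesh ::
  "real \<Rightarrow> nat \<Rightarrow> real \<Rightarrow> real \<Rightarrow> real \<Rightarrow> nat \<Rightarrow> (real \<Rightarrow> real) \<Rightarrow> bool" where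
  "admissible_mesh K q \<sigma> \<beta> \<epsilon> N \<phi> \<longleftrightarrow>
     N > 0 \<and> 8 dvd N \<and>
     mesh_lambda \<sigma> \<beta> \<epsilon> N \<le> mesh_nu q \<sigma> \<beta> \<epsilon> N \<and> mesh_nu q \<sigma> \<beta> \<epsilon> N < 1/4 \<and>
     mesh_defining K N \<phi> \<and>
     h_boundary (node q \<sigma> \<beta> \<epsilon> N \<phi>) N \<le> K * h_inner (node q \<sigma> \<beta> \<epsilon> N \<phi>) N \<and>
     h_inner (node q \<sigma> \<beta> \<epsilon> N \<phi>) N \<le> K * inner_scale q \<epsilon>"


section \<open>Discrete spaces and interpolation\<close>

definition piecewise_poly :: "(nat \<Rightarrow> real) \<Rightarrow> nat \<Rightarrow> nat \<Rightarrow> (real \<Rightarrow> real) \<Rightarrow> bool" where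
  "piecewise_poly x N q v \<longleftrightarrow>
     (\<forall>i\<in>{1..N}. \<exists>p :: real poly. degree p \<le> q \<and> (\<forall>t\<in>{x (i - 1)..x i}. v t = poly p t))"

definition space_Uh ::
  "nat \<Rightarrow> (nat \<Rightarrow> real) \<Rightarrow> nat \<Rightarrow> nat \<Rightarrow> ((real \<Rightarrow> real) \<times> (real \<Rightarrow> real)) set" where
  "space_Uh m x N q = {(y, z) \<in> space_U m. piecewise_poly x N q y \<and> piecewise_poly x N q z}"

definition is_interpolant ::
  "(nat \<Rightarrow> real) \<Rightarrow> nat \<Rightarrow> nat \<Rightarrow> (real \<Rightarrow> real) \<Rightarrow> (real \<Rightarrow> real) \<Rightarrow> bool" where
  "is_interpolant x N q v g \<longleftrightarrow>
     continuous_on {0..2} g \<and> piecewise_poly x N q g \<and>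
     (\<forall>i\<in>{1..N}. g (x (i - 1)) - v (x (i - 1)) = 0 \<and> g (x i) - v (x i) = 0 \<and>
        (\<forall>\<xi> :: real poly. degree \<xi> \<le> q - 2 \<longrightarrow>
           L2_inner (x (i - 1)) (x i) (\<lambda>t. g t - v t) (poly \<xi>) = 0))"

text \<open>The conditions determine the interpolant uniquely on \<open>[0,2]\<close>. Both components of a pair are
  interpolated by this same operator.\<close>

definition interp :: "(nat \<Rightarrow> real) \<Rightarrow> nat \<Rightarrow> nat \<Rightarrow> (real \<Rightarrow> real) \<Rightarrow> (real \<Rightarrow> real)" where
  "interp x N q v = (SOME g. is_interpolant x N q v g)"

end

theory Submission
  imports Defs
begin

text \<open>
  Write \<open>A = I\<^sub>1 u - u\<close> and \<open>\<chi> = (I\<^sub>1 u - u\<^sub>h, I\<^sub>2 w - w\<^sub>h)\<close>. The interpolation conditions imply that on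
  every cell \<open>(I v)'\<close> is the \<open>L\<^sup>2\<close> projection of \<open>v'\<close> onto the polynomials of degree \<open>q - 1\<close>. Hence both
  terms of the form that carry a factor \<open>\<epsilon>\<close> vanish on the interpolation error, and in the convective
  terms the coefficient \<open>b\<close> may be replaced by its difference to a nodal value. With coercivity and Galerkin
  orthogonality, the square of the norm of \<open>\<chi>\<close> is bounded by a multiple of
  \<open>\<Sum> h\<^sub>i\<^sup>2 \<parallel>A'\<parallel>\<^sub>i\<^sup>2 + \<parallel>I\<^sub>2 w - w\<parallel>\<^sup>2\<close>, where \<open>\<parallel>_\<parallel>\<^sub>i\<close> is the \<open>L\<^sup>2\<close> norm on the cell \<open>i\<close> of length \<open>h\<^sub>i\<close>.

  As \<open>(I v)'\<close> is a best approximation, \<open>\<parallel>A'\<parallel>\<^sub>i\<close> is at most the distance of \<open>u'\<close> to any polynomial of degree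
  \<open>q - 1\<close>, and the components of \<open>u'\<close> can be approximated separately: a component is replaced by a
  polynomial where the mesh resolves it and by zero where it is negligible, so components are never
  interpolated. The same works for \<open>w\<close> on the fine cells by Poincare's inequality. On the coarse cells
  this loses a factor \<open>1 / \<epsilon>\<close> for \<open>m = 1\<close>, and the stability of the interpolation operator in the
  maximum norm is used instead.
\<close>

section \<open>Square-integrable functions on an interval\<close>

text \<open>The exponent in \<open>inner_scale\<close> is dictated by the inner layer of
  \<open>w\<close>. Its cells have length of order \<open>s * \<rho>\<close> where the layer is
  strong, with \<open>s = \<epsilon> powr (1 - \<kappa>)\<close> and
  \<open>\<kappa> * (q + 1) = 5/2\<close>. The derivative of order \<open>q + 1\<close> is only
  bounded by \<open>\<epsilon> powi (1 - q)\<close>, and its product with \<open>s ^ (q + 1)\<close>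
  is of order \<open>\<epsilon> powr (-1/2)\<close>. The missing square root of \<epsilon> can be
  regained in the L2 norm but not in the maximum norm. Therefore cell errors are bounded by
  integrals of a weight \<open>G\<close> that concentrates at 1 and whose mass is bounded
  independently of \<epsilon>; these integrals simply add up over the cells. One parameter
  \<open>j\<close> serves both claims. The value \<open>j = q + 1\<close> bounds the sum of cell
  errors weighted with the squared cell lengths, as it occurs in the estimate of the discrete error.
  The value \<open>j = q\<close> bounds the unweighted sum, that is, the derivative of the
  interpolation error, and this is where the convergence result has one order less. The layer
  exponents 3 for \<open>u\<close> with \<open>j = q\<close> and 2 for \<open>w\<close> with
  \<open>j = q + 1\<close> both just meet the condition on the inner layer.\<close>

abbreviation Ioo :: "real \<Rightarrow> real \<Rightarrow> real measure" where
  "Ioo a b \<equiv> lebesgue_on {a<..<b}"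

lemma finite_measure_Ioo: "finite_measure (Ioo a b)"
  by (simp add: finite_measure_lebesgue_on)

text \<open>Turns the set integrals of the definition into integrals over the restricted measure,
  with which all later integrals are formed.\<close>

lemma square_integrable_iff:
  "square_integrable a b v \<longleftrightarrow> v \<in> borel_measurable (Ioo a b) \<and> integrable (Ioo a b) (\<lambda>x. (v x)\<^sup>2)"
  unfolding square_integrable_def set_borel_measurable_def set_integrable_def
  by (simp add: borel_measurable_restrict_space_iff integrable_restrict_space)

lemma L2_inner_eq: "L2_inner a b v w = integral\<^sup>L (Ioo a b) (\<lambda>x. v x * w x)"
  unfolding L2_inner_def set_lebesgue_integral_def
  by (simp add: integral_restrict_space)

lemma square_integrable_measurable:
  "square_integrable a b v \<Longrightarrow> v \<in> borel_measurable (Ioo a b)"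
  by (simp add: square_integrable_iff)

lemma square_integrable_integrable_mult:
  assumes f: "square_integrable a b f" and g: "square_integrable a b g"
  shows "integrable (Ioo a b) (\<lambda>x. f x * g x)"
proof (rule Bochner_Integration.integrable_bound)
  show "integrable (Ioo a b) (\<lambda>x. (f x)\<^sup>2 + (g x)\<^sup>2)"
    using f g by (simp add: square_integrable_iff)
  show "(\<lambda>x. f x * g x) \<in> borel_measurable (Ioo a b)"
    using f g by (auto simp: square_integrable_iff)
  show "AE x in Ioo a b. norm (f x * g x) \<le> norm ((f x)\<^sup>2 + (g x)\<^sup>2)"
  proof (rule AE_I2)
    fix x
    have "2 * (\<bar>f x\<bar> * \<bar>g x\<bar>) \<le> (f x)\<^sup>2 + (g x)\<^sup>2"
      using sum_squares_bound[of "\<bar>f x\<bar>" "\<bar>g x\<bar>"] by (simp add: algebra_simps)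
    then show "norm (f x * g x) \<le> norm ((f x)\<^sup>2 + (g x)\<^sup>2)"
      using mult_nonneg_nonneg[OF abs_ge_zero abs_ge_zero, of "f x" "g x"]
      unfolding real_norm_def abs_mult by linarith
  qed
qed

lemma measure_Ioo [simp]: "a \<le> b \<Longrightarrow> measure (Ioo a b) {a<..<b} = b - a"
  by (simp add: measure_restrict_space)

lemma square_integrable_const [simp]: "square_integrable a b (\<lambda>x. k)"
  using finite_measure.integrable_const[OF finite_measure_Ioo]
  by (simp add: square_integrable_iff)

lemma square_integrable_integrable:
  "square_integrable a b f \<Longrightarrow> integrable (Ioo a b) f"
  using square_integrable_integrable_mult[of a b f "\<lambda>x. 1"] by simp

lemma square_integrable_add:
  assumes f: "square_integrable a b f" and g: "square_integrable a b g"
  shows "square_integrable a b (\<lambda>x. f x + g x)"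
  using square_integrable_integrable_mult[OF f g] f g
  by (auto simp: square_integrable_iff power2_sum mult.assoc)

lemma square_integrable_cmult:
  "square_integrable a b f \<Longrightarrow> square_integrable a b (\<lambda>x. k * f x)"
  by (auto simp: square_integrable_iff power_mult_distrib)

lemma square_integrable_minus:
  "square_integrable a b f \<Longrightarrow> square_integrable a b (\<lambda>x. - f x)"
  using square_integrable_cmult[of a b f "-1"] by simp

lemma square_integrable_diff:
  "square_integrable a b f \<Longrightarrow> square_integrable a b g \<Longrightarrow> square_integrable a b (\<lambda>x. f x - g x)"
  using square_integrable_add[of a b f "\<lambda>x. - g x"] square_integrable_minus by simp

lemma AE_Ioo_I: "(\<And>x. a < x \<Longrightarrow> x < b \<Longrightarrow> P x) \<Longrightarrow> AE x in Ioo a b. P x"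
  by (rule AE_I2) auto

lemma square_integrable_bounded_mult:
  assumes f: "square_integrable a b f" and g: "g \<in> borel_measurable (Ioo a b)"
    and le: "AE x in Ioo a b. \<bar>g x\<bar> \<le> B"
  shows "square_integrable a b (\<lambda>x. g x * f x)"
proof -
  have "integrable (Ioo a b) (\<lambda>x. (g x * f x)\<^sup>2)"
  proof (rule Bochner_Integration.integrable_bound)
    show "integrable (Ioo a b) (\<lambda>x. B\<^sup>2 * (f x)\<^sup>2)"
      using f by (simp add: square_integrable_iff)
    show "(\<lambda>x. (g x * f x)\<^sup>2) \<in> borel_measurable (Ioo a b)"
      using f g by (auto simp: square_integrable_iff)
    show "AE x in Ioo a b. norm ((g x * f x)\<^sup>2) \<le> norm (B\<^sup>2 * (f x)\<^sup>2)"
      using le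
    proof eventually_elim
      case (elim x)
      then have "(g x)\<^sup>2 \<le> B\<^sup>2"
        by (metis abs_ge_zero power2_abs power_mono)
      then show ?case by (simp add: power_mult_distrib mult_right_mono)
    qed
  qed
  then show ?thesis using f g by (auto simp: square_integrable_iff)
qed

lemma square_integrable_bounded:
  assumes "g \<in> borel_measurable (Ioo a b)" and "AE x in Ioo a b. \<bar>g x\<bar> \<le> B"
  shows "square_integrable a b g"
  using square_integrable_bounded_mult[OF square_integrable_const[of a b 1] assms] by simp

lemma borel_measurable_Ioo_continuous:
  "continuous_on {a<..<b} g \<Longrightarrow> g \<in> borel_measurable (Ioo a b)"
  by (rule continuous_imp_measurable_on_sets_lebesgue) auto

lemma continuous_on_bounded_real:
  fixes g :: "real \<Rightarrow> real"
  assumes "continuous_on {a..b} g"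
  obtains B where "B \<ge> 0" "\<And>x. x \<in> {a..b} \<Longrightarrow> \<bar>g x\<bar> \<le> B"
proof -
  have "bounded (g ` {a..b})"
    using assms compact_continuous_image compact_imp_bounded by blast
  then obtain B where "\<And>x. x \<in> {a..b} \<Longrightarrow> \<bar>g x\<bar> \<le> B"
    unfolding bounded_iff by force
  then have "\<And>x. x \<in> {a..b} \<Longrightarrow> \<bar>g x\<bar> \<le> max B 0" by force
  then show thesis using that[of "max B 0"] by simp
qed

lemma square_integrable_continuous:
  assumes "continuous_on {a..b} g"
  shows "square_integrable a b g"
proof -
  obtain B where "\<And>x. x \<in> {a..b} \<Longrightarrow> \<bar>g x\<bar> \<le> B"
    using continuous_on_bounded_real[OF assms] by metis
  then show ?thesis
    using assms
    by (intro square_integrable_bounded[of _ _ _ B] AE_Ioo_I borel_measurable_Ioo_continuous)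
       (auto intro: continuous_on_subset)
qed

lemma square_integrable_mult_continuous:
  assumes f: "square_integrable a b f" and g: "continuous_on {a..b} g"
  shows "square_integrable a b (\<lambda>x. g x * f x)"
proof -
  obtain B where "\<And>x. x \<in> {a..b} \<Longrightarrow> \<bar>g x\<bar> \<le> B"
    using continuous_on_bounded_real[OF g] by metis
  then show ?thesis
    using f g
    by (intro square_integrable_bounded_mult[of _ _ _ _ B] AE_Ioo_I borel_measurable_Ioo_continuous)
       (auto intro: continuous_on_subset)
qed

lemma measurable_Ioo_subset:
  assumes f: "f \<in> borel_measurable (Ioo a b)" and "a \<le> c" "d \<le> b"
  shows "f \<in> borel_measurable (Ioo c d)"
proof -
  have "{c<..<d} \<subseteq> {a<..<b}" using assms by auto
  then show ?thesis
    using f by (rule measurable_restrict_mono[rotated])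
qed

lemma integrable_Ioo_iff:
  fixes f :: "real \<Rightarrow> real"
  shows "integrable (Ioo a b) f \<longleftrightarrow> set_integrable lebesgue {a<..<b} f"
  unfolding set_integrable_def by (simp add: integrable_restrict_space)

lemma integrable_Ioo_subset:
  fixes f :: "real \<Rightarrow> real"
  assumes "integrable (Ioo a b) f" and "a \<le> c" "d \<le> b"
  shows "integrable (Ioo c d) f"
  unfolding integrable_Ioo_iff
  by (rule set_integrable_subset[of _ "{a<..<b}"]) (use assms in \<open>auto simp: integrable_Ioo_iff\<close>)

lemma square_integrable_subset:
  "square_integrable a b f \<Longrightarrow> a \<le> c \<Longrightarrow> d \<le> b \<Longrightarrow> square_integrable c d f"
  unfolding square_integrable_iff
  by (intro conjI; elim conjE; rule measurable_Ioo_subset integrable_Ioo_subset)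

lemma AE_Ioo_iff: "(AE x in Ioo a b. P x) \<longleftrightarrow> (AE x in lebesgue. a < x \<and> x < b \<longrightarrow> P x)"
  by (simp add: AE_restrict_space_iff)

lemma AE_Ioo_subset:
  assumes "AE x in Ioo a b. P x" and "a \<le> c" "d \<le> b"
  shows "AE x in Ioo c d. P x"
  using assms(1) unfolding AE_Ioo_iff by eventually_elim (use assms(2,3) in auto)


section \<open>Additivity over adjacent intervals and partitions\<close>

lemma integral_Ioo_eq:
  fixes f :: "real \<Rightarrow> real"
  assumes "integrable (Ioo a b) f"
  shows "integral\<^sup>L (Ioo a b) f = integral {a..b} f" and "f integrable_on {a..b}"
  using has_integral_integral_lebesgue_on[OF assms] has_integral_Icc_iff_Ioo[of f _ a b]
  by (auto simp: integral_unique integrable_on_def)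

lemma integral_Ioo_combine:
  fixes f :: "real \<Rightarrow> real"
  assumes f: "integrable (Ioo a b) f" and "a \<le> c" "c \<le> b"
  shows "integral\<^sup>L (Ioo a b) f = integral\<^sup>L (Ioo a c) f + integral\<^sup>L (Ioo c b) f"
proof -
  have "integrable (Ioo a c) f" "integrable (Ioo c b) f"
    using assms by (auto intro: integrable_Ioo_subset)
  then show ?thesis
    using assms Henstock_Kurzweil_Integration.integral_combine[where a=a and c=c and b=b and f=f] by (simp add: integral_Ioo_eq)
qed

lemma measurable_Ioo_combine:
  fixes f :: "real \<Rightarrow> real"
  assumes f: "f \<in> borel_measurable (Ioo a c)" and g: "f \<in> borel_measurable (Ioo c b)" and "a \<le> c" "c \<le> b"
  shows "f \<in> borel_measurable (Ioo a b)"
proof -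
  \<comment> \<open>The point \<open>c\<close> belongs to neither open piece, so its value is
    restored by a separate summand.\<close>
  have "(\<lambda>x. indicator {a<..<c} x *\<^sub>R f x + indicator {c<..<b} x *\<^sub>R f x
     + (if x = c \<and> a < c \<and> c < b then f c else 0)) \<in> borel_measurable lebesgue"
    using f g
    by (intro borel_measurable_add measurable_If) (auto simp: borel_measurable_restrict_space_iff)
  also have "(\<lambda>x. indicator {a<..<c} x *\<^sub>R f x + indicator {c<..<b} x *\<^sub>R f x
     + (if x = c \<and> a < c \<and> c < b then f c else 0)) = (\<lambda>x. indicator {a<..<b} x *\<^sub>R f x)"
    using assms(3,4) by (auto simp: fun_eq_iff indicator_def)
  finally show ?thesis by (simp add: borel_measurable_restrict_space_iff)
qed

lemma partition_le:
  fixes x :: "nat \<Rightarrow> real"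
  assumes "\<And>i. i < n \<Longrightarrow> x i \<le> x (Suc i)" and "i \<le> j" "j \<le> n"
  shows "x i \<le> x j"
  using assms(2,3)
proof (induction j rule: dec_induct)
  case (step j)
  then show ?case using assms(1)[of j] by simp
qed simp

lemma integral_Ioo_partition:
  fixes f :: "real \<Rightarrow> real"
  assumes "integrable (Ioo (x 0) (x n)) f" and mono: "\<And>i. i < n \<Longrightarrow> x i \<le> x (Suc i)"
  shows "integral\<^sup>L (Ioo (x 0) (x n)) f = (\<Sum>i<n. integral\<^sup>L (Ioo (x i) (x (Suc i))) f)"
  using assms
proof (induction n)
  case (Suc n)
  have le: "x 0 \<le> x n" "x n \<le> x (Suc n)"
    using partition_le[of "Suc n" x 0 n] Suc.prems(2) by auto
  have "integrable (Ioo (x 0) (x n)) f"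
    using Suc.prems(1) le by (auto intro: integrable_Ioo_subset)
  with Suc.IH Suc.prems show ?case
    using integral_Ioo_combine[OF Suc.prems(1) le] by simp
qed simp

text \<open>Unlike the norm, its square is additive over adjacent intervals, which the passage
  between cell estimates and global estimates needs.\<close>

definition L2_sq :: "real \<Rightarrow> real \<Rightarrow> (real \<Rightarrow> real) \<Rightarrow> real" where
  "L2_sq a b f = integral\<^sup>L (Ioo a b) (\<lambda>x. (f x)\<^sup>2)"

lemma L2_inner_self: "L2_inner a b f f = L2_sq a b f"
  by (simp add: L2_inner_eq L2_sq_def power2_eq_square)

lemma L2_sq_nonneg [simp]: "0 \<le> L2_sq a b f"
  by (simp add: L2_sq_def)

lemma L2_norm_eq: "L2_norm a b f = sqrt (L2_sq a b f)"
  by (simp add: L2_norm_def L2_inner_self)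

lemma L2_norm_power2: "(L2_norm a b f)\<^sup>2 = L2_sq a b f"
  by (simp add: L2_norm_eq)

lemma L2_sq_empty [simp]: "b \<le> a \<Longrightarrow> L2_sq a b f = 0"
  by (simp add: L2_sq_def)

lemma L2_sq_cong_AE:
  assumes "square_integrable a b f" "square_integrable a b g" and eq: "AE x in Ioo a b. f x = g x"
  shows "L2_sq a b f = L2_sq a b g"
  unfolding L2_sq_def using assms(1,2) eventually_mono[OF eq, of "\<lambda>x. (f x)\<^sup>2 = (g x)\<^sup>2"]
  by (intro integral_cong_AE) (auto simp: square_integrable_iff)

lemma L2_sq_cong: "(\<And>x. a < x \<Longrightarrow> x < b \<Longrightarrow> f x = g x) \<Longrightarrow> L2_sq a b f = L2_sq a b g"
  unfolding L2_sq_def by (intro Bochner_Integration.integral_cong) auto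

lemma square_integrable_cong:
  assumes "square_integrable a b f" "\<And>x. a < x \<Longrightarrow> x < b \<Longrightarrow> f x = g x"
  shows "square_integrable a b g"
proof -
  have "f \<in> borel_measurable (Ioo a b) \<longleftrightarrow> g \<in> borel_measurable (Ioo a b)"
    using assms(2) by (intro measurable_cong) auto
  moreover have "integrable (Ioo a b) (\<lambda>x. (f x)\<^sup>2) \<longleftrightarrow> integrable (Ioo a b) (\<lambda>x. (g x)\<^sup>2)"
    using assms(2) by (intro Bochner_Integration.integrable_cong) auto
  ultimately show ?thesis using assms(1) by (simp add: square_integrable_iff)
qed

lemma L2_sq_mono_AE:
  assumes "square_integrable a b f" "square_integrable a b g" "AE x in Ioo a b. \<bar>f x\<bar> \<le> \<bar>g x\<bar>"
  shows "L2_sq a b f \<le> L2_sq a b g"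
  unfolding L2_sq_def using assms
  by (intro integral_mono_AE) (auto simp: square_integrable_iff abs_le_square_iff)

lemma L2_sq_le_integral:
  assumes "square_integrable a b f" "integrable (Ioo a b) G" "\<And>x. a < x \<Longrightarrow> x < b \<Longrightarrow> (f x)\<^sup>2 \<le> G x"
  shows "L2_sq a b f \<le> integral\<^sup>L (Ioo a b) G"
  unfolding L2_sq_def using assms
  by (intro integral_mono_AE) (auto simp: square_integrable_iff intro: AE_Ioo_I)

lemma integral_Ioo_const [simp]: "a \<le> b \<Longrightarrow> integral\<^sup>L (Ioo a b) (\<lambda>x. k) = (b - a) * (k::real)"
  by simp

lemma L2_sq_bounded_le:
  assumes "a \<le> b" "square_integrable a b f" "\<And>x. a < x \<Longrightarrow> x < b \<Longrightarrow> \<bar>f x\<bar> \<le> B"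
  shows "L2_sq a b f \<le> (b - a) * B\<^sup>2"
proof -
  have "(f x)\<^sup>2 \<le> B\<^sup>2" if "a < x" "x < b" for x
    using assms(3)[OF that] by (metis abs_ge_zero power2_abs power_mono)
  then show ?thesis
    using L2_sq_le_integral[OF assms(2), of "\<lambda>x. B\<^sup>2"] assms(1)
      finite_measure.integrable_const[OF finite_measure_Ioo, of a b "B\<^sup>2"] by simp
qed

lemma L2_sq_cmult: "L2_sq a b (\<lambda>x. k * f x) = k\<^sup>2 * L2_sq a b f"
  by (simp add: L2_sq_def power_mult_distrib)

lemma L2_sq_minus_commute: "L2_sq a b (\<lambda>x. f x - g x) = L2_sq a b (\<lambda>x. g x - f x)"
  by (simp add: L2_sq_def power2_commute)

lemma L2_sq_combine:
  assumes "square_integrable a b f" "a \<le> c" "c \<le> b"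
  shows "L2_sq a b f = L2_sq a c f + L2_sq c b f"
  unfolding L2_sq_def using assms by (intro integral_Ioo_combine) (auto simp: square_integrable_iff)

lemma L2_sq_mono_interval:
  assumes "square_integrable a b f" "a \<le> c" "c \<le> d" "d \<le> b"
  shows "L2_sq c d f \<le> L2_sq a b f"
proof -
  have "L2_sq a b f = L2_sq a c f + L2_sq c b f"
    using assms by (intro L2_sq_combine) auto
  also have "L2_sq c b f = L2_sq c d f + L2_sq d b f"
    using assms by (intro L2_sq_combine) (auto intro: square_integrable_subset)
  finally show ?thesis by simp
qed

lemma L2_sq_add_le:
  assumes "square_integrable a b f" "square_integrable a b g"
  shows "L2_sq a b (\<lambda>x. f x + g x) \<le> 2 * L2_sq a b f + 2 * L2_sq a b g"
proof -
  have "L2_sq a b (\<lambda>x. f x + g x) \<le> integral\<^sup>L (Ioo a b) (\<lambda>x. 2 * (f x)\<^sup>2 + 2 * (g x)\<^sup>2)"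
    using assms
    by (intro L2_sq_le_integral square_integrable_add)
       (use sum_squares_bound in \<open>auto simp: square_integrable_iff power2_sum add.commute\<close>)
  also have "\<dots> = 2 * L2_sq a b f + 2 * L2_sq a b g"
    using assms by (simp add: L2_sq_def square_integrable_iff)
  finally show ?thesis .
qed

lemma L2_sq_diff_le:
  assumes "square_integrable a b f" "square_integrable a b g"
  shows "L2_sq a b (\<lambda>x. f x - g x) \<le> 2 * L2_sq a b f + 2 * L2_sq a b g"
  using L2_sq_add_le[OF assms(1) square_integrable_minus[OF assms(2)]]
  by (simp add: L2_sq_def)

text \<open>The square of \<open>s * f x - t * g x\<close> integrates to a nonnegative quadratic
  form in \<open>s\<close> and \<open>t\<close>, and the claim is its discriminant
  condition.\<close>

lemma L2_Cauchy_Schwarz: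
  assumes f: "square_integrable a b f" and g: "square_integrable a b g"
  shows "(integral\<^sup>L (Ioo a b) (\<lambda>x. f x * g x))\<^sup>2 \<le> L2_sq a b f * L2_sq a b g"
proof -
  define I where "I = integral\<^sup>L (Ioo a b) (\<lambda>x. f x * g x)"
  note fg = square_integrable_integrable_mult[OF f g]
  have quad: "0 \<le> s\<^sup>2 * L2_sq a b f - 2 * s * t * I + t\<^sup>2 * L2_sq a b g" for s t
  proof -
    have "0 \<le> integral\<^sup>L (Ioo a b) (\<lambda>x. (s * f x - t * g x)\<^sup>2)" by simp
    also have "(\<lambda>x. (s * f x - t * g x)\<^sup>2) = (\<lambda>x. s\<^sup>2 * (f x)\<^sup>2 - 2 * s * t * (f x * g x) + t\<^sup>2 * (g x)\<^sup>2)"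
      by (simp add: power2_diff power_mult_distrib algebra_simps)
    also have "integral\<^sup>L (Ioo a b) \<dots> = s\<^sup>2 * L2_sq a b f - 2 * s * t * I + t\<^sup>2 * L2_sq a b g"
      using f g fg by (simp add: square_integrable_iff I_def L2_sq_def)
    finally show ?thesis .
  qed
  have "I\<^sup>2 \<le> L2_sq a b f * L2_sq a b g"
  proof (cases "L2_sq a b g = 0")
    case True
    have "I = 0"
    proof (rule ccontr)
      assume "I \<noteq> 0"
      \<comment> \<open>For \<open>s = 1\<close> the form is affine in \<open>t\<close>, and this
        \<open>t\<close> gives it the value \<open>-1\<close>.\<close>
      have "0 \<le> L2_sq a b f - 2 * ((L2_sq a b f + 1) / (2 * I)) * I"
        using quad[of 1 "(L2_sq a b f + 1) / (2 * I)"] True by simp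
      then show False using \<open>I \<noteq> 0\<close> by (simp add: field_simps)
    qed
    then show ?thesis using True by simp
  next
    case False
    then have pos: "L2_sq a b g > 0" using L2_sq_nonneg[of a b g] by linarith
    have "0 \<le> L2_sq a b g * (L2_sq a b f * L2_sq a b g - I\<^sup>2)"
      using quad[of "L2_sq a b g" I] by (simp add: power2_eq_square algebra_simps)
    then show ?thesis using pos by (simp add: zero_le_mult_iff)
  qed
  then show ?thesis by (simp add: I_def)
qed

lemma L2_inner_abs_le:
  assumes f: "square_integrable a b f" and g: "square_integrable a b g"
  shows "\<bar>integral\<^sup>L (Ioo a b) (\<lambda>x. f x * g x)\<bar> \<le> sqrt (L2_sq a b f) * sqrt (L2_sq a b g)"
  using L2_Cauchy_Schwarz[OF assms]
  by (metis real_sqrt_abs real_sqrt_le_mono real_sqrt_mult)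

lemma integral_Ioo_power2_le:
  assumes "a \<le> b" "square_integrable a b g"
  shows "(integral\<^sup>L (Ioo a b) g)\<^sup>2 \<le> (b - a) * L2_sq a b g"
  using L2_Cauchy_Schwarz[OF square_integrable_const[of a b 1] assms(2)] assms(1)
  by (simp add: L2_sq_def)

section \<open>Primitives of square-integrable functions\<close>

lemma integral_Ioo_superset:
  fixes f :: "real \<Rightarrow> real"
  assumes "a \<le> c" "d \<le> b" and "\<And>x. a < x \<Longrightarrow> x < b \<Longrightarrow> x \<notin> {c<..<d} \<Longrightarrow> f x = 0"
  shows "integral\<^sup>L (Ioo a b) f = integral\<^sup>L (Ioo c d) f"
proof -
  have "(\<lambda>x. indicator {a<..<b} x *\<^sub>R f x) = (\<lambda>x. indicator {c<..<d} x *\<^sub>R f x)"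
    using assms by (force simp: indicator_def fun_eq_iff)
  then show ?thesis by (simp add: integral_restrict_space)
qed

text \<open>Absolute continuity with a square-integrable derivative, stated as an integral identity.
  The derivative is an argument and not a chosen object as in \<open>wderiv\<close>, so that several
  representatives of it can be used for one function.\<close>

definition L2_primitive :: "real \<Rightarrow> real \<Rightarrow> (real \<Rightarrow> real) \<Rightarrow> (real \<Rightarrow> real) \<Rightarrow> bool" where
  "L2_primitive a b v g \<longleftrightarrow>
     square_integrable a b g \<and> (\<forall>x\<in>{a..b}. v x = v a + integral\<^sup>L (Ioo a x) g)"

lemma L2_primitive_square_integrable: "L2_primitive a b v g \<Longrightarrow> square_integrable a b g"
  unfolding L2_primitive_def by (rule conjunct1)

lemma L2_primitive_eq:
  "L2_primitive a b v g \<Longrightarrow> a \<le> x \<Longrightarrow> x \<le> b \<Longrightarrow> v x = v a + integral\<^sup>L (Ioo a x) g"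
  unfolding L2_primitive_def by (meson atLeastAtMost_iff)

lemma L2_primitive_diff:
  assumes "L2_primitive a b v g" "a \<le> x" "x \<le> y" "y \<le> b"
  shows "v y = v x + integral\<^sup>L (Ioo x y) g"
proof -
  have "integrable (Ioo a y) g"
    using assms L2_primitive_square_integrable[OF assms(1)]
    by (auto intro: square_integrable_integrable square_integrable_subset)
  then have "integral\<^sup>L (Ioo a y) g = integral\<^sup>L (Ioo a x) g + integral\<^sup>L (Ioo x y) g"
    using assms by (intro integral_Ioo_combine) auto
  moreover have "v x = v a + integral\<^sup>L (Ioo a x) g" "v y = v a + integral\<^sup>L (Ioo a y) g"
    using assms(2-4) by (auto intro!: L2_primitive_eq[OF assms(1)])
  ultimately show ?thesis by linarith
qed

lemma L2_primitive_subset: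
  assumes "L2_primitive a b v g" "a \<le> c" "d \<le> b"
  shows "L2_primitive c d v g"
  unfolding L2_primitive_def
proof
  show "square_integrable c d g"
    using assms L2_primitive_square_integrable[OF assms(1)] by (auto intro: square_integrable_subset)
  show "\<forall>x\<in>{c..d}. v x = v c + integral\<^sup>L (Ioo c x) g"
    using assms(2,3) by (intro ballI L2_primitive_diff[OF assms(1)]) auto
qed

lemma L2_primitive_I:
  assumes "square_integrable a b g" "\<And>x. x \<in> {a..b} \<Longrightarrow> v x = k + integral\<^sup>L (Ioo a x) g"
  shows "L2_primitive a b v g"
proof (cases "a \<le> b")
  case True
  then have "v a = k" using assms(2)[of a] by simp
  then show ?thesis using assms unfolding L2_primitive_def by simp
next
  case False
  then show ?thesis using assms(1) by (simp add: L2_primitive_def)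
qed

lemma square_integrable_combine:
  assumes "square_integrable a c g" "square_integrable c b g" "a \<le> c" "c \<le> b"
  shows "square_integrable a b g"
proof -
  have m: "g \<in> borel_measurable (Ioo a b)"
    using assms by (intro measurable_Ioo_combine[of g a c b]) (auto simp: square_integrable_iff)
  have ac: "set_integrable lebesgue {a<..<c} (\<lambda>x. (g x)\<^sup>2)" and cb: "set_integrable lebesgue {c<..<b} (\<lambda>x. (g x)\<^sup>2)"
    using assms by (auto simp: square_integrable_iff integrable_Ioo_iff)
  have "set_integrable lebesgue ({a<..<c} \<union> {c<..<b}) (\<lambda>x. (g x)\<^sup>2)"
    by (rule set_integrable_Un[OF ac cb]) auto
  moreover have "set_integrable lebesgue ({a<..<c} \<union> {c<..<b}) (\<lambda>x. (g x)\<^sup>2) \<longleftrightarrow>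
     set_integrable lebesgue {a<..<b} (\<lambda>x. (g x)\<^sup>2)"
  proof (rule absolutely_integrable_spike_set_eq)
    have "{x \<in> ({a<..<c} \<union> {c<..<b}) - {a<..<b}. (g x)\<^sup>2 \<noteq> 0} \<subseteq> {c}"
      "{x \<in> {a<..<b} - ({a<..<c} \<union> {c<..<b}). (g x)\<^sup>2 \<noteq> 0} \<subseteq> {c}"
      using assms(3,4) by auto
    then show "negligible {x \<in> ({a<..<c} \<union> {c<..<b}) - {a<..<b}. (g x)\<^sup>2 \<noteq> 0}"
      "negligible {x \<in> {a<..<b} - ({a<..<c} \<union> {c<..<b}). (g x)\<^sup>2 \<noteq> 0}"
      by (meson negligible_sing negligible_subset)+
  qed
  ultimately show ?thesis
    using m by (simp add: square_integrable_iff integrable_Ioo_iff)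
qed

text \<open>Both pieces refer to the same value \<open>v c\<close>, so \<open>v\<close> cannot jump
  at \<open>c\<close> and the integrals add up. Continuous piecewise polynomials become members of
  \<open>H1\<close> in this way.\<close>

lemma L2_primitive_combine:
  assumes "L2_primitive a c v g" "L2_primitive c b v g" "a \<le> c" "c \<le> b"
  shows "L2_primitive a b v g"
  unfolding L2_primitive_def
proof
  show L2_sq: "square_integrable a b g"
    by (rule square_integrable_combine[OF assms(1,2)[THEN L2_primitive_square_integrable] assms(3,4)])
  show "\<forall>x\<in>{a..b}. v x = v a + integral\<^sup>L (Ioo a x) g"
  proof
    fix x assume x: "x \<in> {a..b}"
    show "v x = v a + integral\<^sup>L (Ioo a x) g"
    proof (cases "x \<le> c")
      case True
      then show ?thesis using x by (intro L2_primitive_eq[OF assms(1)]) auto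
    next
      case False
      have "integral\<^sup>L (Ioo a x) g = integral\<^sup>L (Ioo a c) g + integral\<^sup>L (Ioo c x) g"
        using False x assms(3) square_integrable_subset[OF L2_sq, of a x]
        by (intro integral_Ioo_combine square_integrable_integrable) auto
      moreover have "v x = v c + integral\<^sup>L (Ioo c x) g" "v c = v a + integral\<^sup>L (Ioo a c) g"
        using False x assms(3,4) by (auto intro!: L2_primitive_eq[OF assms(2)] L2_primitive_eq[OF assms(1)])
      ultimately show ?thesis by linarith
    qed
  qed
qed

lemma L2_primitive_cong:
  assumes "L2_primitive a b v g" "\<And>x. x \<in> {a..b} \<Longrightarrow> v' x = v x"
  shows "L2_primitive a b v' g"
proof (rule L2_primitive_I[where k="v a"])
  fix x assume x: "x \<in> {a..b}"
  show "v' x = v a + integral\<^sup>L (Ioo a x) g"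
    using x assms(2)[OF x] L2_primitive_eq[OF assms(1), of x] by simp
qed (rule L2_primitive_square_integrable[OF assms(1)])

lemma integral_Ioo_cong_AE:
  fixes f :: "real \<Rightarrow> real"
  assumes "f \<in> borel_measurable (Ioo a b)" "g \<in> borel_measurable (Ioo a b)" "AE x in Ioo a b. f x = g x"
  shows "integral\<^sup>L (Ioo a b) f = integral\<^sup>L (Ioo a b) g"
  using assms by (rule integral_cong_AE)

lemma L2_primitive_cong_AE:
  assumes v: "L2_primitive a b v g" and g': "square_integrable a b g'"
    and eq: "AE x in Ioo a b. g x = g' x"
  shows "L2_primitive a b v g'"
proof (rule L2_primitive_I[where k="v a"])
  fix x assume x: "x \<in> {a..b}"
  have "integral\<^sup>L (Ioo a x) g = integral\<^sup>L (Ioo a x) g'"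
    using L2_primitive_square_integrable[OF v] g' eq x
    by (intro integral_Ioo_cong_AE)
       (auto intro: AE_Ioo_subset square_integrable_measurable square_integrable_subset)
  then show "v x = v a + integral\<^sup>L (Ioo a x) g'"
    using x L2_primitive_eq[OF v, of x] by simp
qed (rule g')

text \<open>Hoelder continuity with exponent \<open>1/2\<close>, from the Cauchy-Schwarz inequality
  against a constant. Continuity, integration by parts and the Poincare inequality rest on
  it.\<close>

lemma L2_primitive_diff_le:
  assumes "L2_primitive a b v g" "x \<in> {a..b}" "y \<in> {a..b}"
  shows "\<bar>v y - v x\<bar> \<le> sqrt (L2_sq a b g) * sqrt \<bar>y - x\<bar>"
proof -
  have *: "\<bar>v y - v x\<bar> \<le> sqrt (L2_sq a b g) * sqrt \<bar>y - x\<bar>" if "a \<le> x" "x \<le> y" "y \<le> b" for x y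
  proof -
    have s: "square_integrable x y g"
      using L2_primitive_square_integrable[OF assms(1)] that by (auto intro: square_integrable_subset)
    have "(v y - v x)\<^sup>2 \<le> (y - x) * L2_sq x y g"
      using L2_primitive_diff[OF assms(1) that] integral_Ioo_power2_le[OF that(2) s] by simp
    also have "\<dots> \<le> (y - x) * L2_sq a b g"
      using L2_primitive_square_integrable[OF assms(1)] that by (intro mult_left_mono L2_sq_mono_interval) auto
    finally have "sqrt ((v y - v x)\<^sup>2) \<le> sqrt ((y - x) * L2_sq a b g)" by (rule real_sqrt_le_mono)
    then show ?thesis using that by (simp add: real_sqrt_mult mult.commute)
  qed
  show ?thesis
  proof (cases "x \<le> y")
    case True then show ?thesis using *[of x y] assms by simp
  next
    case False then show ?thesis using *[of y x] assms by (simp add: abs_minus_commute)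
  qed
qed

lemma L2_primitive_continuous:
  assumes "L2_primitive a b v g"
  shows "continuous_on {a..b} v"
  unfolding continuous_on_iff
proof (intro ballI allI impI)
  fix x e :: real assume x: "x \<in> {a..b}" and e: "e > 0"
  define M where "M = sqrt (L2_sq a b g) + 1"
  have M: "M > 0" unfolding M_def by (simp add: add_nonneg_pos)
  show "\<exists>d>0. \<forall>y\<in>{a..b}. dist y x < d \<longrightarrow> dist (v y) (v x) < e"
  proof (intro exI[of _ "(e / M)\<^sup>2"] conjI ballI impI)
    show "0 < (e / M)\<^sup>2" using e M by simp
    fix y assume y: "y \<in> {a..b}" "dist y x < (e / M)\<^sup>2"
    have "\<bar>v y - v x\<bar> \<le> sqrt (L2_sq a b g) * sqrt \<bar>y - x\<bar>"
      by (rule L2_primitive_diff_le[OF assms x y(1)])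
    also have "\<dots> \<le> M * sqrt \<bar>y - x\<bar>" by (intro mult_right_mono) (auto simp: M_def)
    also have "sqrt \<bar>y - x\<bar> < sqrt ((e / M)\<^sup>2)"
      using y(2) by (intro real_sqrt_less_mono) (simp add: dist_real_def)
    also have "M * sqrt ((e / M)\<^sup>2) = e" using e M by simp
    finally show "dist (v y) (v x) < e" using M by (simp add: dist_real_def)
  qed
qed

text \<open>The difference quotient at \<open>x\<close> is bounded by
  \<open>C * sqrt \<bar>y - x\<bar>\<close>, so \<open>H\<close> has derivative zero everywhere,
  one-sidedly at the ends.\<close>

lemma zero_increment_of_superlinear_bound:
  fixes H :: "real \<Rightarrow> real"
  assumes "a \<le> b" and H: "\<And>x y. a \<le> x \<Longrightarrow> x \<le> y \<Longrightarrow> y \<le> b \<Longrightarrow> \<bar>H y - H x\<bar> \<le> C * (y - x) * sqrt (y - x)"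
  shows "H b = H a"
proof (cases "a = b")
  case False
  have D: "(H has_field_derivative 0) (at x within {a..b})" if x: "x \<in> {a..b}" for x
  proof -
    have b: "norm ((H y - H x) / (y - x)) \<le> C * sqrt \<bar>y - x\<bar>" if "y \<in> {a..b}" "y \<noteq> x" for y
    proof -
      have "\<bar>H y - H x\<bar> \<le> C * \<bar>y - x\<bar> * sqrt \<bar>y - x\<bar>"
        using H[of x y] H[of y x] x that by (cases "x \<le> y") (auto simp: abs_minus_commute)
      then show ?thesis using that by (simp add: abs_divide divide_le_eq mult.assoc mult.left_commute mult.commute)
    qed
    have "((\<lambda>y. C * sqrt \<bar>y - x\<bar>) \<longlongrightarrow> C * sqrt \<bar>x - x\<bar>) (at x within {a..b})"
      by (intro tendsto_intros)
    then have lim: "((\<lambda>y. C * sqrt \<bar>y - x\<bar>) \<longlongrightarrow> 0) (at x within {a..b})" by simp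
    have "((\<lambda>y. (H y - H x) / (y - x)) \<longlongrightarrow> 0) (at x within {a..b})"
      by (rule Lim_null_comparison[OF _ lim])
        (unfold eventually_at_filter, rule always_eventually, use b in blast)
    then show ?thesis by (simp add: has_field_derivative_iff)
  qed
  obtain c where "\<forall>x\<in>{a..b}. H x = c"
    using has_field_derivative_zero_constant[of "{a..b}" H] D by auto
  then show ?thesis using assms(1) by simp
qed simp

text \<open>The defect of the integration by parts formula is additive over intervals and is bounded by
  the length to the power \<open>3/2\<close>, hence vanishes; this avoids Fubini's theorem.\<close>

lemma L2_primitive_by_parts:
  assumes ab: "a \<le> b" and v: "L2_primitive a b v g"
    and th: "\<And>x. x \<in> {a..b} \<Longrightarrow> (\<theta> has_real_derivative \<theta>' x) (at x within {a..b})"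
    and th': "continuous_on {a..b} \<theta>'"
  shows "integral\<^sup>L (Ioo a b) (\<lambda>x. g x * \<theta> x) =
    v b * \<theta> b - v a * \<theta> a - integral\<^sup>L (Ioo a b) (\<lambda>x. v x * \<theta>' x)"
proof -
  obtain T where T: "T \<ge> 0" "\<And>x. x \<in> {a..b} \<Longrightarrow> \<bar>\<theta>' x\<bar> \<le> T"
    using continuous_on_bounded_real[OF th'] by metis
  define M where "M = sqrt (L2_sq a b g)"
  have M: "M \<ge> 0" by (simp add: M_def)
  have cth: "continuous_on {a..b} \<theta>"
    by (meson th DERIV_continuous continuous_on_eq_continuous_within)
  have cv: "continuous_on {a..b} v" by (rule L2_primitive_continuous[OF v])
  have sg: "square_integrable a b g" by (rule L2_primitive_square_integrable[OF v])
  have prim: "L2_primitive a b \<theta> \<theta>'"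
  proof (rule L2_primitive_I)
    show "square_integrable a b \<theta>'" by (rule square_integrable_continuous[OF th'])
    fix x assume x: "x \<in> {a..b}"
    have "(\<theta>' has_integral (\<theta> x - \<theta> a)) {a..x}"
      using x th by (intro fundamental_theorem_of_calculus)
        (auto simp: has_real_derivative_iff_has_vector_derivative[symmetric] intro!: DERIV_subset[OF th])
    moreover have "integrable (Ioo a x) \<theta>'"
      using x th' by (intro square_integrable_integrable square_integrable_continuous)
        (auto intro: continuous_on_subset)
    ultimately show "\<theta> x = \<theta> a + integral\<^sup>L (Ioo a x) \<theta>'"
      by (simp add: integral_Ioo_eq integral_unique)
  qed
  have ig: "integrable (Ioo a b) (\<lambda>x. g x * \<theta> x)" and iv: "integrable (Ioo a b) (\<lambda>x. v x * \<theta>' x)"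
    using square_integrable_integrable_mult sg cv cth th' square_integrable_continuous by blast+
  define H where "H x = v x * \<theta> x - v a * \<theta> a - integral\<^sup>L (Ioo a x) (\<lambda>x. v x * \<theta>' x)
    - integral\<^sup>L (Ioo a x) (\<lambda>x. g x * \<theta> x)" for x
  have "H b = H a"
  proof (rule zero_increment_of_superlinear_bound[OF ab])
    fix x y assume xy: "a \<le> x" "x \<le> y" "y \<le> b"
    have int: "integrable (Ioo x y) g" "integrable (Ioo x y) \<theta>'"
      "integrable (Ioo x y) (\<lambda>x. g x * \<theta> x)" "integrable (Ioo x y) (\<lambda>x. v x * \<theta>' x)"
      using xy sg ig iv L2_primitive_square_integrable[OF prim]
      by (auto intro: integrable_Ioo_subset square_integrable_integrable square_integrable_subset)
    \<comment> \<open>Freezing \<open>v\<close> at \<open>y\<close> and \<theta> at \<open>x\<close>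
      leaves two integrals of differences. The one of \<open>v\<close> is small by its Hoelder
      bound; the one of \<theta> has a Lipschitz factor and is treated by the Cauchy-Schwarz
      inequality.\<close>
    define A where "A = integral\<^sup>L (Ioo x y) (\<lambda>t. v y * \<theta>' t - v t * \<theta>' t)"
    define B where "B = integral\<^sup>L (Ioo x y) (\<lambda>t. g t * (\<theta> x - \<theta> t))"
    have "integral\<^sup>L (Ioo a y) (\<lambda>x. v x * \<theta>' x) = integral\<^sup>L (Ioo a x) (\<lambda>x. v x * \<theta>' x) + integral\<^sup>L (Ioo x y) (\<lambda>x. v x * \<theta>' x)"
      "integral\<^sup>L (Ioo a y) (\<lambda>x. g x * \<theta> x) = integral\<^sup>L (Ioo a x) (\<lambda>x. g x * \<theta> x) + integral\<^sup>L (Ioo x y) (\<lambda>x. g x * \<theta> x)"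
      using xy integrable_Ioo_subset[OF iv, of a y] integrable_Ioo_subset[OF ig, of a y]
      by (auto intro: integral_Ioo_combine)
    then have "H y - H x = v y * \<theta> y - v x * \<theta> x - integral\<^sup>L (Ioo x y) (\<lambda>x. v x * \<theta>' x) - integral\<^sup>L (Ioo x y) (\<lambda>x. g x * \<theta> x)"
      by (simp add: H_def)
    also have "v y * \<theta> y - v x * \<theta> x = v y * integral\<^sup>L (Ioo x y) \<theta>' + integral\<^sup>L (Ioo x y) g * \<theta> x"
      using L2_primitive_diff[OF v xy] L2_primitive_diff[OF prim xy] by (simp add: algebra_simps)
    also have "\<dots> - integral\<^sup>L (Ioo x y) (\<lambda>x. v x * \<theta>' x) - integral\<^sup>L (Ioo x y) (\<lambda>x. g x * \<theta> x) = A + B"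
      using int by (simp add: A_def B_def right_diff_distrib)
    finally have HAB: "H y - H x = A + B" .
    have A: "\<bar>A\<bar> \<le> M * T * (y - x) * sqrt (y - x)"
    proof -
      have "\<bar>A\<bar> \<le> integral\<^sup>L (Ioo x y) (\<lambda>t. \<bar>v y * \<theta>' t - v t * \<theta>' t\<bar>)"
        unfolding A_def by (rule integral_abs_bound)
      also have "\<dots> \<le> integral\<^sup>L (Ioo x y) (\<lambda>t. M * sqrt (y - x) * T)"
      proof (rule integral_mono_AE)
        show "integrable (Ioo x y) (\<lambda>t. \<bar>v y * \<theta>' t - v t * \<theta>' t\<bar>)" using int by auto
        show "integrable (Ioo x y) (\<lambda>t. M * sqrt (y - x) * T)"
          by (rule finite_measure.integrable_const[OF finite_measure_Ioo])
        show "AE t in Ioo x y. \<bar>v y * \<theta>' t - v t * \<theta>' t\<bar> \<le> M * sqrt (y - x) * T"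
        proof (rule AE_Ioo_I)
          fix t assume t: "x < t" "t < y"
          have "\<bar>v y - v t\<bar> \<le> M * sqrt \<bar>y - t\<bar>"
            using t xy L2_primitive_diff_le[OF v, of t y] by (simp add: M_def)
          also have "\<dots> \<le> M * sqrt (y - x)" using t M by (intro mult_left_mono) auto
          finally have "\<bar>v y - v t\<bar> * \<bar>\<theta>' t\<bar> \<le> M * sqrt (y - x) * T"
            using t xy T M by (intro mult_mono) auto
          then show "\<bar>v y * \<theta>' t - v t * \<theta>' t\<bar> \<le> M * sqrt (y - x) * T"
            by (simp add: abs_mult[symmetric] left_diff_distrib)
        qed
      qed
      finally show ?thesis using xy by (simp add: mult_ac)
    qed
    have B: "\<bar>B\<bar> \<le> M * T * (y - x) * sqrt (y - x)"
    proof -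
      have s: "square_integrable x y g" "square_integrable x y (\<lambda>t. \<theta> x - \<theta> t)"
        using xy sg cth
        by (blast intro: square_integrable_subset)
          (use xy in \<open>auto intro!: square_integrable_continuous continuous_intros continuous_on_subset[OF cth]\<close>)
      have dth: "\<bar>\<theta> x - \<theta> t\<bar> \<le> T * (y - x)" if "x < t" "t < y" for t
      proof -
        have "norm (\<theta> t - \<theta> x) \<le> T * norm (t - x)"
          using that xy T by (intro field_differentiable_bound[of "{a..b}" \<theta> \<theta>']) (auto intro: th)
        also have "\<dots> \<le> T * (y - x)" using that T by (intro mult_left_mono) auto
        finally show ?thesis by (simp add: abs_minus_commute)
      qed
      have "\<bar>B\<bar> \<le> sqrt (L2_sq x y g) * sqrt (L2_sq x y (\<lambda>t. \<theta> x - \<theta> t))"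
        unfolding B_def by (rule L2_inner_abs_le[OF s])
      also have "\<dots> \<le> M * sqrt ((y - x) * (T * (y - x))\<^sup>2)"
        unfolding M_def using xy sg s dth
        by (intro mult_mono real_sqrt_le_mono L2_sq_mono_interval L2_sq_bounded_le) auto
      also have "\<dots> = M * T * (y - x) * sqrt (y - x)"
        using xy T by (simp add: real_sqrt_mult)
      finally show ?thesis .
    qed
    show "\<bar>H y - H x\<bar> \<le> 2 * M * T * (y - x) * sqrt (y - x)"
      unfolding HAB using A B by linarith
  qed
  then show ?thesis by (simp add: H_def)
qed

text \<open>Positive and negative part of \<open>f\<close> are densities of two finite measures.
  Vanishing primitives make these measures agree on all half-lines, hence everywhere, so both parts
  coincide almost everywhere, which is only possible if they are zero.\<close>

lemma AE_zero_if_primitive_zero: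
  fixes f :: "real \<Rightarrow> real"
  assumes f: "integrable (Ioo a b) f" and zero: "\<And>x. x \<in> {a..b} \<Longrightarrow> integral\<^sup>L (Ioo a x) f = 0"
  shows "AE x in Ioo a b. f x = 0"
proof (cases "a < b")
  case False
  then show ?thesis by (intro AE_Ioo_I) auto
next
  case True
  define F where "F x = indicator {a<..<b} x *\<^sub>R f x" for x
  have F: "integrable lebesgue F"
    using f by (simp add: F_def[abs_def] integrable_restrict_space)
  \<comment> \<open>Uniqueness of densities is applied to the Borel measure \<open>lborel\<close>,
    while \<open>f\<close> is only Lebesgue measurable; a Borel function equal almost everywhere to
    the extension by zero takes over.\<close>
  then obtain G where G [measurable]: "G \<in> borel_measurable borel" and FG: "AE x in lborel. F x = G x"
    using completion_ex_borel_measurable_real[of F lborel] by (auto simp: borel_measurable_integrable)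
  have FG': "AE x in lebesgue. F x = G x" using FG by (simp add: AE_completion_iff)
  have iGl: "integrable lebesgue G"
    using F FG' by (subst integrable_cong_AE[symmetric, of F]) (auto intro: borel_measurable_integrable measurable_completion)
  have iG: "integrable lborel G" using iGl by (simp add: integrable_completion)
  have tail: "integral\<^sup>L lborel (\<lambda>t. G t * indicator {x<..} t) = 0" for x
  proof -
    have "integral\<^sup>L lborel (\<lambda>t. G t * indicator {x<..} t) = integral\<^sup>L lebesgue (\<lambda>t. G t * indicator {x<..} t)"
      by (subst integral_completion) auto
    also have "\<dots> = integral\<^sup>L lebesgue (\<lambda>t. F t * indicator {x<..} t)"
    proof (rule integral_cong_AE)
      show "(\<lambda>t. G t * indicator {x<..} t) \<in> borel_measurable lebesgue"
        by (rule measurable_completion) simp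
      show "(\<lambda>t. F t * indicator {x<..} t) \<in> borel_measurable lebesgue"
        using borel_measurable_integrable[OF F]
        by (rule borel_measurable_times) (intro borel_measurable_indicator, simp)
      show "AE t in lebesgue. G t * indicator {x<..} t = F t * indicator {x<..} t"
        using FG' by eventually_elim simp
    qed
    also have "(\<lambda>t. F t * indicator {x<..} t) = (\<lambda>t. indicator {max a x<..<b} t *\<^sub>R f t)"
      by (auto simp: F_def indicator_def fun_eq_iff)
    also have "integral\<^sup>L lebesgue \<dots> = integral\<^sup>L (Ioo (max a x) b) f"
      by (simp add: integral_restrict_space)
    also have "\<dots> = 0"
    proof (cases "max a x \<le> b")
      case True
      then have "integral\<^sup>L (Ioo a b) f = integral\<^sup>L (Ioo a (max a x)) f + integral\<^sup>L (Ioo (max a x) b) f"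
        using f by (intro integral_Ioo_combine) auto
      then show ?thesis using zero[of b] zero[of "max a x"] True \<open>a < b\<close> by simp
    next
      case False
      then have "{max a x<..<b} = {}" by auto
      then show ?thesis by (metis integral_lebesgue_on_empty)
    qed
    finally show ?thesis .
  qed
  \<comment> \<open>\<open>ennreal\<close> maps negative numbers to zero, so these are the densities
    given by the two parts of \<open>G\<close>.\<close>
  have dens: "density lborel (\<lambda>x. ennreal (G x)) = density lborel (\<lambda>x. ennreal (- G x))"
  proof (rule measure_eqI_lessThan)
    fix x
    have i: "integrable lborel (\<lambda>t. G t * indicator {x<..} t)"
      using iG by (rule integrable_real_mult_indicator[rotated]) auto
    then obtain r s where rs: "0 \<le> r" "0 \<le> s"
      "(\<integral>\<^sup>+t. ennreal (G t * indicator {x<..} t) \<partial>lborel) = ennreal r"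
      "(\<integral>\<^sup>+t. ennreal (- (G t * indicator {x<..} t)) \<partial>lborel) = ennreal s"
      "integral\<^sup>L lborel (\<lambda>t. G t * indicator {x<..} t) = r - s"
      by (rule integrableE)
    have e: "emeasure (density lborel (\<lambda>x. ennreal (G x))) {x<..} = ennreal r"
      "emeasure (density lborel (\<lambda>x. ennreal (- G x))) {x<..} = ennreal s"
      using rs(3,4) by (auto simp: emeasure_density nn_integral_set_ennreal)
    then show "emeasure (density lborel (\<lambda>x. ennreal (G x))) {x<..} < \<infinity>" by simp
    show "emeasure (density lborel (\<lambda>x. ennreal (G x))) {x<..} = emeasure (density lborel (\<lambda>x. ennreal (- G x))) {x<..}"
      using e rs(5) tail[of x] by simp
  qed auto
  have "AE x in lborel. ennreal (G x) = ennreal (- G x)"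
    by (rule sigma_finite_measure.density_unique[OF sigma_finite_lborel _ _ dens]) auto
  then have "AE x in lborel. F x = 0"
    using FG
  proof eventually_elim
    case (elim x)
    have "G x = 0"
    proof (cases "G x \<ge> 0")
      case True
      then have "ennreal (G x) = 0" using elim(1) by (simp add: ennreal_neg)
      then show ?thesis using True by simp
    next
      case False
      then have "ennreal (- G x) = 0" using elim(1) by (simp add: ennreal_neg)
      then show ?thesis using False by simp
    qed
    then show ?case using elim(2) by simp
  qed
  then have "AE x in lebesgue. F x = 0" by (simp add: AE_completion_iff)
  then show ?thesis unfolding AE_Ioo_iff F_def by eventually_elim auto
qed

section \<open>Weak derivatives in one dimension\<close>

text \<open>The support is enclosed in a compact interval; as its complement is open, the derivative
  vanishes there as well.\<close>

lemma test_functionE: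
  assumes "test_function a b \<theta>" "a < b"
  obtains c d where "a < c" "c \<le> d" "d < b" "\<And>x. x \<notin> {c..d} \<Longrightarrow> \<theta> x = 0" "\<And>x. x \<notin> {c..d} \<Longrightarrow> deriv \<theta> x = 0"
    "\<And>x. (\<theta> has_real_derivative deriv \<theta> x) (at x)" "continuous_on UNIV (deriv \<theta>)"
proof -
  obtain D where D: "\<And>x. (\<theta> has_vector_derivative D x) (at x)" "continuous_on UNIV D"
    using assms(1) unfolding test_function_def C1_differentiable_on_def by auto
  have eq: "deriv \<theta> = D"
    using D(1) by (auto simp: fun_eq_iff has_real_derivative_iff_has_vector_derivative[symmetric] intro: DERIV_imp_deriv)
  have der: "(\<theta> has_real_derivative deriv \<theta> x) (at x)" for x
    using D(1)[of x] by (simp add: eq has_real_derivative_iff_has_vector_derivative)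
  obtain A where A: "compact A" "A \<subseteq> {a<..<b}" "\<And>x. x \<notin> A \<Longrightarrow> \<theta> x = 0"
    using assms(1) unfolding test_function_def by auto
  obtain c d where cd: "a < c" "c \<le> d" "d < b" "A \<subseteq> {c..d}"
  proof (cases "A = {}")
    case True
    then show ?thesis using that[of "(a+b)/2" "(a+b)/2"] assms(2) by auto
  next
    case False
    obtain l where l: "l \<in> A" "\<forall>x\<in>A. l \<le> x" using compact_attains_inf[OF A(1) False] by auto
    obtain u where u: "u \<in> A" "\<forall>x\<in>A. x \<le> u" using compact_attains_sup[OF A(1) False] by auto
    have "a < l" "l \<le> u" "u < b" "A \<subseteq> {l..u}" using l u A(2) by auto
    then show ?thesis by (rule that)
  qed
  have z: "\<theta> x = 0" if "x \<notin> {c..d}" for x using that cd(4) A(3) by blast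
  have z': "deriv \<theta> x = 0" if "x \<notin> {c..d}" for x
  proof -
    have "(\<theta> has_real_derivative 0) (at x)"
    proof (rule has_field_derivative_transform_within_open)
      show "((\<lambda>_. 0) has_real_derivative 0) (at x)" by simp
      show "open (- {c..d})" by (simp add: open_Compl)
      show "x \<in> - {c..d}" using that by simp
      show "\<And>y. y \<in> - {c..d} \<Longrightarrow> 0 = \<theta> y" using z by simp
    qed
    then show ?thesis by (rule DERIV_imp_deriv)
  qed
  show thesis using that[OF cd(1,2,3) z z' der] D(2) eq by simp
qed

text \<open>Integration by parts is applied only on a compact interval around the support of the
  test function. This suits layer components, which are differentiable on the open interval and have
  no values prescribed at its ends.\<close>

lemma L2_primitive_imp_weak_deriv_on_support:
  assumes "a < b" and v: "square_integrable a b v" and g: "square_integrable a b g"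
    and prim: "\<And>c d. a < c \<Longrightarrow> c \<le> d \<Longrightarrow> d < b \<Longrightarrow> L2_primitive c d v g"
  shows "has_weak_deriv a b v g"
  unfolding has_weak_deriv_def
proof (intro conjI allI impI v g)
  fix \<theta> assume "test_function a b \<theta>"
  then obtain c d where cd: "a < c" "c \<le> d" "d < b" and z: "\<And>x. x \<notin> {c..d} \<Longrightarrow> \<theta> x = 0" "\<And>x. x \<notin> {c..d} \<Longrightarrow> deriv \<theta> x = 0"
    and D: "\<And>x. (\<theta> has_real_derivative deriv \<theta> x) (at x)" "continuous_on UNIV (deriv \<theta>)"
    using test_functionE[OF _ assms(1)] by metis
  \<comment> \<open>Slightly beyond the support, so that \<theta> vanishes at both ends and the
    boundary terms drop out.\<close>
  define c' where "c' = (a + c) / 2"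
  define d' where "d' = (d + b) / 2"
  have cd': "a < c'" "c' < c" "d < d'" "d' < b" using cd by (auto simp: c'_def d'_def)
  have "L2_primitive c' d' v g" using prim cd cd' by auto
  then have "integral\<^sup>L (Ioo c' d') (\<lambda>x. g x * \<theta> x) =
      v d' * \<theta> d' - v c' * \<theta> c' - integral\<^sup>L (Ioo c' d') (\<lambda>x. v x * deriv \<theta> x)"
    using D cd cd' by (intro L2_primitive_by_parts)
      (auto intro: has_field_derivative_at_within continuous_on_subset)
  moreover have "\<theta> d' = 0" "\<theta> c' = 0" using z cd cd' by auto
  moreover have "integral\<^sup>L (Ioo a b) (\<lambda>x. g x * \<theta> x) = integral\<^sup>L (Ioo c' d') (\<lambda>x. g x * \<theta> x)"
    "integral\<^sup>L (Ioo a b) (\<lambda>x. v x * deriv \<theta> x) = integral\<^sup>L (Ioo c' d') (\<lambda>x. v x * deriv \<theta> x)"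
    using z cd cd' by (auto intro!: integral_Ioo_superset)
  ultimately show "L2_inner a b v (deriv \<theta>) = - L2_inner a b g \<theta>"
    by (simp add: L2_inner_eq)
qed

lemma L2_primitive_imp_weak_deriv:
  assumes "a < b" "L2_primitive a b v g"
  shows "has_weak_deriv a b v g"
  using assms
  by (intro L2_primitive_imp_weak_deriv_on_support)
    (auto intro: L2_primitive_subset L2_primitive_square_integrable L2_primitive_continuous square_integrable_continuous)

lemma has_weak_deriv_subset:
  assumes v: "has_weak_deriv a b v g" and cd: "a \<le> c" "c < d" "d \<le> b"
  shows "has_weak_deriv c d v g"
  unfolding has_weak_deriv_def
proof (intro conjI allI impI)
  show "square_integrable c d v" "square_integrable c d g"
    using v cd by (auto simp: has_weak_deriv_def intro: square_integrable_subset)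
  fix \<theta> assume th: "test_function c d \<theta>"
  then obtain l u where lu: "c < l" "l \<le> u" "u < d" and z: "\<And>x. x \<notin> {l..u} \<Longrightarrow> \<theta> x = 0" "\<And>x. x \<notin> {l..u} \<Longrightarrow> deriv \<theta> x = 0"
    using test_functionE[OF _ cd(2)] by metis
  have "{c<..<d} \<subseteq> {a<..<b}" using cd by auto
  then have "test_function a b \<theta>" using th unfolding test_function_def by blast
  then have "L2_inner a b v (deriv \<theta>) = - L2_inner a b g \<theta>" using v by (simp add: has_weak_deriv_def)
  moreover have "integral\<^sup>L (Ioo a b) (\<lambda>x. g x * \<theta> x) = integral\<^sup>L (Ioo c d) (\<lambda>x. g x * \<theta> x)"
    "integral\<^sup>L (Ioo a b) (\<lambda>x. v x * deriv \<theta> x) = integral\<^sup>L (Ioo c d) (\<lambda>x. v x * deriv \<theta> x)"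
    using z lu cd by (auto intro!: integral_Ioo_superset)
  ultimately show "L2_inner c d v (deriv \<theta>) = - L2_inner c d g \<theta>"
    by (simp add: L2_inner_eq)
qed

section \<open>The lemma of du Bois-Reymond and representation by primitives\<close>

lemma continuous_antiderivative_UNIV:
  fixes r :: "real \<Rightarrow> real"
  assumes "continuous_on UNIV r"
  obtains R where "\<And>x. (R has_real_derivative r x) (at x)"
proof -
  obtain F where "\<forall>x::real. -\<infinity> < ereal x \<longrightarrow> ereal x < \<infinity> \<longrightarrow> (F has_vector_derivative r x) (at x)"
    using einterval_antiderivative[of "-\<infinity>" "\<infinity>" r] assms by (auto simp: continuous_on_eq_continuous_at)
  then show thesis using that by (auto simp: has_real_derivative_iff_has_vector_derivative)
qed

text \<open>The antiderivative that vanishes at \<open>a\<close> is constant on either side of the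
  support of \<open>r\<close>; the zero mean makes the constant on the right vanish too.\<close>

lemma test_function_antiderivative:
  assumes r: "continuous_on UNIV r" and cd: "a < c" "c \<le> d" "d < b"
    and z: "\<And>x. x \<notin> {c..d} \<Longrightarrow> r x = 0" and mean: "integral\<^sup>L (Ioo a b) r = 0"
  obtains \<theta> where "test_function a b \<theta>" "deriv \<theta> = r"
proof -
  obtain R where R: "\<And>x. (R has_real_derivative r x) (at x)"
    using continuous_antiderivative_UNIV[OF r] by metis
  define \<theta> where "\<theta> x = R x - R a" for x
  have D: "(\<theta> has_real_derivative r x) (at x)" for x
    unfolding \<theta>_def using R[of x] by (auto intro!: derivative_eq_intros)
  have Dv: "(\<theta> has_vector_derivative r x) (at x)" for x
    using D by (simp add: has_real_derivative_iff_has_vector_derivative)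
  have "(r has_integral (\<theta> b - \<theta> a)) {a..b}"
    using cd Dv by (intro fundamental_theorem_of_calculus) (auto intro: has_vector_derivative_at_within)
  moreover have "integrable (Ioo a b) r"
    by (intro square_integrable_integrable square_integrable_continuous continuous_on_subset[OF r]) auto
  ultimately have ba: "\<theta> b = \<theta> a" using mean by (simp add: integral_Ioo_eq integral_unique)
  have left: "\<theta> x = 0" if "x < c" for x
  proof -
    have "\<exists>k. \<forall>y\<in>{..<c}. \<theta> y = k"
    proof (rule has_field_derivative_zero_constant)
      fix y assume "y \<in> {..<c}"
      then show "(\<theta> has_field_derivative 0) (at y within {..<c})"
        using D[of y] z[of y] by (auto intro: has_field_derivative_at_within)
    qed simp
    then have "\<theta> x = \<theta> a" using that cd by auto
    then show ?thesis by (simp add: \<theta>_def)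
  qed
  have right: "\<theta> x = 0" if "d < x" for x
  proof -
    have "\<exists>k. \<forall>y\<in>{d<..}. \<theta> y = k"
    proof (rule has_field_derivative_zero_constant)
      fix y assume "y \<in> {d<..}"
      then show "(\<theta> has_field_derivative 0) (at y within {d<..})"
        using D[of y] z[of y] by (auto intro: has_field_derivative_at_within)
    qed simp
    then have "\<theta> x = \<theta> b" using that cd by auto
    then show ?thesis using ba by (simp add: \<theta>_def)
  qed
  have "test_function a b \<theta>"
    unfolding test_function_def C1_differentiable_on_def
  proof (intro conjI exI)
    show "\<forall>x\<in>UNIV. (\<theta> has_vector_derivative r x) (at x)" using Dv by simp
    show "continuous_on UNIV r" by (rule r)
    show "compact {c..d}" by simp
    show "{c..d} \<subseteq> {a<..<b}" using cd by auto
    show "\<forall>x. x \<notin> {c..d} \<longrightarrow> \<theta> x = 0" using left right by (auto simp: not_le)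
  qed
  moreover have "deriv \<theta> = r" using D by (auto simp: fun_eq_iff intro: DERIV_imp_deriv)
  ultimately show thesis by (rule that)
qed

text \<open>The indicator of \<open>(a, x)\<close> is a pointwise limit of continuous cutoffs with
  compact support in \<open>(a, b)\<close>, and dominated convergence applies with
  \<open>\<bar>f t\<bar>\<close> as majorant.\<close>

lemma integral_zero_if_orthogonal_to_tents:
  assumes f: "square_integrable a b f"
    and orth: "\<And>r c d. continuous_on UNIV r \<Longrightarrow> a < c \<Longrightarrow> c \<le> d \<Longrightarrow> d < b \<Longrightarrow> (\<And>x. x \<notin> {c..d} \<Longrightarrow> r x = 0)
      \<Longrightarrow> integral\<^sup>L (Ioo a b) (\<lambda>x. f x * r x) = 0"
    and x: "x \<in> {a..b}"
  shows "integral\<^sup>L (Ioo a x) f = 0"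
proof (cases "a < x")
  case True
  \<comment> \<open>A trapezoid on \<open>(a, x)\<close>: zero within distance \<open>1 / n\<close>
    of the ends, one from distance \<open>2 / n\<close> on.\<close>
  define r where "r n t = min 1 (max 0 (real n * min (t - a - 1 / real n) (x - 1 / real n - t)))" for n t
  define s where "s n t = (if n = 0 then 0 else r n t)" for n t
  have fx: "integrable (Ioo a x) f"
    using x by (intro square_integrable_integrable square_integrable_subset[OF f]) auto
  have le1: "\<bar>s n t\<bar> \<le> 1" for n t by (auto simp: s_def r_def min_def max_def)
  have cont: "continuous_on UNIV (s n)" for n
    by (cases "n = 0") (auto simp: s_def[abs_def] r_def[abs_def] intro!: continuous_intros)
  have supp: "s n t = 0" if "t \<notin> {a + 1 / real n..x - 1 / real n}" for n t
  proof (cases "n = 0")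
    case False
    have "min (t - a - 1 / real n) (x - 1 / real n - t) \<le> 0" using that by auto
    then have "real n * min (t - a - 1 / real n) (x - 1 / real n - t) \<le> 0"
      by (intro mult_nonneg_nonpos) auto
    then show ?thesis by (simp add: s_def r_def)
  qed (simp add: s_def)
  have zero: "integral\<^sup>L (Ioo a x) (\<lambda>t. f t * s n t) = 0" for n
  proof (cases "n > 0 \<and> a + 1 / real n \<le> x - 1 / real n")
    case True
    have "integral\<^sup>L (Ioo a b) (\<lambda>t. f t * s n t) = 0"
      using True x by (intro orth[OF cont, of "a + 1 / real n" "x - 1 / real n"] supp)
        (auto intro: less_le_trans[of "x - 1 / real n" x])
    moreover have "integral\<^sup>L (Ioo a b) (\<lambda>t. f t * s n t) = integral\<^sup>L (Ioo a x) (\<lambda>t. f t * s n t)"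
    proof (rule integral_Ioo_superset)
      fix t assume "t \<notin> {a<..<x}"
      then have "t \<notin> {a + 1 / real n..x - 1 / real n}" using True
        by (auto simp: not_less not_le intro: less_le_trans[of _ "x" t] le_less_trans[of t a] )
      then show "f t * s n t = 0" using supp by simp
    qed (use x in auto)
    ultimately show ?thesis by simp
  next
    case False
    have "s n t = 0" for t
    proof (cases "n = 0")
      case n: False
      with False have "t \<notin> {a + 1 / real n..x - 1 / real n}" by auto
      then show ?thesis by (rule supp)
    qed (simp add: s_def)
    then show ?thesis by simp
  qed
  have lim: "(\<lambda>n. s n t) \<longlonglongrightarrow> 1" if t: "a < t" "t < x" for t
  proof (rule tendsto_eventually)
    define e where "e = min (t - a) (x - t)"
    have e: "e > 0" using t by (simp add: e_def)
    obtain N :: nat where N: "2 / e < real N" using reals_Archimedean2 by blast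
    show "\<forall>\<^sub>F n in sequentially. s n t = 1"
      unfolding eventually_sequentially
    proof (intro exI allI impI)
      fix n assume n: "N \<le> n"
      have ne: "2 < real n * e"
        using N n e by (metis less_le_trans mult_right_mono of_nat_le_iff less_imp_le pos_divide_less_eq)
      then have n0: "n > 0" by (cases n) auto
      have "min (t - a - 1 / real n) (x - 1 / real n - t) = e - 1 / real n"
        by (simp add: e_def min_def)
      then have "real n * min (t - a - 1 / real n) (x - 1 / real n - t) = real n * e - 1"
        using n0 by (simp add: right_diff_distrib)
      then show "s n t = 1" using ne n0 by (simp add: s_def r_def)
    qed
  qed
  have "(\<lambda>n. integral\<^sup>L (Ioo a x) (\<lambda>t. f t * s n t)) \<longlonglongrightarrow> integral\<^sup>L (Ioo a x) f"
  proof (rule integral_dominated_convergence[where w="\<lambda>t. \<bar>f t\<bar>"])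
    show "f \<in> borel_measurable (Ioo a x)" using fx by (rule borel_measurable_integrable)
    fix n
    show "(\<lambda>t. f t * s n t) \<in> borel_measurable (Ioo a x)"
      using fx cont[of n]
      by (intro borel_measurable_times borel_measurable_Ioo_continuous borel_measurable_integrable)
        (auto intro: continuous_on_subset)
    show "AE t in Ioo a x. norm (f t * s n t) \<le> \<bar>f t\<bar>"
      using le1 by (intro AE_I2) (auto simp: abs_mult mult_left_le)
    show "integrable (Ioo a x) (\<lambda>t. \<bar>f t\<bar>)" using fx by auto
    show "AE t in Ioo a x. (\<lambda>n. f t * s n t) \<longlonglongrightarrow> f t"
      by (rule AE_Ioo_I) (use tendsto_mult[OF tendsto_const lim] in auto)
  qed
  then show ?thesis using zero LIMSEQ_unique[OF _ tendsto_const[of 0]] by simp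
next
  case False
  then show ?thesis using x by simp
qed

text \<open>A continuous compactly supported \<open>r\<close> becomes the derivative of a test
  function after subtraction of the multiple of a fixed bump \<rho> that gives it mean zero. So
  \<open>f - k\<close> is orthogonal to every such \<open>r\<close>, where \<open>k\<close> is the
  average of \<open>f\<close> weighted with \<rho>.\<close>

lemma du_Bois_Reymond:
  assumes "a < b" and f: "square_integrable a b f"
    and orth: "\<And>\<theta>. test_function a b \<theta> \<Longrightarrow> integral\<^sup>L (Ioo a b) (\<lambda>x. f x * deriv \<theta> x) = 0"
  obtains k where "AE x in Ioo a b. f x = k"
proof -
  define l where "l = (2 * a + b) / 3"
  define u where "u = (a + 2 * b) / 3"
  have lu: "a < l" "l < u" "u < b" using assms(1) by (auto simp: l_def u_def field_simps)
  \<comment> \<open>A tent over the middle third of the interval, positive at the midpoint and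
    therefore of nonzero mean.\<close>
  define \<rho> where "\<rho> x = max 0 (min (x - l) (u - x))" for x
  have "continuous_on UNIV \<rho>"
    unfolding \<rho>_def[abs_def] by (intro continuous_intros)
  moreover have "\<And>x. x \<notin> {l..u} \<Longrightarrow> \<rho> x = 0"
    by (auto simp: \<rho>_def min_def max_def)
  ultimately have \<rho>: "continuous_on UNIV \<rho>" "\<And>x. x \<notin> {l..u} \<Longrightarrow> \<rho> x = 0" .
  have \<rho>_si: "square_integrable a b \<rho>"
    by (intro square_integrable_continuous continuous_on_subset[OF \<rho>(1)]) auto
  define m where "m = integral\<^sup>L (Ioo a b) \<rho>"
  have m: "m \<noteq> 0"
  proof
    assume "m = 0"
    then have "integral {a..b} \<rho> = 0"
      using integral_Ioo_eq(1)[OF square_integrable_integrable[OF \<rho>_si]] by (simp add: m_def)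
    moreover have "continuous_on {a..b} \<rho>" using \<rho>(1) by (rule continuous_on_subset) auto
    moreover have "\<rho> x \<ge> 0" for x by (simp add: \<rho>_def)
    ultimately have "\<forall>x\<in>{a..b}. \<rho> x = 0" using integral_eq_0_iff[of a b \<rho>] assms(1) by simp
    then have "\<rho> ((l + u) / 2) = 0" using lu by auto
    then show False using lu by (auto simp: \<rho>_def min_def max_def field_simps split: if_splits)
  qed
  define k where "k = integral\<^sup>L (Ioo a b) (\<lambda>x. f x * \<rho> x) / m"
  have fk: "square_integrable a b (\<lambda>x. f x - k)" by (intro square_integrable_diff f square_integrable_const)
  have "AE x in Ioo a b. f x - k = 0"
  proof (rule AE_zero_if_primitive_zero[OF square_integrable_integrable[OF fk]])
    fix x assume "x \<in> {a..b}"
    then show "integral\<^sup>L (Ioo a x) (\<lambda>x. f x - k) = 0"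
    proof (rule integral_zero_if_orthogonal_to_tents[OF fk, rotated])
      fix r :: "real \<Rightarrow> real" and c d
      assume r: "continuous_on UNIV r" "a < c" "c \<le> d" "d < b" "\<And>x. x \<notin> {c..d} \<Longrightarrow> r x = 0"
      define R where "R = integral\<^sup>L (Ioo a b) r"
      have r_si: "square_integrable a b r"
        by (intro square_integrable_continuous continuous_on_subset[OF r(1)]) auto
      note int = square_integrable_integrable[OF r_si] square_integrable_integrable[OF \<rho>_si]
        square_integrable_integrable_mult[OF f r_si] square_integrable_integrable_mult[OF f \<rho>_si]
      have c1: "continuous_on UNIV (\<lambda>x. r x - R / m * \<rho> x)" using r(1) \<rho>(1) by (intro continuous_intros)
      have z1: "r x - R / m * \<rho> x = 0" if "x \<notin> {min c l..max d u}" for x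
      proof -
        have "x \<notin> {c..d}" "x \<notin> {l..u}" using that by auto
        then show ?thesis using r(5) \<rho>(2) by simp
      qed
      have mean: "integral\<^sup>L (Ioo a b) (\<lambda>x. r x - R / m * \<rho> x) = 0"
        using int m by (simp add: R_def m_def[symmetric])
      obtain \<theta> where th: "test_function a b \<theta>" "deriv \<theta> = (\<lambda>x. r x - R / m * \<rho> x)"
      proof (rule test_function_antiderivative[OF c1 _ _ _ z1 mean])
        show "a < min c l" "min c l \<le> max d u" "max d u < b" using r lu by auto
      qed
      have "0 = integral\<^sup>L (Ioo a b) (\<lambda>x. f x * (r x - R / m * \<rho> x))"
        using orth[OF th(1)] th(2) by simp
      also have "\<dots> = integral\<^sup>L (Ioo a b) (\<lambda>x. f x * r x - R / m * (f x * \<rho> x))"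
        by (simp add: algebra_simps)
      also have "\<dots> = integral\<^sup>L (Ioo a b) (\<lambda>x. f x * r x) - k * R"
        using int by (simp add: k_def)
      finally show "integral\<^sup>L (Ioo a b) (\<lambda>x. (f x - k) * r x) = 0"
        using int by (simp add: left_diff_distrib R_def)
    qed
  qed
  then show thesis using that[of k] by (auto elim: eventually_mono)
qed


text \<open>The difference of \<open>v\<close> and the primitive of \<open>g\<close> has weak
  derivative zero, hence is constant almost everywhere.\<close>

lemma has_weak_deriv_AE_primitive:
  assumes ab: "a < b" and v: "has_weak_deriv a b v g"
  obtains k where "AE x in Ioo a b. v x = k + integral\<^sup>L (Ioo a x) g"
proof -
  have si: "square_integrable a b v" "square_integrable a b g" using v by (auto simp: has_weak_deriv_def)
  define V where "V x = integral\<^sup>L (Ioo a x) g" for x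
  have V: "L2_primitive a b V g" by (rule L2_primitive_I[where k=0]) (auto simp: si V_def)
  have Vsi: "square_integrable a b V"
    by (intro square_integrable_continuous L2_primitive_continuous[OF V])
  have wV: "has_weak_deriv a b V g" by (rule L2_primitive_imp_weak_deriv[OF ab V])
  have "square_integrable a b (\<lambda>x. v x - V x)" by (intro square_integrable_diff si Vsi)
  then obtain k where "AE x in Ioo a b. v x - V x = k"
  proof (rule du_Bois_Reymond[OF ab])
    fix \<theta> assume th: "test_function a b \<theta>"
    obtain D: "continuous_on UNIV (deriv \<theta>)"
      using test_functionE[OF th ab] by metis
    have d: "square_integrable a b (deriv \<theta>)"
      by (intro square_integrable_continuous continuous_on_subset[OF D]) auto
    have "L2_inner a b v (deriv \<theta>) = L2_inner a b V (deriv \<theta>)"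
      using v wV th by (simp add: has_weak_deriv_def)
    then show "integral\<^sup>L (Ioo a b) (\<lambda>x. (v x - V x) * deriv \<theta> x) = 0"
      using square_integrable_integrable_mult[OF si(1) d] square_integrable_integrable_mult[OF Vsi d]
      by (simp add: L2_inner_eq left_diff_distrib)
  qed blast
  then have "AE x in Ioo a b. v x = k + integral\<^sup>L (Ioo a x) g"
    by eventually_elim (simp add: V_def)
  then show thesis by (rule that)
qed

lemma continuous_AE_eq_imp_eq:
  fixes f g :: "real \<Rightarrow> real"
  assumes "a < b" and f: "continuous_on {a..b} f" and g: "continuous_on {a..b} g"
    and eq: "AE x in Ioo a b. f x = g x" and x: "x \<in> {a..b}"
  shows "f x = g x"
proof -
  have c: "continuous_on {a..b} (\<lambda>x. (f x - g x)\<^sup>2)" using f g by (intro continuous_intros)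
  have "integral\<^sup>L (Ioo a b) (\<lambda>x. (f x - g x)\<^sup>2) = integral\<^sup>L (Ioo a b) (\<lambda>x. 0)"
    using eq square_integrable_measurable[OF square_integrable_continuous[OF c]]
    by (intro integral_Ioo_cong_AE) (auto elim: eventually_mono)
  then have "integral {a..b} (\<lambda>x. (f x - g x)\<^sup>2) = 0"
    using integral_Ioo_eq(1)[OF square_integrable_integrable[OF square_integrable_continuous[OF c]]] by simp
  then show ?thesis using integral_eq_0_iff[OF c assms(1)] x by auto
qed

lemma has_weak_deriv_imp_primitive:
  assumes ab: "a < b" and v: "has_weak_deriv a b v g" and c: "continuous_on {a..b} v"
  shows "L2_primitive a b v g"
proof -
  obtain k where k: "AE x in Ioo a b. v x = k + integral\<^sup>L (Ioo a x) g"
    using has_weak_deriv_AE_primitive[OF ab v] .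
  have g: "square_integrable a b g" using v by (simp add: has_weak_deriv_def)
  have V: "L2_primitive a b (\<lambda>x. k + integral\<^sup>L (Ioo a x) g) g"
    by (rule L2_primitive_I[where k=k]) (auto simp: g)
  show ?thesis
    using continuous_AE_eq_imp_eq[OF ab c L2_primitive_continuous[OF V] k]
    by (intro L2_primitive_I[where k=k]) (auto simp: g)
qed

text \<open>The primitives of both derivatives are continuous and agree with \<open>v\<close> almost
  everywhere up to constants, so they agree everywhere, and the difference of the derivatives has a
  vanishing primitive. This makes the choice in \<open>wderiv\<close> harmless.\<close>

lemma has_weak_deriv_unique:
  assumes ab: "a < b" and g: "has_weak_deriv a b v g" and h: "has_weak_deriv a b v h"
  shows "AE x in Ioo a b. g x = h x"
proof -
  obtain k where k: "AE x in Ioo a b. v x = k + integral\<^sup>L (Ioo a x) g"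
    using has_weak_deriv_AE_primitive[OF ab g] .
  obtain l where l: "AE x in Ioo a b. v x = l + integral\<^sup>L (Ioo a x) h"
    using has_weak_deriv_AE_primitive[OF ab h] .
  have si: "square_integrable a b g" "square_integrable a b h" using g h by (auto simp: has_weak_deriv_def)
  have P: "L2_primitive a b (\<lambda>x. k + integral\<^sup>L (Ioo a x) g) g" "L2_primitive a b (\<lambda>x. l + integral\<^sup>L (Ioo a x) h) h"
    by (rule L2_primitive_I, rule si, simp)+
  have ae: "AE x in Ioo a b. k + integral\<^sup>L (Ioo a x) g = l + integral\<^sup>L (Ioo a x) h"
    using k l by eventually_elim simp
  have eq: "k + integral\<^sup>L (Ioo a x) g = l + integral\<^sup>L (Ioo a x) h" if "x \<in> {a..b}" for x
    by (rule continuous_AE_eq_imp_eq[OF ab L2_primitive_continuous[OF P(1)] L2_primitive_continuous[OF P(2)] ae that])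
  have kl: "k = l" using eq[of a] ab by simp
  have "AE x in Ioo a b. g x - h x = 0"
  proof (rule AE_zero_if_primitive_zero)
    show "integrable (Ioo a b) (\<lambda>x. g x - h x)" using si by (intro Bochner_Integration.integrable_diff square_integrable_integrable)
    fix x assume x: "x \<in> {a..b}"
    have "integrable (Ioo a x) g" "integrable (Ioo a x) h"
      using x by (auto intro: square_integrable_integrable si[THEN square_integrable_subset])
    then show "integral\<^sup>L (Ioo a x) (\<lambda>x. g x - h x) = 0" using eq[OF x] kl by simp
  qed
  then show ?thesis by (auto elim: eventually_mono)
qed

lemma has_weak_deriv_wderiv: "has_weak_deriv a b v g \<Longrightarrow> has_weak_deriv a b v (wderiv a b v)"
  unfolding wderiv_def by (rule someI[of "has_weak_deriv a b v"])

lemma wderiv_AE_eq: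
  "a < b \<Longrightarrow> has_weak_deriv a b v g \<Longrightarrow> AE x in Ioo a b. wderiv a b v x = g x"
  by (rule has_weak_deriv_unique[OF _ has_weak_deriv_wderiv])

lemma has_weak_deriv_add:
  assumes "a < b" and v: "has_weak_deriv a b v g" and w: "has_weak_deriv a b w h"
  shows "has_weak_deriv a b (\<lambda>x. v x + w x) (\<lambda>x. g x + h x)"
  unfolding has_weak_deriv_def
proof (intro conjI allI impI)
  have si: "square_integrable a b v" "square_integrable a b g" "square_integrable a b w" "square_integrable a b h"
    using v w by (auto simp: has_weak_deriv_def)
  then show "square_integrable a b (\<lambda>x. v x + w x)" "square_integrable a b (\<lambda>x. g x + h x)"
    by (auto intro: square_integrable_add)
  fix \<theta> assume th: "test_function a b \<theta>"
  obtain D: "\<And>x. (\<theta> has_real_derivative deriv \<theta> x) (at x)" "continuous_on UNIV (deriv \<theta>)"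
    using test_functionE[OF th assms(1)] by metis
  have d: "square_integrable a b (deriv \<theta>)"
    by (intro square_integrable_continuous continuous_on_subset[OF D(2)]) auto
  have "continuous_on UNIV \<theta>" using D(1) by (auto simp: continuous_on_eq_continuous_at intro: DERIV_isCont)
  then have d0: "square_integrable a b \<theta>" by (intro square_integrable_continuous) (auto intro: continuous_on_subset)
  have "L2_inner a b v (deriv \<theta>) = - L2_inner a b g \<theta>" "L2_inner a b w (deriv \<theta>) = - L2_inner a b h \<theta>"
    using v w th by (auto simp: has_weak_deriv_def)
  then show "L2_inner a b (\<lambda>x. v x + w x) (deriv \<theta>) = - L2_inner a b (\<lambda>x. g x + h x) \<theta>"
    using si[THEN square_integrable_integrable_mult, OF d] si[THEN square_integrable_integrable_mult, OF d0]
    by (simp add: L2_inner_eq distrib_right)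
qed

lemma has_weak_deriv_cong:
  assumes "has_weak_deriv a b v g" "\<And>x. a < x \<Longrightarrow> x < b \<Longrightarrow> v x = v' x"
  shows "has_weak_deriv a b v' g"
proof -
  have "L2_inner a b v' \<theta> = L2_inner a b v \<theta>" for \<theta>
    unfolding L2_inner_eq using assms(2) by (intro Bochner_Integration.integral_cong) auto
  then show ?thesis using assms square_integrable_cong[OF _ assms(2)] by (simp add: has_weak_deriv_def)
qed

section \<open>From classical to weak derivatives\<close>

lemma classical_imp_primitive:
  assumes "a \<le> b" "finite P" and c: "continuous_on {a..b} v"
    and D: "\<And>x. x \<in> {a<..<b} - P \<Longrightarrow> (v has_real_derivative g x) (at x)"
    and g: "square_integrable a b g"
  shows "L2_primitive a b v g"
proof (rule L2_primitive_I[OF g])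
  fix x assume x: "x \<in> {a..b}"
  have "(g has_integral (v x - v a)) {a..x}"
    using x D by (intro fundamental_theorem_of_calculus_interior_strong[OF assms(2)] continuous_on_subset[OF c])
      (auto simp: has_real_derivative_iff_has_vector_derivative[symmetric])
  moreover have "integrable (Ioo a x) g"
    using x by (intro square_integrable_integrable square_integrable_subset[OF g]) auto
  ultimately show "v x = v a + integral\<^sup>L (Ioo a x) g"
    by (simp add: integral_Ioo_eq integral_unique)
qed

text \<open>The highest derivative of a layer component is not known to be continuous; it is
  measurable as a limit of difference quotients.\<close>

lemma deriv_measurable_Ioo:
  assumes D: "\<And>x. x \<in> {a<..<b} \<Longrightarrow> (v has_real_derivative g x) (at x)"
  shows "g \<in> borel_measurable (Ioo a b)"
proof -
  \<comment> \<open>Extension by zero makes the difference quotients Borel functions on the whole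
    line; they are the right ones as soon as \<open>x + 1 / real (Suc n)\<close> lies below
    \<open>b\<close>.\<close>
  define V where "V x = indicator {a<..<b} x *\<^sub>R v x" for x
  have "continuous_on {a<..<b} v"
    using D by (meson DERIV_isCont continuous_at_imp_continuous_on)
  then have V [measurable]: "V \<in> borel_measurable borel"
    unfolding V_def[abs_def] by (rule borel_measurable_continuous_on_indicator[rotated]) simp
  define s where "s n x = real (Suc n) * (V (x + 1 / real (Suc n)) - V x)" for n x
  show ?thesis
  proof (rule borel_measurable_LIMSEQ_real)
    fix n
    have "s n \<in> borel_measurable borel" unfolding s_def[abs_def] by measurable
    then show "s n \<in> borel_measurable (Ioo a b)"
      by (simp add: measurable_completion measurable_restrict_space1)
  next
    fix x assume "x \<in> space (Ioo a b)"
    then have x: "a < x" "x < b" by auto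
    have "((\<lambda>h. (v (x + h) - v x) / h) \<longlongrightarrow> g x) (at 0)"
      using D[of x] x by (simp add: DERIV_def)
    moreover have "filterlim (\<lambda>n. 1 / real (Suc n)) (at 0) sequentially"
      using LIMSEQ_Suc[OF lim_1_over_n[where 'a=real]] by (simp add: filterlim_at del: of_nat_Suc)
    ultimately have lim: "(\<lambda>n. (v (x + 1 / real (Suc n)) - v x) / (1 / real (Suc n))) \<longlonglongrightarrow> g x"
      by (rule filterlim_compose)
    have "\<forall>\<^sub>F n in sequentially. 1 / real (Suc n) < b - x"
      using LIMSEQ_Suc[OF lim_1_over_n[where 'a=real]] x by (auto intro: order_tendstoD)
    then have "\<forall>\<^sub>F n in sequentially. (v (x + 1 / real (Suc n)) - v x) / (1 / real (Suc n)) = s n x"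
    proof eventually_elim
      case (elim n)
      have "a < x + 1 / real (Suc n)" using x by (intro add_pos_pos less_trans[OF x(1)]) (auto simp: less_add_same_cancel1)
      then have "V (x + 1 / real (Suc n)) = v (x + 1 / real (Suc n))" "V x = v x"
        using x elim by (auto simp: V_def indicator_def)
      then show ?case by (simp add: s_def)
    qed
    then show "(\<lambda>n. s n x) \<longlonglongrightarrow> g x"
      by (rule Lim_transform_eventually[OF lim])
  qed
qed

lemma classical_imp_weak_deriv:
  assumes ab: "a < b" and D: "\<And>x. x \<in> {a<..<b} \<Longrightarrow> (v has_real_derivative g x) (at x)"
    and v: "\<And>x. x \<in> {a<..<b} \<Longrightarrow> \<bar>v x\<bar> \<le> A" and g: "\<And>x. x \<in> {a<..<b} \<Longrightarrow> \<bar>g x\<bar> \<le> B"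
  shows "has_weak_deriv a b v g"
proof (rule L2_primitive_imp_weak_deriv_on_support[OF ab])
  have c: "continuous_on {a<..<b} v"
    using D by (meson DERIV_isCont continuous_at_imp_continuous_on)
  show "square_integrable a b v"
    using v by (intro square_integrable_bounded[of _ _ _ A] borel_measurable_Ioo_continuous[OF c] AE_Ioo_I) auto
  show gs: "square_integrable a b g"
    using g by (intro square_integrable_bounded[of _ _ _ B] deriv_measurable_Ioo[OF D] AE_Ioo_I) auto
  fix l u assume "a < l" "l \<le> u" "u < b"
  then show "L2_primitive l u v g"
    by (intro classical_imp_primitive[of l u "{}"] continuous_on_subset[OF c] square_integrable_subset[OF gs] D) auto
qed

lemma L2_poincare:
  assumes "a \<le> b" and v: "L2_primitive a b v g" and "v a = 0"
  shows "L2_sq a b v \<le> (b - a)\<^sup>2 * L2_sq a b g"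
proof -
  have "\<bar>v x\<bar> \<le> sqrt (L2_sq a b g) * sqrt (b - a)" if "a < x" "x < b" for x
  proof -
    have "\<bar>v x\<bar> \<le> sqrt (L2_sq a b g) * sqrt \<bar>x - a\<bar>"
      using L2_primitive_diff_le[OF v, of a x] that assms(3) by simp
    also have "\<dots> \<le> sqrt (L2_sq a b g) * sqrt (b - a)" using that by (intro mult_left_mono) auto
    finally show ?thesis .
  qed
  then have "L2_sq a b v \<le> (b - a) * (sqrt (L2_sq a b g) * sqrt (b - a))\<^sup>2"
    using assms(1) by (intro L2_sq_bounded_le square_integrable_continuous L2_primitive_continuous[OF v]) auto
  also have "\<dots> = (b - a)\<^sup>2 * L2_sq a b g"
    using assms(1) by (simp add: power_mult_distrib) (simp add: power2_eq_square)
  finally show ?thesis .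
qed

section \<open>Polynomial approximation\<close>

lemma pderiv_sum: "pderiv (\<Sum>i\<in>A. f i) = (\<Sum>i\<in>A. pderiv (f i))"
  by (induction A rule: infinite_finite_induct) (auto simp: pderiv_add)

lemma poly_antiderivative:
  fixes p :: "real poly"
  obtains P where "pderiv P = p" "degree P \<le> Suc (degree p)" "p = 0 \<Longrightarrow> P = 0"
proof -
  define P where "P = (\<Sum>i\<le>degree p. monom (coeff p i / real (Suc i)) (Suc i))"
  have "pderiv P = (\<Sum>i\<le>degree p. monom (coeff p i) i)"
    unfolding P_def pderiv_sum
    by (rule sum.cong) (simp_all add: pderiv_monom del: of_nat_Suc)
  also have "\<dots> = p" by (rule poly_as_sum_of_monoms)
  finally have "pderiv P = p" .
  moreover have "degree P \<le> Suc (degree p)"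
    unfolding P_def by (rule degree_sum_le) (auto intro: order_trans[OF degree_monom_le])
  moreover have "P = 0" if "p = 0" using that by (simp add: P_def)
  ultimately show thesis by (rule that)
qed

lemma poly_square_integrable: "square_integrable a b (poly p)"
  by (intro square_integrable_continuous continuous_intros)

lemma poly_primitive: "a \<le> b \<Longrightarrow> L2_primitive a b (poly p) (poly (pderiv p))"
  by (intro classical_imp_primitive[of a b "{}"] poly_square_integrable continuous_intros) (auto intro: poly_DERIV)

lemma L2_primitive_add:
  assumes "L2_primitive a b v g" "L2_primitive a b w h"
  shows "L2_primitive a b (\<lambda>x. v x + w x) (\<lambda>x. g x + h x)"
proof (rule L2_primitive_I[where k="v a + w a"])
  note si = L2_primitive_square_integrable[OF assms(1)] L2_primitive_square_integrable[OF assms(2)]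
  show "square_integrable a b (\<lambda>x. g x + h x)" by (intro square_integrable_add si)
  fix x assume x: "x \<in> {a..b}"
  have "integrable (Ioo a x) g" "integrable (Ioo a x) h"
    using x by (auto intro: square_integrable_integrable si[THEN square_integrable_subset])
  then show "v x + w x = v a + w a + integral\<^sup>L (Ioo a x) (\<lambda>x. g x + h x)"
    using L2_primitive_eq[OF assms(1), of x] L2_primitive_eq[OF assms(2), of x] x by simp
qed

lemma L2_primitive_cmult:
  assumes "L2_primitive a b v g"
  shows "L2_primitive a b (\<lambda>x. k * v x) (\<lambda>x. k * g x)"
proof (rule L2_primitive_I[where k="k * v a"])
  show "square_integrable a b (\<lambda>x. k * g x)"
    by (intro square_integrable_cmult L2_primitive_square_integrable[OF assms])
  fix x assume x: "x \<in> {a..b}"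
  then show "k * v x = k * v a + integral\<^sup>L (Ioo a x) (\<lambda>x. k * g x)"
    using L2_primitive_eq[OF assms, of x] by (simp add: distrib_left)
qed

lemma L2_primitive_minus:
  "L2_primitive a b v g \<Longrightarrow> L2_primitive a b w h \<Longrightarrow> L2_primitive a b (\<lambda>x. v x - w x) (\<lambda>x. g x - h x)"
  using L2_primitive_add[OF _ L2_primitive_cmult[of a b w h "-1"]] by simp

text \<open>The antiderivative of \<open>p\<close> is normalised to agree at \<open>a\<close> with
  the continuous representative of \<open>v\<close>, so the Poincare inequality applies to the
  difference. The zero polynomial has degree 0 like the other constants, although its antiderivative
  can be taken constant; the clause for \<open>p = 0\<close> keeps this degree from being
  lost.\<close>

lemma weak_deriv_poly_approx:
  assumes ab: "a < b" and v: "has_weak_deriv a b v g"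
  obtains P where "degree P \<le> Suc (degree p)" "p = 0 \<Longrightarrow> degree P = 0"
    "L2_sq a b (\<lambda>x. v x - poly P x) \<le> (b - a)\<^sup>2 * L2_sq a b (\<lambda>x. g x - poly p x)"
proof -
  obtain k where k: "AE x in Ioo a b. v x = k + integral\<^sup>L (Ioo a x) g"
    using has_weak_deriv_AE_primitive[OF ab v] .
  have si: "square_integrable a b v" "square_integrable a b g" using v by (auto simp: has_weak_deriv_def)
  obtain Q where Q: "pderiv Q = p" "degree Q \<le> Suc (degree p)" "p = 0 \<Longrightarrow> Q = 0"
    using poly_antiderivative by metis
  define P where "P = Q + [:k - poly Q a:]"
  define V where "V x = k + integral\<^sup>L (Ioo a x) g" for x
  have V: "L2_primitive a b V g" by (rule L2_primitive_I[where k=k]) (auto simp: si V_def)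
  have P': "pderiv P = p" by (simp add: P_def pderiv_add Q pderiv_pCons)
  have d: "L2_primitive a b (\<lambda>x. V x - poly P x) (\<lambda>x. g x - poly p x)"
    using L2_primitive_minus[OF V poly_primitive[of a b P]] ab by (simp add: P')
  have "V a - poly P a = 0" by (simp add: V_def P_def)
  then have "L2_sq a b (\<lambda>x. V x - poly P x) \<le> (b - a)\<^sup>2 * L2_sq a b (\<lambda>x. g x - poly p x)"
    using ab by (intro L2_poincare[OF _ d]) auto
  moreover have "L2_sq a b (\<lambda>x. v x - poly P x) = L2_sq a b (\<lambda>x. V x - poly P x)"
    using k by (intro L2_sq_cong_AE square_integrable_diff si poly_square_integrable
      square_integrable_continuous L2_primitive_continuous[OF V]) (auto elim!: eventually_mono simp: V_def)
  moreover have "degree P \<le> Suc (degree p)" unfolding P_def by (rule degree_add_le) (use Q in auto)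
  moreover have "degree P = 0" if "p = 0" using Q(3)[OF that] by (simp add: P_def)
  ultimately show thesis using that by metis
qed

text \<open>A Taylor estimate in the L2 norm. It starts with \<open>F q\<close>, approximated by a
  constant, and each step integrates the polynomial once and gains a factor
  \<open>(b - a)\<^sup>2\<close>.\<close>

lemma weak_deriv_chain_poly_approx:
  assumes ab: "a < b" and F: "\<And>k. k \<le> q \<Longrightarrow> has_weak_deriv a b (F k) (F (Suc k))" and "j \<le> q"
  shows "\<exists>p. degree p \<le> j \<and> L2_sq a b (\<lambda>x. F (q - j) x - poly p x) \<le> (b - a) ^ (2 * Suc j) * L2_sq a b (F (Suc q))"
  using \<open>j \<le> q\<close>
proof (induction j)
  case 0
  obtain P where "degree P = 0" "L2_sq a b (\<lambda>x. F q x - poly P x) \<le> (b - a)\<^sup>2 * L2_sq a b (\<lambda>x. F (Suc q) x - poly 0 x)"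
    using weak_deriv_poly_approx[OF ab F[of q], of 0] by auto
  then show ?case by (intro exI[of _ P]) auto
next
  case (Suc j)
  then obtain p where p: "degree p \<le> j" "L2_sq a b (\<lambda>x. F (q - j) x - poly p x) \<le> (b - a) ^ (2 * Suc j) * L2_sq a b (F (Suc q))"
    by auto
  have "Suc (q - Suc j) = q - j" using Suc.prems by simp
  then have "has_weak_deriv a b (F (q - Suc j)) (F (q - j))" using F[of "q - Suc j"] by simp
  then obtain P where P: "degree P \<le> Suc (degree p)"
    "L2_sq a b (\<lambda>x. F (q - Suc j) x - poly P x) \<le> (b - a)\<^sup>2 * L2_sq a b (\<lambda>x. F (q - j) x - poly p x)"
    using weak_deriv_poly_approx[OF ab, where p=p] by metis
  note P(2)
  also have "(b - a)\<^sup>2 * L2_sq a b (\<lambda>x. F (q - j) x - poly p x) \<le> (b - a)\<^sup>2 * ((b - a) ^ (2 * Suc j) * L2_sq a b (F (Suc q)))"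
    by (intro mult_left_mono p) auto
  also have "\<dots> = (b - a) ^ (2 * Suc (Suc j)) * L2_sq a b (F (Suc q))"
    by (simp add: power2_eq_square mult.assoc)
  finally show ?case using P(1) p(1) by (intro exI[of _ P]) auto
qed

text \<open>A constructive and scale-invariant substitute for compactness in finite dimension:
  dividing out the linear factor of one node lowers the degree, and the separation of the nodes
  bounds the quotient at the others by \<open>2 * M / (\<delta> * h)\<close>.\<close>

lemma poly_bound_by_nodes:
  fixes \<delta> :: real
  assumes "\<delta> > 0"
  shows "\<exists>C\<ge>0. \<forall>p h a M t. degree p \<le> n \<longrightarrow> h > 0 \<longrightarrow> (\<forall>i\<le>n. t i \<in> {a..a+h} \<and> \<bar>poly p (t i)\<bar> \<le> M) \<longrightarrow>
     (\<forall>i j. i < j \<longrightarrow> j \<le> n \<longrightarrow> \<delta> * h \<le> \<bar>t i - t j\<bar>) \<longrightarrow> (\<forall>x\<in>{a..a+h}. \<bar>poly p x\<bar> \<le> C * M)"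
proof (induction n)
  case 0
  show ?case
  proof (intro exI[of _ 1] conjI allI impI ballI)
    fix p :: "real poly" and h a M :: real and t :: "nat \<Rightarrow> real" and x
    assume "degree p \<le> 0" and t: "\<forall>i\<le>0. t i \<in> {a..a+h} \<and> \<bar>poly p (t i)\<bar> \<le> M"
    then obtain c where "p = [:c:]" using degree_eq_zeroE[of p] by auto
    then show "\<bar>poly p x\<bar> \<le> 1 * M" using t by auto
  qed simp
next
  case (Suc n)
  then obtain C where C: "C \<ge> 0" and IH: "\<And>p h a M t x. degree p \<le> n \<Longrightarrow> h > 0 \<Longrightarrow>
      (\<forall>i\<le>n. t i \<in> {a..a+h} \<and> \<bar>poly p (t i)\<bar> \<le> M) \<Longrightarrow>
     (\<forall>i j. i < j \<longrightarrow> j \<le> n \<longrightarrow> \<delta> * h \<le> \<bar>t i - t j\<bar>) \<Longrightarrow> x\<in>{a..a+h} \<Longrightarrow> \<bar>poly p x\<bar> \<le> C * M"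
    by blast
  show ?case
  proof (intro exI[of _ "1 + 2 * C / \<delta>"] conjI allI impI ballI)
    show "0 \<le> 1 + 2 * C / \<delta>" using C assms by simp
    fix p :: "real poly" and h a M :: real and t :: "nat \<Rightarrow> real" and x
    assume p: "degree p \<le> Suc n" and h: "h > 0"
      and t: "\<forall>i\<le>Suc n. t i \<in> {a..a+h} \<and> \<bar>poly p (t i)\<bar> \<le> M"
      and sep: "\<forall>i j. i < j \<longrightarrow> j \<le> Suc n \<longrightarrow> \<delta> * h \<le> \<bar>t i - t j\<bar>" and x: "x \<in> {a..a+h}"
    define t0 where "t0 = t (Suc n)"
    define s where "s = synthetic_div p t0"
    have ps: "poly p y = (y - t0) * poly s y + poly p t0" for y
      using arg_cong[OF synthetic_div_correct'[of t0 p], of "\<lambda>r. poly r y"] by (simp add: s_def algebra_simps)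
    have "\<bar>poly s x\<bar> \<le> C * (2 * M / (\<delta> * h))"
    proof (rule IH[OF _ h _ _ x])
      show "degree s \<le> n" using p by (simp add: s_def degree_synthetic_div)
      show "\<forall>i j. i < j \<longrightarrow> j \<le> n \<longrightarrow> \<delta> * h \<le> \<bar>t i - t j\<bar>" using sep by auto
      show "\<forall>i\<le>n. t i \<in> {a..a+h} \<and> \<bar>poly s (t i)\<bar> \<le> 2 * M / (\<delta> * h)"
      proof (intro allI impI conjI)
        fix i assume i: "i \<le> n"
        show "t i \<in> {a..a+h}" using t i by simp
        have d: "\<delta> * h \<le> \<bar>t i - t0\<bar>" using sep i by (auto simp: t0_def)
        have "\<bar>t i - t0\<bar> * \<bar>poly s (t i)\<bar> = \<bar>poly p (t i) - poly p t0\<bar>"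
          using ps[of "t i"] by (simp add: abs_mult[symmetric])
        also have "\<dots> \<le> \<bar>poly p (t i)\<bar> + \<bar>poly p t0\<bar>" by (rule abs_triangle_ineq4)
        also have "\<dots> \<le> 2 * M" using t[rule_format, of i] t[rule_format, of "Suc n"] i by (simp add: t0_def)
        finally have "\<delta> * h * \<bar>poly s (t i)\<bar> \<le> 2 * M"
          using mult_right_mono[OF d abs_ge_zero[of "poly s (t i)"]] by linarith
        then show "\<bar>poly s (t i)\<bar> \<le> 2 * M / (\<delta> * h)"
          using assms h by (simp add: pos_le_divide_eq mult.commute)
      qed
    qed
    then have "\<bar>x - t0\<bar> * \<bar>poly s x\<bar> \<le> h * (C * (2 * M / (\<delta> * h)))"
      using t[rule_format, of "Suc n"] x h by (intro mult_mono) (auto simp: t0_def)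
    also have "\<dots> = 2 * C / \<delta> * M" using h assms by simp
    finally have "\<bar>(x - t0) * poly s x\<bar> \<le> 2 * C / \<delta> * M" by (simp add: abs_mult)
    moreover have "\<bar>poly p t0\<bar> \<le> M" using t by (simp add: t0_def)
    ultimately show "\<bar>poly p x\<bar> \<le> (1 + 2 * C / \<delta>) * M"
      using ps[of x] abs_triangle_ineq[of "(x - t0) * poly s x" "poly p t0"] by (simp add: distrib_right)
  qed
qed

lemma exists_le_mean_square:
  fixes f :: "real \<Rightarrow> real"
  assumes "c < d" "continuous_on {c..d} f"
  obtains t where "t \<in> {c..d}" "(f t)\<^sup>2 * (d - c) \<le> L2_sq c d f"
proof -
  have "continuous_on {c..d} (\<lambda>t. (f t)\<^sup>2)" using assms(2) by (intro continuous_intros)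
  then obtain t where t: "t \<in> {c..d}" "\<forall>y\<in>{c..d}. (f t)\<^sup>2 \<le> (f y)\<^sup>2"
    using continuous_attains_inf[of "{c..d}" "\<lambda>t. (f t)\<^sup>2"] assms(1) by auto
  have "L2_sq c d (\<lambda>_. f t) \<le> L2_sq c d f"
    using t(2) assms by (intro L2_sq_mono_AE square_integrable_continuous AE_Ioo_I) (auto simp: abs_le_square_iff)
  then show thesis using that[OF t(1)] assms(1) by (simp add: L2_sq_def mult.commute)
qed

text \<open>A polynomial of degree at most \<open>q\<close> that vanishes at both ends is this
  factor times one of degree at most \<open>q - 2\<close>, which matches the moment conditions in
  \<open>is_interpolant\<close>.\<close>

definition bubble :: "real \<Rightarrow> real \<Rightarrow> real poly" where
  "bubble a b = [:- a, 1:] * [:b, - 1:]"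

lemma poly_bubble: "poly (bubble a b) x = (x - a) * (b - x)"
  by (simp add: bubble_def algebra_simps)

text \<open>On the middle half of the interval the bubble is at least
  \<open>3 / 16 * h\<^sup>2\<close>, so it suffices to bound \<open>r\<close> by its values there.
  Each of \<open>n + 1\<close> separated pieces of the middle half contains a point where the square
  of \<open>r\<close> does not exceed its mean, and these points serve as nodes in
  \<open>poly_bound_by_nodes\<close>.\<close>

lemma bubble_weighted_norm_equivalence:
  "\<exists>C>0. \<forall>r a b. degree r \<le> n \<longrightarrow> a < b \<longrightarrow>
     (b - a)\<^sup>2 * L2_sq a b (poly r) \<le> C * integral\<^sup>L (Ioo a b) (\<lambda>x. poly (bubble a b) x * (poly r x)\<^sup>2)"
proof -
  \<comment> \<open>With this value, \<open>n + 1\<close> pieces of length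
    \<open>\<delta> * h\<close>, each followed by a gap of the same length, fill exactly the middle
    half.\<close>
  define \<delta> :: real where "\<delta> = 1 / (4 * (real n + 1))"
  have \<delta>: "\<delta> > 0" by (simp add: \<delta>_def)
  obtain C where C: "C \<ge> 0" and CB: "\<And>p h a M t x. degree p \<le> n \<Longrightarrow> h > 0 \<Longrightarrow>
      (\<forall>i\<le>n. t i \<in> {a..a+h} \<and> \<bar>poly p (t i)\<bar> \<le> M) \<Longrightarrow>
     (\<forall>i j. i < j \<longrightarrow> j \<le> n \<longrightarrow> \<delta> * h \<le> \<bar>t i - t j\<bar>) \<Longrightarrow> x\<in>{a..a+h} \<Longrightarrow> \<bar>poly p x\<bar> \<le> C * M"
    using poly_bound_by_nodes[OF \<delta>, of n] by blast
  define D where "D = C\<^sup>2 * (16 / 3) / \<delta> + 1"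
  have D: "D > 0" using \<delta> by (simp add: D_def add_nonneg_pos)
  show ?thesis
  proof (intro exI[of _ D] conjI allI impI D)
    fix r :: "real poly" and a b :: real
    assume r: "degree r \<le> n" and ab: "a < b"
    define h where "h = b - a"
    have h: "h > 0" "b = a + h" using ab by (auto simp: h_def)
    define W where "W = integral\<^sup>L (Ioo a b) (\<lambda>x. poly (bubble a b) x * (poly r x)\<^sup>2)"
    have iW: "integrable (Ioo a b) (\<lambda>x. poly (bubble a b) x * (poly r x)\<^sup>2)"
      by (intro square_integrable_integrable square_integrable_continuous continuous_intros)
    have W0: "W \<ge> 0" unfolding W_def
      by (rule integral_nonneg_AE, rule AE_Ioo_I) (simp add: poly_bubble)
    define c where "c i = a + h / 4 + 2 * real i * (\<delta> * h)" for i
    have cle: "c i + \<delta> * h \<le> a + 3 * h / 4" if "i \<le> n" for i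
    proof -
      have "(2 * real i + 1) * (\<delta> * h) \<le> (2 * (real n + 1)) * (\<delta> * h)"
        using that \<delta> h by (intro mult_right_mono) auto
      also have "\<dots> = h / 2" by (simp add: \<delta>_def field_simps)
      finally show ?thesis by (simp add: c_def distrib_right)
    qed
    have cge: "a + h / 4 \<le> c i" for i using \<delta> h by (simp add: c_def)
    have lo: "3 / 16 * h\<^sup>2 \<le> poly (bubble a b) x" if "a + h / 4 \<le> x" "x \<le> a + 3 * h / 4" for x
    proof -
      have "0 \<le> (x - a - h / 4) * (a + 3 * h / 4 - x)" using that by simp
      also have "\<dots> = poly (bubble a b) x - 3 / 16 * h\<^sup>2"
        by (simp add: poly_bubble h power2_eq_square field_simps)
      finally show ?thesis by simp
    qed
    have "\<exists>t. t \<in> {c i..c i + \<delta> * h} \<and> (poly r t)\<^sup>2 * (3 / 16 * h\<^sup>2 * (\<delta> * h)) \<le> W" if i: "i \<le> n" for i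
    proof -
      obtain t where t: "t \<in> {c i..c i + \<delta> * h}" "(poly r t)\<^sup>2 * (\<delta> * h) \<le> L2_sq (c i) (c i + \<delta> * h) (poly r)"
      proof (rule exists_le_mean_square[of "c i" "c i + \<delta> * h" "poly r"])
        show "c i < c i + \<delta> * h" using \<delta> h by simp
        show "continuous_on {c i..c i + \<delta> * h} (poly r)" by (intro continuous_intros)
      qed simp
      have "3 / 16 * h\<^sup>2 * L2_sq (c i) (c i + \<delta> * h) (poly r)
          = integral\<^sup>L (Ioo (c i) (c i + \<delta> * h)) (\<lambda>x. 3 / 16 * h\<^sup>2 * (poly r x)\<^sup>2)"
        by (simp add: L2_sq_def)
      also have "\<dots> \<le> integral\<^sup>L (Ioo (c i) (c i + \<delta> * h)) (\<lambda>x. poly (bubble a b) x * (poly r x)\<^sup>2)"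
      proof (rule integral_mono_AE)
        show "integrable (Ioo (c i) (c i + \<delta> * h)) (\<lambda>x. 3 / 16 * h\<^sup>2 * (poly r x)\<^sup>2)"
          "integrable (Ioo (c i) (c i + \<delta> * h)) (\<lambda>x. poly (bubble a b) x * (poly r x)\<^sup>2)"
          by (intro square_integrable_integrable square_integrable_continuous continuous_intros)+
        show "AE x in Ioo (c i) (c i + \<delta> * h). 3 / 16 * h\<^sup>2 * (poly r x)\<^sup>2 \<le> poly (bubble a b) x * (poly r x)\<^sup>2"
          using cge[of i] cle[OF i] by (intro AE_Ioo_I mult_right_mono lo) auto
      qed
      also have "\<dots> \<le> W"
      proof -
        have bd: "a \<le> c i" "c i \<le> c i + \<delta> * h" "c i + \<delta> * h \<le> b"
          using cge[of i] cle[OF i] h \<delta> by auto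
        have i2: "integrable (Ioo (c i) b) (\<lambda>x. poly (bubble a b) x * (poly r x)\<^sup>2)"
          using iW bd by (auto intro: integrable_Ioo_subset)
        have nn: "0 \<le> integral\<^sup>L (Ioo l u) (\<lambda>x. poly (bubble a b) x * (poly r x)\<^sup>2)" if "a \<le> l" "u \<le> b" for l u
          by (rule integral_nonneg_AE, rule AE_Ioo_I) (use that in \<open>simp add: poly_bubble\<close>)
        show ?thesis
          using integral_Ioo_combine[OF iW, of "c i"] integral_Ioo_combine[OF i2, of "c i + \<delta> * h"]
            nn[of a "c i"] nn[of "c i + \<delta> * h" b] bd by (simp add: W_def)
      qed
      finally have "3 / 16 * h\<^sup>2 * L2_sq (c i) (c i + \<delta> * h) (poly r) \<le> W" .
      moreover have "(poly r t)\<^sup>2 * (3 / 16 * h\<^sup>2 * (\<delta> * h)) \<le> 3 / 16 * h\<^sup>2 * L2_sq (c i) (c i + \<delta> * h) (poly r)"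
        using mult_left_mono[OF t(2), of "3 / 16 * h\<^sup>2"] by (simp add: mult_ac)
      ultimately have "(poly r t)\<^sup>2 * (3 / 16 * h\<^sup>2 * (\<delta> * h)) \<le> W" by linarith
      then show ?thesis using t(1) by blast
    qed
    then obtain t where t: "\<And>i. i \<le> n \<Longrightarrow> t i \<in> {c i..c i + \<delta> * h}"
      "\<And>i. i \<le> n \<Longrightarrow> (poly r (t i))\<^sup>2 * (3 / 16 * h\<^sup>2 * (\<delta> * h)) \<le> W" by metis
    define M where "M = sqrt (W / (3 / 16 * h\<^sup>2 * (\<delta> * h)))"
    have bound: "\<bar>poly r x\<bar> \<le> C * M" if "x \<in> {a..a + h}" for x
    proof (rule CB[OF r h(1) _ _ that, of t])
      show "\<forall>i\<le>n. t i \<in> {a..a + h} \<and> \<bar>poly r (t i)\<bar> \<le> M"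
      proof (intro allI impI conjI)
        fix i assume i: "i \<le> n"
        show "t i \<in> {a..a + h}" using t(1)[OF i] cge[of i] cle[OF i] h by auto
        have "(poly r (t i))\<^sup>2 \<le> W / (3 / 16 * h\<^sup>2 * (\<delta> * h))"
          using t(2)[OF i] h \<delta> by (subst pos_le_divide_eq) auto
        then show "\<bar>poly r (t i)\<bar> \<le> M" unfolding M_def using real_sqrt_le_mono by fastforce
      qed
      show "\<forall>i j. i < j \<longrightarrow> j \<le> n \<longrightarrow> \<delta> * h \<le> \<bar>t i - t j\<bar>"
      proof (intro allI impI)
        fix i j assume ij: "i < j" "j \<le> n"
        have "(2 * real i + 2) * (\<delta> * h) \<le> 2 * real j * (\<delta> * h)"
          using ij \<delta> h by (intro mult_right_mono) auto
        then have "c i + 2 * (\<delta> * h) \<le> c j" by (simp add: c_def distrib_right)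
        then show "\<delta> * h \<le> \<bar>t i - t j\<bar>" using t(1)[of i] t(1)[of j] ij by auto
      qed
    qed
    have "L2_sq a b (poly r) \<le> (b - a) * (C * M)\<^sup>2"
      using ab bound h by (intro L2_sq_bounded_le poly_square_integrable) auto
    also have "(C * M)\<^sup>2 = C\<^sup>2 * (W / (3 / 16 * h\<^sup>2 * (\<delta> * h)))"
      using W0 h \<delta> by (simp add: M_def power_mult_distrib)
    finally have "h\<^sup>2 * L2_sq a b (poly r) \<le> h\<^sup>2 * ((b - a) * (C\<^sup>2 * (W / (3 / 16 * h\<^sup>2 * (\<delta> * h)))))"
      by (intro mult_left_mono) auto
    also have "\<dots> = C\<^sup>2 * (16 / 3) / \<delta> * W" using h \<delta> by (simp add: field_simps)
    also have "\<dots> \<le> D * W" using W0 by (intro mult_right_mono) (auto simp: D_def)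
    finally show "(b - a)\<^sup>2 * L2_sq a b (poly r) \<le> D * integral\<^sup>L (Ioo a b) (\<lambda>x. poly (bubble a b) x * (poly r x)\<^sup>2)"
      by (simp add: W_def h_def)
  qed
qed

text \<open>Orthogonalisation by induction on the degree. The induction hypothesis is used for
  \<open>L\<close> and also for \<open>B X\<close>, where it yields the projection of the new
  monomial \<open>X\<close> onto the lower degrees. Removing it leaves \<open>Y\<close>, orthogonal
  to them, and the coefficient \<alpha> matches \<open>L\<close> along \<open>Y\<close>.\<close>

lemma poly_riesz_representation:
  fixes B :: "real poly \<Rightarrow> real poly \<Rightarrow> real"
  assumes sym: "\<And>p q. B p q = B q p"
    and add: "\<And>p q r. B (p + q) r = B p r + B q r"
    and scale: "\<And>c p r. B (smult c p) r = c * B p r"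
    and pos: "\<And>p. p \<noteq> 0 \<Longrightarrow> B p p > 0"
    and "\<And>p q. L (p + q) = L p + L q" and "\<And>c p. L (smult c p) = c * L p"
  shows "\<exists>r. degree r \<le> n \<and> (\<forall>\<xi>. degree \<xi> \<le> n \<longrightarrow> B r \<xi> = L \<xi>)"
  using assms(5,6)
proof (induction n arbitrary: L)
  case 0
  show ?case
  proof (intro exI[of _ "smult (L 1 / B 1 1) 1"] conjI allI impI)
    fix \<xi> :: "real poly" assume "degree \<xi> \<le> 0"
    then obtain c where "\<xi> = [:c:]" using degree_eq_zeroE[of \<xi>] by auto
    then have \<xi>: "\<xi> = smult c 1" by simp
    have "B 1 \<xi> = c * B 1 1" unfolding \<xi> sym[of 1 "smult c 1"] by (rule scale)
    moreover have "B 1 1 > 0" by (rule pos) simp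
    ultimately show "B (smult (L 1 / B 1 1) 1) \<xi> = L \<xi>"
      using 0(2)[of c 1] by (simp only: scale \<xi>[symmetric]) simp
  qed simp
next
  case (Suc n)
  define X :: "real poly" where "X = monom 1 (Suc n)"
  obtain r0 where r0: "degree r0 \<le> n" "\<And>\<xi>. degree \<xi> \<le> n \<Longrightarrow> B r0 \<xi> = B X \<xi>"
    using Suc.IH[of "B X"] add scale sym by metis
  obtain r1 where r1: "degree r1 \<le> n" "\<And>\<xi>. degree \<xi> \<le> n \<Longrightarrow> B r1 \<xi> = L \<xi>"
    using Suc.IH[of L] Suc.prems by metis
  define Y where "Y = X + smult (-1) r0"
  have Yorth: "B Y \<xi> = 0" if "degree \<xi> \<le> n" for \<xi>
    using r0(2)[OF that] by (simp only: Y_def add scale)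
  have "coeff Y (Suc n) = 1"
    using r0(1) by (simp add: Y_def X_def coeff_eq_0)
  then have "Y \<noteq> 0" by auto
  then have BYY: "B Y Y > 0" by (rule pos)
  define \<alpha> where "\<alpha> = L Y / B Y Y"
  have dY: "degree Y \<le> Suc n"
    using r0(1) unfolding Y_def X_def
    by (intro degree_add_le) (auto simp: degree_monom_eq intro: order_trans[OF degree_smult_le])
  show ?case
  proof (intro exI[of _ "r1 + smult \<alpha> Y"] conjI allI impI)
    show "degree (r1 + smult \<alpha> Y) \<le> Suc n"
      using r1(1) dY by (intro degree_add_le) (auto intro: order_trans[OF degree_smult_le])
    fix \<xi> :: "real poly" assume \<xi>: "degree \<xi> \<le> Suc n"
    define c where "c = coeff \<xi> (Suc n)"
    define \<zeta> where "\<zeta> = \<xi> + smult (- c) Y"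
    have "degree \<zeta> \<le> n"
    proof (rule degree_le, intro allI impI)
      fix i assume "n < i"
      then consider "i = Suc n" | "i > Suc n" by linarith
      then show "coeff \<zeta> i = 0"
      proof cases
        case 1 then show ?thesis using \<open>coeff Y (Suc n) = 1\<close> by (simp add: \<zeta>_def c_def)
      next
        case 2 then show ?thesis using \<xi> dY by (simp add: \<zeta>_def coeff_eq_0)
      qed
    qed
    note \<zeta> = this
    have \<xi>eq: "\<xi> = \<zeta> + smult c Y" by (simp add: \<zeta>_def)
    have B2: "B p \<xi> = B p \<zeta> + c * B p Y" for p
      using add[of \<zeta> "smult c Y" p] scale[of c Y p] sym by (metis \<xi>eq)
    have "B (r1 + smult \<alpha> Y) \<xi> = B r1 \<zeta> + c * B r1 Y + \<alpha> * (B Y \<zeta> + c * B Y Y)"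
      by (simp only: add scale B2) (simp add: algebra_simps)
    also have "B r1 Y = 0" using Yorth[OF r1(1)] sym by metis
    also have "B Y \<zeta> = 0" by (rule Yorth[OF \<zeta>])
    also have "B r1 \<zeta> = L \<zeta>" by (rule r1(2)[OF \<zeta>])
    also have "L \<zeta> + c * 0 + \<alpha> * (0 + c * B Y Y) = L \<zeta> + c * L Y" using BYY by (simp add: \<alpha>_def)
    also have "\<dots> = L \<xi>" using Suc.prems by (metis \<xi>eq)
    finally show "B (r1 + smult \<alpha> Y) \<xi> = L \<xi>" .
  qed
qed

section \<open>Local interpolation\<close>

lemma degree_bubble [simp]: "degree (bubble a b) = 2"
  by (simp add: bubble_def degree_mult_eq)

lemma integrable_Ioo_continuous:
  fixes f :: "real \<Rightarrow> real"
  shows "continuous_on {a..b} f \<Longrightarrow> integrable (Ioo a b) f"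
  by (intro square_integrable_integrable square_integrable_continuous)

definition affine_interpolant :: "real \<Rightarrow> real \<Rightarrow> (real \<Rightarrow> real) \<Rightarrow> real poly" where
  "affine_interpolant a b v = [:v a:] + smult ((v b - v a) / (b - a)) [:- a, 1:]"

lemma poly_affine_interpolant:
  "poly (affine_interpolant a b v) x = v a + (v b - v a) / (b - a) * (x - a)"
proof -
  have "poly ([:c:] + smult d [:- a, 1:]) x = c + d * (x - a)" for c d :: real
    by (simp add: algebra_simps)
  then show ?thesis unfolding affine_interpolant_def .
qed

lemma degree_affine_interpolant: "degree (affine_interpolant a b v) \<le> 1"
  unfolding affine_interpolant_def by (intro degree_add_le) (auto intro: order_trans[OF degree_smult_le])

text \<open>The conditions of \<open>is_interpolant\<close> on one cell, with the polynomial itself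
  as argument, so that its degree and derivative are at hand.\<close>

definition cell_interpolant :: "real \<Rightarrow> real \<Rightarrow> nat \<Rightarrow> (real \<Rightarrow> real) \<Rightarrow> real poly \<Rightarrow> bool" where
  "cell_interpolant a b q v p \<longleftrightarrow> degree p \<le> q \<and> poly p a = v a \<and> poly p b = v b \<and>
     (\<forall>\<xi>. degree \<xi> \<le> q - 2 \<longrightarrow> integral\<^sup>L (Ioo a b) (\<lambda>t. (poly p t - v t) * poly \<xi> t) = 0)"

text \<open>The affine interpolant settles the end points, and adding \<open>bubble a b * r\<close>
  does not disturb them. The moment conditions then say that \<open>r\<close> represents the
  functional \<open>L\<close> in the inner product weighted with the bubble, which is definite
  because a nonzero polynomial has only finitely many roots.\<close>

lemma exists_cell_interpolant:
  assumes ab: "a \<le> b" and q: "q \<ge> 2" and v: "continuous_on {a..b} v"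
  shows "\<exists>p. cell_interpolant a b q v p"
proof (cases "a = b")
  case True
  then show ?thesis by (intro exI[of _ "[:v a:]"]) (auto simp: cell_interpolant_def)
next
  case False
  with ab have ab: "a < b" by simp
  define l where "l = affine_interpolant a b v"
  define B where "B r s = integral\<^sup>L (Ioo a b) (\<lambda>x. poly (bubble a b) x * poly r x * poly s x)" for r s
  define L where "L s = integral\<^sup>L (Ioo a b) (\<lambda>x. (v x - poly l x) * poly s x)" for s
  have iB: "integrable (Ioo a b) (\<lambda>x. poly (bubble a b) x * poly r x * poly s x)" for r s
    by (intro integrable_Ioo_continuous continuous_intros)
  have iL: "integrable (Ioo a b) (\<lambda>x. (v x - poly l x) * poly s x)" for s
    by (intro integrable_Ioo_continuous continuous_intros v)
  have "\<exists>r. degree r \<le> q - 2 \<and> (\<forall>\<xi>. degree \<xi> \<le> q - 2 \<longrightarrow> B r \<xi> = L \<xi>)"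
  proof (rule poly_riesz_representation)
    show "B r s = B s r" for r s by (simp add: B_def mult_ac)
    show "B (r + s) t = B r t + B s t" for r s t
      using iB[of r t] iB[of s t] by (simp add: B_def distrib_left distrib_right)
    show "B (smult c r) s = c * B r s" for c r s
    proof -
      have "(\<lambda>x. poly (bubble a b) x * poly (smult c r) x * poly s x) = (\<lambda>x. c * (poly (bubble a b) x * poly r x * poly s x))"
        by (simp add: mult_ac)
      then show ?thesis unfolding B_def by (simp only: integral_mult_right_zero)
    qed
    show "L (r + s) = L r + L s" for r s
      using iL[of r] iL[of s] by (simp add: L_def distrib_left)
    show "L (smult c r) = c * L r" for c r
    proof -
      have "(\<lambda>x. (v x - poly l x) * poly (smult c r) x) = (\<lambda>x. c * ((v x - poly l x) * poly r x))"
        by (simp add: mult_ac)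
      then show ?thesis unfolding L_def by (simp only: integral_mult_right_zero)
    qed
    show "B r r > 0" if "r \<noteq> 0" for r
    proof -
      define f where "f x = poly (bubble a b) x * poly r x * poly r x" for x
      have cf: "continuous_on {a..b} f" unfolding f_def[abs_def] by (intro continuous_intros)
      have f0: "f x \<ge> 0" if "x \<in> {a..b}" for x using that by (simp add: f_def poly_bubble mult.assoc)
      have "B r r = integral {a..b} f"
        unfolding B_def f_def[symmetric] by (rule integral_Ioo_eq(1)[OF integrable_Ioo_continuous[OF cf]])
      moreover have "integral {a..b} f \<ge> 0" using f0 by (intro integral_nonneg integrable_continuous_interval cf) auto
      moreover have "integral {a..b} f \<noteq> 0"
      proof
        assume "integral {a..b} f = 0"
        then have "\<forall>x\<in>{a..b}. f x = 0" using integral_eq_0_iff[OF cf ab f0] by simp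
        then have "{a<..<b} \<subseteq> {x. poly r x = 0}" by (fastforce simp: f_def poly_bubble)
        then have "finite {a<..<b}" using poly_roots_finite[OF that] finite_subset by blast
        then show False using ab by (simp add: infinite_Ioo)
      qed
      ultimately show ?thesis by simp
    qed
  qed
  then obtain r where r: "degree r \<le> q - 2" "\<And>\<xi>. degree \<xi> \<le> q - 2 \<Longrightarrow> B r \<xi> = L \<xi>" by auto
  define p where "p = l + bubble a b * r"
  have "degree (bubble a b * r) \<le> q"
    using degree_mult_le[of "bubble a b" r] r(1) q by simp
  then have "degree p \<le> q"
    unfolding p_def using degree_affine_interpolant[of a b v] q by (intro degree_add_le) (auto simp: l_def)
  moreover have "poly p a = v a" "poly p b = v b"
    using ab by (auto simp: p_def l_def poly_affine_interpolant poly_bubble)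
  moreover have "integral\<^sup>L (Ioo a b) (\<lambda>t. (poly p t - v t) * poly \<xi> t) = 0" if "degree \<xi> \<le> q - 2" for \<xi>
  proof -
    have "(\<lambda>t. (poly p t - v t) * poly \<xi> t)
        = (\<lambda>t. poly (bubble a b) t * poly r t * poly \<xi> t - (v t - poly l t) * poly \<xi> t)"
      by (auto simp: p_def algebra_simps fun_eq_iff)
    then show ?thesis using iB[of r \<xi>] iL[of \<xi>] r(2)[OF that] by (simp add: B_def L_def)
  qed
  ultimately show ?thesis by (intro exI[of _ p]) (simp add: cell_interpolant_def)
qed

text \<open>Integration by parts: the end point conditions remove the boundary terms, and the moment
  conditions remove the remaining integral because \<open>pderiv \<xi>\<close> has degree at most
  \<open>q - 2\<close>.\<close>

lemma cell_interpolant_deriv_orthogonal: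
  assumes ab: "a \<le> b" and p: "cell_interpolant a b q v p" and v: "L2_primitive a b v v'" and \<xi>: "degree \<xi> \<le> q - 1"
  shows "integral\<^sup>L (Ioo a b) (\<lambda>t. (poly (pderiv p) t - v' t) * poly \<xi> t) = 0"
proof -
  have d: "L2_primitive a b (\<lambda>t. poly p t - v t) (\<lambda>t. poly (pderiv p) t - v' t)"
    by (rule L2_primitive_minus[OF poly_primitive[OF ab] v])
  have "integral\<^sup>L (Ioo a b) (\<lambda>t. (poly (pderiv p) t - v' t) * poly \<xi> t) =
    (poly p b - v b) * poly \<xi> b - (poly p a - v a) * poly \<xi> a - integral\<^sup>L (Ioo a b) (\<lambda>t. (poly p t - v t) * poly (pderiv \<xi>) t)"
    by (rule L2_primitive_by_parts[OF ab d]) (auto intro: poly_DERIV has_field_derivative_at_within continuous_intros)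
  moreover have "degree (pderiv \<xi>) \<le> q - 2" using \<xi> by (simp add: degree_pderiv)
  ultimately show ?thesis using p by (simp add: cell_interpolant_def)
qed

text \<open>Pythagoras: \<open>v' - \<xi>\<close> splits into the polynomial \<zeta> and the error
  \<open>e\<close>, which is orthogonal to it.\<close>

lemma cell_interpolant_best_approx:
  assumes ab: "a \<le> b" and p: "cell_interpolant a b q v p" and v: "L2_primitive a b v v'" and \<xi>: "degree \<xi> \<le> q - 1"
  shows "L2_sq a b (\<lambda>t. poly (pderiv p) t - v' t) \<le> L2_sq a b (\<lambda>t. v' t - poly \<xi> t)"
proof -
  define e where "e t = poly (pderiv p) t - v' t" for t
  define \<zeta> where "\<zeta> = pderiv p - \<xi>"
  have "degree (pderiv p) \<le> q - 1" using p by (auto simp: degree_pderiv cell_interpolant_def intro: diff_le_mono)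
  then have "degree \<zeta> \<le> q - 1" unfolding \<zeta>_def using \<xi> by (intro degree_diff_le)
  then have orth: "integral\<^sup>L (Ioo a b) (\<lambda>t. e t * poly \<zeta> t) = 0"
    unfolding e_def by (rule cell_interpolant_deriv_orthogonal[OF ab p v])
  have se: "square_integrable a b e" unfolding e_def[abs_def]
    by (intro square_integrable_diff poly_square_integrable L2_primitive_square_integrable[OF v])
  have sz: "square_integrable a b (poly \<zeta>)" by (rule poly_square_integrable)
  have "(\<lambda>t. (v' t - poly \<xi> t)\<^sup>2) = (\<lambda>t. (poly \<zeta> t)\<^sup>2 - 2 * (e t * poly \<zeta> t) + (e t)\<^sup>2)"
    by (auto simp: \<zeta>_def e_def fun_eq_iff power2_eq_square algebra_simps)
  then have "L2_sq a b (\<lambda>t. v' t - poly \<xi> t) = L2_sq a b (poly \<zeta>) + L2_sq a b e"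
    using se sz square_integrable_integrable_mult[OF se sz] orth by (simp add: L2_sq_def square_integrable_iff)
  then show ?thesis unfolding e_def[symmetric] using L2_sq_nonneg[of a b "poly \<zeta>"] by linarith
qed

text \<open>As interpolation reproduces \<open>P\<close>, only \<open>V = v - P\<close> matters, and
  \<open>p - P\<close> is the affine interpolant of \<open>V\<close> plus
  \<open>bubble a b * r\<close>. Testing the moment conditions with \<open>r\<close> itself bounds
  the weighted integral \<open>w\<close> by means of the L2 norm of \<open>r\<close>, which the norm
  equivalence turns back into \<open>w\<close>.\<close>

lemma cell_interpolant_sup_stability:
  "\<exists>C>0. \<forall>a b v p P M. a < b \<longrightarrow> continuous_on {a..b} v \<longrightarrow> cell_interpolant a b q v p \<longrightarrow> degree P \<le> q \<longrightarrow>
     (\<forall>x\<in>{a..b}. \<bar>v x - poly P x\<bar> \<le> M) \<longrightarrow> L2_sq a b (\<lambda>t. poly p t - v t) \<le> C * (b - a) * M\<^sup>2"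
proof -
  obtain C where C: "C > 0" and equiv: "\<And>r a b. degree r \<le> q - 2 \<Longrightarrow> a < b \<Longrightarrow>
     (b - a)\<^sup>2 * L2_sq a b (poly r) \<le> C * integral\<^sup>L (Ioo a b) (\<lambda>x. poly (bubble a b) x * (poly r x)\<^sup>2)"
    using bubble_weighted_norm_equivalence[of "q - 2"] by blast
  show ?thesis
  proof (intro exI[of _ "8 * C + 8"] conjI allI impI)
    show "8 * C + 8 > 0" using C by simp
    fix a b M :: real and v and p P :: "real poly"
    assume ab: "a < b" and v: "continuous_on {a..b} v" and p: "cell_interpolant a b q v p"
      and P: "degree P \<le> q" and M: "\<forall>x\<in>{a..b}. \<bar>v x - poly P x\<bar> \<le> M"
    define V where "V x = v x - poly P x" for x
    have cV: "continuous_on {a..b} V" unfolding V_def[abs_def] by (intro continuous_intros v)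
    have VM: "\<bar>V x\<bar> \<le> M" if "x \<in> {a..b}" for x using M that by (simp add: V_def)
    have M0: "M \<ge> 0" using VM[of a] ab by auto
    define l where "l = affine_interpolant a b V"
    have lM: "\<bar>poly l x\<bar> \<le> M" if "x \<in> {a..b}" for x
    proof -
      define s where "s = (x - a) / (b - a)"
      have s: "0 \<le> s" "s \<le> 1" using that ab by (auto simp: s_def)
      have "poly l x = V a + (V b - V a) * s"
        by (simp add: l_def poly_affine_interpolant s_def)
      also have "\<dots> = (1 - s) * V a + s * V b" by (simp add: algebra_simps)
      finally have "poly l x = (1 - s) * V a + s * V b" .
      then have "\<bar>poly l x\<bar> \<le> (1 - s) * \<bar>V a\<bar> + s * \<bar>V b\<bar>"
        using s abs_triangle_ineq[of "(1 - s) * V a" "s * V b"] by (simp add: abs_mult)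
      also have "\<dots> \<le> (1 - s) * M + s * M" using s VM[of a] VM[of b] ab by (intro add_mono mult_left_mono) auto
      finally show ?thesis by (simp add: algebra_simps)
    qed
    have Vl: "\<bar>V x - poly l x\<bar> \<le> 2 * M" if "x \<in> {a..b}" for x
      using VM[OF that] lM[OF that] abs_triangle_ineq4[of "V x" "poly l x"] by linarith
    have cVl: "continuous_on {a..b} (\<lambda>x. V x - poly l x)" by (intro continuous_intros cV)
    have sVl: "L2_sq a b (\<lambda>x. V x - poly l x) \<le> (b - a) * (2 * M)\<^sup>2"
      using ab Vl by (intro L2_sq_bounded_le square_integrable_continuous cVl) auto
    \<comment> \<open>The polynomial vanishes at both ends, hence the bubble divides it. The bound
      \<open>max q 1\<close> on the degree allows for the affine part when \<open>q\<close> is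
      0.\<close>
    obtain r where r: "degree r \<le> q - 2" "p - P - l = bubble a b * r"
    proof -
      define R where "R = p - P - l"
      have "poly R a = 0" "poly R b = 0"
        using p ab by (auto simp: R_def l_def poly_affine_interpolant V_def cell_interpolant_def)
      then obtain R1 where R1: "R = [:- a, 1:] * R1" by (auto simp: poly_eq_0_iff_dvd elim: dvdE)
      then have "poly R1 b = 0" using \<open>poly R b = 0\<close> ab by simp
      then obtain R2 where R2: "R1 = [:- b, 1:] * R2" by (auto simp: poly_eq_0_iff_dvd elim: dvdE)
      have eq: "R = bubble a b * (- R2)" by (simp add: R1 R2 bubble_def algebra_simps smult_add_left)
      show thesis
      proof (cases "R2 = 0")
        case True
        then show ?thesis using that[of 0] eq by (simp add: R_def)
      next
        case False
        have "degree R \<le> max q 1"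
          unfolding R_def using p P degree_affine_interpolant[of a b V]
          by (intro degree_diff_le) (auto simp: cell_interpolant_def l_def)
        moreover have "degree R = 2 + degree R2"
          using False eq degree_mult_eq[of "bubble a b" "- R2"] degree_bubble[of a b] by fastforce
        ultimately show ?thesis using that[of "- R2"] eq by (auto simp: R_def)
      qed
    qed
    define w where "w = integral\<^sup>L (Ioo a b) (\<lambda>x. poly (bubble a b) x * (poly r x)\<^sup>2)"
    have w0: "w \<ge> 0" unfolding w_def
      by (rule integral_nonneg_AE, rule AE_Ioo_I) (simp add: poly_bubble)
    have peq: "poly p t - v t = poly (bubble a b) t * poly r t + (poly l t - V t)" for t
      using arg_cong[OF r(2), of "\<lambda>s. poly s t"] by (simp add: V_def)
    have iVl: "integrable (Ioo a b) (\<lambda>t. (V t - poly l t) * poly r t)"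
      by (intro integrable_Ioo_continuous continuous_intros cVl[unfolded]) (rule cV)
    have ib: "integrable (Ioo a b) (\<lambda>x. poly (bubble a b) x * (poly r x)\<^sup>2)"
      by (intro integrable_Ioo_continuous continuous_intros)
    have "0 = integral\<^sup>L (Ioo a b) (\<lambda>t. (poly p t - v t) * poly r t)"
      using p r(1) by (simp add: cell_interpolant_def)
    also have "(\<lambda>t. (poly p t - v t) * poly r t) = (\<lambda>t. poly (bubble a b) t * (poly r t)\<^sup>2 - (V t - poly l t) * poly r t)"
      unfolding peq by (auto simp: fun_eq_iff power2_eq_square algebra_simps)
    also have "integral\<^sup>L (Ioo a b) \<dots> = w - integral\<^sup>L (Ioo a b) (\<lambda>t. (V t - poly l t) * poly r t)"
      using iVl ib by (simp add: w_def)
    finally have "w\<^sup>2 = (integral\<^sup>L (Ioo a b) (\<lambda>t. (V t - poly l t) * poly r t))\<^sup>2" by simp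
    also have "\<dots> \<le> L2_sq a b (\<lambda>t. V t - poly l t) * L2_sq a b (poly r)"
      by (intro L2_Cauchy_Schwarz square_integrable_continuous cVl poly_square_integrable)
    also have "\<dots> \<le> ((b - a) * (2 * M)\<^sup>2) * L2_sq a b (poly r)"
      by (intro mult_right_mono sVl) auto
    finally have "(b - a)\<^sup>2 * w\<^sup>2 \<le> (b - a)\<^sup>2 * (((b - a) * (2 * M)\<^sup>2) * L2_sq a b (poly r))"
      by (rule mult_left_mono) simp
    also have "\<dots> = ((b - a) * (2 * M)\<^sup>2) * ((b - a)\<^sup>2 * L2_sq a b (poly r))"
      by (simp only: mult_ac)
    also have "\<dots> \<le> ((b - a) * (2 * M)\<^sup>2) * (C * w)"
      unfolding w_def using ab by (intro mult_left_mono equiv r(1)) auto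
    finally have "(b - a) * w * ((b - a) * w) \<le> (b - a) * w * (C * (2 * M)\<^sup>2)"
      by (simp add: power2_eq_square mult_ac)
    \<comment> \<open>One factor \<open>(b - a) * w\<close> is cancelled; for \<open>w = 0\<close>
      the bound holds anyway.\<close>
    then have hw: "(b - a) * w \<le> C * (2 * M)\<^sup>2"
    proof (cases "w = 0")
      case False
      then have "(b - a) * w > 0" using w0 ab by simp
      then show ?thesis using \<open>(b - a) * w * ((b - a) * w) \<le> (b - a) * w * (C * (2 * M)\<^sup>2)\<close>
        by (simp add: mult_le_cancel_left_pos)
    qed (use C in auto)
    \<comment> \<open>One of the two bubbles in the square is bounded by
      \<open>(b - a)\<^sup>2\<close>; the other one serves as the weight in
      \<open>w\<close>.\<close>
    have "L2_sq a b (\<lambda>t. poly (bubble a b) t * poly r t) \<le> integral\<^sup>L (Ioo a b) (\<lambda>x. (b - a)\<^sup>2 * (poly (bubble a b) x * (poly r x)\<^sup>2))"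
    proof (rule L2_sq_le_integral)
      show "square_integrable a b (\<lambda>t. poly (bubble a b) t * poly r t)"
        by (intro square_integrable_continuous continuous_intros)
      show "integrable (Ioo a b) (\<lambda>x. (b - a)\<^sup>2 * (poly (bubble a b) x * (poly r x)\<^sup>2))"
        by (intro integrable_Ioo_continuous continuous_intros)
      fix x assume x: "a < x" "x < b"
      have "poly (bubble a b) x \<le> (b - a)\<^sup>2"
        using x unfolding poly_bubble power2_eq_square by (intro mult_mono) auto
      moreover have "0 \<le> poly (bubble a b) x" using x by (simp add: poly_bubble)
      ultimately have "(poly (bubble a b) x)\<^sup>2 * (poly r x)\<^sup>2 \<le> ((b - a)\<^sup>2 * poly (bubble a b) x) * (poly r x)\<^sup>2"
        unfolding power2_eq_square[of "poly (bubble a b) x"] by (intro mult_right_mono) auto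
      then show "(poly (bubble a b) x * poly r x)\<^sup>2 \<le> (b - a)\<^sup>2 * (poly (bubble a b) x * (poly r x)\<^sup>2)"
        by (simp add: power_mult_distrib mult.assoc)
    qed
    also have "\<dots> = (b - a) * ((b - a) * w)" by (simp add: w_def power2_eq_square)
    also have "\<dots> \<le> (b - a) * (C * (2 * M)\<^sup>2)" using ab by (intro mult_left_mono hw) auto
    finally have b1: "L2_sq a b (\<lambda>t. poly (bubble a b) t * poly r t) \<le> (b - a) * (C * (2 * M)\<^sup>2)" .
    have "L2_sq a b (\<lambda>t. poly p t - v t) \<le> 2 * L2_sq a b (\<lambda>t. poly (bubble a b) t * poly r t) + 2 * L2_sq a b (\<lambda>t. poly l t - V t)"
      unfolding peq by (intro L2_sq_add_le square_integrable_continuous continuous_intros cV)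
    also have "\<dots> \<le> 2 * ((b - a) * (C * (2 * M)\<^sup>2)) + 2 * ((b - a) * (2 * M)\<^sup>2)"
      using b1 sVl L2_sq_minus_commute[of a b "\<lambda>t. poly l t" V] by linarith
    also have "\<dots> = (8 * C + 8) * (b - a) * M\<^sup>2" by (simp add: power2_eq_square algebra_simps)
    finally show "L2_sq a b (\<lambda>t. poly p t - v t) \<le> (8 * C + 8) * (b - a) * M\<^sup>2" .
  qed
qed

text \<open>On a degenerate cell both polynomials take the prescribed value at the single point, so the
  choice of the cell does not matter at a node.\<close>

lemma exists_interpolant:
  assumes q: "q \<ge> 2" and x0: "x 0 = 0" and xN: "x N = 2" and N: "N > 0"
    and mono: "\<And>i. i < N \<Longrightarrow> x i \<le> x (Suc i)" and v: "continuous_on {0..2} v"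
  shows "\<exists>g. is_interpolant x N q v g"
proof -
  have xm: "x i \<le> x j" if "i \<le> j" "j \<le> N" for i j using partition_le[of N x i j] mono that by auto
  have sub: "{x (i - 1)..x i} \<subseteq> {0..2}" if "i \<in> {1..N}" for i
    using xm[of 0 "i - 1"] xm[of i N] that x0 xN by auto
  have "\<exists>p. cell_interpolant (x (i - 1)) (x i) q v p" if "i \<in> {1..N}" for i
    using sub[OF that] that by (intro exists_cell_interpolant q continuous_on_subset[OF v] xm) auto
  then obtain p where p: "\<And>i. i \<in> {1..N} \<Longrightarrow> cell_interpolant (x (i - 1)) (x i) q v (p i)" by metis
  define c where "c t = (SOME i. i \<in> {1..N} \<and> t \<in> {x (i - 1)..x i})" for t
  define g where "g t = poly (p (c t)) t" for t
  have g: "g t = poly (p i) t" if i: "i \<in> {1..N}" and t: "t \<in> {x (i - 1)..x i}" for i t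
  proof -
    have c: "c t \<in> {1..N} \<and> t \<in> {x (c t - 1)..x (c t)}"
      unfolding c_def by (rule someI[of _ i]) (use i t in auto)
    have endpt: "poly (p k) t = v t" if "k \<in> {1..N}" "t = x k \<or> t = x (k - 1)" for k
      using p[OF that(1)] that(2) by (auto simp: cell_interpolant_def)
    consider "c t = i" | "c t < i" | "i < c t" by linarith
    then show ?thesis
    proof cases
      case 1 then show ?thesis by (simp add: g_def)
    next
      case 2
      then have "x (c t) \<le> x (i - 1)" using i by (intro xm) auto
      then have "t = x (c t)" "t = x (i - 1)" using c t by auto
      then show ?thesis using endpt[of i] endpt[of "c t"] c i by (simp add: g_def)
    next
      case 3
      then have "x i \<le> x (c t - 1)" using c by (intro xm) auto
      then have "t = x (c t - 1)" "t = x i" using c t by auto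
      then show ?thesis using endpt[of i] endpt[of "c t"] c i by (simp add: g_def)
    qed
  qed
  have cover: "{0..2} = (\<Union>i\<in>{1..N}. {x (i - 1)..x i})"
  proof
    show "(\<Union>i\<in>{1..N}. {x (i - 1)..x i}) \<subseteq> {0..2}" using sub by blast
    show "{0..2} \<subseteq> (\<Union>i\<in>{1..N}. {x (i - 1)..x i})"
    proof
      fix t :: real assume t: "t \<in> {0..2}"
      have ex: "\<exists>i. 1 \<le> i \<and> i \<le> N \<and> t \<le> x i" using t N xN by (intro exI[of _ N]) auto
      define i where "i = (LEAST i. 1 \<le> i \<and> i \<le> N \<and> t \<le> x i)"
      have i: "1 \<le> i \<and> i \<le> N \<and> t \<le> x i" unfolding i_def by (rule LeastI_ex[OF ex])
      have "x (i - 1) \<le> t"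
      proof (cases "i = 1")
        case True then show ?thesis using t x0 by simp
      next
        case False
        then have "i - 1 < i" "1 \<le> i - 1" using i by auto
        then have "\<not> t \<le> x (i - 1)" using not_less_Least[of "i - 1"] i unfolding i_def by fastforce
        then show ?thesis by simp
      qed
      then show "t \<in> (\<Union>i\<in>{1..N}. {x (i - 1)..x i})" using i by auto
    qed
  qed
  have "continuous_on {0..2} g"
    unfolding cover
  proof (rule continuous_on_closed_Union)
    fix i assume i: "i \<in> {1..N}"
    have "continuous_on {x (i - 1)..x i} (poly (p i))" by (intro continuous_intros)
    then show "continuous_on {x (i - 1)..x i} g" by (rule continuous_on_eq) (use g[OF i] in auto)
  qed auto
  moreover have "piecewise_poly x N q g"
    unfolding piecewise_poly_def
  proof (intro ballI exI conjI)
    fix i assume i: "i \<in> {1..N}"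
    show "degree (p i) \<le> q" using p[OF i] by (simp add: cell_interpolant_def)
    show "g t = poly (p i) t" if "t \<in> {x (i - 1)..x i}" for t by (rule g[OF i that])
  qed
  moreover have "g (x (i - 1)) - v (x (i - 1)) = 0 \<and> g (x i) - v (x i) = 0 \<and>
        (\<forall>\<xi> :: real poly. degree \<xi> \<le> q - 2 \<longrightarrow> L2_inner (x (i - 1)) (x i) (\<lambda>t. g t - v t) (poly \<xi>) = 0)"
    if i: "i \<in> {1..N}" for i
  proof -
    have "x (i - 1) \<le> x i" using xm[of "i - 1" i] i by auto
    then have "g (x (i - 1)) = poly (p i) (x (i - 1))" "g (x i) = poly (p i) (x i)"
      using g[OF i] by auto
    moreover have "L2_inner (x (i - 1)) (x i) (\<lambda>t. g t - v t) (poly \<xi>)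
      = integral\<^sup>L (Ioo (x (i - 1)) (x i)) (\<lambda>t. (poly (p i) t - v t) * poly \<xi> t)" for \<xi>
      unfolding L2_inner_eq using g[OF i] by (intro Bochner_Integration.integral_cong) auto
    ultimately show ?thesis using p[OF i] by (simp add: cell_interpolant_def)
  qed
  ultimately show ?thesis unfolding is_interpolant_def by blast
qed

section \<open>The weak S-type mesh\<close>

text \<open>The derivative is integrated, which tolerates the finitely many exceptional points of
  \<phi>; there \<open>g\<close> takes the value \<open>B\<close>.\<close>

lemma increment_le_of_deriv_le:
  fixes f :: "real \<Rightarrow> real"
  assumes ab: "a \<le> b" and fin: "finite P" and c: "continuous_on {a..b} f"
    and D: "\<And>x. x \<in> {a<..<b} - P \<Longrightarrow> f differentiable (at x) \<and> deriv f x \<le> B"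
  shows "f b - f a \<le> B * (b - a)"
proof -
  define g where "g x = (if x \<in> {a<..<b} - P then deriv f x else B)" for x
  have "(g has_integral (f b - f a)) {a..b}"
  proof (rule fundamental_theorem_of_calculus_interior_strong[OF fin ab _ c])
    fix x assume x: "x \<in> {a<..<b} - P"
    then have "(f has_real_derivative deriv f x) (at x)"
      using D[OF x] by (simp add: DERIV_deriv_iff_real_differentiable)
    then show "(f has_vector_derivative g x) (at x)"
      using x by (simp add: g_def has_real_derivative_iff_has_vector_derivative)
  qed
  moreover have "((\<lambda>x. B) has_integral (b - a) * B) {a..b}"
    using has_integral_const_real[of B a b] ab by simp
  ultimately have "f b - f a \<le> (b - a) * B"
    by (rule has_integral_le) (use D in \<open>auto simp: g_def\<close>)
  then show ?thesis by (simp add: mult.commute)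
qed

text \<open>One mesh for fixed \<epsilon> and \<open>N\<close>. The named constants of the
  estimates, such as \<open>C0\<close>, \<open>C1\<close> and \<open>CF\<close>, mention only
  \<open>q\<close>, \<open>K\<close>, \<sigma> and \<beta>, so that uniformity in \<epsilon> and
  \<open>N\<close> can be read off from their definitions.\<close>

locale S_mesh =
  fixes q :: nat and K \<sigma> \<beta> \<epsilon> :: real and N :: nat and \<phi> :: "real \<Rightarrow> real"
  assumes q: "q > 2" and \<beta>: "\<beta> > 0" and \<sigma>: "\<sigma> \<ge> real q + 1" and \<epsilon>: "\<epsilon> > 0"
    and mesh: "admissible_mesh K q \<sigma> \<beta> \<epsilon> N \<phi>"
begin

abbreviation x :: "nat \<Rightarrow> real" where "x \<equiv> node q \<sigma> \<beta> \<epsilon> N \<phi>"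
abbreviation s :: real where "s \<equiv> inner_scale q \<epsilon>"
abbreviation lam :: real where "lam \<equiv> mesh_lambda \<sigma> \<beta> \<epsilon> N"
abbreviation \<nu> :: real where "\<nu> \<equiv> mesh_nu q \<sigma> \<beta> \<epsilon> N"
abbreviation \<psi> :: "real \<Rightarrow> real" where "\<psi> \<equiv> mesh_characterising \<phi>"
abbreviation H :: real where "H \<equiv> h_inner x N"
definition \<rho> :: real where "\<rho> = max_abs_deriv \<psi> / real N"
definition R :: real where "R = H + \<rho>"
definition m :: nat where "m = N div 8"

lemma N_eq: "N = 8 * m" and m_pos: "m > 0"
  using mesh by (auto simp: admissible_mesh_def m_def)

text \<open>As \<open>m\<close> depends on \<open>N\<close>, the equation \<open>N = 8 * m\<close> itself would loop as a simplification rule.\<close>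

lemma N_simps: "N div 8 = m" "N div 2 = 4 * m" "3 * N div 8 = 3 * m" "5 * N div 8 = 5 * m"
    "7 * N div 8 = 7 * m" "real N = 8 * real m" "i \<le> N \<longleftrightarrow> i \<le> 8 * m" "N - i = 8 * m - i"
proof -
  have *: "N = 8 * k \<Longrightarrow> N div 8 = k \<and> N div 2 = 4 * k \<and> 3 * N div 8 = 3 * k \<and> 5 * N div 8 = 5 * k
      \<and> 7 * N div 8 = 7 * k \<and> real N = 8 * real k \<and> (i \<le> N \<longleftrightarrow> i \<le> 8 * k) \<and> N - i = 8 * k - i" for k
    by simp
  show "N div 8 = m" "N div 2 = 4 * m" "3 * N div 8 = 3 * m" "5 * N div 8 = 5 * m"
    "7 * N div 8 = 7 * m" "real N = 8 * real m" "i \<le> N \<longleftrightarrow> i \<le> 8 * m" "N - i = 8 * m - i"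
    using *[OF N_eq] by blast+
qed

lemma N8: "real N \<ge> 8" using m_pos by (simp add: N_simps)

lemma lnN: "ln (real N) > 0" using N8 by simp

lemma \<sigma>_pos: "\<sigma> > 0" using \<sigma> by linarith

definition \<kappa> :: real where "\<kappa> = 5 / (2 * (real q + 1))"

lemma \<kappa>: "0 < \<kappa>" "\<kappa> < 1" "\<kappa> * real q < 5/2" "\<kappa> * (real q + 1) = 5/2"
  using q by (auto simp: \<kappa>_def field_simps)

lemma s_eq: "s = \<epsilon> powr (1 - \<kappa>)" by (simp add: inner_scale_def \<kappa>_def)

lemma s_pos: "s > 0" using \<epsilon> by (simp add: s_eq)

lemma \<epsilon>_le_s: "\<epsilon> \<le> s"
proof -
  have "\<sigma> / \<beta> * \<epsilon> * ln (real N) \<le> \<sigma> / \<beta> * s * ln (real N)"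
    using mesh by (simp add: admissible_mesh_def mesh_lambda_def mesh_nu_def)
  then show ?thesis using lnN \<sigma>_pos \<beta> by (simp add: field_simps)
qed

text \<open>Smallness of \<epsilon> is contained in \<open>lam \<le> \<nu>\<close>: above 1, the
  exponent \<open>1 - \<kappa>\<close> would make \<open>s\<close> smaller than \<epsilon>.\<close>

lemma \<epsilon>1: "\<epsilon> \<le> 1"
proof (rule ccontr)
  assume "\<not> \<epsilon> \<le> 1"
  then have "\<epsilon> powr (1 - \<kappa>) < \<epsilon> powr 1" using \<kappa> by (intro powr_less_mono) auto
  then show False using \<epsilon>_le_s \<epsilon> by (simp add: s_eq)
qed

lemma s1: "s \<le> 1" using \<epsilon>1 \<epsilon> \<kappa> by (simp add: s_eq powr_le1)

lemma lam_pos: "lam > 0" using lnN \<sigma>_pos \<beta> \<epsilon> by (simp add: mesh_lambda_def)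
lemma lam_le_\<nu>: "lam \<le> \<nu>" using mesh by (simp add: admissible_mesh_def)
lemma \<nu>_less: "\<nu> < 1/4" using mesh by (simp add: admissible_mesh_def)

lemma defining: "mesh_defining K N \<phi>" using mesh by (simp add: admissible_mesh_def)

section \<open>The mesh-defining and the mesh characterising function\<close>

lemma \<phi>_mono: "0 \<le> t \<Longrightarrow> t \<le> u \<Longrightarrow> u \<le> 1/2 \<Longrightarrow> \<phi> t \<le> \<phi> u"
  using defining mono_onD[of "{0..1/2}" \<phi> t u] by (simp add: mesh_defining_def)

lemma \<phi>_0: "\<phi> 0 = 0" and \<phi>_half: "\<phi> (1/2) = ln (real N)"
  using defining by (auto simp: mesh_defining_def)

lemma \<phi>_nonneg: "0 \<le> t \<Longrightarrow> t \<le> 1/2 \<Longrightarrow> \<phi> t \<ge> 0"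
  using \<phi>_mono[of 0 t] by (simp add: \<phi>_0)

lemma \<phi>_cont: "continuous_on {0..1/2} \<phi>"
  using defining by (simp add: mesh_defining_def piecewise_C1_differentiable_on_def)

lemma \<phi>_exceptional: obtains P where "finite P" "\<And>t. t \<in> {0<..<1/2} - P \<Longrightarrow> \<phi> differentiable (at t)"
proof -
  obtain P where P: "finite P" "\<phi> C1_differentiable_on ({0..1/2} - P)"
    using defining by (auto simp: mesh_defining_def piecewise_C1_differentiable_on_def)
  then show thesis using that[of P] by (auto simp: C1_differentiable_on_eq)
qed

lemma \<phi>_increment:
  assumes "0 \<le> t" "t \<le> u" "u \<le> 1/2"
  shows "\<phi> u - \<phi> t \<le> K * real N * (u - t)"
proof -
  obtain P where P: "finite P" "\<And>t. t \<in> {0<..<1/2} - P \<Longrightarrow> \<phi> differentiable (at t)"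
    using \<phi>_exceptional by metis
  show ?thesis
  proof (rule increment_le_of_deriv_le[OF assms(2) P(1)])
    show "continuous_on {t..u} \<phi>" by (rule continuous_on_subset[OF \<phi>_cont]) (use assms in auto)
    fix y assume y: "y \<in> {t<..<u} - P"
    then have "y \<in> {0<..<1/2} - P" using assms by auto
    then show "\<phi> differentiable (at y) \<and> deriv \<phi> y \<le> K * real N"
      using P(2) defining by (auto simp: mesh_defining_def)
  qed
qed

text \<open>\<phi> has to climb from 0 to \<open>ln (real N) > 0\<close> with slope at most
  \<open>K * real N\<close>.\<close>

lemma K_pos: "K > 0"
proof -
  have "0 < K * real N * (1/2)" using \<phi>_increment[of 0 "1/2"] lnN by (simp add: \<phi>_0 \<phi>_half)
  then show ?thesis using N8 by (simp add: zero_less_mult_iff)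
qed

text \<open>The supremum in \<open>max_abs_deriv\<close> is an upper bound only if the values are
  bounded. Where \<psi> is differentiable, so is \<open>\<phi> = - ln \<psi>\<close>, and the
  derivative of \<psi> is that of \<phi> multiplied by \<open>- \<psi>\<close>, with \<psi> at most
  one.\<close>

lemma \<psi>_deriv_bound:
  assumes t: "t \<in> {0<..<1/2}" and d: "\<psi> differentiable (at t)"
  shows "\<bar>deriv \<psi> t\<bar> \<le> K * real N"
proof -
  have "(\<psi> has_real_derivative deriv \<psi> t) (at t)"
    using d by (simp add: DERIV_deriv_iff_real_differentiable)
  moreover have "\<psi> t > 0" by (simp add: mesh_characterising_def)
  ultimately have "((\<lambda>t. - ln (\<psi> t)) has_real_derivative - (deriv \<psi> t / \<psi> t)) (at t)"
    by (auto intro!: derivative_eq_intros)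
  moreover have "(\<lambda>t. - ln (\<psi> t)) = \<phi>" by (simp add: mesh_characterising_def)
  ultimately have D: "(\<phi> has_real_derivative - (deriv \<psi> t / \<psi> t)) (at t)" by simp
  have up: "- (deriv \<psi> t / \<psi> t) \<le> K * real N"
    using D defining t unfolding mesh_defining_def by (metis DERIV_imp_deriv real_differentiable_def)
  have "- (deriv \<psi> t / \<psi> t) \<ge> 0"
    using mono_on_imp_deriv_nonneg[OF _ D, of "{0..1/2}"] defining t by (simp add: mesh_defining_def)
  moreover have \<psi>: "0 < \<psi> t" "\<psi> t \<le> 1" using \<phi>_nonneg[of t] t by (auto simp: mesh_characterising_def)
  ultimately have "\<bar>deriv \<psi> t\<bar> = \<psi> t * - (deriv \<psi> t / \<psi> t)" by (auto simp: divide_le_0_iff)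
  also have "\<dots> \<le> 1 * (K * real N)"
    using up \<psi> \<open>- (deriv \<psi> t / \<psi> t) \<ge> 0\<close> by (intro mult_mono) auto
  finally show ?thesis by simp
qed

lemma \<psi>_differentiable: "\<phi> differentiable (at t) \<Longrightarrow> \<psi> differentiable (at t)"
proof -
  assume "\<phi> differentiable (at t)"
  then have "(\<phi> has_real_derivative deriv \<phi> t) (at t)" by (simp add: DERIV_deriv_iff_real_differentiable)
  then have "(\<psi> has_real_derivative - (exp (- \<phi> t) * deriv \<phi> t)) (at t)"
    unfolding mesh_characterising_def[abs_def] by (auto intro!: derivative_eq_intros)
  then show ?thesis unfolding real_differentiable_def by blast
qed

lemma bdd_above_\<psi>: "bdd_above ((\<lambda>t. \<bar>deriv \<psi> t\<bar>) ` {t \<in> {0<..<1/2}. \<psi> differentiable (at t)})"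
  using \<psi>_deriv_bound by (intro bdd_aboveI[of _ "K * real N"]) auto

lemma max_abs_deriv_le: "max_abs_deriv \<psi> \<le> K * real N"
  unfolding max_abs_deriv_def
proof (rule cSUP_least)
  obtain P where P: "finite P" "\<And>t. t \<in> {0<..<1/2} - P \<Longrightarrow> \<phi> differentiable (at t)"
    using \<phi>_exceptional by metis
  have "infinite ({0<..<1/2::real} - P)" using P(1) by (simp add: infinite_Ioo)
  then obtain t where "t \<in> {0<..<1/2} - P" by (metis finite.emptyI equals0I)
  then show "{t \<in> {0<..<1/2}. \<psi> differentiable (at t)} \<noteq> {}" using P(2) \<psi>_differentiable by auto
qed (use \<psi>_deriv_bound in auto)

lemma \<psi>_decrement:
  assumes "0 \<le> t" "t \<le> u" "u \<le> 1/2"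
  shows "\<psi> t - \<psi> u \<le> max_abs_deriv \<psi> * (u - t)"
proof -
  obtain P where P: "finite P" "\<And>t. t \<in> {0<..<1/2} - P \<Longrightarrow> \<phi> differentiable (at t)"
    using \<phi>_exceptional by metis
  have "(\<lambda>t. - \<psi> t) u - (\<lambda>t. - \<psi> t) t \<le> max_abs_deriv \<psi> * (u - t)"
  proof (rule increment_le_of_deriv_le[OF assms(2) P(1)])
    have "continuous_on {0..1/2} (\<lambda>t. - \<psi> t)"
      unfolding mesh_characterising_def by (intro continuous_intros \<phi>_cont)
    then show "continuous_on {t..u} (\<lambda>t. - \<psi> t)" by (rule continuous_on_subset) (use assms in auto)
    fix y assume y: "y \<in> {t<..<u} - P"
    then have y2: "y \<in> {0<..<1/2} - P" using assms by auto
    then have d: "\<psi> differentiable (at y)" using P(2) \<psi>_differentiable by auto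
    then have "(\<psi> has_real_derivative deriv \<psi> y) (at y)" by (simp add: DERIV_deriv_iff_real_differentiable)
    then have D: "((\<lambda>t. - \<psi> t) has_real_derivative - deriv \<psi> y) (at y)" by (auto intro!: derivative_eq_intros)
    have "\<bar>deriv \<psi> y\<bar> \<le> max_abs_deriv \<psi>"
      unfolding max_abs_deriv_def using d y2 by (intro cSUP_upper bdd_above_\<psi>) auto
    then have "- deriv \<psi> y \<le> max_abs_deriv \<psi>" by linarith
    then show "(\<lambda>t. - \<psi> t) differentiable at y \<and> deriv (\<lambda>t. - \<psi> t) y \<le> max_abs_deriv \<psi>"
      using D DERIV_imp_deriv[OF D] unfolding real_differentiable_def by auto
  qed
  then show ?thesis by simp
qed

text \<open>\<psi> drops from 1 to \<open>1 / real N\<close> over a length of \<open>1/2\<close>, so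
  the largest slope is at least 1. The rate thereby absorbs the coarse cell lengths and the powers
  of \<open>1 / real N\<close> that remain of the layers at the transition points.\<close>

lemma \<rho>_ge: "1 / real N \<le> \<rho>"
proof -
  have "\<psi> 0 - \<psi> (1/2) \<le> max_abs_deriv \<psi> / 2" using \<psi>_decrement[of 0 "1/2"] by simp
  moreover have "\<psi> 0 = 1" "\<psi> (1/2) = 1 / real N"
    using N8 by (auto simp: mesh_characterising_def \<phi>_0 \<phi>_half exp_minus inverse_eq_divide)
  moreover have "1 / real N \<le> 1/8" using N8 by (simp add: divide_le_eq)
  ultimately have "1 \<le> max_abs_deriv \<psi>" by linarith
  then show ?thesis using N8 by (simp add: \<rho>_def divide_right_mono)
qed

lemma \<rho>_pos: "\<rho> > 0" using \<rho>_ge N8 by (smt (verit) divide_pos_pos)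

lemma \<rho>_le: "\<rho> \<le> K"
  using max_abs_deriv_le N8 by (simp add: \<rho>_def divide_le_eq)

text \<open>\<open>\<sigma> / \<beta>\<close> is the scaling of the nodes, 4 the step of the
  argument of \<phi> in units of \<open>1 / real N\<close>, and \<open>exp (4 * K)\<close> bounds
  the ratio of \<psi> at adjacent nodes.\<close>

definition C0 :: real where "C0 = 4 * \<sigma> / \<beta> * exp (4 * K)"

lemma C0_pos: "C0 > 0" using \<sigma>_pos \<beta> by (simp add: C0_def)

text \<open>The increment \<open>\<phi> u - \<phi> t = ln (\<psi> t / \<psi> u)\<close> is at most \<open>(\<psi> t - \<psi> u) / \<psi> u\<close>, and \<open>\<psi> t\<close> and \<open>\<psi> u\<close> are
  comparable because \<open>max \<phi>'\<close> is at most \<open>K N\<close>.\<close>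

lemma graded_cell:
  assumes t: "0 \<le> t" "t \<le> u" "u \<le> 1/2" "u - t \<le> 4 / real N" and r: "r > 0"
    and y: "\<sigma> / \<beta> * r * \<phi> t \<le> y"
  shows "(\<sigma> / \<beta> * r * \<phi> u - \<sigma> / \<beta> * r * \<phi> t) / r * exp (- \<beta> * y / (\<sigma> * r)) \<le> C0 * \<rho>"
proof -
  define d where "d = \<phi> u - \<phi> t"
  have d0: "d \<ge> 0" using \<phi>_mono[OF t(1-3)] by (simp add: d_def)
  have "d \<le> K * real N * (u - t)" using \<phi>_increment[OF t(1-3)] by (simp add: d_def)
  also have "\<dots> \<le> K * real N * (4 / real N)" using t(4) K_pos by (intro mult_left_mono) auto
  finally have d4: "d \<le> 4 * K" using N8 by simp
  have M0: "max_abs_deriv \<psi> \<ge> 0" using \<rho>_pos N8 by (simp add: \<rho>_def zero_less_divide_iff)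
  \<comment> \<open>At distance \<open>\<sigma> / \<beta> * r * \<phi> t\<close> from the layer the
    exponential is exactly \<open>\<psi> t\<close>, and it decreases with the distance
    \<open>y\<close>.\<close>
  have "\<phi> t \<le> \<beta> * y / (\<sigma> * r)"
    using y \<sigma>_pos \<beta> r by (simp add: field_simps)
  then have e: "exp (- \<beta> * y / (\<sigma> * r)) \<le> \<psi> t" by (simp add: mesh_characterising_def)
  have "\<psi> t = exp d * \<psi> u" by (simp add: mesh_characterising_def d_def exp_add[symmetric])
  then have 1: "d * \<psi> u \<le> \<psi> t - \<psi> u"
    using exp_ge_add_one_self[of d] mult_right_mono[of "1 + d" "exp d" "\<psi> u"]
    by (simp add: mesh_characterising_def algebra_simps)
  have "d * \<psi> t = exp d * (d * \<psi> u)" using \<open>\<psi> t = exp d * \<psi> u\<close> by simp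
  also have "\<dots> \<le> exp (4 * K) * (max_abs_deriv \<psi> * (u - t))"
    by (rule mult_mono)
      (use 1 \<psi>_decrement[OF t(1-3)] d4 d0 in \<open>auto simp: mesh_characterising_def\<close>)
  also have "\<dots> \<le> exp (4 * K) * (max_abs_deriv \<psi> * (4 / real N))"
    using t(4) M0 by (intro mult_left_mono) auto
  also have "\<dots> = exp (4 * K) * (4 * \<rho>)" by (simp add: \<rho>_def)
  finally have 2: "d * \<psi> t \<le> exp (4 * K) * (4 * \<rho>)" .
  have "(\<sigma> / \<beta> * r * \<phi> u - \<sigma> / \<beta> * r * \<phi> t) / r = \<sigma> / \<beta> * d"
    using r by (simp add: d_def right_diff_distrib[symmetric] del: times_divide_eq_left times_divide_eq_right)
  then have "(\<sigma> / \<beta> * r * \<phi> u - \<sigma> / \<beta> * r * \<phi> t) / r * exp (- \<beta> * y / (\<sigma> * r)) \<le> \<sigma> / \<beta> * d * \<psi> t"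
    using e d0 \<sigma>_pos \<beta> by (simp only:) (intro mult_left_mono, auto)
  also have "\<dots> \<le> \<sigma> / \<beta> * (exp (4 * K) * (4 * \<rho>))"
    unfolding mult.assoc[of "\<sigma> / \<beta>"] using 2 \<sigma>_pos \<beta> by (intro mult_left_mono) auto
  also have "\<dots> = C0 * \<rho>" by (simp add: C0_def)
  finally show ?thesis .
qed

section \<open>Nodes and their symmetry\<close>

lemma node_left_layer: "i \<le> m \<Longrightarrow> x i = \<sigma> / \<beta> * \<epsilon> * \<phi> (4 * real i / real N)"
  by (simp add: node_def left_node_def N_simps)

text \<open>At a transition index the formulas of both adjacent regions give the same node since
  \<open>\<phi> (1/2) = ln (real N)\<close>. Each formula thus holds on a closed range of indices,
  and no cell mixes two of them.\<close>

lemma node_coarse: "m \<le> i \<Longrightarrow> i \<le> 3 * m \<Longrightarrow>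
    x i = lam + (1 - \<nu> - lam) * (real i - real m) / (2 * real m)"
proof (cases "i = m")
  case True
  have "x m = \<sigma> / \<beta> * \<epsilon> * \<phi> (1/2)" using m_pos by (simp add: node_left_layer N_simps)
  then show ?thesis using True by (simp add: \<phi>_half mesh_lambda_def)
next
  case False
  assume "m \<le> i" "i \<le> 3 * m"
  with False show ?thesis by (simp add: node_def left_node_def N_simps)
qed

lemma node_inner: "3 * m \<le> i \<Longrightarrow> i \<le> 4 * m \<Longrightarrow>
    x i = 1 - \<sigma> / \<beta> * s * \<phi> (2 - 4 * real i / real N)"
proof (cases "i = 3 * m")
  case True
  have "x (3 * m) = 1 - \<nu>" using m_pos by (simp add: node_coarse)
  moreover have "2 - 4 * real i / real N = 1/2" using True m_pos by (simp add: N_simps)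
  ultimately show ?thesis using True by (simp only: \<phi>_half) (simp add: mesh_nu_def)
next
  case False
  assume "3 * m \<le> i" "i \<le> 4 * m"
  with False m_pos show ?thesis by (simp add: node_def left_node_def N_simps)
qed

lemma node_0: "x 0 = 0" using node_left_layer[of 0] by (simp add: \<phi>_0)

lemma node_middle: "x (4 * m) = 1"
  using node_inner[of "4 * m"] m_pos by (simp add: N_simps \<phi>_0)

lemma node_reflect: "i \<le> 8 * m \<Longrightarrow> x (8 * m - i) = 2 - x i"
proof -
  assume i: "i \<le> 8 * m"
  consider "i < 4 * m" | "i = 4 * m" | "i > 4 * m" by linarith
  then show ?thesis
  proof cases
    case 2
    then have "8 * m - i = 4 * m" by simp
    then show ?thesis using 2 node_middle by (metis (no_types) diff_add_cancel one_add_one add_diff_cancel)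
  qed (use i in \<open>auto simp: node_def N_simps\<close>)
qed

lemma node_N: "x (8 * m) = 2" using node_reflect[of 0] by (simp add: node_0)

text \<open>The grading condition for a layer of width \<open>r\<close>, with \<open>D\<close> the
  distance to it. The exponential is chosen so that its \<sigma>-th power is the decay
  \<open>exp (- \<beta> * D t / r)\<close> of the layer; powers up to \<sigma> of the condition
  therefore balance powers of the cell length.\<close>

definition resolved :: "real \<Rightarrow> (real \<Rightarrow> real) \<Rightarrow> real \<Rightarrow> real \<Rightarrow> bool" where
  "resolved r D a b \<longleftrightarrow> (\<forall>t\<in>{a..b}. (b - a) / r * exp (- \<beta> * D t / (\<sigma> * r)) \<le> C0 * \<rho>)"

text \<open>Large enough for the three kinds of cells, whose lengths are at most
  \<open>K * H\<close>, \<open>4 * \<rho>\<close> and \<open>H\<close>.\<close>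

definition C1 :: real where "C1 = K + 5"

text \<open>The last conjunct separates the coarse cells, on which every layer component is negligible, from
  the fine ones. The distance \<open>3/4\<close> compensates a negative power of \<open>\<epsilon>\<close> in the derivatives of the
  boundary layer components of \<open>w\<close>.\<close>

definition graded :: "real \<Rightarrow> real \<Rightarrow> bool" where
  "graded a b \<longleftrightarrow> 0 \<le> a \<and> a \<le> b \<and> b \<le> 2 \<and> (b \<le> 1 \<or> 1 \<le> a) \<and> b - a \<le> C1 * R \<and> b - a \<le> 1 \<and>
     ((\<forall>t\<in>{a..b}. lam \<le> t) \<or> resolved \<epsilon> (\<lambda>t. t) a b) \<and>
     ((\<forall>t\<in>{a..b}. lam \<le> 2 - t) \<or> resolved \<epsilon> (\<lambda>t. 2 - t) a b) \<and>
     ((\<forall>t\<in>{a..b}. \<nu> \<le> \<bar>1 - t\<bar>) \<or> resolved s (\<lambda>t. \<bar>1 - t\<bar>) a b) \<and>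
     ((\<forall>t\<in>{a..b}. lam \<le> t \<and> lam \<le> 2 - t \<and> \<nu> \<le> \<bar>1 - t\<bar>) \<or>
      ((\<forall>t\<in>{a..b}. 3/4 \<le> t) \<or> resolved \<epsilon> (\<lambda>t. t) a b) \<and>
      ((\<forall>t\<in>{a..b}. 3/4 \<le> 2 - t) \<or> resolved \<epsilon> (\<lambda>t. 2 - t) a b))"

lemma resolved_reflect:
  "resolved r d a b \<Longrightarrow> (\<And>t. d' t = d (2 - t)) \<Longrightarrow> resolved r d' (2 - b) (2 - a)"
  by (auto simp: resolved_def)

text \<open>Reflection at 1 exchanges the conditions for the two boundary layers and preserves that
  for the inner layer, so only the left half of the mesh has to be examined.\<close>

lemma graded_reflect:
  assumes g: "graded a b" shows "graded (2 - b) (2 - a)"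
proof -
  have r: "resolved \<epsilon> (\<lambda>t. t) a b \<Longrightarrow> resolved \<epsilon> (\<lambda>t. 2 - t) (2 - b) (2 - a)"
    "resolved \<epsilon> (\<lambda>t. 2 - t) a b \<Longrightarrow> resolved \<epsilon> (\<lambda>t. t) (2 - b) (2 - a)"
    "resolved s (\<lambda>t. \<bar>1 - t\<bar>) a b \<Longrightarrow> resolved s (\<lambda>t. \<bar>1 - t\<bar>) (2 - b) (2 - a)"
    by (erule resolved_reflect; simp add: abs_minus_commute)+
  have all: "(\<forall>t\<in>{2 - b..2 - a}. P t) \<longleftrightarrow> (\<forall>t\<in>{a..b}. P (2 - t))" for P :: "real \<Rightarrow> bool"
  proof safe
    fix t assume h: "\<forall>t\<in>{a..b}. P (2 - t)" and t: "t \<in> {2 - b..2 - a}"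
    show "P t" using h[rule_format, of "2 - t"] t by auto
  qed auto
  have ab: "\<bar>1 - (2 - t)\<bar> = \<bar>1 - t\<bar>" for t :: real by linarith
  show ?thesis
    using g r unfolding graded_def all ab by (auto simp: conj_commute)
qed

section \<open>Cell lengths, and grading of all cells\<close>

lemma mesh_width_ge: "finite I \<Longrightarrow> i \<in> I \<Longrightarrow> x i - x (i - 1) \<le> mesh_width x I"
  unfolding mesh_width_def by (intro Max_ge) auto

lemma inner_width: "i \<in> {3 * m + 1..5 * m} \<Longrightarrow> x i - x (i - 1) \<le> H"
  unfolding h_inner_def using mesh_width_ge[of "{3 * m + 1..5 * m}" i] by (simp add: N_simps)

lemma boundary_width: "i \<in> {1..m} \<Longrightarrow> x i - x (i - 1) \<le> K * H"
proof -
  assume i: "i \<in> {1..m}"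
  have "x i - x (i - 1) \<le> h_boundary x N"
    unfolding h_boundary_def by (rule mesh_width_ge) (use i in \<open>simp_all add: N_simps\<close>)
  then show ?thesis using mesh by (simp add: admissible_mesh_def)
qed

lemma H_le: "H \<le> K" 
proof -
  have "H \<le> K * s" using mesh by (simp add: admissible_mesh_def)
  also have "\<dots> \<le> K * 1" using s1 K_pos by (intro mult_left_mono) auto
  finally show ?thesis by simp
qed

lemma cell_mono_left: assumes i: "i \<in> {1..4 * m}" shows "x (i - 1) \<le> x i"
proof -
  have r: "real (i - 1) = real i - 1" using i by (simp add: of_nat_diff)
  consider "i \<le> m" | "m < i" "i \<le> 3 * m" | "3 * m < i" by linarith
  then show ?thesis
  proof cases
    case 1
    have "\<phi> (4 * real (i - 1) / real N) \<le> \<phi> (4 * real i / real N)"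
      using 1 m_pos by (intro \<phi>_mono divide_right_mono) (auto simp: N_simps divide_le_eq)
    then have "\<sigma> / \<beta> * \<epsilon> * \<phi> (4 * real (i - 1) / real N) \<le> \<sigma> / \<beta> * \<epsilon> * \<phi> (4 * real i / real N)"
      using \<sigma>_pos \<beta> \<epsilon> by (intro mult_left_mono) auto
    then show ?thesis using 1 node_left_layer[of i] node_left_layer[of "i - 1"] by simp
  next
    case 2
    have "(1 - \<nu> - lam) * (real (i - 1) - real m) / (2 * real m) \<le> (1 - \<nu> - lam) * (real i - real m) / (2 * real m)"
      using lam_le_\<nu> \<nu>_less m_pos by (intro divide_right_mono mult_left_mono) auto
    then show ?thesis using 2 by (simp add: node_coarse)
  next
    case 3
    have "\<phi> (2 - 4 * real i / real N) \<le> \<phi> (2 - 4 * real (i - 1) / real N)"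
      using 3 i m_pos by (intro \<phi>_mono diff_left_mono divide_right_mono) (auto simp: N_simps field_simps)
    then have "\<sigma> / \<beta> * s * \<phi> (2 - 4 * real i / real N) \<le> \<sigma> / \<beta> * s * \<phi> (2 - 4 * real (i - 1) / real N)"
      using \<sigma>_pos \<beta> s_pos by (intro mult_left_mono) auto
    then show ?thesis using 3 i node_inner[of i] node_inner[of "i - 1"] by simp
  qed
qed

lemma cell_mono: assumes i: "i \<in> {1..8 * m}" shows "x (i - 1) \<le> x i"
proof (cases "i \<le> 4 * m")
  case True then show ?thesis using cell_mono_left[of i] i by simp
next
  case False
  define j where "j = 8 * m + 1 - i"
  have j: "j \<in> {1..4 * m}" "j - 1 = 8 * m - i" "j = 8 * m - (i - 1)" using False i by (auto simp: j_def)
  have "x (j - 1) = 2 - x i" unfolding j(2) using i by (intro node_reflect) auto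
  moreover have "x j = 2 - x (i - 1)" unfolding j(3) using i by (intro node_reflect) auto
  ultimately show ?thesis using cell_mono_left[OF j(1)] by linarith
qed

lemma node_mono: "i \<le> j \<Longrightarrow> j \<le> 8 * m \<Longrightarrow> x i \<le> x j"
  using partition_le[of "8 * m" x i j] cell_mono[of "Suc _"] by simp

lemma H_pos: "H \<ge> 0"
  using inner_width[of "3 * m + 1"] cell_mono[of "3 * m + 1"] m_pos by simp

lemma R_pos: "R > 0" and R_ge_\<rho>: "\<rho> \<le> R" and R_le: "R \<le> 2 * K"
  using H_pos \<rho>_pos \<rho>_le H_le by (auto simp: R_def)

text \<open>Cells at the boundary are resolved on the scale \<epsilon>, cells next to 1 on the scale
  \<open>s\<close>, and the equidistant ones have length at most \<open>4 / real N\<close>. All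
  other conditions hold by distance, as \<open>lam \<le> \<nu> < 1/4\<close>.\<close>

lemma graded_left_cell: assumes i: "i \<in> {1..4 * m}" shows "graded (x (i - 1)) (x i)"
proof -
  have r: "real (i - 1) = real i - 1" using i by (simp add: of_nat_diff)
  have le: "x (i - 1) \<le> x i" by (rule cell_mono_left[OF i])
  have b: "0 \<le> x (i - 1)" "x i \<le> 1"
    using node_mono[of 0 "i - 1"] node_mono[of i "4 * m"] i by (auto simp: node_0 node_middle)
  note ln' = lam_pos lam_le_\<nu> \<nu>_less
  have C1': "K * H \<le> C1 * R" "4 * \<rho> \<le> C1 * R" "H \<le> C1 * R"
    using K_pos H_pos \<rho>_pos by (auto simp: C1_def R_def algebra_simps intro: add_increasing add_increasing2)
  have wd: "4 / real N \<le> 4 * \<rho>" using \<rho>_ge by simp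
  consider "i \<le> m" | "m < i" "i \<le> 3 * m" | "3 * m < i" by linarith
  then show ?thesis
  proof cases
    case 1
    have xm: "x i \<le> lam" using node_mono[of i m] 1 node_coarse[of m] by simp
    have "resolved \<epsilon> (\<lambda>t. t) (x (i - 1)) (x i)"
      unfolding resolved_def
    proof
      fix t assume t: "t \<in> {x (i - 1)..x i}"
      have e: "x (i - 1) = \<sigma> / \<beta> * \<epsilon> * \<phi> (4 * real (i - 1) / real N)" "x i = \<sigma> / \<beta> * \<epsilon> * \<phi> (4 * real i / real N)"
        using 1 node_left_layer[of i] node_left_layer[of "i - 1"] by simp_all
      show "(x i - x (i - 1)) / \<epsilon> * exp (- \<beta> * t / (\<sigma> * \<epsilon>)) \<le> C0 * \<rho>"
        unfolding e
      proof (rule graded_cell)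
        show "4 * real (i - 1) / real N \<le> 4 * real i / real N" by (intro divide_right_mono) auto
        show "4 * real i / real N \<le> 1/2" using 1 m_pos by (simp add: N_simps divide_le_eq)
        show "4 * real i / real N - 4 * real (i - 1) / real N \<le> 4 / real N" unfolding r by (simp add: diff_divide_distrib[symmetric])
        show "\<sigma> / \<beta> * \<epsilon> * \<phi> (4 * real (i - 1) / real N) \<le> t" using t e by simp
      qed (use \<epsilon> in auto)
    qed
    moreover have "x i - x (i - 1) \<le> C1 * R" using boundary_width[of i] 1 i C1' by auto
    moreover have "\<forall>t\<in>{x (i - 1)..x i}. lam \<le> 2 - t" "\<forall>t\<in>{x (i - 1)..x i}. \<nu> \<le> \<bar>1 - t\<bar>" "\<forall>t\<in>{x (i - 1)..x i}. 3/4 \<le> 2 - t"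
      using xm ln' by auto
    ultimately show ?thesis unfolding graded_def using le b by auto
  next
    case 2
    have e: "x (i - 1) = lam + (1 - \<nu> - lam) * (real i - 1 - real m) / (2 * real m)"
      "x i = lam + (1 - \<nu> - lam) * (real i - real m) / (2 * real m)"
      using 2 node_coarse[of i] node_coarse[of "i - 1"] r by auto
    have "x i - x (i - 1) = (1 - \<nu> - lam) / (2 * real m)"
      unfolding e by (simp add: diff_divide_distrib[symmetric] right_diff_distrib[symmetric])
    also have "\<dots> \<le> 1 / (2 * real m)" using ln' by (intro divide_right_mono) auto
    also have "\<dots> = 4 / real N" by (simp add: N_simps)
    finally have w: "x i - x (i - 1) \<le> C1 * R" using wd C1' by linarith
    have "lam \<le> x (i - 1)" "x i \<le> 1 - \<nu>"
      using node_mono[of m "i - 1"] node_mono[of i "3 * m"] 2 node_coarse[of m] node_coarse[of "3 * m"] m_pos by auto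
    then have "\<forall>t\<in>{x (i - 1)..x i}. lam \<le> t \<and> lam \<le> 2 - t \<and> \<nu> \<le> \<bar>1 - t\<bar>" using ln' b by auto
    then show ?thesis unfolding graded_def using le b w by auto
  next
    case 3
    have lo: "1 - \<nu> \<le> x (i - 1)"
      using node_mono[of "3 * m" "i - 1"] 3 i node_coarse[of "3 * m"] m_pos by auto
    have "resolved s (\<lambda>t. \<bar>1 - t\<bar>) (x (i - 1)) (x i)"
      unfolding resolved_def
    proof
      fix t assume t: "t \<in> {x (i - 1)..x i}"
      have e: "x (i - 1) = 1 - \<sigma> / \<beta> * s * \<phi> (2 - 4 * real (i - 1) / real N)" "x i = 1 - \<sigma> / \<beta> * s * \<phi> (2 - 4 * real i / real N)"
        using 3 i node_inner[of i] node_inner[of "i - 1"] by simp_all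
      have "x i - x (i - 1) = \<sigma> / \<beta> * s * \<phi> (2 - 4 * real (i - 1) / real N) - \<sigma> / \<beta> * s * \<phi> (2 - 4 * real i / real N)"
        unfolding e by simp
      moreover have "(\<sigma> / \<beta> * s * \<phi> (2 - 4 * real (i - 1) / real N) - \<sigma> / \<beta> * s * \<phi> (2 - 4 * real i / real N)) / s
        * exp (- \<beta> * \<bar>1 - t\<bar> / (\<sigma> * s)) \<le> C0 * \<rho>"
      proof (rule graded_cell)
        show "0 \<le> 2 - 4 * real i / real N" using i m_pos by (simp add: N_simps divide_le_eq)
        show "2 - 4 * real i / real N \<le> 2 - 4 * real (i - 1) / real N" by (intro diff_left_mono divide_right_mono) auto
        show "2 - 4 * real (i - 1) / real N \<le> 1/2" using 3 i m_pos by (simp add: r N_simps field_simps)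
        show "2 - 4 * real (i - 1) / real N - (2 - 4 * real i / real N) \<le> 4 / real N" unfolding r by (simp add: diff_divide_distrib[symmetric])
        have "t \<le> x i" using t by simp
        then have "1 - x i \<le> \<bar>1 - t\<bar>" by linarith
        then show "\<sigma> / \<beta> * s * \<phi> (2 - 4 * real i / real N) \<le> \<bar>1 - t\<bar>" using e(2) by linarith
      qed (use s_pos in auto)
      ultimately show "(x i - x (i - 1)) / s * exp (- \<beta> * \<bar>1 - t\<bar> / (\<sigma> * s)) \<le> C0 * \<rho>" by simp
    qed
    moreover have "x i - x (i - 1) \<le> C1 * R" using inner_width[of i] 3 i C1' by auto
    moreover have "\<forall>t\<in>{x (i - 1)..x i}. lam \<le> t" "\<forall>t\<in>{x (i - 1)..x i}. lam \<le> 2 - t" "\<forall>t\<in>{x (i - 1)..x i}. 3/4 \<le> t" "\<forall>t\<in>{x (i - 1)..x i}. 3/4 \<le> 2 - t"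
      using lo b ln' by auto
    ultimately show ?thesis unfolding graded_def using le b by auto
  qed
qed

lemma graded_cell_all: assumes i: "i \<in> {1..N}" shows "graded (x (i - 1)) (x i)"
proof (cases "i \<le> 4 * m")
  case True then show ?thesis using graded_left_cell[of i] i by simp
next
  case False
  define j where "j = 8 * m + 1 - i"
  have i8: "1 \<le> i" "i \<le> 8 * m" using i by (auto simp: N_simps)
  then have j: "j \<in> {1..4 * m}" "j - 1 = 8 * m - i" "j = 8 * m - (i - 1)" using False by (auto simp: j_def)
  have "x (j - 1) = 2 - x i" unfolding j(2) using i8 by (intro node_reflect) auto
  moreover have "x j = 2 - x (i - 1)" unfolding j(3) using i8 by (intro node_reflect) auto
  ultimately show ?thesis using graded_reflect[OF graded_left_cell[OF j(1)]] by simp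
qed

end

section \<open>The bilinear form\<close>

lemma L2_young:
  assumes f: "square_integrable a b f" and g: "square_integrable a b g" and \<eta>: "\<eta> > 0"
  shows "\<bar>integral\<^sup>L (Ioo a b) (\<lambda>x. f x * g x)\<bar> \<le> L2_sq a b f / (4 * \<eta>) + \<eta> * L2_sq a b g"
proof -
  have "\<bar>integral\<^sup>L (Ioo a b) (\<lambda>x. f x * g x)\<bar> \<le> integral\<^sup>L (Ioo a b) (\<lambda>x. \<bar>f x * g x\<bar>)"
    by (rule integral_abs_bound)
  also have "\<dots> \<le> integral\<^sup>L (Ioo a b) (\<lambda>x. (f x)\<^sup>2 / (4 * \<eta>) + \<eta> * (g x)\<^sup>2)"
  proof (rule integral_mono_AE)
    show "integrable (Ioo a b) (\<lambda>x. \<bar>f x * g x\<bar>)"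
      using square_integrable_integrable_mult[OF f g] by (rule integrable_abs)
    show "integrable (Ioo a b) (\<lambda>x. (f x)\<^sup>2 / (4 * \<eta>) + \<eta> * (g x)\<^sup>2)"
      using f g by (auto simp: square_integrable_iff)
    show "AE x in Ioo a b. \<bar>f x * g x\<bar> \<le> (f x)\<^sup>2 / (4 * \<eta>) + \<eta> * (g x)\<^sup>2"
    proof (rule AE_I2)
      fix x
      have "0 \<le> (\<bar>f x\<bar> - 2 * \<eta> * \<bar>g x\<bar>)\<^sup>2 / (4 * \<eta>)" using \<eta> by simp
      also have "\<dots> = (f x)\<^sup>2 / (4 * \<eta>) + \<eta> * (g x)\<^sup>2 - \<bar>f x * g x\<bar>"
        using \<eta> by (simp add: power2_diff abs_mult field_simps power2_eq_square)
      finally show "\<bar>f x * g x\<bar> \<le> (f x)\<^sup>2 / (4 * \<eta>) + \<eta> * (g x)\<^sup>2" by simp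
    qed
  qed
  also have "\<dots> = L2_sq a b f / (4 * \<eta>) + \<eta> * L2_sq a b g"
    using f g by (simp add: square_integrable_iff L2_sq_def)
  finally show ?thesis .
qed

lemma L2_sq_mult_le:
  assumes f: "square_integrable a b f" and g: "continuous_on {a..b} g" and B: "\<And>x. a < x \<Longrightarrow> x < b \<Longrightarrow> \<bar>g x\<bar> \<le> B"
  shows "L2_sq a b (\<lambda>x. g x * f x) \<le> B\<^sup>2 * L2_sq a b f"
proof -
  have "L2_sq a b (\<lambda>x. g x * f x) \<le> L2_sq a b (\<lambda>x. B * f x)"
    using f g B
    by (intro L2_sq_mono_AE square_integrable_mult_continuous square_integrable_cmult AE_Ioo_I)
      (auto simp: abs_mult intro!: mult_right_mono intro: order_trans[OF _ abs_ge_self])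
  then show ?thesis by (simp add: L2_sq_cmult)
qed

text \<open>The pointwise bound \<open>B\<close> excludes an infinite essential supremum, which
  \<open>real_of_ereal\<close> would turn into 0.\<close>

lemma Linf_norm_AE:
  assumes g: "g \<in> borel_measurable (Ioo a b)" and B: "\<And>x. a < x \<Longrightarrow> x < b \<Longrightarrow> \<bar>g x\<bar> \<le> B"
  shows "AE x in Ioo a b. \<bar>g x\<bar> \<le> Linf_norm a b g"
proof -
  define e where "e = esssup (Ioo a b) (\<lambda>x. ereal \<bar>g x\<bar>)"
  have "(\<lambda>x. ereal \<bar>g x\<bar>) \<in> borel_measurable (Ioo a b)"
    using g by (intro borel_measurable_ereal borel_measurable_abs)
  then have "e \<le> ereal B"
    unfolding e_def using B by (intro esssup_I AE_Ioo_I) auto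
  have "AE x in Ioo a b. ereal \<bar>g x\<bar> \<le> e" unfolding e_def by (rule esssup_AE)
  then show ?thesis
  proof eventually_elim
    case (elim x)
    then show ?case using \<open>e \<le> ereal B\<close> unfolding Linf_norm_def e_def[symmetric] by (cases e) auto
  qed
qed

lemma L2_sq_shift:
  assumes "continuous_on {0..1} v"
  shows "L2_sq 1 2 (\<lambda>x. v (x - 1)) = L2_sq 0 1 v" and "square_integrable 1 2 (\<lambda>x. v (x - 1))"
proof -
  have c: "continuous_on {1..2} (\<lambda>x. v (x - 1))"
    by (rule continuous_on_compose2[OF assms]) (auto intro!: continuous_intros)
  then show "square_integrable 1 2 (\<lambda>x. v (x - 1))" by (rule square_integrable_continuous)
  have "L2_sq 1 2 (\<lambda>x. v (x - 1)) = integral {1..2} (\<lambda>x. (v (x - 1))\<^sup>2)"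
    unfolding L2_sq_def by (rule integral_Ioo_eq(1)) (intro integrable_Ioo_continuous continuous_intros c)
  also have "\<dots> = integral {1 + -1..2 + -1} (\<lambda>x. (v x)\<^sup>2)"
    using integral_shift[of 1 "-1" 2 "\<lambda>x. (v x)\<^sup>2"] assms by (auto intro!: continuous_intros simp: o_def)
  also have "\<dots> = L2_sq 0 1 v"
    unfolding L2_sq_def
    using integral_Ioo_eq(1)[OF integrable_Ioo_continuous[OF continuous_on_power[OF assms]], of 2] by simp
  finally show "L2_sq 1 2 (\<lambda>x. v (x - 1)) = L2_sq 0 1 v" .
qed

text \<open>Together with \<open>H1_I\<close> this identifies \<open>H1\<close> with the primitives
  of square-integrable functions, \<open>wderiv\<close> being one of the possible
  derivatives.\<close>

lemma H1_D:
  assumes "v \<in> H1 a b" "a < b"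
  shows "L2_primitive a b v (wderiv a b v)"
proof -
  obtain D where "D 0 = v" "has_weak_deriv a b (D 0) (D (Suc 0))"
    using assms by (auto simp: H1_def sobolev_def)
  then have "has_weak_deriv a b v (wderiv a b v)" using has_weak_deriv_wderiv by metis
  then show ?thesis using assms by (intro has_weak_deriv_imp_primitive) (auto simp: H1_def)
qed

lemma H1_I:
  assumes "L2_primitive a b v g" "a < b"
  shows "v \<in> H1 a b"
proof -
  have c: "continuous_on {a..b} v" by (rule L2_primitive_continuous[OF assms(1)])
  have w: "has_weak_deriv a b v g" by (rule L2_primitive_imp_weak_deriv[OF assms(2,1)])
  have "sobolev 1 a b v"
    unfolding sobolev_def using w square_integrable_continuous[OF c]
    by (intro conjI exI[of _ "\<lambda>j. if j = 0 then v else g"]) auto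
  then show ?thesis using c by (simp add: H1_def)
qed

lemma wderiv_primitive_AE_eq:
  "a < b \<Longrightarrow> L2_primitive a b v g \<Longrightarrow> AE x in Ioo a b. wderiv a b v x = g x"
  by (intro wderiv_AE_eq L2_primitive_imp_weak_deriv)

lemma integral_mult_diff:
  assumes "square_integrable a b f" "square_integrable a b g" "square_integrable a b h"
  shows "integral\<^sup>L (Ioo a b) (\<lambda>x. (f x - g x) * h x) =
    integral\<^sup>L (Ioo a b) (\<lambda>x. f x * h x) - integral\<^sup>L (Ioo a b) (\<lambda>x. g x * h x)"
  using square_integrable_integrable_mult[OF assms(1,3)] square_integrable_integrable_mult[OF assms(2,3)]
  by (simp add: left_diff_distrib)

lemma piecewise_poly_deriv:
  fixes v :: "real \<Rightarrow> real"
  assumes "x (i - 1) < t" "t < x i" "\<And>t. t \<in> {x (i - 1)..x i} \<Longrightarrow> v t = poly p t"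
  shows "deriv v t = poly (pderiv p) t"
proof -
  have "(v has_real_derivative poly (pderiv p) t) (at t)"
    by (rule has_field_derivative_transform_within_open[OF poly_DERIV, of "{x (i - 1)<..<x i}"]) (use assms in auto)
  then show ?thesis by (rule DERIV_imp_deriv)
qed

text \<open>Inside a cell \<open>deriv v\<close> is the derivative of the polynomial, and the nodes
  are a null set. The closed cells share their end points, so the pieces can be glued.\<close>

lemma piecewise_poly_primitive:
  assumes v: "piecewise_poly x N q v" and mono: "\<And>i. i \<in> {1..N} \<Longrightarrow> x (i - 1) \<le> x i"
  shows "n \<le> N \<Longrightarrow> L2_primitive (x 0) (x n) v (deriv v)"
proof (induction n)
  case 0
  have "{x 0<..<x 0} = {}" by simp
  then have "square_integrable (x 0) (x 0) (deriv v)" by (simp add: square_integrable_def set_borel_measurable_def)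
  then show ?case by (intro L2_primitive_I[where k="v (x 0)"]) auto
next
  case (Suc n)
  obtain p where p: "\<forall>t\<in>{x n..x (Suc n)}. v t = poly p t"
    using v Suc.prems unfolding piecewise_poly_def by (metis Suc_le_mono Suc_pred' atLeastAtMost_iff diff_Suc_1 le0 One_nat_def)
  have le: "x n \<le> x (Suc n)" using mono[of "Suc n"] Suc.prems by simp
  have le0: "x 0 \<le> x n"
    using partition_le[of N x 0 n] mono[of "Suc _"] Suc.prems by simp
  have d: "deriv v t = poly (pderiv p) t" if "x n < t" "t < x (Suc n)" for t
    using piecewise_poly_deriv[of x "Suc n" t v p] that p by simp
  have "L2_primitive (x n) (x (Suc n)) (poly p) (deriv v)"
    using d by (intro L2_primitive_cong_AE[OF poly_primitive[OF le]] AE_Ioo_I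
        square_integrable_cong[OF poly_square_integrable[of _ _ "pderiv p"]]) auto
  then have "L2_primitive (x n) (x (Suc n)) v (deriv v)"
    by (rule L2_primitive_cong) (use p in auto)
  then show ?case by (rule L2_primitive_combine[OF Suc.IH[OF Suc_leD[OF Suc.prems]] _ le0 le])
qed

lemma integral_Ioo_cells:
  fixes f :: "real \<Rightarrow> real" and x :: "nat \<Rightarrow> real"
  assumes "integrable (Ioo (x 0) (x N)) f" and mono: "\<And>i. i \<in> {1..N} \<Longrightarrow> x (i - 1) \<le> x i"
  shows "integral\<^sup>L (Ioo (x 0) (x N)) f = (\<Sum>i\<in>{1..N}. integral\<^sup>L (Ioo (x (i - 1)) (x i)) f)"
proof -
  have "integral\<^sup>L (Ioo (x 0) (x N)) f = (\<Sum>i<N. integral\<^sup>L (Ioo (x i) (x (Suc i))) f)"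
    by (rule integral_Ioo_partition[OF assms(1)]) (use mono[of "Suc _"] in simp)
  also have "\<dots> = (\<Sum>i\<in>{1..N}. integral\<^sup>L (Ioo (x (i - 1)) (x i)) f)"
    by (rule sum.reindex_bij_witness[of _ "\<lambda>i. i - 1" Suc]) auto
  finally show ?thesis .
qed

lemma L2_sq_cells:
  fixes f :: "real \<Rightarrow> real" and x :: "nat \<Rightarrow> real"
  assumes "square_integrable (x 0) (x N) f" and "\<And>i. i \<in> {1..N} \<Longrightarrow> x (i - 1) \<le> x i"
  shows "L2_sq (x 0) (x N) f = (\<Sum>i\<in>{1..N}. L2_sq (x (i - 1)) (x i) f)"
  unfolding L2_sq_def using assms by (intro integral_Ioo_cells) (auto simp: square_integrable_iff)

definition triple_sq :: "real \<Rightarrow> real \<Rightarrow> (real \<Rightarrow> real) \<Rightarrow> (real \<Rightarrow> real) \<Rightarrow> (real \<Rightarrow> real) \<Rightarrow> real" where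
  "triple_sq \<beta> \<delta> y y' z = L2_sq 0 2 z + \<beta>\<^sup>2 / 2 * L2_sq 0 2 y' + \<delta> * L2_sq 0 2 y"

lemma triple_norm_eq:
  assumes "L2_primitive 0 2 y y'"
  shows "triple_norm \<beta> \<delta> (y, z) = sqrt (triple_sq \<beta> \<delta> y y' z)"
proof -
  have "L2_sq 0 2 (wderiv 0 2 y) = L2_sq 0 2 y'"
    using wderiv_primitive_AE_eq[OF _ assms] H1_D[OF H1_I[OF assms]]
    by (intro L2_sq_cong_AE L2_primitive_square_integrable[OF assms]) (auto intro: L2_primitive_square_integrable)
  then show ?thesis by (simp add: triple_norm_def triple_sq_def L2_norm_power2)
qed

text \<open>\<open>L\<close> bounds all coefficients at once. Two derivatives of \<open>b\<close>
  are kept because the term with the first one is integrated by parts in the error estimate;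
  \<open>b1\<close> is one-sided at 0 and 2 and agrees with \<open>deriv b\<close> in
  between.\<close>

locale delay_form =
  fixes \<beta> \<delta> L :: real and b c d b1 b2 :: "real \<Rightarrow> real"
  assumes \<beta>: "\<beta> > 0" and \<delta>: "\<delta> > 0" and L: "L \<ge> 0"
    and b1: "\<And>x. x \<in> {0..2} \<Longrightarrow> (b has_real_derivative b1 x) (at x within {0..2})"
    and b2: "\<And>x. x \<in> {0..2} \<Longrightarrow> (b1 has_real_derivative b2 x) (at x within {0..2})"
    and cont: "continuous_on {0..2} b2" "continuous_on {0..2} c" "continuous_on {0..2} d"
    and bound: "\<And>x. x \<in> {0..2} \<Longrightarrow> \<bar>b1 x\<bar> \<le> L" "\<And>x. x \<in> {0..2} \<Longrightarrow> \<bar>b2 x\<bar> \<le> L"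
      "\<And>x. x \<in> {0..2} \<Longrightarrow> \<bar>c x\<bar> \<le> L" "\<And>x. x \<in> {0..2} \<Longrightarrow> \<bar>d x\<bar> \<le> L"
    and b_ge: "\<And>x. x \<in> {0<..<2} \<Longrightarrow> b x \<ge> \<beta>\<^sup>2"
    and c_ge: "\<And>x. x \<in> {0<..<2} \<Longrightarrow> c x - Linf_norm 1 2 d / 2 - (Linf_norm 0 2 (deriv b))\<^sup>2 / (2 * \<beta>\<^sup>2) \<ge> \<delta>"
begin

lemma cont_b: "continuous_on {0..2} b" and cont_b1: "continuous_on {0..2} b1"
  by (meson b1 b2 DERIV_continuous continuous_on_eq_continuous_within)+

lemma deriv_b: "0 < x \<Longrightarrow> x < 2 \<Longrightarrow> deriv b x = b1 x"
  using b1[of x] by (intro DERIV_imp_deriv) (simp add: at_within_Icc_at)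

text \<open>The bilinear form with the derivatives as separate arguments, so that it can be
  evaluated with any of their representatives.\<close>

definition F where
  "F \<epsilon> u u' w w' y y' z z' =
     - \<epsilon> * integral\<^sup>L (Ioo 0 2) (\<lambda>x. w' x * y' x)
     + integral\<^sup>L (Ioo 0 2) (\<lambda>x. b x * u' x * y' x)
     + integral\<^sup>L (Ioo 0 2) (\<lambda>x. b1 x * u' x * y x)
     + integral\<^sup>L (Ioo 0 2) (\<lambda>x. c x * u x * y x)
     + integral\<^sup>L (Ioo 1 2) (\<lambda>x. d x * u (x - 1) * y x)
     + \<epsilon> * integral\<^sup>L (Ioo 0 2) (\<lambda>x. u' x * z' x)
     + integral\<^sup>L (Ioo 0 2) (\<lambda>x. w x * z x)" for \<epsilon> :: real and u u' w w' y y' z z' :: "real \<Rightarrow> real"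

lemma form_B_eq:
  assumes u: "L2_primitive 0 2 u u'" and w: "L2_primitive 0 2 w w'"
    and y: "L2_primitive 0 2 y y'" and z: "L2_primitive 0 2 z z'"
  shows "form_B \<epsilon> b c d (u, w) (y, z) = F \<epsilon> u u' w w' y y' z z'"
proof -
  have ae: "AE x in Ioo 0 2. wderiv 0 2 u x = u' x" "AE x in Ioo 0 2. wderiv 0 2 w x = w' x"
    "AE x in Ioo 0 2. wderiv 0 2 y x = y' x" "AE x in Ioo 0 2. wderiv 0 2 z x = z' x"
    by (intro wderiv_primitive_AE_eq assms; simp)+
  have si: "square_integrable 0 2 u'" "square_integrable 0 2 w'" "square_integrable 0 2 y'" "square_integrable 0 2 z'"
    "square_integrable 0 2 (wderiv 0 2 u)" "square_integrable 0 2 (wderiv 0 2 w)" "square_integrable 0 2 (wderiv 0 2 y)" "square_integrable 0 2 (wderiv 0 2 z)"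
    using assms H1_D[OF H1_I, OF _ _ zero_less_numeral] by (auto intro: L2_primitive_square_integrable)
  note m = si[THEN square_integrable_measurable]
    square_integrable_measurable[OF square_integrable_continuous[OF L2_primitive_continuous[OF y]]]
  have mb: "b \<in> borel_measurable (Ioo 0 2)" "b1 \<in> borel_measurable (Ioo 0 2)"
    by (intro square_integrable_measurable square_integrable_continuous cont_b cont_b1)+
  have db: "deriv b \<in> borel_measurable (Ioo 0 2)"
    using mb(2) deriv_b by (subst measurable_cong[of _ _ b1]) auto
  have e1: "integral\<^sup>L (Ioo 0 2) (\<lambda>x. wderiv 0 2 w x * wderiv 0 2 y x) = integral\<^sup>L (Ioo 0 2) (\<lambda>x. w' x * y' x)"
    by (rule integral_Ioo_cong_AE; (intro borel_measurable_times m)?; use ae(2,3) in \<open>eventually_elim, simp\<close>)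
  have e2: "integral\<^sup>L (Ioo 0 2) (\<lambda>x. b x * wderiv 0 2 u x * wderiv 0 2 y x) = integral\<^sup>L (Ioo 0 2) (\<lambda>x. b x * u' x * y' x)"
    by (rule integral_Ioo_cong_AE; (intro borel_measurable_times m mb)?; use ae(1,3) in \<open>eventually_elim, simp\<close>)
  have "AE x in Ioo 0 2. deriv b x = b1 x" by (rule AE_Ioo_I) (rule deriv_b)
  then have "AE x in Ioo 0 2. deriv b x * wderiv 0 2 u x * y x = b1 x * u' x * y x"
    using ae(1) by eventually_elim simp
  then have e3: "integral\<^sup>L (Ioo 0 2) (\<lambda>x. deriv b x * wderiv 0 2 u x * y x) = integral\<^sup>L (Ioo 0 2) (\<lambda>x. b1 x * u' x * y x)"
    by (intro integral_Ioo_cong_AE borel_measurable_times m mb db) auto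
  have e4: "integral\<^sup>L (Ioo 0 2) (\<lambda>x. wderiv 0 2 u x * wderiv 0 2 z x) = integral\<^sup>L (Ioo 0 2) (\<lambda>x. u' x * z' x)"
    by (rule integral_Ioo_cong_AE; (intro borel_measurable_times m)?; use ae(1,4) in \<open>eventually_elim, simp\<close>)
  show ?thesis
    by (simp add: form_B_def F_def L2_inner_eq e1 e2 e3 e4)
qed

lemma F_diff:
  assumes u: "L2_primitive 0 2 u u'" and w: "L2_primitive 0 2 w w'"
    and v: "L2_primitive 0 2 v v'" and r: "L2_primitive 0 2 r r'"
    and y: "L2_primitive 0 2 y y'" and z: "L2_primitive 0 2 z z'"
  shows "F \<epsilon> (\<lambda>x. u x - v x) (\<lambda>x. u' x - v' x) (\<lambda>x. w x - r x) (\<lambda>x. w' x - r' x) y y' z z' =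
    F \<epsilon> u u' w w' y y' z z' - F \<epsilon> v v' r r' y y' z z'"
proof -
  note s' = assms[THEN L2_primitive_square_integrable]
  note cc = assms[THEN L2_primitive_continuous]
  note s = cc[THEN square_integrable_continuous]
  have sh: "square_integrable 1 2 (\<lambda>x. u (x - 1))" "square_integrable 1 2 (\<lambda>x. v (x - 1))"
    by (rule L2_sq_shift(2), rule continuous_on_subset[OF cc(1)], simp, rule L2_sq_shift(2), rule continuous_on_subset[OF cc(3)], simp)
  have y12: "square_integrable 1 2 y" by (rule square_integrable_subset[OF s(5)]) auto
  have d12: "continuous_on {1..2} d" by (rule continuous_on_subset[OF cont(3)]) auto
  show ?thesis
    unfolding F_def right_diff_distrib
    by (subst integral_mult_diff; (intro s s' square_integrable_mult_continuous sh y12 cont cont_b cont_b1 d12)?)+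
       (simp add: algebra_simps)
qed

text \<open>The assumption on \<open>c\<close> is made for this estimate: it subtracts exactly what
  the terms with \<open>deriv b\<close> and with the delay cost.\<close>

lemma F_coercive:
  assumes y: "L2_primitive 0 2 y y'" and z: "L2_primitive 0 2 z z'"
  shows "triple_sq \<beta> \<delta> y y' z \<le> F \<epsilon> y y' z z' y y' z z'"
proof -
  define B where "B = Linf_norm 0 2 (deriv b)"
  define D where "D = Linf_norm 1 2 d"
  note s' = L2_primitive_square_integrable[OF y] L2_primitive_square_integrable[OF z]
  note cy = L2_primitive_continuous[OF y] and cz = L2_primitive_continuous[OF z]
  have sy: "square_integrable 0 2 y" by (rule square_integrable_continuous[OF cy])
  have y12: "square_integrable 1 2 y" by (rule square_integrable_subset[OF sy]) auto
  have d12: "continuous_on {1..2} d" by (rule continuous_on_subset[OF cont(3)]) auto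
  have c01: "continuous_on {0..1} y" by (rule continuous_on_subset[OF cy]) auto
  note sh = L2_sq_shift[OF c01]
  have "AE x in Ioo 0 2. \<bar>deriv b x\<bar> \<le> B"
    unfolding B_def
  proof (rule Linf_norm_AE)
    have "b1 \<in> borel_measurable (Ioo 0 2)"
      by (intro borel_measurable_Ioo_continuous continuous_on_subset[OF cont_b1]) auto
    then show "deriv b \<in> borel_measurable (Ioo 0 2)" using deriv_b by (subst measurable_cong[of _ _ b1]) auto
    show "\<bar>deriv b x\<bar> \<le> L" if "0 < x" "x < 2" for x using deriv_b[OF that] bound(1)[of x] that by simp
  qed
  moreover have "AE x in Ioo 0 2. deriv b x = b1 x" by (rule AE_Ioo_I) (rule deriv_b)
  ultimately have aeb: "AE x in Ioo 0 2. \<bar>b1 x\<bar> \<le> B" by eventually_elim simp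
  have aed: "AE x in Ioo 1 2. \<bar>d x\<bar> \<le> D"
    unfolding D_def using bound(4)
    by (intro Linf_norm_AE[where B=L] borel_measurable_Ioo_continuous continuous_on_subset[OF cont(3)]) auto
  have i1: "integrable (Ioo 0 2) (\<lambda>x. b x * y' x * y' x)" "integrable (Ioo 0 2) (\<lambda>x. b1 x * y' x * y x)"
    "integrable (Ioo 0 2) (\<lambda>x. c x * y x * y x)"
    by (intro square_integrable_integrable_mult square_integrable_mult_continuous s' sy cont cont_b cont_b1)+
  have i2: "integrable (Ioo 1 2) (\<lambda>x. d x * y (x - 1) * y x)"
    by (intro square_integrable_integrable_mult square_integrable_mult_continuous sh y12 d12)
  have i3: "integrable (Ioo 0 2) (\<lambda>x. (y' x)\<^sup>2)" "integrable (Ioo 0 2) (\<lambda>x. (y x)\<^sup>2)"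
    "integrable (Ioo 1 2) (\<lambda>x. (y x)\<^sup>2)" "integrable (Ioo 1 2) (\<lambda>x. (y (x - 1))\<^sup>2)"
    using s' sy y12 sh by (auto simp: square_integrable_iff)
  have "\<beta>\<^sup>2 / 2 * L2_sq 0 2 y' + (\<delta> + D / 2) * L2_sq 0 2 y
      = integral\<^sup>L (Ioo 0 2) (\<lambda>x. \<beta>\<^sup>2 / 2 * (y' x)\<^sup>2 + (\<delta> + D / 2) * (y x)\<^sup>2)"
    using i3 by (simp add: L2_sq_def)
  also have "\<dots> \<le> integral\<^sup>L (Ioo 0 2) (\<lambda>x. b x * y' x * y' x + b1 x * y' x * y x + c x * y x * y x)"
  proof (rule integral_mono_AE)
    show "integrable (Ioo 0 2) (\<lambda>x. \<beta>\<^sup>2 / 2 * (y' x)\<^sup>2 + (\<delta> + D / 2) * (y x)\<^sup>2)" using i3 by auto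
    show "integrable (Ioo 0 2) (\<lambda>x. b x * y' x * y' x + b1 x * y' x * y x + c x * y x * y x)" using i1 by auto
    have "AE x in Ioo 0 2. 0 < x \<and> x < 2" by (rule AE_Ioo_I) simp
    then show "AE x in Ioo 0 2. \<beta>\<^sup>2 / 2 * (y' x)\<^sup>2 + (\<delta> + D / 2) * (y x)\<^sup>2 \<le> b x * y' x * y' x + b1 x * y' x * y x + c x * y x * y x"
      using aeb
    proof eventually_elim
      case (elim x)
      \<comment> \<open>Young's inequality with the weights that charge
        \<open>\<beta>\<^sup>2 / 2\<close> to the derivative, half of what \<open>b\<close>
        provides; the other half remains in the norm.\<close>
      have "0 \<le> (\<beta> * \<bar>y' x\<bar> - B / \<beta> * \<bar>y x\<bar>)\<^sup>2 / 2" by simp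
      also have "\<dots> = \<beta>\<^sup>2 / 2 * (y' x)\<^sup>2 + B\<^sup>2 / (2 * \<beta>\<^sup>2) * (y x)\<^sup>2 - B * (\<bar>y' x\<bar> * \<bar>y x\<bar>)"
        using \<beta> by (simp add: power2_diff power_mult_distrib power_divide field_simps) (simp add: power2_eq_square)
      finally have 1: "B * (\<bar>y' x\<bar> * \<bar>y x\<bar>) \<le> \<beta>\<^sup>2 / 2 * (y' x)\<^sup>2 + B\<^sup>2 / (2 * \<beta>\<^sup>2) * (y x)\<^sup>2" by simp
      have "\<bar>b1 x * y' x * y x\<bar> \<le> B * (\<bar>y' x\<bar> * \<bar>y x\<bar>)"
        using elim by (simp add: abs_mult mult.assoc mult_right_mono)
      then have 2: "- (b1 x * y' x * y x) \<le> B * (\<bar>y' x\<bar> * \<bar>y x\<bar>)" by linarith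
      have 3: "\<beta>\<^sup>2 * (y' x)\<^sup>2 \<le> b x * (y' x)\<^sup>2" using b_ge[of x] elim by (intro mult_right_mono) auto
      have "(\<delta> + D / 2 + B\<^sup>2 / (2 * \<beta>\<^sup>2)) * (y x)\<^sup>2 \<le> c x * (y x)\<^sup>2"
        using c_ge[of x] elim by (intro mult_right_mono) (auto simp: B_def D_def)
      then have 4: "(\<delta> + D / 2) * (y x)\<^sup>2 + B\<^sup>2 / (2 * \<beta>\<^sup>2) * (y x)\<^sup>2 \<le> c x * (y x)\<^sup>2" by (simp add: distrib_right)
      have 5: "b x * y' x * y' x = b x * (y' x)\<^sup>2" "c x * y x * y x = c x * (y x)\<^sup>2"
        by (simp_all add: power2_eq_square)
      have "\<beta>\<^sup>2 * (y' x)\<^sup>2 = \<beta>\<^sup>2 / 2 * (y' x)\<^sup>2 + \<beta>\<^sup>2 / 2 * (y' x)\<^sup>2" by simp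
      then show ?case using 1 2 3 4 unfolding 5 by linarith
    qed
  qed
  also have "\<dots> = integral\<^sup>L (Ioo 0 2) (\<lambda>x. b x * y' x * y' x) + integral\<^sup>L (Ioo 0 2) (\<lambda>x. b1 x * y' x * y x)
     + integral\<^sup>L (Ioo 0 2) (\<lambda>x. c x * y x * y x)" using i1 by simp
  finally have M: "\<beta>\<^sup>2 / 2 * L2_sq 0 2 y' + (\<delta> + D / 2) * L2_sq 0 2 y \<le> \<dots>" .
  have "- integral\<^sup>L (Ioo 1 2) (\<lambda>x. d x * y (x - 1) * y x) = integral\<^sup>L (Ioo 1 2) (\<lambda>x. - (d x * y (x - 1) * y x))" by simp
  also have "\<dots> \<le> integral\<^sup>L (Ioo 1 2) (\<lambda>x. D / 2 * (y (x - 1))\<^sup>2 + D / 2 * (y x)\<^sup>2)"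
  proof (rule integral_mono_AE)
    show "integrable (Ioo 1 2) (\<lambda>x. - (d x * y (x - 1) * y x))" using i2 by auto
    show "integrable (Ioo 1 2) (\<lambda>x. D / 2 * (y (x - 1))\<^sup>2 + D / 2 * (y x)\<^sup>2)" using i3 by auto
    show "AE x in Ioo 1 2. - (d x * y (x - 1) * y x) \<le> D / 2 * (y (x - 1))\<^sup>2 + D / 2 * (y x)\<^sup>2"
      using aed
    proof eventually_elim
      case (elim x)
      have "- (d x * y (x - 1) * y x) \<le> \<bar>d x * y (x - 1) * y x\<bar>" by simp
      also have "\<dots> = \<bar>d x\<bar> * (\<bar>y (x - 1)\<bar> * \<bar>y x\<bar>)" by (simp add: abs_mult)
      also have "\<dots> \<le> D * (\<bar>y (x - 1)\<bar> * \<bar>y x\<bar>)" using elim by (intro mult_right_mono) auto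
      also have "\<dots> \<le> D * (((y (x - 1))\<^sup>2 + (y x)\<^sup>2) / 2)"
        using elim sum_squares_bound[of "\<bar>y (x - 1)\<bar>" "\<bar>y x\<bar>"] by (intro mult_left_mono) auto
      finally show ?case by (simp add: algebra_simps)
    qed
  qed
  also have "\<dots> = D / 2 * (L2_sq 1 2 (\<lambda>x. y (x - 1)) + L2_sq 1 2 y)"
    using i3 by (simp add: L2_sq_def algebra_simps)
  \<comment> \<open>The delayed part is the norm over \<open>(0,1)\<close>. The two halves make up
    one full norm, so the delay costs only \<open>D / 2\<close>.\<close>
  also have "L2_sq 1 2 (\<lambda>x. y (x - 1)) + L2_sq 1 2 y = L2_sq 0 2 y"
    using L2_sq_combine[OF sy, of 1] sh by simp
  finally have N: "- integral\<^sup>L (Ioo 1 2) (\<lambda>x. d x * y (x - 1) * y x) \<le> D / 2 * L2_sq 0 2 y" .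
  \<comment> \<open>The two terms with the factor \<epsilon> differ only in sign and cancel.\<close>
  have "F \<epsilon> y y' z z' y y' z z' = integral\<^sup>L (Ioo 0 2) (\<lambda>x. b x * y' x * y' x) + integral\<^sup>L (Ioo 0 2) (\<lambda>x. b1 x * y' x * y x)
     + integral\<^sup>L (Ioo 0 2) (\<lambda>x. c x * y x * y x) + integral\<^sup>L (Ioo 1 2) (\<lambda>x. d x * y (x - 1) * y x) + L2_sq 0 2 z"
    by (simp add: F_def L2_sq_def power2_eq_square mult.commute[of "z' _"])
  then show ?thesis using M N by (simp add: triple_sq_def distrib_right)
qed

end

section \<open>Reduction to the interpolation error\<close>

lemma interpolant_cell:
  assumes g: "is_interpolant x N q v g" and i: "i \<in> {1..N}" and le: "x (i - 1) \<le> x i"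
  obtains p where "cell_interpolant (x (i - 1)) (x i) q v p" "\<And>t. t \<in> {x (i - 1)..x i} \<Longrightarrow> g t = poly p t"
proof -
  obtain p where p: "degree p \<le> q" "\<And>t. t \<in> {x (i - 1)..x i} \<Longrightarrow> g t = poly p t"
    using g i unfolding is_interpolant_def piecewise_poly_def by blast
  have e: "g (x (i - 1)) - v (x (i - 1)) = 0" "g (x i) - v (x i) = 0"
    and m: "\<And>\<xi>. degree \<xi> \<le> q - 2 \<Longrightarrow> L2_inner (x (i - 1)) (x i) (\<lambda>t. g t - v t) (poly \<xi>) = 0"
    using g i unfolding is_interpolant_def by blast+
  have "L2_inner (x (i - 1)) (x i) (\<lambda>t. g t - v t) (poly \<xi>)
    = integral\<^sup>L (Ioo (x (i - 1)) (x i)) (\<lambda>t. (poly p t - v t) * poly \<xi> t)" for \<xi>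
    unfolding L2_inner_eq using p(2) by (intro Bochner_Integration.integral_cong) auto
  then have "cell_interpolant (x (i - 1)) (x i) q v p"
    unfolding cell_interpolant_def using p e m le by auto
  then show thesis using that p(2) by blast
qed

locale interpolation_error =
  fixes x :: "nat \<Rightarrow> real" and N q :: nat and v v' g :: "real \<Rightarrow> real"
  assumes x0: "x 0 = 0" and xN: "x N = 2" and mono: "\<And>i. i \<in> {1..N} \<Longrightarrow> x (i - 1) \<le> x i"
    and v: "L2_primitive 0 2 v v'" and g: "is_interpolant x N q v g"
begin

lemma node_bounds: assumes "i \<le> N" shows "0 \<le> x i" "x i \<le> 2"
  using partition_le[of N x 0 i] partition_le[of N x i N] mono[of "Suc _"] assms x0 xN by auto

lemma interpolant_primitive: "L2_primitive 0 2 g (deriv g)"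
  using piecewise_poly_primitive[of x N q g N] g mono x0 xN by (simp add: is_interpolant_def)

lemma error_primitive: "L2_primitive 0 2 (\<lambda>t. g t - v t) (\<lambda>t. deriv g t - v' t)"
  by (rule L2_primitive_minus[OF interpolant_primitive v])

lemma v_cell: assumes "i \<in> {1..N}" shows "L2_primitive (x (i - 1)) (x i) v v'"
  using node_bounds[of "i - 1"] node_bounds[of i] assms by (intro L2_primitive_subset[OF v]) auto

lemma error_node:
  assumes N: "N > 0" and i: "i \<le> N"
  shows "g (x i) - v (x i) = 0"
proof (cases "i = 0")
  case True
  have "1 \<in> {1..N}" using N by simp
  then have "g (x (1 - 1)) - v (x (1 - 1)) = 0" using g unfolding is_interpolant_def by blast
  then show ?thesis using True by simp
next
  case False
  then have "i \<in> {1..N}" using i by simp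
  then show ?thesis using g unfolding is_interpolant_def by blast
qed

lemma error_deriv_cell:
  assumes "\<And>t. t \<in> {x (i - 1)..x i} \<Longrightarrow> g t = poly p t" "x (i - 1) < t" "t < x i"
  shows "deriv g t = poly (pderiv p) t"
  using piecewise_poly_deriv[OF assms(2,3)] assms(1) by blast

lemma error_deriv_orthogonal:
  assumes i: "i \<in> {1..N}" and \<xi>: "degree \<xi> \<le> q - 1"
  shows "integral\<^sup>L (Ioo (x (i - 1)) (x i)) (\<lambda>t. (deriv g t - v' t) * poly \<xi> t) = 0"
proof -
  obtain p where p: "cell_interpolant (x (i - 1)) (x i) q v p" "\<And>t. t \<in> {x (i - 1)..x i} \<Longrightarrow> g t = poly p t"
    using interpolant_cell[OF g i mono[OF i]] by metis
  have "integral\<^sup>L (Ioo (x (i - 1)) (x i)) (\<lambda>t. (deriv g t - v' t) * poly \<xi> t)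
    = integral\<^sup>L (Ioo (x (i - 1)) (x i)) (\<lambda>t. (poly (pderiv p) t - v' t) * poly \<xi> t)"
    using error_deriv_cell[OF p(2)] by (intro Bochner_Integration.integral_cong) auto
  then show ?thesis using cell_interpolant_deriv_orthogonal[OF mono[OF i] p(1) v_cell[OF i] \<xi>] by simp
qed

lemma error_best_approx:
  assumes i: "i \<in> {1..N}" and \<xi>: "degree \<xi> \<le> q - 1"
  shows "L2_sq (x (i - 1)) (x i) (\<lambda>t. deriv g t - v' t) \<le> L2_sq (x (i - 1)) (x i) (\<lambda>t. v' t - poly \<xi> t)"
proof -
  obtain p where p: "cell_interpolant (x (i - 1)) (x i) q v p" "\<And>t. t \<in> {x (i - 1)..x i} \<Longrightarrow> g t = poly p t"
    using interpolant_cell[OF g i mono[OF i]] by metis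
  have "L2_sq (x (i - 1)) (x i) (\<lambda>t. deriv g t - v' t) = L2_sq (x (i - 1)) (x i) (\<lambda>t. poly (pderiv p) t - v' t)"
    using error_deriv_cell[OF p(2)] by (intro L2_sq_cong) auto
  then show ?thesis using cell_interpolant_best_approx[OF mono[OF i] p(1) v_cell[OF i] \<xi>] by simp
qed

lemma error_poincare:
  assumes i: "i \<in> {1..N}"
  shows "L2_sq (x (i - 1)) (x i) (\<lambda>t. g t - v t) \<le> (x i - x (i - 1))\<^sup>2 * L2_sq (x (i - 1)) (x i) (\<lambda>t. deriv g t - v' t)"
proof (rule L2_poincare[OF mono[OF i]])
  show "L2_primitive (x (i - 1)) (x i) (\<lambda>t. g t - v t) (\<lambda>t. deriv g t - v' t)"
    using node_bounds[of "i - 1"] node_bounds[of i] i by (intro L2_primitive_subset[OF error_primitive]) auto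
  have "N > 0" "i - 1 \<le> N" using i by auto
  then show "g (x (i - 1)) - v (x (i - 1)) = 0" by (rule error_node)
qed

lemma error_sup_stability:
  assumes C: "\<forall>a b v p P M. a < b \<longrightarrow> continuous_on {a..b} v \<longrightarrow> cell_interpolant a b q v p \<longrightarrow> degree P \<le> q \<longrightarrow>
     (\<forall>x\<in>{a..b}. \<bar>v x - poly P x\<bar> \<le> M) \<longrightarrow> L2_sq a b (\<lambda>t. poly p t - v t) \<le> C * (b - a) * M\<^sup>2"
    and i: "i \<in> {1..N}" and P: "degree P \<le> q" and M: "\<And>t. t \<in> {x (i - 1)..x i} \<Longrightarrow> \<bar>v t - poly P t\<bar> \<le> M"
  shows "L2_sq (x (i - 1)) (x i) (\<lambda>t. g t - v t) \<le> C * (x i - x (i - 1)) * M\<^sup>2"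
proof (cases "x (i - 1) < x i")
  case True
  obtain p where p: "cell_interpolant (x (i - 1)) (x i) q v p" "\<And>t. t \<in> {x (i - 1)..x i} \<Longrightarrow> g t = poly p t"
    using interpolant_cell[OF g i mono[OF i]] by metis
  have "L2_sq (x (i - 1)) (x i) (\<lambda>t. g t - v t) = L2_sq (x (i - 1)) (x i) (\<lambda>t. poly p t - v t)"
    using p(2) by (intro L2_sq_cong) auto
  also have "\<dots> \<le> C * (x i - x (i - 1)) * M\<^sup>2"
    using C True L2_primitive_continuous[OF v_cell[OF i]] p(1) P M by blast
  finally show ?thesis .
next
  case False
  then show ?thesis using mono[OF i] by simp
qed

end

context delay_form
begin

text \<open>Of the interpolation errors \<open>A\<close> and \<open>W\<close> only the orthogonality
  of the derivatives and the zeros of \<open>A\<close> at the nodes are used. Each term with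
  \<open>A\<close> gains a factor of the cell length, which yields the common weighted sum on the
  right.\<close>

lemma F_error_bound:
  fixes x :: "nat \<Rightarrow> real"
  assumes x0: "x 0 = 0" and xN: "x N = 2" and N: "N > 0" and mono: "\<And>i. i \<in> {1..N} \<Longrightarrow> x (i - 1) \<le> x i"
    and A: "L2_primitive 0 2 A A'" and A0: "\<And>i. i \<le> N \<Longrightarrow> A (x i) = 0" and W: "L2_primitive 0 2 W W'"
    and oA: "\<And>i \<xi>. i \<in> {1..N} \<Longrightarrow> degree \<xi> \<le> q - 1 \<Longrightarrow> integral\<^sup>L (Ioo (x (i - 1)) (x i)) (\<lambda>t. A' t * poly \<xi> t) = 0"
    and oW: "\<And>i \<xi>. i \<in> {1..N} \<Longrightarrow> degree \<xi> \<le> q - 1 \<Longrightarrow> integral\<^sup>L (Ioo (x (i - 1)) (x i)) (\<lambda>t. W' t * poly \<xi> t) = 0"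
    and y: "piecewise_poly x N q y" and z: "piecewise_poly x N q z" and \<eta>: "\<eta> > 0"
  shows "F \<epsilon> A A' W W' y (deriv y) z (deriv z) \<le>
    (3 * L\<^sup>2 + 1) / (4 * \<eta>) * (\<Sum>i\<in>{1..N}. (x i - x (i - 1))\<^sup>2 * L2_sq (x (i - 1)) (x i) A') + L2_sq 0 2 W / (4 * \<eta>)
    + \<eta> * ((1 + 2 * L\<^sup>2) * L2_sq 0 2 (deriv y) + (2 * L\<^sup>2 + 2) * L2_sq 0 2 y + L2_sq 0 2 z)"
proof -
  define Su where "Su = (\<Sum>i\<in>{1..N}. (x i - x (i - 1))\<^sup>2 * L2_sq (x (i - 1)) (x i) A')"
  have yp: "L2_primitive 0 2 y (deriv y)" and zp: "L2_primitive 0 2 z (deriv z)"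
    using piecewise_poly_primitive[OF y mono, of N] piecewise_poly_primitive[OF z mono, of N] x0 xN by auto
  note prim = A W yp zp
  note s' = prim[THEN L2_primitive_square_integrable]
  note cc = prim[THEN L2_primitive_continuous]
  note s = cc[THEN square_integrable_continuous]
  have nb: "0 \<le> x i" "x i \<le> 2" if "i \<le> N" for i
    using partition_le[of N x 0 i] partition_le[of N x i N] mono[of "Suc _"] that x0 xN by auto
  have cellb: "0 \<le> x (i - 1)" "x (i - 1) \<le> x i" "x i \<le> 2" if "i \<in> {1..N}" for i
    using nb[of "i - 1"] nb[of i] mono[OF that] that by auto
  have polys: "\<exists>p. degree p \<le> q \<and> (\<forall>t\<in>{x (i - 1)..x i}. v t = poly p t) \<and>
       (\<forall>t\<in>{x (i - 1)<..<x i}. deriv v t = poly (pderiv p) t)"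
    if v: "piecewise_poly x N q v" and i: "i \<in> {1..N}" for v i
  proof -
    obtain p where p: "degree p \<le> q" "\<And>t. t \<in> {x (i - 1)..x i} \<Longrightarrow> v t = poly p t"
      using v i unfolding piecewise_poly_def by blast
    have "deriv v t = poly (pderiv p) t" if "t \<in> {x (i - 1)<..<x i}" for t
      using piecewise_poly_deriv[of x i t v p] that p(2) by auto
    then show ?thesis using p by blast
  qed
  have pd: "degree (pderiv p) \<le> q - 1" if "degree p \<le> q" for p :: "real poly"
    using that by (auto simp: degree_pderiv)
  \<comment> \<open>Inside a cell the derivative of a discrete function is a polynomial of degree at
    most \<open>q - 1\<close>.\<close>
  have z0: "integral\<^sup>L (Ioo 0 2) (\<lambda>t. V' t * deriv v t) = 0"
    if v: "piecewise_poly x N q v" "square_integrable 0 2 (deriv v)" and V': "square_integrable 0 2 V'"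
      and o: "\<And>i \<xi>. i \<in> {1..N} \<Longrightarrow> degree \<xi> \<le> q - 1 \<Longrightarrow> integral\<^sup>L (Ioo (x (i - 1)) (x i)) (\<lambda>t. V' t * poly \<xi> t) = 0"
    for V' v
  proof -
    have "integral\<^sup>L (Ioo (x (i - 1)) (x i)) (\<lambda>t. V' t * deriv v t) = 0" if i: "i \<in> {1..N}" for i
    proof -
      obtain p where p: "degree p \<le> q" "\<And>t. t \<in> {x (i - 1)<..<x i} \<Longrightarrow> deriv v t = poly (pderiv p) t"
        using polys[OF v(1) i] by blast
      have "integral\<^sup>L (Ioo (x (i - 1)) (x i)) (\<lambda>t. V' t * deriv v t) = integral\<^sup>L (Ioo (x (i - 1)) (x i)) (\<lambda>t. V' t * poly (pderiv p) t)"
        using p(2) by (intro Bochner_Integration.integral_cong) auto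
      then show ?thesis using o[OF i pd[OF p(1)]] by simp
    qed
    then show ?thesis
      using integral_Ioo_cells[of x N "\<lambda>t. V' t * deriv v t"] square_integrable_integrable_mult[OF V' v(2)] mono x0 xN by simp
  qed
  have t1: "integral\<^sup>L (Ioo 0 2) (\<lambda>t. W' t * deriv y t) = 0" using z0[OF y s'(3) s'(2) oW] .
  have t6: "integral\<^sup>L (Ioo 0 2) (\<lambda>t. A' t * deriv z t) = 0" using z0[OF z s'(4) s'(1) oA] .
  have cellA: "L2_sq (x (i - 1)) (x i) A \<le> (x i - x (i - 1))\<^sup>2 * L2_sq (x (i - 1)) (x i) A'" if i: "i \<in> {1..N}" for i
    using cellb[OF i] A0[of "i - 1"] i
    by (intro L2_poincare L2_primitive_subset[OF A]) auto
  have sqA: "L2_sq 0 2 A \<le> Su"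
  proof -
    have "L2_sq 0 2 A = (\<Sum>i\<in>{1..N}. L2_sq (x (i - 1)) (x i) A)"
      using L2_sq_cells[of x N A] s(1) mono x0 xN by simp
    then show ?thesis unfolding Su_def by (simp only:) (rule sum_mono, rule cellA)
  qed
  have cell: "integral\<^sup>L (Ioo (x (i - 1)) (x i)) (\<lambda>t. b t * A' t * deriv y t + b1 t * A' t * y t)
     \<le> (L\<^sup>2 + 1) / (4 * \<eta>) * ((x i - x (i - 1))\<^sup>2 * L2_sq (x (i - 1)) (x i) A')
       + \<eta> * ((1 + 2 * L\<^sup>2) * L2_sq (x (i - 1)) (x i) (deriv y) + 2 * L\<^sup>2 * L2_sq (x (i - 1)) (x i) y)"
    if i: "i \<in> {1..N}" for i
  proof -
    define l u where "l = x (i - 1)" and "u = x i"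
    have lu: "0 \<le> l" "l \<le> u" "u \<le> 2" using cellb[OF i] by (auto simp: l_def u_def)
    obtain p where p: "degree p \<le> q" "\<And>t. t \<in> {l..u} \<Longrightarrow> y t = poly p t" "\<And>t. t \<in> {l<..<u} \<Longrightarrow> deriv y t = poly (pderiv p) t"
      using polys[OF y i] unfolding l_def u_def by blast
    have sub: "{l..u} \<subseteq> {0..2}" using lu by auto
    note cs = cont_b[THEN continuous_on_subset, OF sub] cont_b1[THEN continuous_on_subset, OF sub] cont(1)[THEN continuous_on_subset, OF sub]
    have sA': "square_integrable l u A'" "square_integrable l u A" using s s' lu by (auto intro: square_integrable_subset)
    have D1: "(b has_real_derivative b1 t) (at t within {l..u})" "(b1 has_real_derivative b2 t) (at t within {l..u})" if "t \<in> {l..u}" for t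
      using b1[of t] b2[of t] that sub by (auto intro: DERIV_subset)
    have eqy: "L2_sq l u (deriv y) = L2_sq l u (poly (pderiv p))" "L2_sq l u y = L2_sq l u (poly p)"
      using p by (auto intro!: L2_sq_cong)
    have o1: "integral\<^sup>L (Ioo l u) (\<lambda>t. A' t * poly (pderiv p) t) = 0"
      using oA[OF i pd[OF p(1)]] by (simp add: l_def u_def)
    have sb: "square_integrable l u (\<lambda>t. (b t - b l) * A' t)" "square_integrable l u (\<lambda>t. b t * A' t)" "square_integrable l u (\<lambda>t. b1 t * A' t)"
      by (intro square_integrable_mult_continuous sA' cs continuous_intros)+
    note sp = poly_square_integrable[of l u p] poly_square_integrable[of l u "pderiv p"]
    \<comment> \<open>The summand with the constant \<open>b l\<close> integrates to zero, and
      \<open>b t - b l\<close> is bounded by \<open>L\<close> times the cell length.\<close>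
    have "integral\<^sup>L (Ioo l u) (\<lambda>t. b t * A' t * deriv y t + b1 t * A' t * y t)
       = integral\<^sup>L (Ioo l u) (\<lambda>t. (b t - b l) * A' t * poly (pderiv p) t + b l * (A' t * poly (pderiv p) t) + b1 t * A' t * poly p t)"
      using p by (intro Bochner_Integration.integral_cong) (auto simp: algebra_simps)
    also have "\<dots> = integral\<^sup>L (Ioo l u) (\<lambda>t. (b t - b l) * A' t * poly (pderiv p) t) + integral\<^sup>L (Ioo l u) (\<lambda>t. b1 t * A' t * poly p t)"
      using square_integrable_integrable_mult[OF sb(1) sp(2)] square_integrable_integrable_mult[OF sb(3) sp(1)]
        square_integrable_integrable_mult[OF sA'(1) sp(2)] o1 by simp
    finally have split: "integral\<^sup>L (Ioo l u) (\<lambda>t. b t * A' t * deriv y t + b1 t * A' t * y t) = \<dots>" .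
    have "\<bar>integral\<^sup>L (Ioo l u) (\<lambda>t. (b t - b l) * A' t * poly (pderiv p) t)\<bar>
      \<le> L2_sq l u (\<lambda>t. (b t - b l) * A' t) / (4 * \<eta>) + \<eta> * L2_sq l u (poly (pderiv p))"
      by (rule L2_young[OF sb(1) sp(2) \<eta>])
    also have "L2_sq l u (\<lambda>t. (b t - b l) * A' t) \<le> (L * (u - l))\<^sup>2 * L2_sq l u A'"
    proof (rule L2_sq_mult_le[OF sA'(1)])
      show "continuous_on {l..u} (\<lambda>t. b t - b l)" by (intro continuous_intros cs)
      fix t assume t: "l < t" "t < u"
      have "norm (b t - b l) \<le> L * norm (t - l)"
        using t sub bound(1) lu by (intro field_differentiable_bound[of "{l..u}" b b1]) (auto intro: D1)
      also have "\<dots> \<le> L * (u - l)" using t L by (intro mult_left_mono) auto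
      finally show "\<bar>b t - b l\<bar> \<le> L * (u - l)" by simp
    qed
    finally have e1: "\<bar>integral\<^sup>L (Ioo l u) (\<lambda>t. (b t - b l) * A' t * poly (pderiv p) t)\<bar>
      \<le> (L * (u - l))\<^sup>2 * L2_sq l u A' / (4 * \<eta>) + \<eta> * L2_sq l u (poly (pderiv p))"
      using \<eta> by (simp add: divide_right_mono)
    \<comment> \<open>The factor \<open>b1\<close> is not small, so the derivative is moved away
      from \<open>A'\<close>. No boundary terms arise, and the Poincare inequality for
      \<open>A\<close> supplies the cell length.\<close>
    have Alu: "A l = 0" "A u = 0" using A0[of "i - 1"] A0[of i] i by (auto simp: l_def u_def)
    have "integral\<^sup>L (Ioo l u) (\<lambda>t. A' t * (b1 t * poly p t)) = A u * (b1 u * poly p u) - A l * (b1 l * poly p l)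
      - integral\<^sup>L (Ioo l u) (\<lambda>t. A t * (b2 t * poly p t + b1 t * poly (pderiv p) t))"
    proof (rule L2_primitive_by_parts[OF lu(2) L2_primitive_subset[OF A lu(1,3)]])
      fix t assume "t \<in> {l..u}"
      then show "((\<lambda>t. b1 t * poly p t) has_real_derivative b2 t * poly p t + b1 t * poly (pderiv p) t) (at t within {l..u})"
        using D1(2)[of t] by (auto intro!: derivative_eq_intros DERIV_subset[OF poly_DERIV] simp: mult.commute)
    qed (intro continuous_intros cs)
    then have "\<bar>integral\<^sup>L (Ioo l u) (\<lambda>t. b1 t * A' t * poly p t)\<bar> = \<bar>integral\<^sup>L (Ioo l u) (\<lambda>t. A t * (b2 t * poly p t + b1 t * poly (pderiv p) t))\<bar>"
      using Alu by (simp add: mult_ac)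
    also have "\<dots> \<le> L2_sq l u A / (4 * \<eta>) + \<eta> * L2_sq l u (\<lambda>t. b2 t * poly p t + b1 t * poly (pderiv p) t)"
      by (intro L2_young sA' \<eta> square_integrable_continuous continuous_intros cs)
    also have "L2_sq l u (\<lambda>t. b2 t * poly p t + b1 t * poly (pderiv p) t) \<le> 2 * L2_sq l u (\<lambda>t. b2 t * poly p t) + 2 * L2_sq l u (\<lambda>t. b1 t * poly (pderiv p) t)"
      by (intro L2_sq_add_le square_integrable_continuous continuous_intros cs)
    also have "L2_sq l u (\<lambda>t. b2 t * poly p t) \<le> L\<^sup>2 * L2_sq l u (poly p)"
      using bound(2) sub by (intro L2_sq_mult_le sp cs) auto
    also have "L2_sq l u (\<lambda>t. b1 t * poly (pderiv p) t) \<le> L\<^sup>2 * L2_sq l u (poly (pderiv p))"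
      using bound(1) sub by (intro L2_sq_mult_le sp cs) auto
    also have "L2_sq l u A \<le> (u - l)\<^sup>2 * L2_sq l u A'" using cellA[OF i] by (simp add: l_def u_def)
    finally have e2: "\<bar>integral\<^sup>L (Ioo l u) (\<lambda>t. b1 t * A' t * poly p t)\<bar> \<le>
       (u - l)\<^sup>2 * L2_sq l u A' / (4 * \<eta>) + \<eta> * (2 * (L\<^sup>2 * L2_sq l u (poly p)) + 2 * (L\<^sup>2 * L2_sq l u (poly (pderiv p))))"
      using \<eta> by (simp add: divide_right_mono)
    have "integral\<^sup>L (Ioo l u) (\<lambda>t. b t * A' t * deriv y t + b1 t * A' t * y t) \<le>
       ((L * (u - l))\<^sup>2 * L2_sq l u A' / (4 * \<eta>) + \<eta> * L2_sq l u (poly (pderiv p))) + ((u - l)\<^sup>2 * L2_sq l u A' / (4 * \<eta>) + \<eta> * (2 * (L\<^sup>2 * L2_sq l u (poly p)) + 2 * (L\<^sup>2 * L2_sq l u (poly (pderiv p)))))"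
      unfolding split using e1 e2 by linarith
    also have "\<dots> = (L\<^sup>2 + 1) / (4 * \<eta>) * ((u - l)\<^sup>2 * L2_sq l u A') + \<eta> * ((1 + 2 * L\<^sup>2) * L2_sq l u (poly (pderiv p)) + 2 * L\<^sup>2 * L2_sq l u (poly p))"
      unfolding power_mult_distrib using \<eta> by (simp add: field_simps)
    finally show ?thesis unfolding eqy[symmetric] unfolding l_def u_def .
  qed
  have iM: "integrable (Ioo 0 2) (\<lambda>t. b t * A' t * deriv y t)" "integrable (Ioo 0 2) (\<lambda>t. b1 t * A' t * y t)"
    by (intro square_integrable_integrable_mult square_integrable_mult_continuous s s' cont_b cont_b1)+
  have "integral\<^sup>L (Ioo 0 2) (\<lambda>t. b t * A' t * deriv y t) + integral\<^sup>L (Ioo 0 2) (\<lambda>t. b1 t * A' t * y t)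
     = integral\<^sup>L (Ioo (x 0) (x N)) (\<lambda>t. b t * A' t * deriv y t + b1 t * A' t * y t)"
    using iM by (simp add: x0 xN)
  also have "\<dots> = (\<Sum>i\<in>{1..N}. integral\<^sup>L (Ioo (x (i - 1)) (x i)) (\<lambda>t. b t * A' t * deriv y t + b1 t * A' t * y t))"
    using iM mono by (intro integral_Ioo_cells) (auto simp: x0 xN)
  also have "\<dots> \<le> (\<Sum>i\<in>{1..N}. (L\<^sup>2 + 1) / (4 * \<eta>) * ((x i - x (i - 1))\<^sup>2 * L2_sq (x (i - 1)) (x i) A')
       + \<eta> * ((1 + 2 * L\<^sup>2) * L2_sq (x (i - 1)) (x i) (deriv y) + 2 * L\<^sup>2 * L2_sq (x (i - 1)) (x i) y))"
    by (intro sum_mono cell)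
  also have "\<dots> = (L\<^sup>2 + 1) / (4 * \<eta>) * Su + \<eta> * ((1 + 2 * L\<^sup>2) * (\<Sum>i\<in>{1..N}. L2_sq (x (i - 1)) (x i) (deriv y))
       + 2 * L\<^sup>2 * (\<Sum>i\<in>{1..N}. L2_sq (x (i - 1)) (x i) y))"
    unfolding Su_def by (simp only: sum.distrib sum_distrib_left distrib_left)
  also have "(\<Sum>i\<in>{1..N}. L2_sq (x (i - 1)) (x i) (deriv y)) = L2_sq 0 2 (deriv y)"
    using L2_sq_cells[of x N "deriv y"] s' mono by (simp add: x0 xN)
  also have "(\<Sum>i\<in>{1..N}. L2_sq (x (i - 1)) (x i) y) = L2_sq 0 2 y"
    using L2_sq_cells[of x N y] s mono by (simp add: x0 xN)
  finally have M: "integral\<^sup>L (Ioo 0 2) (\<lambda>t. b t * A' t * deriv y t) + integral\<^sup>L (Ioo 0 2) (\<lambda>t. b1 t * A' t * y t)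
     \<le> (L\<^sup>2 + 1) / (4 * \<eta>) * Su + \<eta> * ((1 + 2 * L\<^sup>2) * L2_sq 0 2 (deriv y) + 2 * L\<^sup>2 * L2_sq 0 2 y)" .
  have "\<bar>integral\<^sup>L (Ioo 0 2) (\<lambda>t. c t * A t * y t)\<bar> \<le> L2_sq 0 2 (\<lambda>t. c t * A t) / (4 * \<eta>) + \<eta> * L2_sq 0 2 y"
    by (intro L2_young square_integrable_mult_continuous s cont \<eta>)
  also have "L2_sq 0 2 (\<lambda>t. c t * A t) \<le> L\<^sup>2 * L2_sq 0 2 A" using bound(3) by (intro L2_sq_mult_le s cont) auto
  also have "\<dots> \<le> L\<^sup>2 * Su" by (intro mult_left_mono sqA) auto
  finally have t4: "\<bar>integral\<^sup>L (Ioo 0 2) (\<lambda>t. c t * A t * y t)\<bar> \<le> L\<^sup>2 * Su / (4 * \<eta>) + \<eta> * L2_sq 0 2 y"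
    using \<eta> by (simp add: divide_right_mono)
  have cA01: "continuous_on {0..1} A" by (rule continuous_on_subset[OF cc(1)]) auto
  have d12: "continuous_on {1..2} d" by (rule continuous_on_subset[OF cont(3)]) auto
  have y12: "square_integrable 1 2 y" by (rule square_integrable_subset[OF s(3)]) auto
  note sh = L2_sq_shift[OF cA01]
  have "\<bar>integral\<^sup>L (Ioo 1 2) (\<lambda>t. d t * A (t - 1) * y t)\<bar> \<le> L2_sq 1 2 (\<lambda>t. d t * A (t - 1)) / (4 * \<eta>) + \<eta> * L2_sq 1 2 y"
    by (intro L2_young square_integrable_mult_continuous sh y12 d12 \<eta>)
  also have "L2_sq 1 2 (\<lambda>t. d t * A (t - 1)) \<le> L\<^sup>2 * L2_sq 1 2 (\<lambda>t. A (t - 1))" using bound(4) by (intro L2_sq_mult_le sh d12) auto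
  also have "L2_sq 1 2 (\<lambda>t. A (t - 1)) \<le> L2_sq 0 2 A" unfolding sh(1) by (intro L2_sq_mono_interval s) auto
  also have "L2_sq 0 2 A \<le> Su" by (rule sqA)
  also have "L2_sq 1 2 y \<le> L2_sq 0 2 y" by (intro L2_sq_mono_interval s) auto
  finally have t5: "\<bar>integral\<^sup>L (Ioo 1 2) (\<lambda>t. d t * A (t - 1) * y t)\<bar> \<le> L\<^sup>2 * Su / (4 * \<eta>) + \<eta> * L2_sq 0 2 y"
    using \<eta> by (simp add: divide_right_mono mult_left_mono)
  have t7: "\<bar>integral\<^sup>L (Ioo 0 2) (\<lambda>t. W t * z t)\<bar> \<le> L2_sq 0 2 W / (4 * \<eta>) + \<eta> * L2_sq 0 2 z"
    by (intro L2_young s \<eta>)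
  \<comment> \<open>\<open>3 * L\<^sup>2 + 1\<close> consists of \<open>L\<^sup>2 + 1\<close> from
    the convective terms and \<open>L\<^sup>2\<close> each from the reaction term and the delay
    term.\<close>
  have "F \<epsilon> A A' W W' y (deriv y) z (deriv z) \<le>
     ((L\<^sup>2 + 1) / (4 * \<eta>) * Su + \<eta> * ((1 + 2 * L\<^sup>2) * L2_sq 0 2 (deriv y) + 2 * L\<^sup>2 * L2_sq 0 2 y))
     + (L\<^sup>2 * Su / (4 * \<eta>) + \<eta> * L2_sq 0 2 y) + (L\<^sup>2 * Su / (4 * \<eta>) + \<eta> * L2_sq 0 2 y) + (L2_sq 0 2 W / (4 * \<eta>) + \<eta> * L2_sq 0 2 z)"
    unfolding F_def t1 t6 using M t4 t5 t7 by linarith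
  also have "\<dots> = (3 * L\<^sup>2 + 1) / (4 * \<eta>) * Su + L2_sq 0 2 W / (4 * \<eta>)
    + \<eta> * ((1 + 2 * L\<^sup>2) * L2_sq 0 2 (deriv y) + (2 * L\<^sup>2 + 2) * L2_sq 0 2 y + L2_sq 0 2 z)"
    using \<eta> by (simp add: field_simps)
  finally show ?thesis unfolding Su_def .
qed

text \<open>The parameter of the Young inequalities is chosen so that half of the norm can be absorbed.\<close>

lemma discrete_error_estimate:
  obtains C where "C > 0" "\<And>\<epsilon> (x :: nat \<Rightarrow> real) N q m f \<Phi> u w uh wh gu gw.
     x 0 = 0 \<Longrightarrow> x N = 2 \<Longrightarrow> N > 0 \<Longrightarrow> (\<And>i. i \<in> {1..N} \<Longrightarrow> x (i - 1) \<le> x i) \<Longrightarrow>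
     solves_in (space_U m) \<epsilon> b c d f \<Phi> u w \<Longrightarrow> solves_in (space_Uh m x N q) \<epsilon> b c d f \<Phi> uh wh \<Longrightarrow>
     is_interpolant x N q u gu \<Longrightarrow> is_interpolant x N q w gw \<Longrightarrow>
     L2_primitive 0 2 (\<lambda>t. gu t - uh t) (deriv (\<lambda>t. gu t - uh t)) \<and>
     triple_sq \<beta> \<delta> (\<lambda>t. gu t - uh t) (deriv (\<lambda>t. gu t - uh t)) (\<lambda>t. gw t - wh t)
       \<le> C * ((\<Sum>i\<in>{1..N}. (x i - x (i - 1))\<^sup>2 * L2_sq (x (i - 1)) (x i) (\<lambda>t. deriv gu t - wderiv 0 2 u t))
              + L2_sq 0 2 (\<lambda>t. gw t - w t))"
proof
  \<comment> \<open>The three entries keep the coefficients of the Young terms below half of the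
    weights \<open>\<beta>\<^sup>2 / 2\<close>, \<delta> and 1 of the norm.\<close>
  define \<eta> where "\<eta> = min (\<beta>\<^sup>2 / (4 * (1 + 2 * L\<^sup>2))) (min (\<delta> / (2 * (2 * L\<^sup>2 + 2))) (1 / 2))"
  have pos: "1 + 2 * L\<^sup>2 > 0" "2 * L\<^sup>2 + 2 > 0" by (auto simp: add_pos_nonneg add_nonneg_pos)
  have \<eta>: "\<eta> > 0" using \<beta> \<delta> pos by (simp add: \<eta>_def)
  have "\<eta> \<le> \<beta>\<^sup>2 / (4 * (1 + 2 * L\<^sup>2))" "\<eta> \<le> \<delta> / (2 * (2 * L\<^sup>2 + 2))" "\<eta> \<le> 1/2"
    unfolding \<eta>_def by (rule min.cobounded1 min.coboundedI2 order_refl)+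
  then have \<eta>_le: "\<eta> * (1 + 2 * L\<^sup>2) \<le> \<beta>\<^sup>2 / 4" "\<eta> * (2 * L\<^sup>2 + 2) \<le> \<delta> / 2" "\<eta> \<le> 1/2"
    using pos by (auto simp: field_simps)
  define C where "C = (3 * L\<^sup>2 + 1) / (2 * \<eta>)"
  show "C > 0" using \<eta> by (simp add: C_def add_nonneg_pos)
  fix \<epsilon> :: real and x :: "nat \<Rightarrow> real" and N q m f \<Phi> u w uh wh gu gw
  assume x0: "x 0 = 0" and xN: "x N = 2" and N: "N > 0" and mono: "\<And>i. i \<in> {1..N} \<Longrightarrow> x (i - 1) \<le> x i"
    and S: "solves_in (space_U m) \<epsilon> b c d f \<Phi> u w" and Sh: "solves_in (space_Uh m x N q) \<epsilon> b c d f \<Phi> uh wh"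
    and gu: "is_interpolant x N q u gu" and gw: "is_interpolant x N q w gw"
  define y where "y t = gu t - uh t" for t
  define z where "z t = gw t - wh t" for t
  have U: "(u, w) \<in> space_U m" and Uh: "(uh, wh) \<in> space_Uh m x N q" using S Sh by (auto simp: solves_in_def)
  then have "u \<in> H1 0 2" "w \<in> H1 0 2" "uh \<in> H1 0 2" "wh \<in> H1 0 2"
    by (auto simp: space_Uh_def space_U_def H1_0_def split: if_splits)
  then have prim: "L2_primitive 0 2 u (wderiv 0 2 u)" "L2_primitive 0 2 w (wderiv 0 2 w)"
    "L2_primitive 0 2 uh (wderiv 0 2 uh)" "L2_primitive 0 2 wh (wderiv 0 2 wh)"
    by (auto intro: H1_D)
  interpret u: interpolation_error x N q u "wderiv 0 2 u" gu
    by unfold_locales (use x0 xN mono prim gu in auto)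
  interpret w: interpolation_error x N q w "wderiv 0 2 w" gw
    by unfold_locales (use x0 xN mono prim gw in auto)
  have pp: "piecewise_poly x N q (\<lambda>t. f t - g t)" if fg: "piecewise_poly x N q f" "piecewise_poly x N q g" for f g
    unfolding piecewise_poly_def
  proof
    fix i assume i: "i \<in> {1..N}"
    obtain p r where "degree p \<le> q" "degree r \<le> q" "\<forall>t\<in>{x (i - 1)..x i}. f t = poly p t" "\<forall>t\<in>{x (i - 1)..x i}. g t = poly r t"
      using fg i unfolding piecewise_poly_def by blast
    then show "\<exists>p. degree p \<le> q \<and> (\<forall>t\<in>{x (i - 1)..x i}. f t - g t = poly p t)"
      by (intro exI[of _ "p - r"]) (auto intro: degree_diff_le)
  qed
  have ppy: "piecewise_poly x N q y" and ppz: "piecewise_poly x N q z"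
    using gu gw Uh unfolding y_def[abs_def] z_def[abs_def] by (auto simp: is_interpolant_def space_Uh_def intro: pp)
  have yp: "L2_primitive 0 2 y (deriv y)" and zp: "L2_primitive 0 2 z (deriv z)"
    using piecewise_poly_primitive[OF ppy mono, of N] piecewise_poly_primitive[OF ppz mono, of N] x0 xN by auto
  \<comment> \<open>Interpolation keeps the boundary values, so the difference to the discrete
    solution lies in the discrete space for either boundary condition and can serve as test
    function.\<close>
  have bc: "gu 0 = u 0" "gu 2 = u 2" "gw 0 = w 0" "gw 2 = w 2"
    using u.error_node[OF N, of 0] u.error_node[OF N, of N] w.error_node[OF N, of 0] w.error_node[OF N, of N] x0 xN by auto
  have yH: "y \<in> H1 0 2" "z \<in> H1 0 2" using H1_I[OF yp] H1_I[OF zp] by auto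
  have yz: "(y, z) \<in> space_Uh m x N q"
    using yH ppy ppz U Uh bc by (auto simp: space_Uh_def space_U_def H1_0_def y_def z_def split: if_splits)
  then have yzU: "(y, z) \<in> space_U m" by (simp add: space_Uh_def)
  have "form_B \<epsilon> b c d (u, w) (y, z) = form_B \<epsilon> b c d (uh, wh) (y, z)"
    using bspec[OF conjunct2[OF S[unfolded solves_in_def]] yzU] bspec[OF conjunct2[OF Sh[unfolded solves_in_def]] yz]
    by simp
  then have gal: "F \<epsilon> u (wderiv 0 2 u) w (wderiv 0 2 w) y (deriv y) z (deriv z) =
      F \<epsilon> uh (wderiv 0 2 uh) wh (wderiv 0 2 wh) y (deriv y) z (deriv z)"
    using form_B_eq[OF prim(1,2) yp zp] form_B_eq[OF prim(3,4) yp zp] by simp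
  \<comment> \<open>Two representatives of the derivative of \<open>y\<close> occur:
    \<open>deriv y\<close> exhibits the piecewise polynomial, \<open>y1\<close> is a difference and
    allows \<open>F\<close> to be split. Both evaluate the same \<open>form_B\<close>, hence give
    the same value of \<open>F\<close>.\<close>
  define y1 where "y1 t = deriv gu t - wderiv 0 2 uh t" for t
  define z1 where "z1 t = deriv gw t - wderiv 0 2 wh t" for t
  have y1: "L2_primitive 0 2 y y1" and z1: "L2_primitive 0 2 z z1"
    unfolding y_def[abs_def] z_def[abs_def] y1_def[abs_def] z1_def[abs_def]
    by (intro L2_primitive_minus u.interpolant_primitive w.interpolant_primitive prim)+
  have "triple_sq \<beta> \<delta> y (deriv y) z \<le> F \<epsilon> y (deriv y) z (deriv z) y (deriv y) z (deriv z)"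
    by (rule F_coercive[OF yp zp])
  also have "\<dots> = F \<epsilon> y y1 z z1 y (deriv y) z (deriv z)"
    using form_B_eq[OF yp zp yp zp, of \<epsilon>] form_B_eq[OF y1 z1 yp zp, of \<epsilon>] by simp
  also have "\<dots> = F \<epsilon> gu (deriv gu) gw (deriv gw) y (deriv y) z (deriv z)
      - F \<epsilon> uh (wderiv 0 2 uh) wh (wderiv 0 2 wh) y (deriv y) z (deriv z)"
    unfolding y1_def[abs_def] z1_def[abs_def] y_def[abs_def] z_def[abs_def]
    by (rule F_diff[OF u.interpolant_primitive w.interpolant_primitive prim(3,4) yp[unfolded y_def[abs_def]] zp[unfolded z_def[abs_def]]])
  also have "\<dots> = F \<epsilon> (\<lambda>t. gu t - u t) (\<lambda>t. deriv gu t - wderiv 0 2 u t) (\<lambda>t. gw t - w t) (\<lambda>t. deriv gw t - wderiv 0 2 w t)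
      y (deriv y) z (deriv z)"
    using F_diff[OF u.interpolant_primitive w.interpolant_primitive prim(1,2) yp zp, of \<epsilon>] gal by simp
  also have "\<dots> \<le> (3 * L\<^sup>2 + 1) / (4 * \<eta>) * (\<Sum>i\<in>{1..N}. (x i - x (i - 1))\<^sup>2 * L2_sq (x (i - 1)) (x i) (\<lambda>t. deriv gu t - wderiv 0 2 u t))
    + L2_sq 0 2 (\<lambda>t. gw t - w t) / (4 * \<eta>)
    + \<eta> * ((1 + 2 * L\<^sup>2) * L2_sq 0 2 (deriv y) + (2 * L\<^sup>2 + 2) * L2_sq 0 2 y + L2_sq 0 2 z)"
    by (rule F_error_bound[OF x0 xN N mono u.error_primitive u.error_node[OF N] w.error_primitive
      u.error_deriv_orthogonal w.error_deriv_orthogonal ppy ppz \<eta>])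
  finally have est: "triple_sq \<beta> \<delta> y (deriv y) z \<le> (3 * L\<^sup>2 + 1) / (4 * \<eta>) * (\<Sum>i\<in>{1..N}. (x i - x (i - 1))\<^sup>2 * L2_sq (x (i - 1)) (x i) (\<lambda>t. deriv gu t - wderiv 0 2 u t))
    + L2_sq 0 2 (\<lambda>t. gw t - w t) / (4 * \<eta>)
    + \<eta> * ((1 + 2 * L\<^sup>2) * L2_sq 0 2 (deriv y) + (2 * L\<^sup>2 + 2) * L2_sq 0 2 y + L2_sq 0 2 z)" (is "_ \<le> ?a * ?S + ?b + ?r") .
  have "?r = \<eta> * (1 + 2 * L\<^sup>2) * L2_sq 0 2 (deriv y) + \<eta> * (2 * L\<^sup>2 + 2) * L2_sq 0 2 y + \<eta> * L2_sq 0 2 z"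
    by (simp add: algebra_simps)
  also have "\<dots> \<le> \<beta>\<^sup>2 / 4 * L2_sq 0 2 (deriv y) + \<delta> / 2 * L2_sq 0 2 y + 1 / 2 * L2_sq 0 2 z"
    using \<eta>_le by (intro add_mono mult_right_mono) auto
  also have "\<dots> = triple_sq \<beta> \<delta> y (deriv y) z / 2" by (simp add: triple_sq_def field_simps)
  finally have half: "?r \<le> triple_sq \<beta> \<delta> y (deriv y) z / 2" .
  have absorb: "T \<le> 2 * P" if "T \<le> P + r" "r \<le> T / 2" for T P r :: real using that by simp
  have "triple_sq \<beta> \<delta> y (deriv y) z \<le> 2 * (?a * ?S + ?b)" by (rule absorb[OF est half])
  also have "?b \<le> ?a * L2_sq 0 2 (\<lambda>t. gw t - w t)"
    using \<eta> mult_right_mono[of 1 "3 * L\<^sup>2 + 1" "L2_sq 0 2 (\<lambda>t. gw t - w t)"] by (simp add: divide_right_mono)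
  also have "2 * (?a * ?S + ?a * L2_sq 0 2 (\<lambda>t. gw t - w t)) = C * (?S + L2_sq 0 2 (\<lambda>t. gw t - w t))"
    using \<eta> by (simp add: C_def field_simps)
  finally have "triple_sq \<beta> \<delta> y (deriv y) z \<le> C * (?S + L2_sq 0 2 (\<lambda>t. gw t - w t))" by simp
  then show "L2_primitive 0 2 (\<lambda>t. gu t - uh t) (deriv (\<lambda>t. gu t - uh t)) \<and>
     triple_sq \<beta> \<delta> (\<lambda>t. gu t - uh t) (deriv (\<lambda>t. gu t - uh t)) (\<lambda>t. gw t - wh t) \<le> C * (?S + L2_sq 0 2 (\<lambda>t. gw t - w t))"
    using yp unfolding y_def[abs_def] z_def[abs_def] by simp
qed

end

section \<open>Layer components on graded cells\<close>

text \<open>Approximation of the first derivative gains the power \<open>2 * q\<close> of the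
  length, and the weight completes it to \<open>2 * j\<close>. The pointwise bound is integrated and
  may thus vary over the cell.\<close>

lemma chain_component:
  fixes F :: "nat \<Rightarrow> real \<Rightarrow> real"
  assumes ab: "a < b" and q: "q \<ge> 1" and F: "\<And>k. k \<le> q \<Longrightarrow> has_weak_deriv a b (F k) (F (Suc k))"
    and j: "q \<le> j" and Q: "integrable (Ioo a b) Q"
    and le: "\<And>t. a < t \<Longrightarrow> t < b \<Longrightarrow> ((b - a) ^ j * F (Suc q) t)\<^sup>2 \<le> Q t"
  shows "\<exists>p. degree p \<le> q - 1 \<and> (b - a) ^ (2 * (j - q)) * L2_sq a b (\<lambda>t. F 1 t - poly p t) \<le> integral\<^sup>L (Ioo a b) Q"
proof -
  have "q - (q - 1) = 1" "Suc (q - 1) = q" using q by auto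
  then obtain p where p: "degree p \<le> q - 1" "L2_sq a b (\<lambda>t. F 1 t - poly p t) \<le> (b - a) ^ (2 * q) * L2_sq a b (F (Suc q))"
    using weak_deriv_chain_poly_approx[where F=F and q=q and j="q - 1", OF ab F] by auto
  have si: "square_integrable a b (F (Suc q))" using F[of q] by (simp add: has_weak_deriv_def)
  have "(b - a) ^ (2 * (j - q)) * L2_sq a b (\<lambda>t. F 1 t - poly p t) \<le> (b - a) ^ (2 * (j - q)) * ((b - a) ^ (2 * q) * L2_sq a b (F (Suc q)))"
    using ab by (intro mult_left_mono p) auto
  also have "\<dots> = (b - a) ^ (2 * j) * L2_sq a b (F (Suc q))"
  proof -
    have "2 * (j - q) + 2 * q = 2 * j" using j by simp
    then show ?thesis by (simp only: mult.assoc[symmetric] power_add[symmetric])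
  qed
  also have "\<dots> = L2_sq a b (\<lambda>t. (b - a) ^ j * F (Suc q) t)"
    unfolding L2_sq_cmult by (simp add: power_even_eq)
  also have "\<dots> \<le> integral\<^sup>L (Ioo a b) Q" by (intro L2_sq_le_integral square_integrable_cmult si Q le)
  finally show ?thesis using p(1) by blast
qed

lemma power_powi_le_1:
  fixes \<epsilon> :: real
  assumes "0 < \<epsilon>" "\<epsilon> \<le> 1" "e + int n \<ge> 0"
  shows "\<epsilon> powi e * \<epsilon> ^ n \<le> 1"
proof -
  have "\<epsilon> powi e * \<epsilon> ^ n = \<epsilon> powi (e + int n)" using assms by (simp add: power_int_add)
  also have "\<dots> = \<epsilon> ^ nat (e + int n)" using assms(3) by (simp add: power_int_def)
  also have "\<dots> \<le> 1" using assms by (intro power_le_one) auto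
  finally show ?thesis .
qed

context S_mesh
begin

text \<open>Here \<sigma> has to be at least \<open>q + 1\<close>: the decay is the \<sigma>-th
  power of a number at most one, hence at most its \<open>j\<close>-th power, and this pays for
  \<open>j\<close> factors \<open>(b - a) / r\<close>.\<close>

lemma exp_resolved:
  assumes r: "resolved r D a b" "r > 0" and t: "t \<in> {a..b}" "D t \<ge> 0" and j: "j \<le> q + 1" and ab: "a \<le> b"
  shows "(b - a) ^ j * exp (- \<beta> * D t / r) \<le> r ^ j * (C0 * \<rho>) ^ j"
proof -
  define e where "e = - \<beta> * D t / (\<sigma> * r)"
  have e0: "e \<le> 0" using \<beta> \<sigma>_pos r t by (simp add: e_def divide_le_0_iff mult_le_0_iff)
  have "- \<beta> * D t / r = \<sigma> * e" using \<sigma>_pos r by (simp add: e_def)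
  also have "\<dots> \<le> real j * e" using e0 j \<sigma> by (intro mult_right_mono_neg) auto
  finally have "exp (- \<beta> * D t / r) \<le> exp e ^ j" by (simp add: exp_of_nat_mult[symmetric])
  then have "(b - a) ^ j * exp (- \<beta> * D t / r) \<le> (b - a) ^ j * exp e ^ j" using ab by (intro mult_left_mono) auto
  also have "\<dots> = r ^ j * ((b - a) / r * exp e) ^ j" using r by (simp add: power_mult_distrib power_divide)
  also have "\<dots> \<le> r ^ j * (C0 * \<rho>) ^ j"
    using r t ab by (intro mult_left_mono power_mono) (auto simp: resolved_def e_def)
  finally show ?thesis .
qed

text \<open>By the choice of the transition point the exponential is \<open>N\<close> to the power
  \<open>- \<sigma>\<close>.\<close>

lemma exp_lam: "exp (- \<beta> * lam / \<epsilon>) \<le> \<rho> ^ (q + 1)"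
proof -
  have "- \<beta> * lam / \<epsilon> = - \<sigma> * ln (real N)" using \<beta> \<epsilon> by (simp add: mesh_lambda_def)
  also have "\<dots> \<le> - (real (q + 1)) * ln (real N)" using \<sigma> lnN by (intro mult_right_mono) auto
  finally have "exp (- \<beta> * lam / \<epsilon>) \<le> exp (real (q + 1) * (- ln (real N)))"
    by (simp only: exp_le_cancel_iff mult_minus_left mult_minus_right)
  also have "\<dots> = (1 / real N) ^ (q + 1)"
    using N8 by (simp only: exp_of_nat_mult) (simp add: exp_minus inverse_eq_divide)
  also have "\<dots> \<le> \<rho> ^ (q + 1)" using \<rho>_ge by (intro power_mono) auto
  finally show ?thesis .
qed

lemma exp_far: "lam \<le> D \<Longrightarrow> exp (- \<beta> * D / \<epsilon>) \<le> \<rho> ^ (q + 1)"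
proof -
  assume "lam \<le> D"
  then have "exp (- \<beta> * D / \<epsilon>) \<le> exp (- \<beta> * lam / \<epsilon>)" using \<beta> \<epsilon> by (simp add: divide_right_mono)
  then show ?thesis using exp_lam by linarith
qed

text \<open>The distance exceeds \<open>lam\<close> by at least \<open>1/2\<close> because
  \<open>lam < 1/4\<close>. The first part gives the power of \<rho>, the surplus decays faster than
  any power of \<epsilon>, of which one is kept.\<close>

lemma exp_very_far: "3/4 \<le> D \<Longrightarrow> exp (- \<beta> * D / \<epsilon>) \<le> 2 / \<beta> * \<epsilon> * \<rho> ^ (q + 1)"
proof -
  assume D: "3/4 \<le> D"
  define z where "z = \<beta> / (2 * \<epsilon>)"
  have z: "z > 0" using \<beta> \<epsilon> by (simp add: z_def)
  have "\<beta> * (lam + 1/2) \<le> \<beta> * D" using D lam_le_\<nu> \<nu>_less \<beta> by (intro mult_left_mono) auto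
  then have "- \<beta> * D / \<epsilon> \<le> - \<beta> * lam / \<epsilon> + - z" using \<epsilon> by (simp add: z_def field_simps)
  then have "exp (- \<beta> * D / \<epsilon>) \<le> exp (- \<beta> * lam / \<epsilon>) * exp (- z)" by (simp only: exp_le_cancel_iff flip: exp_add)
  also have "\<dots> \<le> \<rho> ^ (q + 1) * (1 / z)"
  proof (intro mult_mono exp_lam)
    have "z \<le> exp z" using exp_ge_add_one_self[of z] by linarith
    then show "exp (- z) \<le> 1 / z" using z by (simp add: exp_minus field_simps)
  qed (use \<rho>_pos in auto)
  also have "\<dots> = 2 / \<beta> * \<epsilon> * \<rho> ^ (q + 1)" using \<beta> \<epsilon> by (simp add: z_def)
  finally show ?thesis .
qed

text \<open>The bound for \<open>1 / \<epsilon>\<close> in the case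
  \<open>\<epsilon> powr \<kappa> > 1/2\<close>.\<close>

definition C\<kappa> :: real where "C\<kappa> = 2 powr (1 / \<kappa>)"

lemma C\<kappa>_pos: "C\<kappa> > 0" by (simp add: C\<kappa>_def)

text \<open>The factor \<open>exp (- \<beta> y / s)\<close> is consumed by the mesh grading. For small \<open>\<epsilon>\<close> the remaining factor
  still decays on the scale \<open>\<epsilon>\<close>, which yields the square root of \<open>\<epsilon>\<close> in the \<open>L\<^sup>2\<close> norm; otherwise \<open>1 / \<epsilon>\<close> is
  bounded.\<close>

lemma exp_inner_remainder:
  assumes y: "y \<ge> 0"
  shows "exp (- \<beta> * y * (1 / \<epsilon> - 1 / s)) ^ 2 \<le> \<epsilon> * (exp (- \<beta> * y / \<epsilon>) / \<epsilon> + C\<kappa>)"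
proof -
  have inv_s: "1 / s = \<epsilon> powr \<kappa> / \<epsilon>" using \<epsilon> by (simp add: s_eq powr_diff)
  show ?thesis
  proof (cases "\<epsilon> powr \<kappa> \<le> 1/2")
    case True
    \<comment> \<open>At least half of the decay rate is left, and squaring restores the full
      rate.\<close>
    have "1 / (2 * \<epsilon>) \<le> 1 / \<epsilon> - 1 / s" unfolding inv_s using True \<epsilon> by (simp add: field_simps)
    then have "2 * (\<beta> * y) * (1 / (2 * \<epsilon>)) \<le> 2 * (\<beta> * y) * (1 / \<epsilon> - 1 / s)"
      using \<beta> y by (intro mult_left_mono) auto
    moreover have "2 * (\<beta> * y) * (1 / (2 * \<epsilon>)) = \<beta> * y / \<epsilon>" using \<epsilon> by simp
    moreover have "2 * (- \<beta> * y * (1 / \<epsilon> - 1 / s)) = - (2 * (\<beta> * y) * (1 / \<epsilon> - 1 / s))" by simp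
    ultimately have "2 * (- \<beta> * y * (1 / \<epsilon> - 1 / s)) \<le> - \<beta> * y / \<epsilon>" by simp
    then have "exp (- \<beta> * y * (1 / \<epsilon> - 1 / s)) ^ 2 \<le> exp (- \<beta> * y / \<epsilon>)" by (simp add: exp_double[symmetric] del: exp_le_cancel_iff) (simp only: exp_le_cancel_iff)
    also have "\<dots> \<le> \<epsilon> * (exp (- \<beta> * y / \<epsilon>) / \<epsilon> + C\<kappa>)" using \<epsilon> C\<kappa>_pos by (simp add: distrib_left)
    finally show ?thesis .
  next
    case False
    then have "(\<epsilon> powr \<kappa>) powr (1 / \<kappa>) \<ge> (1/2) powr (1 / \<kappa>)" using \<kappa> by (intro powr_mono2) auto
    then have "\<epsilon> \<ge> 1 / C\<kappa>" using \<kappa> \<epsilon> by (simp add: powr_powr C\<kappa>_def powr_divide)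
    then have 1: "1 \<le> \<epsilon> * C\<kappa>" using C\<kappa>_pos by (simp add: field_simps)
    have "1 / s \<le> 1 / \<epsilon>" using \<epsilon> \<epsilon>_le_s by (simp add: frac_le)
    then have "exp (- \<beta> * y * (1 / \<epsilon> - 1 / s)) \<le> 1" using \<beta> y by (simp add: mult_nonneg_nonneg)
    then have "exp (- \<beta> * y * (1 / \<epsilon> - 1 / s)) ^ 2 \<le> 1" by (intro power_le_one) auto
    also have "\<dots> \<le> \<epsilon> * (exp (- \<beta> * y / \<epsilon>) / \<epsilon> + C\<kappa>)" using 1 \<epsilon> by (simp add: distrib_left add_increasing)
    finally show ?thesis .
  qed
qed

text \<open>The exponent of \<epsilon> is \<open>2 * j - 2 * \<kappa> * j\<close>, and
  \<open>2 * \<kappa> * j\<close> is at most \<open>2 * \<kappa> * (q + 1) = 5\<close>. For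
  \<open>j \<ge> 3\<close>, which \<open>q > 2\<close> guarantees in the applications,
  \<open>2 * j - 5\<close> is a true subtraction.\<close>

lemma s_power_le: assumes j: "3 \<le> j" "j \<le> q + 1" shows "(s ^ j)\<^sup>2 \<le> \<epsilon> ^ (2 * j - 5)"
proof -
  have "(s ^ j)\<^sup>2 = \<epsilon> powr ((1 - \<kappa>) * real (2 * j))"
    using \<epsilon> by (simp add: s_eq powr_power power_mult[symmetric] mult_ac)
  also have "\<dots> \<le> \<epsilon> powr real (2 * j - 5)"
  proof (rule powr_mono')
    have "\<kappa> * real j \<le> \<kappa> * (real q + 1)" using j \<kappa> by (intro mult_left_mono) auto
    then have "\<kappa> * real (2 * j) \<le> 5" using \<kappa> by simp
    then show "real (2 * j - 5) \<le> (1 - \<kappa>) * real (2 * j)" using j by (simp add: of_nat_diff algebra_simps)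
  qed (use \<epsilon> \<epsilon>1 in auto)
  also have "\<dots> = \<epsilon> ^ (2 * j - 5)" using \<epsilon> by (rule powr_realpow)
  finally show ?thesis .
qed

text \<open>The rate \<open>1 / \<epsilon>\<close> is split into \<open>1 / s\<close> and the rest:
  the first part is balanced by the cell length, the second contributes one more \<epsilon> and the
  integrable peak, so that \<open>2 * j - 5\<close> becomes \<open>2 * j - 4\<close>.\<close>

lemma exp_inner:
  assumes r: "resolved s D a b" and t: "t \<in> {a..b}" "D t \<ge> 0" and j: "3 \<le> j" "j \<le> q + 1" and ab: "a \<le> b"
  shows "((b - a) ^ j * exp (- \<beta> * D t / \<epsilon>))\<^sup>2 \<le> (C0 * \<rho>) ^ (2 * j) * \<epsilon> ^ (2 * j - 4) * (exp (- \<beta> * D t / \<epsilon>) / \<epsilon> + C\<kappa>)"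
proof -
  define f where "f = exp (- \<beta> * D t * (1 / \<epsilon> - 1 / s))"
  have "- \<beta> * D t / \<epsilon> = - \<beta> * D t / s + - \<beta> * D t * (1 / \<epsilon> - 1 / s)" by (simp add: right_diff_distrib)
  then have "exp (- \<beta> * D t / \<epsilon>) = exp (- \<beta> * D t / s) * f" by (simp only: f_def exp_add)
  then have "(b - a) ^ j * exp (- \<beta> * D t / \<epsilon>) = ((b - a) ^ j * exp (- \<beta> * D t / s)) * f" by simp
  also have "\<dots> \<le> (s ^ j * (C0 * \<rho>) ^ j) * f"
    by (intro mult_right_mono exp_resolved[OF r s_pos t j(2) ab]) (simp add: f_def)
  finally have "((b - a) ^ j * exp (- \<beta> * D t / \<epsilon>))\<^sup>2 \<le> ((s ^ j * (C0 * \<rho>) ^ j) * f)\<^sup>2"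
    using ab by (intro power_mono) auto
  also have "\<dots> = (C0 * \<rho>) ^ (2 * j) * ((s ^ j)\<^sup>2 * f\<^sup>2)"
    by (simp add: power_mult_distrib power_mult[symmetric] mult.commute mult.left_commute)
  also have "\<dots> \<le> (C0 * \<rho>) ^ (2 * j) * (\<epsilon> ^ (2 * j - 5) * (\<epsilon> * (exp (- \<beta> * D t / \<epsilon>) / \<epsilon> + C\<kappa>)))"
    unfolding f_def using exp_inner_remainder[OF t(2)] s_power_le[OF j] \<epsilon> C0_pos \<rho>_pos
    by (intro mult_left_mono mult_mono) auto
  also have "\<epsilon> ^ (2 * j - 5) * (\<epsilon> * (exp (- \<beta> * D t / \<epsilon>) / \<epsilon> + C\<kappa>)) = \<epsilon> ^ (2 * j - 4) * (exp (- \<beta> * D t / \<epsilon>) / \<epsilon> + C\<kappa>)"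
  proof -
    have "2 * j - 4 = Suc (2 * j - 5)" using j by simp
    then show ?thesis by simp
  qed
  finally show ?thesis by (simp add: mult.assoc)
qed

text \<open>A peak of height \<open>1 / \<epsilon>\<close> and width \<epsilon> at 1. The constant 1
  lets bounds without a peak be expressed by the same weight.\<close>

definition G :: "real \<Rightarrow> real" where "G t = 1 + exp (- \<beta> * \<bar>1 - t\<bar> / \<epsilon>) / \<epsilon>"

lemma G_ge_1: "G t \<ge> 1" using \<epsilon> by (simp add: G_def)

lemma G_continuous: "continuous_on A G"
  unfolding G_def[abs_def] using \<epsilon> by (intro continuous_intros) auto

lemma G_integrable: "integrable (Ioo a b) G"
  by (intro integrable_Ioo_continuous G_continuous)

lemma integral_G_ge: "a \<le> b \<Longrightarrow> b - a \<le> integral\<^sup>L (Ioo a b) G"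
proof -
  assume "a \<le> b"
  have "integral\<^sup>L (Ioo a b) (\<lambda>x. 1) \<le> integral\<^sup>L (Ioo a b) G"
    using G_ge_1 finite_measure.integrable_const[OF finite_measure_Ioo]
    by (intro integral_mono_AE G_integrable) auto
  then show ?thesis using \<open>a \<le> b\<close> by simp
qed

text \<open>With the distance \<open>\<bar>1 - t\<bar>\<close> resolved on either side of 1 there is
  an explicit primitive; the peak contributes at most \<open>1 / \<beta>\<close> on each
  side.\<close>

lemma integral_G_le: "integral\<^sup>L (Ioo 0 2) G \<le> 2 + 2 / \<beta>"
proof -
  have e: "integral\<^sup>L (Ioo a b) G = P b - P a" if "a \<le> b" and
    D: "\<And>t. a < t \<Longrightarrow> t < b \<Longrightarrow> (P has_real_derivative G t) (at t)" and c: "continuous_on {a..b} P" for a b P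
  proof -
    have "L2_primitive a b P G"
      using that by (intro classical_imp_primitive[of a b "{}"] square_integrable_continuous G_continuous) auto
    then show ?thesis using L2_primitive_diff[of a b P G a b] that(1) by simp
  qed
  have "integral\<^sup>L (Ioo 0 1) G = (1 + exp (- \<beta> * (1 - 1) / \<epsilon>) / \<beta>) - (0 + exp (- \<beta> * (1 - 0) / \<epsilon>) / \<beta>)"
  proof (rule e[of 0 1 "\<lambda>t. t + exp (- \<beta> * (1 - t) / \<epsilon>) / \<beta>"])
    fix t :: real assume "0 < t" "t < 1"
    then show "((\<lambda>t. t + exp (- \<beta> * (1 - t) / \<epsilon>) / \<beta>) has_real_derivative G t) (at t)"
      using \<beta> \<epsilon> unfolding G_def by (auto intro!: derivative_eq_intros simp: field_simps)
  qed (use \<beta> \<epsilon> in \<open>auto intro!: continuous_intros\<close>)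
  also have "\<dots> \<le> 1 + 1 / \<beta>" using \<beta> by simp
  finally have 1: "integral\<^sup>L (Ioo 0 1) G \<le> 1 + 1 / \<beta>" .
  have "integral\<^sup>L (Ioo 1 2) G = (2 - exp (- \<beta> * (2 - 1) / \<epsilon>) / \<beta>) - (1 - exp (- \<beta> * (1 - 1) / \<epsilon>) / \<beta>)"
  proof (rule e[of 1 2 "\<lambda>t. t - exp (- \<beta> * (t - 1) / \<epsilon>) / \<beta>"])
    fix t :: real assume "1 < t" "t < 2"
    then show "((\<lambda>t. t - exp (- \<beta> * (t - 1) / \<epsilon>) / \<beta>) has_real_derivative G t) (at t)"
      using \<beta> \<epsilon> unfolding G_def by (auto intro!: derivative_eq_intros simp: field_simps)
  qed (use \<beta> \<epsilon> in \<open>auto intro!: continuous_intros\<close>)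
  also have "\<dots> \<le> 1 + 1 / \<beta>" using \<beta> by simp
  finally have 2: "integral\<^sup>L (Ioo 1 2) G \<le> 1 + 1 / \<beta>" .
  have "integral\<^sup>L (Ioo 0 2) G = integral\<^sup>L (Ioo 0 1) G + integral\<^sup>L (Ioo 1 2) G"
    by (rule integral_Ioo_combine[OF G_integrable]) auto
  then show ?thesis using 1 2 by (simp add: field_simps)
qed

text \<open>One factor for each source of a constant. All factors except \<open>K\<^sup>2\<close>
  are at least one, so every case of \<open>layer_component\<close> is covered by replacing the
  factors foreign to it by one.\<close>

definition CF :: real where
  "CF = K\<^sup>2 * (1 + C\<kappa>) * (1 + C0) ^ (2 * q + 2) * (1 + K)\<^sup>2 * (1 + 2 / \<beta>)\<^sup>2"

lemma CF_factor:
  assumes "0 \<le> A" "A \<le> (1 + C\<kappa>)" "0 \<le> B" "B \<le> (1 + C0) ^ (2 * q + 2)" "0 \<le> C" "C \<le> (1 + K)\<^sup>2" "0 \<le> D" "D \<le> (1 + 2 / \<beta>)\<^sup>2"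
  shows "K\<^sup>2 * A * B * C * D \<le> CF"
  unfolding CF_def using assms C\<kappa>_pos C0_pos K_pos by (intro mult_mono mult_nonneg_nonneg) auto

lemma CF_factors_ge_1: "1 \<le> (1 + C0) ^ (2 * q + 2)" "1 \<le> (1 + K)\<^sup>2" "1 \<le> (1 + 2 / \<beta>)\<^sup>2"
  by (rule one_le_power, use C0_pos K_pos \<beta> in simp)+

lemma CF_ge_K2: "K\<^sup>2 \<le> CF"
proof -
  have "K\<^sup>2 * 1 * 1 * 1 * 1 \<le> CF" using CF_factors_ge_1 C\<kappa>_pos by (intro CF_factor) auto
  then show ?thesis by simp
qed

lemma CF_pos: "CF > 0" using CF_ge_K2 K_pos by (smt (verit) zero_less_power)

lemma C0_\<rho>_power: assumes "j \<le> q + 1" shows "(C0 * \<rho>) ^ (2 * j) \<le> (1 + C0) ^ (2 * q + 2) * R ^ (2 * j)"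
proof -
  have "(C0 * \<rho>) ^ (2 * j) \<le> (1 + C0) ^ (2 * j) * R ^ (2 * j)"
    unfolding power_mult_distrib using C0_pos \<rho>_pos R_ge_\<rho> by (intro mult_mono power_mono) auto
  also have "\<dots> \<le> (1 + C0) ^ (2 * q + 2) * R ^ (2 * j)"
    using assms C0_pos R_pos by (intro mult_right_mono power_increasing) auto
  finally show ?thesis .
qed

text \<open>For \<open>j = q\<close> two powers of \<rho> are left over and are bounded through
  \<open>\<rho> \<le> K\<close>.\<close>

lemma \<rho>_power: assumes "q \<le> j" "j \<le> q + 1" shows "\<rho> ^ (2 * (q + 1)) \<le> (1 + K)\<^sup>2 * R ^ (2 * j)"
proof -
  have "\<rho> ^ (2 * (q + 1)) = \<rho> ^ (2 * (q + 1 - j)) * \<rho> ^ (2 * j)"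
  proof -
    have "2 * (q + 1) = 2 * (q + 1 - j) + 2 * j" using assms by simp
    then show ?thesis by (simp only: power_add)
  qed
  also have "\<dots> \<le> (1 + K)\<^sup>2 * R ^ (2 * j)"
  proof (intro mult_mono power_mono R_ge_\<rho>)
    have "\<rho> ^ (2 * (q + 1 - j)) \<le> (1 + K) ^ (2 * (q + 1 - j))" using \<rho>_le \<rho>_pos by (intro power_mono) auto
    also have "\<dots> \<le> (1 + K) ^ 2" using assms K_pos by (intro power_increasing) auto
    finally show "\<rho> ^ (2 * (q + 1 - j)) \<le> (1 + K)\<^sup>2" .
  qed (use \<rho>_pos in auto)
  finally show ?thesis .
qed

text \<open>In the first two alternatives a polynomial comes from \<open>chain_component\<close>, in
  the last two it is zero. The conditions on \<open>e\<close> make the total power of \<epsilon>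
  nonnegative: resolution on the scale \<epsilon> contributes \<open>j\<close> powers, resolution on
  the scale \<open>s\<close> only \<open>j - 2\<close> besides \<open>G\<close>; at distance
  \<open>lam\<close> the derivative \<open>F 1\<close> needs \<open>e \<ge> 1\<close>, while at
  distance \<open>3/4\<close> the exponential supplies the missing power.\<close>

lemma layer_component:
  assumes ab: "a < b" "b - a \<le> 1" and F: "\<And>k. k \<le> q \<Longrightarrow> has_weak_deriv a b (F k) (F (Suc k))"
    and bd: "\<And>k t. k \<le> q + 1 \<Longrightarrow> a < t \<Longrightarrow> t < b \<Longrightarrow> \<bar>F k t\<bar> \<le> K * \<epsilon> powi (e - int k) * exp (- \<beta> * D t / \<epsilon>)"
    and D: "\<And>t. t \<in> {a..b} \<Longrightarrow> 0 \<le> D t" and j: "q \<le> j" "j \<le> q + 1" and e: "e \<ge> int (q + 1) - int j"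
    and alt: "resolved \<epsilon> D a b \<or>
      (resolved s D a b \<and> e \<ge> int (q + 3) - int j \<and> (\<forall>t\<in>{a..b}. D t = \<bar>1 - t\<bar>)) \<or>
      ((\<forall>t\<in>{a..b}. lam \<le> D t) \<and> e \<ge> 1) \<or> (\<forall>t\<in>{a..b}. 3/4 \<le> D t)"
  shows "\<exists>p. degree p \<le> q - 1 \<and>
     (b - a) ^ (2 * (j - q)) * L2_sq a b (\<lambda>t. F 1 t - poly p t) \<le> CF * R ^ (2 * j) * integral\<^sup>L (Ioo a b) G"
proof -
  have j3: "3 \<le> j" using j q by simp
  have chain: ?thesis if Q: "\<And>t. a < t \<Longrightarrow> t < b \<Longrightarrow> ((b - a) ^ j * F (Suc q) t)\<^sup>2 \<le> CF * R ^ (2 * j) * G t"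
    using chain_component[OF ab(1) _ F j(1) _ Q] q G_integrable by simp
  have zero: ?thesis if Q: "\<And>t. a < t \<Longrightarrow> t < b \<Longrightarrow> (F 1 t)\<^sup>2 \<le> CF * R ^ (2 * j)"
  proof -
    have si: "square_integrable a b (F 1)" using F[of 1] q by (simp add: has_weak_deriv_def)
    have "L2_sq a b (F 1) \<le> integral\<^sup>L (Ioo a b) (\<lambda>t. CF * R ^ (2 * j))"
      using Q finite_measure.integrable_const[OF finite_measure_Ioo] by (intro L2_sq_le_integral si) auto
    also have "\<dots> = CF * R ^ (2 * j) * (b - a)" using ab by simp
    also have "\<dots> \<le> CF * R ^ (2 * j) * integral\<^sup>L (Ioo a b) G"
      using ab CF_pos R_pos by (intro mult_left_mono integral_G_ge) auto
    finally have "L2_sq a b (F 1) \<le> CF * R ^ (2 * j) * integral\<^sup>L (Ioo a b) G" .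
    \<comment> \<open>As \<open>b - a \<le> 1\<close>, the weight is at most one.\<close>
    moreover have "(b - a) ^ (2 * (j - q)) * L2_sq a b (F 1) \<le> 1 * L2_sq a b (F 1)"
      using ab by (intro mult_right_mono power_le_one) auto
    ultimately show ?thesis by (intro exI[of _ 0]) auto
  qed
  have K2: "\<bar>X\<bar> \<le> K * Y \<Longrightarrow> X\<^sup>2 \<le> K\<^sup>2 * Y\<^sup>2" for X Y :: real
    by (metis abs_ge_zero power2_abs power_mono power_mult_distrib)
  have pe: "0 < \<epsilon> powi i" for i using \<epsilon> by simp
  have nn: "0 \<le> K * \<epsilon> powi i" for i using pe[of i] K_pos by simp
  from alt consider "resolved \<epsilon> D a b" | "resolved s D a b" "e \<ge> int (q + 3) - int j" "\<forall>t\<in>{a..b}. D t = \<bar>1 - t\<bar>"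
    | "\<forall>t\<in>{a..b}. lam \<le> D t" "e \<ge> 1" | "\<forall>t\<in>{a..b}. 3/4 \<le> D t" by blast
  then show ?thesis
  proof cases
    case 1
    show ?thesis
    proof (rule chain)
      fix t assume t: "a < t" "t < b"
      have "\<bar>(b - a) ^ j * F (Suc q) t\<bar> \<le> (b - a) ^ j * (K * \<epsilon> powi (e - int (Suc q)) * exp (- \<beta> * D t / \<epsilon>))"
        using bd[of "Suc q" t] t ab by (simp add: abs_mult)
      also have "\<dots> = K * \<epsilon> powi (e - int (Suc q)) * ((b - a) ^ j * exp (- \<beta> * D t / \<epsilon>))" by simp
      also have "\<dots> \<le> K * \<epsilon> powi (e - int (Suc q)) * (\<epsilon> ^ j * (C0 * \<rho>) ^ j)"
        using t D j pe K_pos less_imp_le[OF ab(1)] by (intro mult_left_mono exp_resolved[OF 1 \<epsilon>] nn) auto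
      also have "\<dots> = K * ((\<epsilon> powi (e - int (Suc q)) * \<epsilon> ^ j) * (C0 * \<rho>) ^ j)" by (simp only: mult_ac)
      also have "\<dots> \<le> K * (1 * (C0 * \<rho>) ^ j)"
        using e \<epsilon> \<epsilon>1 K_pos C0_pos \<rho>_pos by (intro mult_left_mono mult_right_mono power_powi_le_1) auto
      finally have "((b - a) ^ j * F (Suc q) t)\<^sup>2 \<le> K\<^sup>2 * ((C0 * \<rho>) ^ j)\<^sup>2" by (intro K2) simp
      also have "\<dots> \<le> K\<^sup>2 * ((1 + C0) ^ (2 * q + 2) * R ^ (2 * j))"
        using C0_\<rho>_power[OF j(2)] by (intro mult_left_mono) (auto simp: power_mult[symmetric] mult.commute)
      also have "\<dots> \<le> CF * R ^ (2 * j)"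
        using CF_factor[of 1 "(1 + C0) ^ (2 * q + 2)" 1 1] C\<kappa>_pos C0_pos K_pos \<beta> R_pos
        by (simp add: mult.assoc[symmetric] one_le_power mult_right_mono)
      also have "\<dots> \<le> CF * R ^ (2 * j) * G t" using G_ge_1[of t] CF_pos R_pos by simp
      finally show "((b - a) ^ j * F (Suc q) t)\<^sup>2 \<le> CF * R ^ (2 * j) * G t" .
    qed
  next
    case 2
    show ?thesis
    proof (rule chain)
      fix t assume t: "a < t" "t < b"
      have "\<bar>(b - a) ^ j * F (Suc q) t\<bar> \<le> (b - a) ^ j * (K * \<epsilon> powi (e - int (Suc q)) * exp (- \<beta> * D t / \<epsilon>))"
        using bd[of "Suc q" t] t ab by (simp add: abs_mult)
      then have "\<bar>(b - a) ^ j * F (Suc q) t\<bar> \<le> K * (\<epsilon> powi (e - int (Suc q)) * ((b - a) ^ j * exp (- \<beta> * D t / \<epsilon>)))"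
        by (simp add: mult_ac)
      then have "((b - a) ^ j * F (Suc q) t)\<^sup>2 \<le> K\<^sup>2 * (\<epsilon> powi (e - int (Suc q)) * ((b - a) ^ j * exp (- \<beta> * D t / \<epsilon>)))\<^sup>2"
        by (rule K2)
      also have "\<dots> = K\<^sup>2 * ((\<epsilon> powi (e - int (Suc q)))\<^sup>2 * ((b - a) ^ j * exp (- \<beta> * D t / \<epsilon>))\<^sup>2)"
        by (simp add: power_mult_distrib)
      also have "\<dots> \<le> K\<^sup>2 * ((\<epsilon> powi (e - int (Suc q)))\<^sup>2 * ((C0 * \<rho>) ^ (2 * j) * \<epsilon> ^ (2 * j - 4) * (exp (- \<beta> * D t / \<epsilon>) / \<epsilon> + C\<kappa>)))"
        using t D j3 j less_imp_le[OF ab(1)] by (intro mult_left_mono exp_inner 2) auto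
      also have "\<dots> = K\<^sup>2 * (((\<epsilon> powi (e - int (Suc q)) * \<epsilon> ^ (j - 2))\<^sup>2) * ((C0 * \<rho>) ^ (2 * j) * (exp (- \<beta> * D t / \<epsilon>) / \<epsilon> + C\<kappa>)))"
      proof -
        have "2 * j - 4 = (j - 2) * 2" by simp
        then have "\<epsilon> ^ (2 * j - 4) = (\<epsilon> ^ (j - 2))\<^sup>2" by (simp only: power_mult)
        then show ?thesis by (simp only: power_mult_distrib mult_ac)
      qed
      also have "\<dots> \<le> K\<^sup>2 * (1\<^sup>2 * ((C0 * \<rho>) ^ (2 * j) * (exp (- \<beta> * D t / \<epsilon>) / \<epsilon> + C\<kappa>)))"
      proof (intro mult_left_mono mult_right_mono power_mono power_powi_le_1)
        show "0 \<le> e - int (Suc q) + int (j - 2)" using 2(2) j3 by (simp add: of_nat_diff)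
      qed (use \<epsilon> \<epsilon>1 C\<kappa>_pos C0_pos \<rho>_pos in \<open>auto simp: less_imp_le\<close>)
      also have "\<dots> \<le> K\<^sup>2 * (1\<^sup>2 * (((1 + C0) ^ (2 * q + 2) * R ^ (2 * j)) * ((1 + C\<kappa>) * G t)))"
      proof (intro mult_left_mono mult_mono C0_\<rho>_power[OF j(2)])
        have "exp (- \<beta> * D t / \<epsilon>) / \<epsilon> = G t - 1" using 2(3) t by (simp add: G_def)
        moreover have "C\<kappa> \<le> C\<kappa> * G t" using G_ge_1[of t] C\<kappa>_pos by simp
        ultimately show "exp (- \<beta> * D t / \<epsilon>) / \<epsilon> + C\<kappa> \<le> (1 + C\<kappa>) * G t" by (simp add: distrib_right)
      qed (use \<epsilon> C\<kappa>_pos C0_pos \<rho>_pos R_pos in auto)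
      also have "\<dots> = (K\<^sup>2 * (1 + C\<kappa>) * (1 + C0) ^ (2 * q + 2) * 1 * 1) * R ^ (2 * j) * G t" by (simp add: mult_ac)
      also have "\<dots> \<le> CF * R ^ (2 * j) * G t"
        using CF_factors_ge_1 C\<kappa>_pos C0_pos K_pos \<beta> R_pos G_ge_1[of t]
        by (intro mult_right_mono CF_factor) (auto intro: one_le_power)
      finally show "((b - a) ^ j * F (Suc q) t)\<^sup>2 \<le> CF * R ^ (2 * j) * G t" .
    qed
  next
    case 3
    show ?thesis
    proof (rule zero)
      fix t assume t: "a < t" "t < b"
      have "\<bar>F 1 t\<bar> \<le> K * \<epsilon> powi (e - 1) * exp (- \<beta> * D t / \<epsilon>)" using bd[of 1 t] t by simp
      also have "\<dots> \<le> K * 1 * \<rho> ^ (q + 1)"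
        using 3 t K_pos pe power_powi_le_1[OF \<epsilon> \<epsilon>1, of "e - 1" 0]
        by (intro mult_mono exp_far) (auto simp: less_imp_le)
      finally have "(F 1 t)\<^sup>2 \<le> K\<^sup>2 * (\<rho> ^ (q + 1))\<^sup>2" by (intro K2) simp
      also have "(\<rho> ^ (q + 1))\<^sup>2 = \<rho> ^ (2 * (q + 1))" by (simp only: power_mult[symmetric] mult.commute)
      also have "K\<^sup>2 * \<dots> \<le> K\<^sup>2 * ((1 + K)\<^sup>2 * R ^ (2 * j))" using \<rho>_power[OF j] by (intro mult_left_mono) auto
      also have "\<dots> = (K\<^sup>2 * 1 * 1 * (1 + K)\<^sup>2 * 1) * R ^ (2 * j)" by simp
      also have "\<dots> \<le> CF * R ^ (2 * j)"
        using CF_factors_ge_1 C\<kappa>_pos C0_pos K_pos \<beta> R_pos by (intro mult_right_mono CF_factor) (auto intro: one_le_power)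
      finally show "(F 1 t)\<^sup>2 \<le> CF * R ^ (2 * j)" .
    qed
  next
    case 4
    show ?thesis
    proof (rule zero)
      fix t assume t: "a < t" "t < b"
      have e0: "e \<ge> 0" using e j by simp
      have "\<bar>F 1 t\<bar> \<le> K * \<epsilon> powi (e - 1) * exp (- \<beta> * D t / \<epsilon>)" using bd[of 1 t] t by simp
      also have "\<dots> \<le> K * \<epsilon> powi (e - 1) * (2 / \<beta> * \<epsilon> * \<rho> ^ (q + 1))"
        using 4 t by (intro mult_left_mono exp_very_far nn) auto
      also have "\<dots> = K * ((\<epsilon> powi (e - 1) * \<epsilon> ^ 1) * (2 / \<beta> * \<rho> ^ (q + 1)))" by simp
      also have "\<dots> \<le> K * (1 * (2 / \<beta> * \<rho> ^ (q + 1)))"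
        using e0 \<epsilon> \<epsilon>1 K_pos \<beta> \<rho>_pos by (intro mult_left_mono mult_right_mono power_powi_le_1) auto
      finally have "(F 1 t)\<^sup>2 \<le> K\<^sup>2 * (2 / \<beta> * \<rho> ^ (q + 1))\<^sup>2" by (intro K2) simp
      also have "(2 / \<beta> * \<rho> ^ (q + 1))\<^sup>2 = (2 / \<beta>)\<^sup>2 * \<rho> ^ (2 * (q + 1))"
        by (simp only: power_mult_distrib power_mult[symmetric] mult.commute[of "q + 1"])
      also have "K\<^sup>2 * \<dots> \<le> K\<^sup>2 * ((2 / \<beta>)\<^sup>2 * ((1 + K)\<^sup>2 * R ^ (2 * j)))" using \<rho>_power[OF j] by (intro mult_left_mono) auto
      also have "\<dots> = (K\<^sup>2 * 1 * 1 * (1 + K)\<^sup>2 * (2 / \<beta>)\<^sup>2) * R ^ (2 * j)" by simp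
      also have "\<dots> \<le> CF * R ^ (2 * j)"
        using CF_factors_ge_1 C\<kappa>_pos C0_pos K_pos \<beta> R_pos
        by (intro mult_right_mono CF_factor) (auto intro: one_le_power power_mono)
      finally show "(F 1 t)\<^sup>2 \<le> CF * R ^ (2 * j)" .
    qed
  qed
qed

end

section \<open>Interpolation error of a decomposed solution\<close>

lemma derivs_upto_weak_deriv:
  assumes D: "derivs_upto n A F" and A: "open A" "{a<..<b} \<subseteq> A" and ab: "a < b" and k: "k < n"
    and bd: "\<And>k t. k \<le> n \<Longrightarrow> a < t \<Longrightarrow> t < b \<Longrightarrow> \<bar>F k t\<bar> \<le> B k"
  shows "has_weak_deriv a b (F k) (F (Suc k))"
proof (rule classical_imp_weak_deriv[OF ab])
  fix t assume t: "t \<in> {a<..<b}"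
  then have "(F k has_real_derivative F (Suc k) t) (at t within A)"
    using D A k by (auto simp: derivs_upto_def)
  then show "(F k has_real_derivative F (Suc k) t) (at t)" using t A by (metis at_within_open subsetD)
  show "\<bar>F k t\<bar> \<le> B k" "\<bar>F (Suc k) t\<bar> \<le> B (Suc k)" using bd t k by auto
qed

lemma poly_approx_sum4:
  fixes f1 f2 f3 f4 :: "real \<Rightarrow> real"
  assumes si: "square_integrable a b v" "square_integrable a b f1" "square_integrable a b f2"
      "square_integrable a b f3" "square_integrable a b f4"
    and eq: "AE t in Ioo a b. v t = f1 t + f2 t + f3 t + f4 t" and h: "h \<ge> 0"
    and "\<exists>p. degree p \<le> n \<and> h * L2_sq a b (\<lambda>t. f1 t - poly p t) \<le> X1"
    and "\<exists>p. degree p \<le> n \<and> h * L2_sq a b (\<lambda>t. f2 t - poly p t) \<le> X2"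
    and "\<exists>p. degree p \<le> n \<and> h * L2_sq a b (\<lambda>t. f3 t - poly p t) \<le> X3"
    and "\<exists>p. degree p \<le> n \<and> h * L2_sq a b (\<lambda>t. f4 t - poly p t) \<le> X4"
  shows "\<exists>p. degree p \<le> n \<and> h * L2_sq a b (\<lambda>t. v t - poly p t) \<le> 4 * (X1 + X2 + X3 + X4)"
proof -
  obtain p1 p2 p3 p4 where p: "degree p1 \<le> n" "degree p2 \<le> n" "degree p3 \<le> n" "degree p4 \<le> n"
    and X: "h * L2_sq a b (\<lambda>t. f1 t - poly p1 t) \<le> X1" "h * L2_sq a b (\<lambda>t. f2 t - poly p2 t) \<le> X2"
      "h * L2_sq a b (\<lambda>t. f3 t - poly p3 t) \<le> X3" "h * L2_sq a b (\<lambda>t. f4 t - poly p4 t) \<le> X4"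
    using assms(8-11) by blast
  define g1 g2 g3 g4 where "g1 t = f1 t - poly p1 t" and "g2 t = f2 t - poly p2 t"
    and "g3 t = f3 t - poly p3 t" and "g4 t = f4 t - poly p4 t" for t
  have sg: "square_integrable a b g1" "square_integrable a b g2" "square_integrable a b g3" "square_integrable a b g4"
    unfolding g1_def[abs_def] g2_def[abs_def] g3_def[abs_def] g4_def[abs_def]
    by (intro square_integrable_diff si poly_square_integrable)+
  have "L2_sq a b (\<lambda>t. v t - poly (p1 + p2 + p3 + p4) t) = L2_sq a b (\<lambda>t. (g1 t + g2 t) + (g3 t + g4 t))"
    using eq by (intro L2_sq_cong_AE square_integrable_diff si poly_square_integrable square_integrable_add sg)
      (auto elim!: eventually_mono simp: g1_def g2_def g3_def g4_def)
  also have "\<dots> \<le> 2 * L2_sq a b (\<lambda>t. g1 t + g2 t) + 2 * L2_sq a b (\<lambda>t. g3 t + g4 t)"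
    by (intro L2_sq_add_le square_integrable_add sg)
  also have "\<dots> \<le> 2 * (2 * L2_sq a b g1 + 2 * L2_sq a b g2) + 2 * (2 * L2_sq a b g3 + 2 * L2_sq a b g4)"
    by (intro add_mono mult_left_mono L2_sq_add_le sg) auto
  finally have "h * L2_sq a b (\<lambda>t. v t - poly (p1 + p2 + p3 + p4) t)
      \<le> h * (2 * (2 * L2_sq a b g1 + 2 * L2_sq a b g2) + 2 * (2 * L2_sq a b g3 + 2 * L2_sq a b g4))"
    using h by (rule mult_left_mono)
  also have "\<dots> = 4 * (h * L2_sq a b g1 + h * L2_sq a b g2 + h * L2_sq a b g3 + h * L2_sq a b g4)" by (simp add: algebra_simps)
  also have "\<dots> \<le> 4 * (X1 + X2 + X3 + X4)"
    unfolding g1_def[abs_def] g2_def[abs_def] g3_def[abs_def] g4_def[abs_def]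
    by (intro mult_left_mono add_mono X) simp
  finally show ?thesis using p by (intro exI[of _ "p1 + p2 + p3 + p4"]) (auto intro!: degree_add_le)
qed

text \<open>Stability in the maximum norm asks for a pointwise bound; this is the Taylor polynomial
  at the left end, with the factorial in the remainder dropped.\<close>

lemma taylor_poly_approx:
  assumes D: "derivs_upto (Suc n) A F" and A: "open A" "{a..b} \<subseteq> A" and bd: "\<And>t. t \<in> {a..b} \<Longrightarrow> \<bar>F (Suc n) t\<bar> \<le> B"
  obtains P where "degree P \<le> n" "\<And>t. t \<in> {a..b} \<Longrightarrow> \<bar>F 0 t - poly P t\<bar> \<le> B * (b - a) ^ Suc n"
proof
  define P where "P = (\<Sum>i<Suc n. smult (F i a / fact i) ([:- a, 1:] ^ i))"
  show "degree P \<le> n"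
    unfolding P_def
  proof (rule degree_sum_le)
    fix i assume "i \<in> {..<Suc n}"
    then show "degree (smult (F i a / fact i) ([:- a, 1:] ^ i)) \<le> n"
      using degree_smult_le[of "F i a / fact i" "[:- a, 1:] ^ i"] by (simp add: degree_linear_power)
  qed simp
  fix t assume t: "t \<in> {a..b}"
  have Pt: "poly P t = (\<Sum>i<Suc n. F i a / fact i * (t - a) ^ i)"
    by (simp add: P_def poly_sum poly_power del: sum.lessThan_Suc)
  have B0: "B \<ge> 0" using bd[OF t] by linarith
  show "\<bar>F 0 t - poly P t\<bar> \<le> B * (b - a) ^ Suc n"
  proof (cases "t = a")
    case True
    have "poly P t = (\<Sum>i<Suc n. if i = 0 then F 0 a else 0)"
      unfolding Pt using True by (intro sum.cong) (auto simp: power_0_left)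
    then have "poly P t = F 0 a" by simp
    then show ?thesis using True B0 t by simp
  next
    case False
    then have at: "a < t" using t by simp
    have der: "DERIV (F i) y :> F (Suc i) y" if "i < Suc n" "a \<le> y" "y \<le> t" for i y
    proof -
      have y: "y \<in> A" using that t A by auto
      then have "(F i has_real_derivative F (Suc i) y) (at y within A)" using D that by (auto simp: derivs_upto_def)
      then show ?thesis using A y by (metis at_within_open)
    qed
    obtain y where y: "a < y" "y < t" "F 0 t = (\<Sum>i<Suc n. F i a / fact i * (t - a) ^ i) + F (Suc n) y / fact (Suc n) * (t - a) ^ Suc n"
      using Taylor_up[of "Suc n" F "F 0" a t a] der at by auto
    have "\<bar>F 0 t - poly P t\<bar> = \<bar>F (Suc n) y\<bar> / fact (Suc n) * (t - a) ^ Suc n"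
      using y at by (simp add: Pt abs_mult abs_divide del: sum.lessThan_Suc fact_Suc power_Suc)
    also have "\<dots> \<le> B / 1 * (b - a) ^ Suc n"
      using bd[of y] y t at B0 fact_ge_1[of "Suc n", where 'a=real]
      by (intro mult_mono frac_le power_mono) (auto simp del: fact_Suc)
    finally show ?thesis by simp
  qed
qed

text \<open>The components behind the existential quantifiers are fixed here. The order of the
  boundary condition is called \<open>mu\<close>, as \<open>m\<close> stands for
  \<open>N div 8\<close> in the mesh.\<close>

locale decomposed_solution = S_mesh +
  fixes mu :: nat and u w u' w' :: "real \<Rightarrow> real" and S E1 E2 W1 W2 tS tE1 tE2 tW1 tW2 :: "nat \<Rightarrow> real \<Rightarrow> real"
  assumes mu: "mu \<ge> 1"
    and u: "L2_primitive 0 2 u u'" and w: "L2_primitive 0 2 w w'"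
    and u_eq: "\<And>t. t \<in> {0<..<2} \<Longrightarrow> u t = S 0 t + E1 0 t + E2 0 t + W1 0 t * indicator {0<..<1} t + W2 0 t * indicator {1<..<2} t"
    and w_eq: "\<And>t. t \<in> {0<..<2} \<Longrightarrow> w t = tS 0 t + tE1 0 t + tE2 0 t + tW1 0 t * indicator {0<..<1} t + tW2 0 t * indicator {1<..<2} t"
    and S_weak: "\<And>k. k \<le> q \<Longrightarrow> has_weak_deriv 0 1 (S k) (S (Suc k))" "\<And>k. k \<le> q \<Longrightarrow> has_weak_deriv 1 2 (S k) (S (Suc k))"
    and derivs: "derivs_upto (q + 1) {0<..<2} E1" "derivs_upto (q + 1) {0<..<2} E2"
      "derivs_upto (q + 1) {0<..<1} W1" "derivs_upto (q + 1) {1<..<2} W2"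
      "derivs_upto (q + 1) ({0<..<2} - {1}) tS"
      "derivs_upto (q + 1) {0<..<2} tE1" "derivs_upto (q + 1) {0<..<2} tE2"
      "derivs_upto (q + 1) {0<..<1} tW1" "derivs_upto (q + 1) {1<..<2} tW2"
    and S_bd: "L2_norm 0 1 (S (q + 1)) + L2_norm 1 2 (S (q + 1)) \<le> K"
    and E_bd: "\<And>k t. k \<le> q + 1 \<Longrightarrow> t \<in> {0<..<2} \<Longrightarrow>
       \<bar>E1 k t\<bar> \<le> K * \<epsilon> powi (int mu - int k) * exp (- \<beta> * t / \<epsilon>) \<and>
       \<bar>E2 k t\<bar> \<le> K * \<epsilon> powi (int mu - int k) * exp (- \<beta> * (2 - t) / \<epsilon>) \<and>
       \<bar>tE1 k t\<bar> \<le> K * \<epsilon> powi (int mu - 1 - int k) * exp (- \<beta> * t / \<epsilon>) \<and>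
       \<bar>tE2 k t\<bar> \<le> K * \<epsilon> powi (int mu - 1 - int k) * exp (- \<beta> * (2 - t) / \<epsilon>)"
    and tS_bd: "\<And>k t. k \<le> q + 1 \<Longrightarrow> t \<in> {0<..<2} - {1} \<Longrightarrow> \<bar>tS k t\<bar> \<le> K * \<epsilon>"
    and W1_bd: "\<And>k t. k \<le> q + 1 \<Longrightarrow> t \<in> {0<..<1} \<Longrightarrow>
       \<bar>W1 k t\<bar> \<le> K * \<epsilon> powi (3 - int k) * exp (- \<beta> * (1 - t) / \<epsilon>) \<and>
       \<bar>tW1 k t\<bar> \<le> K * \<epsilon> powi (2 - int k) * exp (- \<beta> * (1 - t) / \<epsilon>)"
    and W2_bd: "\<And>k t. k \<le> q + 1 \<Longrightarrow> t \<in> {1<..<2} \<Longrightarrow>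
       \<bar>W2 k t\<bar> \<le> K * \<epsilon> powi (3 - int k) * exp (- \<beta> * (t - 1) / \<epsilon>) \<and>
       \<bar>tW2 k t\<bar> \<le> K * \<epsilon> powi (2 - int k) * exp (- \<beta> * (t - 1) / \<epsilon>)"
begin

section \<open>Approximation on single cells\<close>

lemma layer_weak_deriv:
  assumes F: "derivs_upto (q + 1) A F" "open A" "{a<..<b} \<subseteq> A" and ab: "a < b"
    and bd: "\<And>k t. k \<le> q + 1 \<Longrightarrow> a < t \<Longrightarrow> t < b \<Longrightarrow> \<bar>F k t\<bar> \<le> K * \<epsilon> powi (e - int k) * exp (- \<beta> * D t / \<epsilon>)"
    and D: "\<And>t. t \<in> {a..b} \<Longrightarrow> 0 \<le> D t" and k: "k \<le> q"
  shows "has_weak_deriv a b (F k) (F (Suc k))"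
proof (rule derivs_upto_weak_deriv[OF F ab])
  show "k < q + 1" using k by simp
  fix k t assume kt: "k \<le> q + 1" "a < t" "t < b"
  have "K * \<epsilon> powi (e - int k) * exp (- \<beta> * D t / \<epsilon>) \<le> K * \<epsilon> powi (e - int k) * 1"
    using D[of t] kt \<beta> \<epsilon> K_pos by (intro mult_left_mono) (auto simp: divide_le_0_iff)
  then show "\<bar>F k t\<bar> \<le> K * \<epsilon> powi (e - int k)" using bd[OF kt] by simp
qed

lemma layer_cell:
  assumes F: "derivs_upto (q + 1) A F" "open A" "{a<..<b} \<subseteq> A" and ab: "a < b" "b - a \<le> 1"
    and bd: "\<And>k t. k \<le> q + 1 \<Longrightarrow> a < t \<Longrightarrow> t < b \<Longrightarrow> \<bar>F k t\<bar> \<le> K * \<epsilon> powi (e - int k) * exp (- \<beta> * D t / \<epsilon>)"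
    and D: "\<And>t. t \<in> {a..b} \<Longrightarrow> 0 \<le> D t" and j: "q \<le> j" "j \<le> q + 1" and e: "e \<ge> int (q + 1) - int j"
    and alt: "resolved \<epsilon> D a b \<or>
      (resolved s D a b \<and> e \<ge> int (q + 3) - int j \<and> (\<forall>t\<in>{a..b}. D t = \<bar>1 - t\<bar>)) \<or>
      ((\<forall>t\<in>{a..b}. lam \<le> D t) \<and> e \<ge> 1) \<or> (\<forall>t\<in>{a..b}. 3/4 \<le> D t)"
  shows "has_weak_deriv a b (F 0) (F 1)" "\<exists>p. degree p \<le> q - 1 \<and>
     (b - a) ^ (2 * (j - q)) * L2_sq a b (\<lambda>t. F 1 t - poly p t) \<le> CF * R ^ (2 * j) * integral\<^sup>L (Ioo a b) G"
proof -
  note wd = layer_weak_deriv[OF F ab(1) bd D]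
  show "has_weak_deriv a b (F 0) (F 1)" using wd[of 0] by simp
  show "\<exists>p. degree p \<le> q - 1 \<and>
     (b - a) ^ (2 * (j - q)) * L2_sq a b (\<lambda>t. F 1 t - poly p t) \<le> CF * R ^ (2 * j) * integral\<^sup>L (Ioo a b) G"
    by (rule layer_component[OF ab wd bd D j e alt])
qed

text \<open>A graded cell lies on one side of 1, so its right end \<open>b\<close> decides which
  inner layer component is active on it.\<close>

definition W :: "real \<Rightarrow> nat \<Rightarrow> real \<Rightarrow> real" where "W b = (if b \<le> 1 then W1 else W2)"
definition tW :: "real \<Rightarrow> nat \<Rightarrow> real \<Rightarrow> real" where "tW b = (if b \<le> 1 then tW1 else tW2)"

lemma cell_side:
  assumes "graded a b" "a < b"
  obtains A where "open A" "{a<..<b} \<subseteq> A" "derivs_upto (q + 1) A (W b)" "derivs_upto (q + 1) A (tW b)"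
    "A = (if b \<le> 1 then {0<..<1} else {1<..<2})"
proof -
  have "0 \<le> a" "b \<le> 2" "b \<le> 1 \<or> 1 \<le> a" using assms by (auto simp: graded_def)
  then show thesis using assms(2) derivs by (intro that[of "if b \<le> 1 then {0<..<1} else {1<..<2}"]) (auto simp: W_def tW_def)
qed

lemma W_bd:
  assumes "graded a b" "a < b" "k \<le> q + 1" "a < t" "t < b"
  shows "\<bar>W b k t\<bar> \<le> K * \<epsilon> powi (3 - int k) * exp (- \<beta> * \<bar>1 - t\<bar> / \<epsilon>)"
    "\<bar>tW b k t\<bar> \<le> K * \<epsilon> powi (2 - int k) * exp (- \<beta> * \<bar>1 - t\<bar> / \<epsilon>)"
proof -
  have g: "0 \<le> a" "b \<le> 2" "b \<le> 1 \<or> 1 \<le> a" using assms by (auto simp: graded_def)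
  have "\<bar>W b k t\<bar> \<le> K * \<epsilon> powi (3 - int k) * exp (- \<beta> * \<bar>1 - t\<bar> / \<epsilon>) \<and>
    \<bar>tW b k t\<bar> \<le> K * \<epsilon> powi (2 - int k) * exp (- \<beta> * \<bar>1 - t\<bar> / \<epsilon>)"
  proof (cases "b \<le> 1")
    case True then show ?thesis using W1_bd[of k t] g assms by (simp add: W_def tW_def)
  next
    case False
    then have "\<bar>1 - t\<bar> = t - 1" using g assms by auto
    then show ?thesis using W2_bd[of k t] g assms False by (simp add: W_def tW_def)
  qed
  then show "\<bar>W b k t\<bar> \<le> K * \<epsilon> powi (3 - int k) * exp (- \<beta> * \<bar>1 - t\<bar> / \<epsilon>)"
    "\<bar>tW b k t\<bar> \<le> K * \<epsilon> powi (2 - int k) * exp (- \<beta> * \<bar>1 - t\<bar> / \<epsilon>)" by auto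
qed

lemma u_w_cell_eq:
  assumes "graded a b" "a < b" "a < t" "t < b"
  shows "u t = S 0 t + E1 0 t + E2 0 t + W b 0 t" "w t = tS 0 t + tE1 0 t + tE2 0 t + tW b 0 t"
proof -
  have g: "0 \<le> a" "b \<le> 2" "b \<le> 1 \<or> 1 \<le> a" using assms by (auto simp: graded_def)
  show "u t = S 0 t + E1 0 t + E2 0 t + W b 0 t" "w t = tS 0 t + tE1 0 t + tE2 0 t + tW b 0 t"
    using u_eq[of t] w_eq[of t] g assms by (auto simp: W_def tW_def indicator_def)
qed

text \<open>Uniqueness of weak derivatives identifies the given representative with the sum of the
  derivatives of the components.\<close>

lemma weak_sum4_AE:
  assumes ab: "0 \<le> a" "a < b" "b \<le> 2" and v: "L2_primitive 0 2 v v'"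
    and f: "has_weak_deriv a b f1 g1" "has_weak_deriv a b f2 g2" "has_weak_deriv a b f3 g3" "has_weak_deriv a b f4 g4"
    and eq: "\<And>t. a < t \<Longrightarrow> t < b \<Longrightarrow> v t = f1 t + f2 t + f3 t + f4 t"
  shows "AE t in Ioo a b. v' t = g1 t + g2 t + g3 t + g4 t"
proof -
  have "has_weak_deriv a b (\<lambda>t. f1 t + f2 t + f3 t + f4 t) (\<lambda>t. g1 t + g2 t + g3 t + g4 t)"
    using ab f by (intro has_weak_deriv_add) auto
  then have 1: "has_weak_deriv a b v (\<lambda>t. g1 t + g2 t + g3 t + g4 t)"
    by (rule has_weak_deriv_cong) (simp add: eq)
  have "has_weak_deriv a b v v'"
    using ab by (intro L2_primitive_imp_weak_deriv L2_primitive_subset[OF v]) auto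
  from has_weak_deriv_unique[OF ab(2) this 1] show ?thesis .
qed

text \<open>Boundary layers have exponent \<open>mu \<ge> 1\<close>, so distance \<open>lam\<close>
  suffices where they are not resolved. The inner layer has exponent 3, which for
  \<open>j = q\<close> is exactly what resolution on the scale \<open>s\<close> demands. The smooth
  part only needs \<open>b - a \<le> C1 * R\<close>.\<close>

lemma u_cell:
  assumes g: "graded a b" and ab: "a < b" and j: "q \<le> j" "j \<le> q + 1"
  shows "\<exists>p. degree p \<le> q - 1 \<and> (b - a) ^ (2 * (j - q)) * L2_sq a b (\<lambda>t. u' t - poly p t) \<le>
    4 * R ^ (2 * j) * (C1 ^ (2 * j) * L2_sq a b (S (q + 1)) + 3 * CF * integral\<^sup>L (Ioo a b) G)"
proof -
  have gb: "0 \<le> a" "b \<le> 2" "b \<le> 1 \<or> 1 \<le> a" "b - a \<le> C1 * R" "b - a \<le> 1" using g by (auto simp: graded_def)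
  have sub: "{a<..<b} \<subseteq> {0<..<2}" using gb by auto
  define X where "X = CF * R ^ (2 * j) * integral\<^sup>L (Ioo a b) G"
  have S': "has_weak_deriv a b (S k) (S (Suc k))" if "k \<le> q" for k
    using gb(3) S_weak[OF that] has_weak_deriv_subset[of 0 1 _ _ a b] has_weak_deriv_subset[of 1 2 _ _ a b] gb(1,2) ab by auto
  have Ssi: "square_integrable a b (S (q + 1))" using S'[of q] by (simp add: has_weak_deriv_def)
  have "\<exists>p. degree p \<le> q - 1 \<and> (b - a) ^ (2 * (j - q)) * L2_sq a b (\<lambda>t. S 1 t - poly p t) \<le> integral\<^sup>L (Ioo a b) (\<lambda>t. (C1 * R) ^ (2 * j) * (S (q + 1) t)\<^sup>2)"
  proof (rule chain_component[where F=S and q=q and j=j, OF ab _ S' j(1)])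
    show "1 \<le> q" using q by simp
    show "integrable (Ioo a b) (\<lambda>t. (C1 * R) ^ (2 * j) * (S (q + 1) t)\<^sup>2)" using Ssi by (auto simp: square_integrable_iff)
    fix t
    have "((b - a) ^ j)\<^sup>2 \<le> ((C1 * R) ^ j)\<^sup>2" using gb ab by (intro power_mono) auto
    then show "((b - a) ^ j * S (Suc q) t)\<^sup>2 \<le> (C1 * R) ^ (2 * j) * (S (q + 1) t)\<^sup>2"
      by (simp add: power_mult_distrib power_even_eq mult_right_mono)
  qed
  then have cS: "\<exists>p. degree p \<le> q - 1 \<and> (b - a) ^ (2 * (j - q)) * L2_sq a b (\<lambda>t. S 1 t - poly p t) \<le> (C1 * R) ^ (2 * j) * L2_sq a b (S (q + 1))"
    by (simp add: L2_sq_def)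
  have alt1: "resolved \<epsilon> (\<lambda>t. t) a b \<or> (resolved s (\<lambda>t. t) a b \<and> int mu \<ge> int (q + 3) - int j \<and> (\<forall>t\<in>{a..b}. t = \<bar>1 - t\<bar>)) \<or>
      ((\<forall>t\<in>{a..b}. lam \<le> t) \<and> int mu \<ge> 1) \<or> (\<forall>t\<in>{a..b}. 3/4 \<le> t)"
    using g mu by (auto simp: graded_def)
  have alt2: "resolved \<epsilon> (\<lambda>t. 2 - t) a b \<or> (resolved s (\<lambda>t. 2 - t) a b \<and> int mu \<ge> int (q + 3) - int j \<and> (\<forall>t\<in>{a..b}. 2 - t = \<bar>1 - t\<bar>)) \<or>
      ((\<forall>t\<in>{a..b}. lam \<le> 2 - t) \<and> int mu \<ge> 1) \<or> (\<forall>t\<in>{a..b}. 3/4 \<le> 2 - t)"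
    using g mu by (auto simp: graded_def)
  have "resolved s (\<lambda>t. \<bar>1 - t\<bar>) a b \<or> (\<forall>t\<in>{a..b}. lam \<le> \<bar>1 - t\<bar>)"
    using g lam_le_\<nu> unfolding graded_def by (meson order_trans)
  then have alt3: "resolved \<epsilon> (\<lambda>t. \<bar>1 - t\<bar>) a b \<or> (resolved s (\<lambda>t. \<bar>1 - t\<bar>) a b \<and> (3::int) \<ge> int (q + 3) - int j \<and> (\<forall>t\<in>{a..b}. \<bar>1 - t\<bar> = \<bar>1 - t\<bar>)) \<or>
      ((\<forall>t\<in>{a..b}. lam \<le> \<bar>1 - t\<bar>) \<and> (3::int) \<ge> 1) \<or> (\<forall>t\<in>{a..b}. 3/4 \<le> \<bar>1 - t\<bar>)"
    using j by auto
  have e: "int mu \<ge> int (q + 1) - int j" "(3::int) \<ge> int (q + 1) - int j" using mu j by auto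
  obtain A where A: "open A" "{a<..<b} \<subseteq> A" "derivs_upto (q + 1) A (W b)" using cell_side[OF g ab] by metis
  note c1 = layer_cell[OF derivs(1) _ sub ab gb(5) _ _ j e(1) alt1]
  note c2 = layer_cell[OF derivs(2) _ sub ab gb(5) _ _ j e(1) alt2]
  note c3 = layer_cell[OF A(3,1,2) ab gb(5) W_bd(1)[OF g ab] _ j e(2) alt3]
  have c1': "has_weak_deriv a b (E1 0) (E1 1)" "\<exists>p. degree p \<le> q - 1 \<and> (b - a) ^ (2 * (j - q)) * L2_sq a b (\<lambda>t. E1 1 t - poly p t) \<le> X"
    unfolding X_def using E_bd sub gb by (intro c1; force)+
  have c2': "has_weak_deriv a b (E2 0) (E2 1)" "\<exists>p. degree p \<le> q - 1 \<and> (b - a) ^ (2 * (j - q)) * L2_sq a b (\<lambda>t. E2 1 t - poly p t) \<le> X"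
    unfolding X_def using E_bd sub gb by (intro c2; force)+
  have c3': "has_weak_deriv a b (W b 0) (W b 1)" "\<exists>p. degree p \<le> q - 1 \<and> (b - a) ^ (2 * (j - q)) * L2_sq a b (\<lambda>t. W b 1 t - poly p t) \<le> X"
    unfolding X_def by (intro c3; simp)+
  have S01: "has_weak_deriv a b (S 0) (S 1)" using S'[of 0] by simp
  have ae: "AE t in Ioo a b. u' t = S 1 t + E1 1 t + E2 1 t + W b 1 t"
    by (rule weak_sum4_AE[OF gb(1) ab gb(2) u S01 c1'(1) c2'(1) c3'(1)]) (rule u_w_cell_eq(1)[OF g ab])
  have "\<exists>p. degree p \<le> q - 1 \<and> (b - a) ^ (2 * (j - q)) * L2_sq a b (\<lambda>t. u' t - poly p t) \<le> 4 * ((C1 * R) ^ (2 * j) * L2_sq a b (S (q + 1)) + X + X + X)"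
  proof (rule poly_approx_sum4[OF _ _ _ _ _ ae _ cS c1'(2) c2'(2) c3'(2)])
    show "square_integrable a b u'" using gb by (intro square_integrable_subset[OF L2_primitive_square_integrable[OF u]]) auto
  qed (use S01 c1'(1) c2'(1) c3'(1) ab in \<open>auto simp: has_weak_deriv_def\<close>)
  then show ?thesis by (simp add: X_def power_mult_distrib algebra_simps)
qed

text \<open>The exponent \<open>mu - 1\<close> of the boundary layers may be zero, so at distance
  \<open>lam\<close> their derivatives could keep a factor \<open>1 / \<epsilon>\<close>; resolution
  or distance \<open>3/4\<close> is required instead. The inner layer has exponent 2, exactly the
  limit for \<open>j = q + 1\<close>.\<close>

lemma w_fine_cell:
  assumes g: "graded a b" and ab: "a < b"
    and fine: "(\<forall>t\<in>{a..b}. 3/4 \<le> t) \<or> resolved \<epsilon> (\<lambda>t. t) a b" "(\<forall>t\<in>{a..b}. 3/4 \<le> 2 - t) \<or> resolved \<epsilon> (\<lambda>t. 2 - t) a b"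
  shows "\<exists>p. degree p \<le> q - 1 \<and> (b - a)\<^sup>2 * L2_sq a b (\<lambda>t. w' t - poly p t) \<le>
    4 * R ^ (2 * (q + 1)) * (C1 ^ (2 * (q + 1)) * K\<^sup>2 + 3 * CF) * integral\<^sup>L (Ioo a b) G"
proof -
  have gb: "0 \<le> a" "b \<le> 2" "b \<le> 1 \<or> 1 \<le> a" "b - a \<le> C1 * R" "b - a \<le> 1" using g by (auto simp: graded_def)
  have sub: "{a<..<b} \<subseteq> {0<..<2}" "{a<..<b} \<subseteq> {0<..<2} - {1}" using gb by auto
  define X where "X = CF * R ^ (2 * (q + 1)) * integral\<^sup>L (Ioo a b) G"
  define Y where "Y = (C1 * R) ^ (2 * (q + 1)) * K\<^sup>2 * integral\<^sup>L (Ioo a b) G"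
  have j: "q \<le> q + 1" "q + 1 \<le> q + 1" by auto
  have S': "has_weak_deriv a b (tS k) (tS (Suc k))" if "k \<le> q" for k
  proof (rule derivs_upto_weak_deriv[OF derivs(5) _ sub(2) ab])
    fix k t assume "k \<le> q + 1" "a < t" "t < b"
    then show "\<bar>tS k t\<bar> \<le> (\<lambda>_. K * \<epsilon>) k" using tS_bd[of k t] subsetD[OF sub(2), of t] by auto
  qed (use that in auto)
  have "\<exists>p. degree p \<le> q - 1 \<and> (b - a) ^ (2 * (q + 1 - q)) * L2_sq a b (\<lambda>t. tS 1 t - poly p t) \<le> integral\<^sup>L (Ioo a b) (\<lambda>t. (C1 * R) ^ (2 * (q + 1)) * K\<^sup>2 * G t)"
  proof (rule chain_component[where F=tS and q=q and j="q + 1", OF ab _ S' j(1)])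
    show "1 \<le> q" using q by simp
    show "integrable (Ioo a b) (\<lambda>t. (C1 * R) ^ (2 * (q + 1)) * K\<^sup>2 * G t)" using G_integrable by simp
    fix t assume t: "a < t" "t < b"
    have "\<bar>tS (Suc q) t\<bar> \<le> K * \<epsilon>" using tS_bd[of "Suc q" t] subsetD[OF sub(2), of t] t by auto
    also have "\<dots> \<le> K" using \<epsilon>1 K_pos by simp
    finally have "(tS (Suc q) t)\<^sup>2 \<le> K\<^sup>2" by (metis abs_ge_zero power2_abs power_mono)
    moreover have "((b - a) ^ (q + 1))\<^sup>2 \<le> ((C1 * R) ^ (q + 1))\<^sup>2" using gb ab by (intro power_mono) auto
    ultimately have "((b - a) ^ (q + 1))\<^sup>2 * (tS (Suc q) t)\<^sup>2 \<le> ((C1 * R) ^ (q + 1))\<^sup>2 * K\<^sup>2" by (intro mult_mono) auto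
    also have "\<dots> = (C1 * R) ^ (2 * (q + 1)) * K\<^sup>2 * 1" by (simp only: power_even_eq mult_1_right)
    also have "\<dots> \<le> (C1 * R) ^ (2 * (q + 1)) * K\<^sup>2 * G t"
      unfolding power_even_eq by (intro mult_left_mono G_ge_1) simp
    finally show "((b - a) ^ (q + 1) * tS (Suc q) t)\<^sup>2 \<le> (C1 * R) ^ (2 * (q + 1)) * K\<^sup>2 * G t"
      by (simp only: power_mult_distrib)
  qed
  then have cS: "\<exists>p. degree p \<le> q - 1 \<and> (b - a) ^ (2 * (q + 1 - q)) * L2_sq a b (\<lambda>t. tS 1 t - poly p t) \<le> Y"
    unfolding Y_def by (simp only: integral_mult_right_zero)
  have alt1: "resolved \<epsilon> (\<lambda>t. t) a b \<or> (resolved s (\<lambda>t. t) a b \<and> int mu - 1 \<ge> int (q + 3) - int (q + 1) \<and> (\<forall>t\<in>{a..b}. t = \<bar>1 - t\<bar>)) \<or>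
      ((\<forall>t\<in>{a..b}. lam \<le> t) \<and> int mu - 1 \<ge> 1) \<or> (\<forall>t\<in>{a..b}. 3/4 \<le> t)"
    using fine by auto
  have alt2: "resolved \<epsilon> (\<lambda>t. 2 - t) a b \<or> (resolved s (\<lambda>t. 2 - t) a b \<and> int mu - 1 \<ge> int (q + 3) - int (q + 1) \<and> (\<forall>t\<in>{a..b}. 2 - t = \<bar>1 - t\<bar>)) \<or>
      ((\<forall>t\<in>{a..b}. lam \<le> 2 - t) \<and> int mu - 1 \<ge> 1) \<or> (\<forall>t\<in>{a..b}. 3/4 \<le> 2 - t)"
    using fine by auto
  have "resolved s (\<lambda>t. \<bar>1 - t\<bar>) a b \<or> (\<forall>t\<in>{a..b}. lam \<le> \<bar>1 - t\<bar>)"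
    using g lam_le_\<nu> unfolding graded_def by (meson order_trans)
  then have alt3: "resolved \<epsilon> (\<lambda>t. \<bar>1 - t\<bar>) a b \<or> (resolved s (\<lambda>t. \<bar>1 - t\<bar>) a b \<and> (2::int) \<ge> int (q + 3) - int (q + 1) \<and> (\<forall>t\<in>{a..b}. \<bar>1 - t\<bar> = \<bar>1 - t\<bar>)) \<or>
      ((\<forall>t\<in>{a..b}. lam \<le> \<bar>1 - t\<bar>) \<and> (2::int) \<ge> 1) \<or> (\<forall>t\<in>{a..b}. 3/4 \<le> \<bar>1 - t\<bar>)"
    by auto
  have e: "int mu - 1 \<ge> int (q + 1) - int (q + 1)" "(2::int) \<ge> int (q + 1) - int (q + 1)" using mu by auto
  obtain A where A: "open A" "{a<..<b} \<subseteq> A" "derivs_upto (q + 1) A (tW b)" using cell_side[OF g ab] by metis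
  note c1 = layer_cell[OF derivs(6) _ sub(1) ab gb(5) _ _ j e(1) alt1]
  note c2 = layer_cell[OF derivs(7) _ sub(1) ab gb(5) _ _ j e(1) alt2]
  note c3 = layer_cell[OF A(3,1,2) ab gb(5) W_bd(2)[OF g ab] _ j e(2) alt3]
  have c1': "has_weak_deriv a b (tE1 0) (tE1 1)" "\<exists>p. degree p \<le> q - 1 \<and> (b - a) ^ (2 * (q + 1 - q)) * L2_sq a b (\<lambda>t. tE1 1 t - poly p t) \<le> X"
    unfolding X_def using E_bd sub gb by (intro c1; force)+
  have c2': "has_weak_deriv a b (tE2 0) (tE2 1)" "\<exists>p. degree p \<le> q - 1 \<and> (b - a) ^ (2 * (q + 1 - q)) * L2_sq a b (\<lambda>t. tE2 1 t - poly p t) \<le> X"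
    unfolding X_def using E_bd sub gb by (intro c2; force)+
  have c3': "has_weak_deriv a b (tW b 0) (tW b 1)" "\<exists>p. degree p \<le> q - 1 \<and> (b - a) ^ (2 * (q + 1 - q)) * L2_sq a b (\<lambda>t. tW b 1 t - poly p t) \<le> X"
    unfolding X_def by (intro c3; simp)+
  have S01: "has_weak_deriv a b (tS 0) (tS 1)" using S'[of 0] by simp
  have ae: "AE t in Ioo a b. w' t = tS 1 t + tE1 1 t + tE2 1 t + tW b 1 t"
    by (rule weak_sum4_AE[OF gb(1) ab gb(2) w S01 c1'(1) c2'(1) c3'(1)]) (rule u_w_cell_eq(2)[OF g ab])
  have "\<exists>p. degree p \<le> q - 1 \<and> (b - a) ^ (2 * (q + 1 - q)) * L2_sq a b (\<lambda>t. w' t - poly p t) \<le> 4 * (Y + X + X + X)"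
  proof (rule poly_approx_sum4[OF _ _ _ _ _ ae _ cS c1'(2) c2'(2) c3'(2)])
    show "square_integrable a b w'" using gb by (intro square_integrable_subset[OF L2_primitive_square_integrable[OF w]]) auto
  qed (use S01 c1'(1) c2'(1) c3'(1) ab in \<open>auto simp: has_weak_deriv_def\<close>)
  moreover have "4 * (Y + X + X + X) = 4 * R ^ (2 * (q + 1)) * (C1 ^ (2 * (q + 1)) * K\<^sup>2 + 3 * CF) * integral\<^sup>L (Ioo a b) G"
    unfolding X_def Y_def power_mult_distrib by (simp add: algebra_simps del: power_Suc)
  ultimately show ?thesis by simp
qed

text \<open>The values of the layer components, unlike their derivatives, carry no negative power of
  \<epsilon>, so away from the layers they are of the size \<open>\<rho> ^ (q + 1)\<close>. Only
  \<open>tS\<close> is approximated by a polynomial. The summand 3 counts the layer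
  components.\<close>

lemma w_coarse_cell:
  assumes g: "graded a b" and ab: "a < b" and coarse: "\<forall>t\<in>{a..b}. lam \<le> t \<and> lam \<le> 2 - t \<and> \<nu> \<le> \<bar>1 - t\<bar>"
  shows "\<exists>P. degree P \<le> q \<and> (\<forall>t\<in>{a..b}. \<bar>w t - poly P t\<bar> \<le> K * (C1 ^ (q + 1) + 3) * R ^ (q + 1))"
proof -
  have gb: "0 \<le> a" "b \<le> 2" "b \<le> 1 \<or> 1 \<le> a" "b - a \<le> C1 * R" using g by (auto simp: graded_def)
  have \<nu>: "\<nu> > 0" using lam_pos lam_le_\<nu> by linarith
  have "lam \<le> a" "lam \<le> 2 - b" "\<nu> \<le> \<bar>1 - a\<bar>" "\<nu> \<le> \<bar>1 - b\<bar>" using coarse ab by auto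
  \<comment> \<open>A coarse cell keeps away from 0, 1 and 2, so the whole closed cell lies where
    \<open>tS\<close> is classically differentiable.\<close>
  then have ab2: "0 < a" "b < 2" "b < 1 \<or> 1 < a" using lam_pos \<nu> gb by auto
  then have sub: "{a..b} \<subseteq> {0<..<2} - {1}" by auto
  have D: "derivs_upto (Suc q) ({0<..<2} - {1}) tS" using derivs(5) by simp
  obtain P where P: "degree P \<le> q" "\<And>t. t \<in> {a..b} \<Longrightarrow> \<bar>tS 0 t - poly P t\<bar> \<le> K * (b - a) ^ Suc q"
  proof (rule taylor_poly_approx[OF D _ sub])
    fix t assume "t \<in> {a..b}"
    then have "\<bar>tS (Suc q) t\<bar> \<le> K * \<epsilon>" using tS_bd[of "Suc q" t] subsetD[OF sub, of t] by auto
    also have "\<dots> \<le> K" using \<epsilon>1 K_pos by simp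
    finally show "\<bar>tS (Suc q) t\<bar> \<le> K" .
  qed auto
  have "\<bar>w t - poly P t\<bar> \<le> K * (C1 ^ (q + 1) + 3) * R ^ (q + 1)" if t: "t \<in> {a..b}" for t
  proof -
    have far: "\<bar>X\<bar> \<le> K * R ^ (q + 1)" if X: "\<bar>X\<bar> \<le> K * \<epsilon> powi n * exp (- \<beta> * d / \<epsilon>)" "n \<ge> 0" "lam \<le> d" for X n d
    proof -
      note X(1)
      also have "K * \<epsilon> powi n * exp (- \<beta> * d / \<epsilon>) \<le> K * 1 * \<rho> ^ (q + 1)"
        using X \<epsilon> K_pos power_powi_le_1[OF \<epsilon> \<epsilon>1, of n 0] by (intro mult_mono exp_far) auto
      also have "\<dots> \<le> K * 1 * R ^ (q + 1)" using K_pos R_ge_\<rho> \<rho>_pos by (intro mult_left_mono power_mono) auto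
      finally show ?thesis by simp
    qed
    have lt: "lam \<le> t" "lam \<le> 2 - t" "lam \<le> \<bar>1 - t\<bar>" using coarse t lam_le_\<nu> by fastforce+
    have t2: "t \<in> {0<..<2}" "t \<in> {0<..<1} \<or> t \<in> {1<..<2}" using t ab2 by auto
    have "\<bar>tE1 0 t\<bar> \<le> K * \<epsilon> powi (int mu - 1) * exp (- \<beta> * t / \<epsilon>)"
      "\<bar>tE2 0 t\<bar> \<le> K * \<epsilon> powi (int mu - 1) * exp (- \<beta> * (2 - t) / \<epsilon>)"
      using E_bd[of 0 t] t2 by auto
    then have E: "\<bar>tE1 0 t\<bar> \<le> K * R ^ (q + 1)" "\<bar>tE2 0 t\<bar> \<le> K * R ^ (q + 1)"
      using far[OF _ _ lt(1)] far[OF _ _ lt(2)] mu by auto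
    define y where "y = tW1 0 t * indicator {0<..<1} t + tW2 0 t * indicator {1<..<2} t"
    have "\<bar>y\<bar> \<le> K * R ^ (q + 1)"
    proof (cases "t < 1")
      case True
      then have "\<bar>y\<bar> \<le> K * \<epsilon> powi 2 * exp (- \<beta> * \<bar>1 - t\<bar> / \<epsilon>)" using W1_bd[of 0 t] t2 by (auto simp: y_def)
      then show ?thesis using far[OF _ _ lt(3), of y 2] by simp
    next
      case False
      then have "\<bar>y\<bar> \<le> K * \<epsilon> powi 2 * exp (- \<beta> * \<bar>1 - t\<bar> / \<epsilon>)" using W2_bd[of 0 t] t2 by (auto simp: y_def)
      then show ?thesis using far[OF _ _ lt(3), of y 2] by simp
    qed
    moreover have "\<bar>tS 0 t - poly P t\<bar> \<le> K * (C1 ^ (q + 1) * R ^ (q + 1))"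
    proof -
      have "(b - a) ^ Suc q \<le> (C1 * R) ^ Suc q" using gb ab by (intro power_mono) auto
      then have "K * (b - a) ^ Suc q \<le> K * (C1 * R) ^ Suc q" using K_pos by (intro mult_left_mono) auto
      then show ?thesis using P(2)[OF t] unfolding power_mult_distrib Suc_eq_plus1 by linarith
    qed
    moreover have "w t - poly P t = (tS 0 t - poly P t) + tE1 0 t + tE2 0 t + y"
      using w_eq[OF t2(1)] by (simp add: y_def)
    moreover have "K * (C1 ^ (q + 1) + 3) * R ^ (q + 1) = K * (C1 ^ (q + 1) * R ^ (q + 1)) + 3 * (K * R ^ (q + 1))"
      by (simp add: algebra_simps)
    ultimately show ?thesis using E by linarith
  qed
  then show ?thesis using P(1) by blast
qed

section \<open>Summation over the mesh\<close>

lemma node_end: "x N = 2" using node_N N_eq by metis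

lemma N_pos: "N > 0" using N8 by simp

lemma cell_le: "i \<in> {1..N} \<Longrightarrow> x (i - 1) \<le> x i" using graded_cell_all by (auto simp: graded_def)

lemma sum_integral_G: "(\<Sum>i\<in>{1..N}. integral\<^sup>L (Ioo (x (i - 1)) (x i)) G) \<le> 2 + 2 / \<beta>"
proof -
  have "(\<Sum>i\<in>{1..N}. integral\<^sup>L (Ioo (x (i - 1)) (x i)) G) = integral\<^sup>L (Ioo (x 0) (x N)) G"
    by (rule integral_Ioo_cells[where x=x and N=N, OF G_integrable cell_le, symmetric])
  then show ?thesis using integral_G_le by (simp add: node_0 node_end)
qed

text \<open>\<open>S\<close> is controlled on \<open>(0,1)\<close> and \<open>(1,2)\<close>
  separately, and each half contributes at most \<open>K\<^sup>2\<close>; no derivative across 1 is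
  involved.\<close>

lemma sum_S: "(\<Sum>i\<in>{1..N}. L2_sq (x (i - 1)) (x i) (S (q + 1))) \<le> 2 * K\<^sup>2"
proof -
  have si: "square_integrable 0 1 (S (q + 1))" "square_integrable 1 2 (S (q + 1))"
    using S_weak[of q] by (auto simp: has_weak_deriv_def)
  have si2: "square_integrable 0 2 (S (q + 1))" by (rule square_integrable_combine[OF si]) auto
  have nn: "0 \<le> L2_norm 0 1 (S (q + 1))" "0 \<le> L2_norm 1 2 (S (q + 1))" by (auto simp: L2_norm_eq)
  then have "L2_norm 0 1 (S (q + 1)) \<le> K" "L2_norm 1 2 (S (q + 1)) \<le> K" using S_bd by auto
  then have "(L2_norm 0 1 (S (q + 1)))\<^sup>2 \<le> K\<^sup>2" "(L2_norm 1 2 (S (q + 1)))\<^sup>2 \<le> K\<^sup>2" using nn by (auto intro: power_mono)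
  then have "L2_sq 0 1 (S (q + 1)) + L2_sq 1 2 (S (q + 1)) \<le> 2 * K\<^sup>2" by (simp add: L2_norm_power2)
  moreover have "(\<Sum>i\<in>{1..N}. L2_sq (x (i - 1)) (x i) (S (q + 1))) = L2_sq (x 0) (x N) (S (q + 1))"
    by (rule L2_sq_cells[where x=x and N=N, OF _ cell_le, symmetric]) (simp_all only: node_0 node_end si2)
  moreover have "L2_sq 0 2 (S (q + 1)) = L2_sq 0 1 (S (q + 1)) + L2_sq 1 2 (S (q + 1))"
    by (rule L2_sq_combine[OF si2]) auto
  ultimately show ?thesis by (simp add: node_0 node_end)
qed

lemma C1_ge_1: "C1 \<ge> 1" using K_pos by (simp add: C1_def)

text \<open>The factor 4 comes from the splitting into four components and 3 counts the layers;
  \<open>2 * K\<^sup>2\<close> is the total for \<open>S\<close>, and \<open>2 + 2 / \<beta>\<close>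
  bounds the mass of \<open>G\<close>.\<close>

definition CU :: real where "CU = 4 * (C1 ^ (2 * (q + 1)) * (2 * K\<^sup>2) + 3 * CF * (2 + 2 / \<beta>))"

text \<open>Best approximation carries the bounds for \<open>u'\<close> over to the interpolation
  error, and both parts of the cell bounds are additive. Cells of length zero contribute
  nothing.\<close>

lemma u_interpolation_error:
  assumes g: "interpolation_error x N q u u' g" and j: "q \<le> j" "j \<le> q + 1"
  shows "(\<Sum>i\<in>{1..N}. (x i - x (i - 1)) ^ (2 * (j - q)) * L2_sq (x (i - 1)) (x i) (\<lambda>t. deriv g t - u' t)) \<le> CU * R ^ (2 * j)"
proof -
  interpret interpolation_error x N q u u' g by fact
  have cell: "(x i - x (i - 1)) ^ (2 * (j - q)) * L2_sq (x (i - 1)) (x i) (\<lambda>t. deriv g t - u' t) \<le>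
    4 * R ^ (2 * j) * (C1 ^ (2 * (q + 1)) * L2_sq (x (i - 1)) (x i) (S (q + 1)) + 3 * CF * integral\<^sup>L (Ioo (x (i - 1)) (x i)) G)"
    if i: "i \<in> {1..N}" for i
  proof (cases "x (i - 1) < x i")
    case True
    obtain p where p: "degree p \<le> q - 1" "(x i - x (i - 1)) ^ (2 * (j - q)) * L2_sq (x (i - 1)) (x i) (\<lambda>t. u' t - poly p t) \<le>
      4 * R ^ (2 * j) * (C1 ^ (2 * j) * L2_sq (x (i - 1)) (x i) (S (q + 1)) + 3 * CF * integral\<^sup>L (Ioo (x (i - 1)) (x i)) G)"
      using u_cell[OF graded_cell_all[OF i] True j] by auto
    have "(x i - x (i - 1)) ^ (2 * (j - q)) * L2_sq (x (i - 1)) (x i) (\<lambda>t. deriv g t - u' t) \<le>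
      (x i - x (i - 1)) ^ (2 * (j - q)) * L2_sq (x (i - 1)) (x i) (\<lambda>t. u' t - poly p t)"
      using True by (intro mult_left_mono error_best_approx[OF i p(1)]) auto
    also note p(2)
    also have "4 * R ^ (2 * j) * (C1 ^ (2 * j) * L2_sq (x (i - 1)) (x i) (S (q + 1)) + 3 * CF * integral\<^sup>L (Ioo (x (i - 1)) (x i)) G) \<le>
      4 * R ^ (2 * j) * (C1 ^ (2 * (q + 1)) * L2_sq (x (i - 1)) (x i) (S (q + 1)) + 3 * CF * integral\<^sup>L (Ioo (x (i - 1)) (x i)) G)"
      using C1_ge_1 j R_pos by (intro mult_left_mono add_right_mono mult_right_mono power_increasing) auto
    finally show ?thesis .
  next
    case False
    then have "x i \<le> x (i - 1)" by simp
    then show ?thesis by simp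
  qed
  have "(\<Sum>i\<in>{1..N}. (x i - x (i - 1)) ^ (2 * (j - q)) * L2_sq (x (i - 1)) (x i) (\<lambda>t. deriv g t - u' t)) \<le>
    (\<Sum>i\<in>{1..N}. 4 * R ^ (2 * j) * (C1 ^ (2 * (q + 1)) * L2_sq (x (i - 1)) (x i) (S (q + 1)) + 3 * CF * integral\<^sup>L (Ioo (x (i - 1)) (x i)) G))"
    by (rule sum_mono) (rule cell)
  also have "\<dots> = 4 * R ^ (2 * j) * (C1 ^ (2 * (q + 1)) * (\<Sum>i\<in>{1..N}. L2_sq (x (i - 1)) (x i) (S (q + 1)))
      + 3 * CF * (\<Sum>i\<in>{1..N}. integral\<^sup>L (Ioo (x (i - 1)) (x i)) G))"
    by (simp only: sum.distrib sum_distrib_left[symmetric])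
  also have "\<dots> \<le> 4 * R ^ (2 * j) * (C1 ^ (2 * (q + 1)) * (2 * K\<^sup>2) + 3 * CF * (2 + 2 / \<beta>))"
    using C1_ge_1 R_pos CF_pos by (intro mult_left_mono add_mono sum_S sum_integral_G) auto
  also have "\<dots> = CU * R ^ (2 * j)" by (simp add: CU_def)
  finally show ?thesis .
qed

definition CW :: "real \<Rightarrow> real" where
  "CW Cs = (4 * (C1 ^ (2 * (q + 1)) * K\<^sup>2 + 3 * CF) + Cs * (K * (C1 ^ (q + 1) + 3))\<^sup>2) * (2 + 2 / \<beta>)"

text \<open>On a coarse cell the length is bounded by the integral of \<open>G\<close>, so coarse
  and fine cells are summed alike, with the sum of their constants.\<close>

lemma w_interpolation_error:
  assumes g: "interpolation_error x N q w w' g" and Cs: "Cs > 0"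
    and stab: "\<forall>a b v p P M. a < b \<longrightarrow> continuous_on {a..b} v \<longrightarrow> cell_interpolant a b q v p \<longrightarrow> degree P \<le> q \<longrightarrow>
     (\<forall>x\<in>{a..b}. \<bar>v x - poly P x\<bar> \<le> M) \<longrightarrow> L2_sq a b (\<lambda>t. poly p t - v t) \<le> Cs * (b - a) * M\<^sup>2"
  shows "L2_sq 0 2 (\<lambda>t. g t - w t) \<le> CW Cs * R ^ (2 * (q + 1))"
proof -
  interpret interpolation_error x N q w w' g by fact
  define Y where "Y = 4 * (C1 ^ (2 * (q + 1)) * K\<^sup>2 + 3 * CF)"
  define Z where "Z = Cs * (K * (C1 ^ (q + 1) + 3))\<^sup>2"
  have YZ: "Y \<ge> 0" "Z \<ge> 0" using CF_pos C1_ge_1 Cs by (auto simp: Y_def Z_def)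
  have cell: "L2_sq (x (i - 1)) (x i) (\<lambda>t. g t - w t) \<le> (Y + Z) * R ^ (2 * (q + 1)) * integral\<^sup>L (Ioo (x (i - 1)) (x i)) G"
    if i: "i \<in> {1..N}" for i
  proof (cases "x (i - 1) < x i")
    case True
    define I where "I = integral\<^sup>L (Ioo (x (i - 1)) (x i)) G"
    have I: "x i - x (i - 1) \<le> I" "I \<ge> 0" using integral_G_ge[of "x (i - 1)" "x i"] True by (auto simp: I_def)
    have R0: "R ^ (2 * (q + 1)) * I \<ge> 0" using R_pos I by simp
    note gr = graded_cell_all[OF i]
    have "(\<forall>t\<in>{x (i - 1)..x i}. lam \<le> t \<and> lam \<le> 2 - t \<and> \<nu> \<le> \<bar>1 - t\<bar>) \<or>
      ((\<forall>t\<in>{x (i - 1)..x i}. 3/4 \<le> t) \<or> resolved \<epsilon> (\<lambda>t. t) (x (i - 1)) (x i)) \<and>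
      ((\<forall>t\<in>{x (i - 1)..x i}. 3/4 \<le> 2 - t) \<or> resolved \<epsilon> (\<lambda>t. 2 - t) (x (i - 1)) (x i))"
      using gr unfolding graded_def by blast
    then show ?thesis
    proof (elim disjE[of "\<forall>t\<in>{x (i - 1)..x i}. lam \<le> t \<and> lam \<le> 2 - t \<and> \<nu> \<le> \<bar>1 - t\<bar>"] conjE)
      assume "\<forall>t\<in>{x (i - 1)..x i}. lam \<le> t \<and> lam \<le> 2 - t \<and> \<nu> \<le> \<bar>1 - t\<bar>"
      then obtain P where P: "degree P \<le> q" "\<And>t. t \<in> {x (i - 1)..x i} \<Longrightarrow> \<bar>w t - poly P t\<bar> \<le> K * (C1 ^ (q + 1) + 3) * R ^ (q + 1)"
        using w_coarse_cell[OF gr True] by blast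
      have "L2_sq (x (i - 1)) (x i) (\<lambda>t. g t - w t) \<le> Cs * (x i - x (i - 1)) * (K * (C1 ^ (q + 1) + 3) * R ^ (q + 1))\<^sup>2"
        by (rule error_sup_stability[OF stab i P])
      also have "\<dots> \<le> Cs * I * (K * (C1 ^ (q + 1) + 3) * R ^ (q + 1))\<^sup>2"
        using I Cs by (intro mult_right_mono mult_left_mono) auto
      also have "\<dots> = Z * (R ^ (2 * (q + 1)) * I)"
        unfolding Z_def power_even_eq power_mult_distrib by (simp only: mult_ac)
      also have "\<dots> \<le> (Y + Z) * (R ^ (2 * (q + 1)) * I)" using YZ R0 by (intro mult_right_mono) auto
      finally show ?thesis by (simp only: I_def mult.assoc)
    next
      assume f: "(\<forall>t\<in>{x (i - 1)..x i}. 3/4 \<le> t) \<or> resolved \<epsilon> (\<lambda>t. t) (x (i - 1)) (x i)"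
        "(\<forall>t\<in>{x (i - 1)..x i}. 3/4 \<le> 2 - t) \<or> resolved \<epsilon> (\<lambda>t. 2 - t) (x (i - 1)) (x i)"
      obtain p where p: "degree p \<le> q - 1" "(x i - x (i - 1))\<^sup>2 * L2_sq (x (i - 1)) (x i) (\<lambda>t. w' t - poly p t) \<le>
        4 * R ^ (2 * (q + 1)) * (C1 ^ (2 * (q + 1)) * K\<^sup>2 + 3 * CF) * I"
        using w_fine_cell[OF gr True f] unfolding I_def by blast
      have "L2_sq (x (i - 1)) (x i) (\<lambda>t. g t - w t) \<le> (x i - x (i - 1))\<^sup>2 * L2_sq (x (i - 1)) (x i) (\<lambda>t. deriv g t - w' t)"
        by (rule error_poincare[OF i])
      also have "\<dots> \<le> (x i - x (i - 1))\<^sup>2 * L2_sq (x (i - 1)) (x i) (\<lambda>t. w' t - poly p t)"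
        by (intro mult_left_mono error_best_approx[OF i p(1)]) auto
      also note p(2)
      also have "4 * R ^ (2 * (q + 1)) * (C1 ^ (2 * (q + 1)) * K\<^sup>2 + 3 * CF) * I = Y * (R ^ (2 * (q + 1)) * I)"
        unfolding Y_def by (simp only: mult_ac)
      also have "\<dots> \<le> (Y + Z) * (R ^ (2 * (q + 1)) * I)" using YZ R0 by (intro mult_right_mono) auto
      finally show ?thesis by (simp only: I_def mult.assoc)
    qed
  next
    case False
    then have "x i \<le> x (i - 1)" by simp
    then show ?thesis by simp
  qed
  have si: "square_integrable (x 0) (x N) (\<lambda>t. g t - w t)"
    using square_integrable_continuous[OF L2_primitive_continuous[OF error_primitive]] by (simp only: node_0 node_end)
  have "L2_sq 0 2 (\<lambda>t. g t - w t) = L2_sq (x 0) (x N) (\<lambda>t. g t - w t)" by (simp only: node_0 node_end)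
  also have "\<dots> = (\<Sum>i\<in>{1..N}. L2_sq (x (i - 1)) (x i) (\<lambda>t. g t - w t))"
    by (rule L2_sq_cells[OF si cell_le])
  also have "\<dots> \<le> (\<Sum>i\<in>{1..N}. (Y + Z) * R ^ (2 * (q + 1)) * integral\<^sup>L (Ioo (x (i - 1)) (x i)) G)"
    by (rule sum_mono) (rule cell)
  also have "\<dots> = (Y + Z) * R ^ (2 * (q + 1)) * (\<Sum>i\<in>{1..N}. integral\<^sup>L (Ioo (x (i - 1)) (x i)) G)"
    by (simp only: sum_distrib_left[symmetric])
  also have "\<dots> \<le> (Y + Z) * R ^ (2 * (q + 1)) * (2 + 2 / \<beta>)"
    using YZ R_pos by (intro mult_left_mono sum_integral_G) auto
  also have "\<dots> = CW Cs * R ^ (2 * (q + 1))" by (simp only: CW_def Y_def Z_def mult_ac)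
  finally show ?thesis .
qed

end

section \<open>The error estimate\<close>

lemma derivs_upto_continuous:
  assumes "derivs_upto (Suc k) {a..b} D"
  shows "continuous_on {a..b} (D k)"
  using assms unfolding derivs_upto_def
  by (meson DERIV_continuous continuous_on_eq_continuous_within lessI)

lemma admissible_data_delay_form:
  assumes "admissible_data m \<beta> \<delta> b c d f \<Phi>"
  obtains L b1 b2 where "delay_form \<beta> \<delta> L b c d b1 b2"
proof -
  obtain Db where Db: "Db 0 = b" "\<And>n. derivs_upto n {0..2} Db"
    using assms by (auto simp: admissible_data_def smooth_on_closed_def)
  obtain Dc where Dc: "Dc 0 = c" "\<And>n. derivs_upto n {0..2} Dc"
    using assms by (auto simp: admissible_data_def smooth_on_closed_def)
  obtain Dd where Dd: "Dd 0 = d" "\<And>n. derivs_upto n {0..2} Dd"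
    using assms by (auto simp: admissible_data_def smooth_on_closed_def)
  have cont: "continuous_on {0..2} (Db 1)" "continuous_on {0..2} (Db 2)" "continuous_on {0..2} c" "continuous_on {0..2} d"
    using derivs_upto_continuous[OF Db(2)] derivs_upto_continuous[OF Dc(2), of 0]
      derivs_upto_continuous[OF Dd(2), of 0] Dc(1) Dd(1) by auto
  obtain L1 where L1: "\<And>t. t \<in> {0..2} \<Longrightarrow> \<bar>Db 1 t\<bar> \<le> L1" using continuous_on_bounded_real[OF cont(1)] by metis
  obtain L2 where L2: "\<And>t. t \<in> {0..2} \<Longrightarrow> \<bar>Db 2 t\<bar> \<le> L2" using continuous_on_bounded_real[OF cont(2)] by metis
  obtain L3 where L3: "\<And>t. t \<in> {0..2} \<Longrightarrow> \<bar>c t\<bar> \<le> L3" using continuous_on_bounded_real[OF cont(3)] by metis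
  obtain L4 where L4: "L4 \<ge> 0" "\<And>t. t \<in> {0..2} \<Longrightarrow> \<bar>d t\<bar> \<le> L4" using continuous_on_bounded_real[OF cont(4)] by metis
  define L where "L = max (max L1 L2) (max L3 L4)"
  have "delay_form \<beta> \<delta> L b c d (Db 1) (Db 2)"
  proof
    show "\<beta> > 0" "\<delta> > 0" using assms by (auto simp: admissible_data_def)
    show "L \<ge> 0" using L4(1) by (simp add: L_def)
    fix t :: real assume t: "t \<in> {0..2}"
    show "(b has_real_derivative Db 1 t) (at t within {0..2})"
      using Db(2)[of 1] t by (auto simp: derivs_upto_def Db(1))
    have "derivs_upto 2 {0..2} Db" by (rule Db(2))
    then have "(Db 1 has_real_derivative Db (Suc 1) t) (at t within {0..2})"
      unfolding derivs_upto_def using t by (meson one_less_numeral_iff semiring_norm(76))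
    then show "(Db 1 has_real_derivative Db 2 t) (at t within {0..2})" by (simp add: numeral_2_eq_2)
    show "\<bar>Db 1 t\<bar> \<le> L" "\<bar>Db 2 t\<bar> \<le> L" "\<bar>c t\<bar> \<le> L" "\<bar>d t\<bar> \<le> L"
      using L1[OF t] L2[OF t] L3[OF t] L4(2)[OF t] by (auto simp: L_def)
  qed (use assms cont in \<open>auto simp: admissible_data_def\<close>)
  then show thesis by (rule that)
qed

lemma solution_decomposition_locale:
  assumes "S_mesh q K \<sigma> \<beta> \<epsilon> N \<phi>" and "m \<ge> 1" and "solution_decomposition m q \<beta> K \<epsilon> u w"
    and "L2_primitive 0 2 u u'" "L2_primitive 0 2 w w'"
  obtains S E1 E2 W1 W2 tS tE1 tE2 tW1 tW2
  where "decomposed_solution q K \<sigma> \<beta> \<epsilon> N \<phi> m u w u' w' S E1 E2 W1 W2 tS tE1 tE2 tW1 tW2"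
proof -
  obtain S E1 E2 W1 W2 tS tE1 tE2 tW1 tW2 :: "nat \<Rightarrow> real \<Rightarrow> real" where
    e: "\<forall>x\<in>{0<..<2}. u x = S 0 x + E1 0 x + E2 0 x
        + W1 0 x * indicator {0<..<1} x + W2 0 x * indicator {1<..<2} x"
      "\<forall>x\<in>{0<..<2}. w x = tS 0 x + tE1 0 x + tE2 0 x
        + tW1 0 x * indicator {0<..<1} x + tW2 0 x * indicator {1<..<2} x"
    and S: "\<forall>k\<le>q. has_weak_deriv 0 1 (S k) (S (Suc k)) \<and> has_weak_deriv 1 2 (S k) (S (Suc k))"
    and D: "derivs_upto (q + 1) {0<..<2} E1" "derivs_upto (q + 1) {0<..<2} E2"
      "derivs_upto (q + 1) {0<..<1} W1" "derivs_upto (q + 1) {1<..<2} W2"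
      "derivs_upto (q + 1) ({0<..<2} - {1}) tS"
      "derivs_upto (q + 1) {0<..<2} tE1" "derivs_upto (q + 1) {0<..<2} tE2"
      "derivs_upto (q + 1) {0<..<1} tW1" "derivs_upto (q + 1) {1<..<2} tW2"
    and B: "\<forall>k\<le>q + 1.
        L2_norm 0 1 (S k) + L2_norm 1 2 (S k) \<le> K \<and>
        (\<forall>x\<in>{0<..<2}.
           \<bar>E1 k x\<bar> \<le> K * \<epsilon> powi (int m - int k) * exp (- \<beta> * x / \<epsilon>) \<and>
           \<bar>E2 k x\<bar> \<le> K * \<epsilon> powi (int m - int k) * exp (- \<beta> * (2 - x) / \<epsilon>) \<and>
           \<bar>tE1 k x\<bar> \<le> K * \<epsilon> powi (int m - 1 - int k) * exp (- \<beta> * x / \<epsilon>) \<and>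
           \<bar>tE2 k x\<bar> \<le> K * \<epsilon> powi (int m - 1 - int k) * exp (- \<beta> * (2 - x) / \<epsilon>)) \<and>
        (\<forall>x\<in>{0<..<2} - {1}. \<bar>tS k x\<bar> \<le> K * \<epsilon>) \<and>
        (\<forall>x\<in>{0<..<1}.
           \<bar>W1 k x\<bar> \<le> K * \<epsilon> powi (3 - int k) * exp (- \<beta> * (1 - x) / \<epsilon>) \<and>
           \<bar>tW1 k x\<bar> \<le> K * \<epsilon> powi (2 - int k) * exp (- \<beta> * (1 - x) / \<epsilon>)) \<and>
        (\<forall>x\<in>{1<..<2}.
           \<bar>W2 k x\<bar> \<le> K * \<epsilon> powi (3 - int k) * exp (- \<beta> * (x - 1) / \<epsilon>) \<and>
           \<bar>tW2 k x\<bar> \<le> K * \<epsilon> powi (2 - int k) * exp (- \<beta> * (x - 1) / \<epsilon>))"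
    using assms(3) unfolding solution_decomposition_def by (elim exE conjE) (rule that)
  have "decomposed_solution_axioms q K \<beta> \<epsilon> m u w u' w' S E1 E2 W1 W2 tS tE1 tE2 tW1 tW2"
    by unfold_locales (use e S B assms(2,4,5) in \<open>blast intro: D\<close>)+
  then show thesis using that assms(1) by (simp add: decomposed_solution_def)
qed

lemma triple_sq_add_le:
  assumes "L2_primitive 0 2 y y'" "L2_primitive 0 2 v v'" "square_integrable 0 2 z" "square_integrable 0 2 r" "\<delta> \<ge> 0"
  shows "triple_sq \<beta> \<delta> (\<lambda>t. y t - v t) (\<lambda>t. y' t - v' t) (\<lambda>t. z t - r t)
    \<le> 2 * triple_sq \<beta> \<delta> y y' z + 2 * triple_sq \<beta> \<delta> v v' r"
proof -
  note si = assms(1,2)[THEN L2_primitive_square_integrable]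
    assms(1,2)[THEN L2_primitive_continuous, THEN square_integrable_continuous] assms(3,4)
  have "triple_sq \<beta> \<delta> (\<lambda>t. y t - v t) (\<lambda>t. y' t - v' t) (\<lambda>t. z t - r t)
    \<le> (2 * L2_sq 0 2 z + 2 * L2_sq 0 2 r) + \<beta>\<^sup>2 / 2 * (2 * L2_sq 0 2 y' + 2 * L2_sq 0 2 v') + \<delta> * (2 * L2_sq 0 2 y + 2 * L2_sq 0 2 v)"
    unfolding triple_sq_def using assms(5) by (intro add_mono mult_left_mono L2_sq_diff_le si) auto
  also have "\<dots> = 2 * triple_sq \<beta> \<delta> y y' z + 2 * triple_sq \<beta> \<delta> v v' r"
    by (simp add: triple_sq_def algebra_simps)
  finally show ?thesis .
qed

theorem theorem5p5:
  fixes m q :: nat and \<beta> \<delta> \<sigma> K :: real and b c d f \<Phi> :: "real \<Rightarrow> real"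
  assumes "q > 2"
    and "admissible_data m \<beta> \<delta> b c d f \<Phi>"
    and "\<sigma> \<ge> real q + 1"
  shows "\<exists>C>0. \<forall>(\<epsilon>::real) (N::nat) (\<phi>::real \<Rightarrow> real) (u::real \<Rightarrow> real) (w::real \<Rightarrow> real)
            (uh::real \<Rightarrow> real) (wh::real \<Rightarrow> real).
     \<epsilon> > 0 \<and> admissible_mesh K q \<sigma> \<beta> \<epsilon> N \<phi> \<and>
     solves_in (space_U m) \<epsilon> b c d f \<Phi> u w \<and>
     solution_decomposition m q \<beta> K \<epsilon> u w \<and>
     sobolev (q + 1) 0 2 u \<and> sobolev (q + 1) 0 2 w \<and>
     solves_in (space_Uh m (node q \<sigma> \<beta> \<epsilon> N \<phi>) N q) \<epsilon> b c d f \<Phi> uh wh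
     \<longrightarrow>
     (let x = node q \<sigma> \<beta> \<epsilon> N \<phi>;
          rate = h_inner x N + max_abs_deriv (mesh_characterising \<phi>) / real N
      in triple_norm \<beta> \<delta> (\<lambda>t. interp x N q u t - uh t, \<lambda>t. interp x N q w t - wh t)
           \<le> C * rate ^ (q + 1) \<and>
         triple_norm \<beta> \<delta> (\<lambda>t. u t - uh t, \<lambda>t. w t - wh t) \<le> C * rate ^ q)"
proof -
  obtain L b1 b2 where "delay_form \<beta> \<delta> L b c d b1 b2" using admissible_data_delay_form[OF assms(2)] .
  then interpret delay_form \<beta> \<delta> L b c d b1 b2 .
  obtain Cd where Cd: "Cd > 0" and discrete: "\<And>\<epsilon> (x :: nat \<Rightarrow> real) N q m f \<Phi> u w uh wh gu gw.
     x 0 = 0 \<Longrightarrow> x N = 2 \<Longrightarrow> N > 0 \<Longrightarrow> (\<And>i. i \<in> {1..N} \<Longrightarrow> x (i - 1) \<le> x i) \<Longrightarrow>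
     solves_in (space_U m) \<epsilon> b c d f \<Phi> u w \<Longrightarrow> solves_in (space_Uh m x N q) \<epsilon> b c d f \<Phi> uh wh \<Longrightarrow>
     is_interpolant x N q u gu \<Longrightarrow> is_interpolant x N q w gw \<Longrightarrow>
     L2_primitive 0 2 (\<lambda>t. gu t - uh t) (deriv (\<lambda>t. gu t - uh t)) \<and>
     triple_sq \<beta> \<delta> (\<lambda>t. gu t - uh t) (deriv (\<lambda>t. gu t - uh t)) (\<lambda>t. gw t - wh t)
       \<le> Cd * ((\<Sum>i\<in>{1..N}. (x i - x (i - 1))\<^sup>2 * L2_sq (x (i - 1)) (x i) (\<lambda>t. deriv gu t - wderiv 0 2 u t))
              + L2_sq 0 2 (\<lambda>t. gw t - w t))"
    using discrete_error_estimate by blast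
  obtain Cs where Cs: "Cs > 0" and stab: "\<forall>a b v p P M. a < b \<longrightarrow> continuous_on {a..b} v \<longrightarrow> cell_interpolant a b q v p \<longrightarrow>
     degree P \<le> q \<longrightarrow> (\<forall>x\<in>{a..b}. \<bar>v x - poly P x\<bar> \<le> M) \<longrightarrow> L2_sq a b (\<lambda>t. poly p t - v t) \<le> Cs * (b - a) * M\<^sup>2"
    using cell_interpolant_sup_stability[of q] by blast
  \<comment> \<open>Outside the locale these constants have only \<open>q\<close>, \<open>K\<close>,
    \<sigma>, \<beta> and \<open>Cs\<close> as arguments; they are fixed before \<epsilon>,
    \<open>N\<close> and the mesh appear.\<close>
  define KU where "KU = decomposed_solution.CU q K \<sigma> \<beta>"
  define KW where "KW = decomposed_solution.CW q K \<sigma> \<beta> Cs"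
  define T1 where "T1 = Cd * (KU + KW)"
  define T2 where "T2 = 2 * (KW * (2 * K)\<^sup>2 + \<beta>\<^sup>2 / 2 * KU + \<delta> * KU * (2 * K)\<^sup>2) + 2 * T1 * (2 * K)\<^sup>2"
  \<comment> \<open>The sign of the constants becomes available only once a mesh is given, hence the
    absolute values; the summand 1 makes \<open>C\<close> positive.\<close>
  define C where "C = 1 + sqrt \<bar>T1\<bar> + sqrt \<bar>T2\<bar>"
  have "0 \<le> sqrt \<bar>T1\<bar>" "0 \<le> sqrt \<bar>T2\<bar>" "sqrt T1 \<le> sqrt \<bar>T1\<bar>" "sqrt T2 \<le> sqrt \<bar>T2\<bar>" by auto
  then have C: "C > 0" "sqrt T1 \<le> C" "sqrt T2 \<le> C" unfolding C_def by linarith+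
  have main: "triple_norm \<beta> \<delta> (\<lambda>t. interp x N q u t - uh t, \<lambda>t. interp x N q w t - wh t) \<le> C * rate ^ (q + 1) \<and>
         triple_norm \<beta> \<delta> (\<lambda>t. u t - uh t, \<lambda>t. w t - wh t) \<le> C * rate ^ q"
    if \<epsilon>: "\<epsilon> > 0" and mesh: "admissible_mesh K q \<sigma> \<beta> \<epsilon> N \<phi>"
      and sol: "solves_in (space_U m) \<epsilon> b c d f \<Phi> u w"
      and dec: "solution_decomposition m q \<beta> K \<epsilon> u w"
      and solh: "solves_in (space_Uh m x N q) \<epsilon> b c d f \<Phi> uh wh"
      and x: "x = node q \<sigma> \<beta> \<epsilon> N \<phi>" and rate: "rate = h_inner x N + max_abs_deriv (mesh_characterising \<phi>) / real N"
    for \<epsilon> N \<phi> u w uh wh x rate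
  proof -
    have S: "S_mesh q K \<sigma> \<beta> \<epsilon> N \<phi>" by unfold_locales (use assms \<epsilon> mesh \<beta> in auto)
    have "m \<ge> 1" using assms(2) by (auto simp: admissible_data_def)
    have "u \<in> H1 0 2" "w \<in> H1 0 2" "uh \<in> H1 0 2" "wh \<in> H1 0 2"
      using sol solh by (auto simp: solves_in_def space_Uh_def space_U_def H1_0_def split: if_splits)
    then have prim: "L2_primitive 0 2 u (wderiv 0 2 u)" "L2_primitive 0 2 w (wderiv 0 2 w)"
      "L2_primitive 0 2 uh (wderiv 0 2 uh)" "L2_primitive 0 2 wh (wderiv 0 2 wh)"
      by (auto intro: H1_D)
    obtain S E1 E2 W1 W2 tS tE1 tE2 tW1 tW2 where
      "decomposed_solution q K \<sigma> \<beta> \<epsilon> N \<phi> m u w (wderiv 0 2 u) (wderiv 0 2 w) S E1 E2 W1 W2 tS tE1 tE2 tW1 tW2"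
      by (rule solution_decomposition_locale[OF S \<open>m \<ge> 1\<close> dec prim(1,2)])
    then interpret decomposed_solution q K \<sigma> \<beta> \<epsilon> N \<phi> m u w "wderiv 0 2 u" "wderiv 0 2 w" S E1 E2 W1 W2 tS tE1 tE2 tW1 tW2 .
    have x0: "x 0 = 0" and xN: "x N = 2" and le: "\<And>i. i \<in> {1..N} \<Longrightarrow> x (i - 1) \<le> x i"
      unfolding x by (rule node_0, rule node_end, rule cell_le)
    have le': "x i \<le> x (Suc i)" if "i < N" for i using le[of "Suc i"] that by simp
    have rR: "rate = R" by (simp add: rate x R_def \<rho>_def)
    have cu: "continuous_on {0..2} u" "continuous_on {0..2} w" using prim by (auto intro: L2_primitive_continuous)
    have q2: "q \<ge> 2" using assms(1) by simp
    define gu where "gu = interp x N q u"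
    define gw where "gw = interp x N q w"
    have gu: "is_interpolant x N q u gu"
      unfolding gu_def interp_def by (rule someI_ex[OF exists_interpolant[OF q2 x0 xN N_pos le' cu(1)]])
    have gw: "is_interpolant x N q w gw"
      unfolding gw_def interp_def by (rule someI_ex[OF exists_interpolant[OF q2 x0 xN N_pos le' cu(2)]])
    have iu: "interpolation_error x N q u (wderiv 0 2 u) gu" and iw: "interpolation_error x N q w (wderiv 0 2 w) gw"
      by (unfold_locales, (use x0 xN le prim gu gw in auto)+)
    interpret u: interpolation_error x N q u "wderiv 0 2 u" gu by (rule iu)
    interpret w: interpolation_error x N q w "wderiv 0 2 w" gw by (rule iw)
    define Su where "Su = (\<Sum>i\<in>{1..N}. (x i - x (i - 1))\<^sup>2 * L2_sq (x (i - 1)) (x i) (\<lambda>t. deriv gu t - wderiv 0 2 u t))"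
    have Su: "Su \<le> KU * R ^ (2 * (q + 1))"
      using u_interpolation_error[OF iu[unfolded x], of "q + 1"] by (simp add: Su_def KU_def x)
    \<comment> \<open>With \<open>j = q\<close> the weight disappears and one order is lost.\<close>
    have "(\<Sum>i\<in>{1..N}. L2_sq (x (i - 1)) (x i) (\<lambda>t. deriv gu t - wderiv 0 2 u t)) \<le> KU * R ^ (2 * q)"
      using u_interpolation_error[OF iu[unfolded x], of q] by (simp add: KU_def x)
    moreover have "L2_sq (x 0) (x N) (\<lambda>t. deriv gu t - wderiv 0 2 u t) = (\<Sum>i\<in>{1..N}. L2_sq (x (i - 1)) (x i) (\<lambda>t. deriv gu t - wderiv 0 2 u t))"
      using L2_primitive_square_integrable[OF u.error_primitive] by (intro L2_sq_cells le) (simp_all only: x0 xN)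
    ultimately have A': "L2_sq 0 2 (\<lambda>t. deriv gu t - wderiv 0 2 u t) \<le> KU * R ^ (2 * q)" by (simp add: x0 xN)
    have Aw: "L2_sq 0 2 (\<lambda>t. gw t - w t) \<le> KW * R ^ (2 * (q + 1))"
      using w_interpolation_error[OF iw[unfolded x] Cs stab] by (simp add: KW_def)
    have "L2_sq (x 0) (x N) (\<lambda>t. gu t - u t) = (\<Sum>i\<in>{1..N}. L2_sq (x (i - 1)) (x i) (\<lambda>t. gu t - u t))"
      using square_integrable_continuous[OF L2_primitive_continuous[OF u.error_primitive]] by (intro L2_sq_cells le) (simp_all only: x0 xN)
    also have "\<dots> \<le> Su" unfolding Su_def by (intro sum_mono u.error_poincare)
    finally have A: "L2_sq 0 2 (\<lambda>t. gu t - u t) \<le> KU * R ^ (2 * (q + 1))" using Su by (simp add: x0 xN)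
    define e where "e t = gu t - uh t" for t
    define r where "r t = gw t - wh t" for t
    have ep: "L2_primitive 0 2 e (deriv e)" and et: "triple_sq \<beta> \<delta> e (deriv e) r \<le> Cd * (Su + L2_sq 0 2 (\<lambda>t. gw t - w t))"
      using discrete[OF x0 xN N_pos le sol solh gu gw] unfolding e_def[abs_def] r_def[abs_def] Su_def by auto
    have "Cd * (Su + L2_sq 0 2 (\<lambda>t. gw t - w t)) \<le> Cd * (KU * R ^ (2 * (q + 1)) + KW * R ^ (2 * (q + 1)))"
      using Cd Su Aw by (intro mult_left_mono add_mono) auto
    with et have E1: "triple_sq \<beta> \<delta> e (deriv e) r \<le> T1 * R ^ (2 * (q + 1))"
      by (simp only: T1_def distrib_right mult.assoc)
    have root: "sqrt (T * R ^ (2 * n)) = sqrt T * R ^ n" for T n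
      using R_pos by (simp add: real_sqrt_mult power_even_eq)
    have "triple_norm \<beta> \<delta> (e, r) \<le> sqrt (T1 * R ^ (2 * (q + 1)))"
      unfolding triple_norm_eq[OF ep] by (rule real_sqrt_le_mono[OF E1])
    also have "\<dots> \<le> C * R ^ (q + 1)" unfolding root using C R_pos by (intro mult_right_mono) auto
    finally have P1: "triple_norm \<beta> \<delta> (e, r) \<le> C * R ^ (q + 1)" .
    \<comment> \<open>Only the derivative of the interpolation error is limited to
      \<open>R ^ (2 * q)\<close>; in the other terms the surplus factor \<open>R\<^sup>2\<close> is
      bounded through \<open>R \<le> 2 * K\<close>.\<close>
    have R2: "R ^ (2 * (q + 1)) \<le> (2 * K)\<^sup>2 * R ^ (2 * q)"
    proof -
      have "R\<^sup>2 \<le> (2 * K)\<^sup>2" using R_le R_pos by (intro power_mono) auto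
      then have "R\<^sup>2 * R ^ (2 * q) \<le> (2 * K)\<^sup>2 * R ^ (2 * q)" by (intro mult_right_mono) auto
      then show ?thesis by (simp add: power2_eq_square mult.assoc)
    qed
    \<comment> \<open>Since \<open>R\<close> is positive, the sign of a coefficient can be read off
      from an estimate whose left side is nonnegative.\<close>
    have coeff_nonneg: "T \<ge> 0" if "0 \<le> T * R ^ (2 * (q + 1))" for T
    proof (rule ccontr)
      assume "\<not> T \<ge> 0"
      then have "T * R ^ (2 * (q + 1)) < 0" using R_pos by (intro mult_neg_pos zero_less_power) auto
      then show False using that by linarith
    qed
    have KU0: "KU \<ge> 0" by (rule coeff_nonneg[OF order_trans[OF L2_sq_nonneg A]])
    have KW0: "KW \<ge> 0" by (rule coeff_nonneg[OF order_trans[OF L2_sq_nonneg Aw]])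
    have T10: "T1 \<ge> 0" using Cd KU0 KW0 by (simp add: T1_def)
    have weaken: "X \<le> (T * (2 * K)\<^sup>2) * R ^ (2 * q)" if "X \<le> T * R ^ (2 * (q + 1))" "T \<ge> 0" for X T
      using that(1) mult_left_mono[OF R2 that(2)] unfolding mult.assoc by (rule order_trans)
    \<comment> \<open>The error \<open>u - uh\<close> is the superclose part \<open>e\<close> minus
      the interpolation error, and likewise for \<open>w - wh\<close>.\<close>
    have d: "L2_primitive 0 2 (\<lambda>t. e t - (gu t - u t)) (\<lambda>t. deriv e t - (deriv gu t - wderiv 0 2 u t))"
      by (rule L2_primitive_minus[OF ep u.error_primitive])
    have rsi: "square_integrable 0 2 r" "square_integrable 0 2 (\<lambda>t. gw t - w t)"
      unfolding r_def[abs_def]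
      by (intro square_integrable_continuous continuous_on_diff L2_primitive_continuous[OF w.interpolant_primitive]
        L2_primitive_continuous[OF prim(4)] cu)+
    have "triple_sq \<beta> \<delta> (\<lambda>t. e t - (gu t - u t)) (\<lambda>t. deriv e t - (deriv gu t - wderiv 0 2 u t)) (\<lambda>t. r t - (gw t - w t))
      \<le> 2 * triple_sq \<beta> \<delta> e (deriv e) r + 2 * triple_sq \<beta> \<delta> (\<lambda>t. gu t - u t) (\<lambda>t. deriv gu t - wderiv 0 2 u t) (\<lambda>t. gw t - w t)"
      using \<delta> by (intro triple_sq_add_le ep u.error_primitive rsi) auto
    also have "triple_sq \<beta> \<delta> (\<lambda>t. gu t - u t) (\<lambda>t. deriv gu t - wderiv 0 2 u t) (\<lambda>t. gw t - w t) \<le>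
      (KW * (2 * K)\<^sup>2) * R ^ (2 * q) + \<beta>\<^sup>2 / 2 * (KU * R ^ (2 * q)) + \<delta> * ((KU * (2 * K)\<^sup>2) * R ^ (2 * q))"
      unfolding triple_sq_def using \<delta>
      by (intro add_mono mult_left_mono A' weaken[OF Aw KW0] weaken[OF A KU0]) auto
    also have "triple_sq \<beta> \<delta> e (deriv e) r \<le> (T1 * (2 * K)\<^sup>2) * R ^ (2 * q)" by (rule weaken[OF E1 T10])
    also have "2 * ((T1 * (2 * K)\<^sup>2) * R ^ (2 * q)) + 2 * ((KW * (2 * K)\<^sup>2) * R ^ (2 * q) + \<beta>\<^sup>2 / 2 * (KU * R ^ (2 * q)) + \<delta> * ((KU * (2 * K)\<^sup>2) * R ^ (2 * q)))
      = T2 * R ^ (2 * q)"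
      by (simp add: T2_def algebra_simps)
    finally have E2: "triple_sq \<beta> \<delta> (\<lambda>t. e t - (gu t - u t)) (\<lambda>t. deriv e t - (deriv gu t - wderiv 0 2 u t)) (\<lambda>t. r t - (gw t - w t))
      \<le> T2 * R ^ (2 * q)" by simp
    have "triple_norm \<beta> \<delta> (\<lambda>t. e t - (gu t - u t), \<lambda>t. r t - (gw t - w t)) \<le> sqrt (T2 * R ^ (2 * q))"
      unfolding triple_norm_eq[OF d] by (rule real_sqrt_le_mono[OF E2])
    also have "\<dots> \<le> C * R ^ q" unfolding root using C R_pos by (intro mult_right_mono) auto
    finally have P2: "triple_norm \<beta> \<delta> (\<lambda>t. e t - (gu t - u t), \<lambda>t. r t - (gw t - w t)) \<le> C * R ^ q" .
    have "(\<lambda>t. e t - (gu t - u t)) = (\<lambda>t. u t - uh t)" "(\<lambda>t. r t - (gw t - w t)) = (\<lambda>t. w t - wh t)"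
      by (auto simp: e_def r_def)
    with P1 P2 show ?thesis unfolding rR by (simp only: e_def[abs_def] r_def[abs_def] gu_def gw_def simp_thms)
  qed
  show ?thesis
    unfolding Let_def
    by (intro exI[of _ C] conjI[OF C(1)] allI impI) (elim conjE, rule main, (assumption | rule refl)+)
qed

end
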